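(* Let $\mathbb{K}$ be a commutative superring with $\mathbb{K}\supseteq\mathbb{Q}$. For every Lie $\mathbb{K}$-superalgebra $\mathfrak{g}$, the following are representations by coderivations of $\mathfrak{g}\times\mathfrak{g}$ in $S(\mathfrak{g})$: $(\Phi_c,0)$ and $(0,\Phi_c)$ with $c\in\mathbb{K}_0^\times\cup\{0\}$, and $(\Phi_d,\Phi_{-d})$ with $d\in\mathbb{K}_0^\times$.
   Context: Conventions. A commutative superring $\mathbb{K}=\mathbb{K}_0\oplus\mathbb{K}_1$ is a unital $\mathbb{Z}/2$-graded ring with $ab=(-1)^{p(a)p(b)}ba$ and $a^2=0$ for $a\in\mathbb{K}_1$; $p$ denotes parity, and formulas containing $p(\cdot)$ are written for nonzero homogeneous elements and extended by linearity. $\mathbb{K}_0^\times$ is the group of units of $\mathbb{K}_0$; $\mathbb{K}\supseteq\mathbb{Q}$ means all positive integers are invertible in $\mathbb{K}$. A $\mathbb{K}$-module $M=M_0\oplus M_1$ is a graded right module with $p(m\alpha)=p(m)+p(\alpha)$, and $\alpha m:=(-1)^{p(\alpha)p(m)}m\alpha$. $Hom(M,N)$ is the graded group of right $\mathbb{K}$-linear maps; $(F\otimes G)(v\otimes w)=(-1)^{p(G)p(v)}F(v)\otimes G(w)$; $[F,G]=F\circ G-(-1)^{p(F)p(G)}G\circ F$ on $Hom(M,M)$. A Lie $\mathbb{K}$-superalgebra is a $\mathbb{K}$-module $\mathfrak{g}$ with an even $\mathbb{K}$-bilinear bracket satisfying $[X,Y]=-(-1)^{p(X)p(Y)}[Y,X]$;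 $[X,X]=0$ for $X\in\mathfrak{g}_0$; $[[X,Y],Z]=[X,[Y,Z]]-(-1)^{p(X)p(Y)}[Y,[X,Z]]$; $[Y,[Y,Y]]=0$ for $Y\in\mathfrak{g}_1$. Write $\mathrm{ad}X=[X,\cdot]$. $S(\mathfrak{g})$ is the quotient of the tensor algebra $T(\mathfrak{g})$ by the ideal generated by $v\otimes w-(-1)^{p(v)p(w)}w\otimes v$ and $u\otimes u$ ($u\in\mathfrak{g}_1$); $\Delta:S(\mathfrak{g})\to S(\mathfrak{g})\otimes S(\mathfrak{g})$ is the superalgebra morphism with $\Delta(X)=X\otimes1+1\otimes X$ for $X\in\mathfrak{g}$. A coderivation of $S(\mathfrak{g})$ is a $\Phi\in Hom(S(\mathfrak g),S(\mathfrak g))$ with $\Delta\circ\Phi=(\Phi\otimes id+id\otimes\Phi)\circ\Delta$. For $\varphi=\sum_nc_nt^n\in\mathbb{K}_0[[t]]$ and $a\in\mathfrak{g}$, let $\varphi^a\in Hom(S(\mathfrak{g}),\mathfrak{g})$ be given by $\varphi^a(1)=c_0a$ and $$\varphi^a(X_1\cdots X_n)=(-1)^{p(a)(p(X_1)+\cdots+p(X_n))}\,c_n\sum_{s\in\Sigma_n}\alpha(X_{s(1)},\dots,X_{s(n)})\,\mathrm{ad}X_{s(1)}\circ\cdots\circ\mathrm{ad}X_{s(n)}(a),$$ with $\alpha=\pm1$ the Koszul sign such that $\alpha(X_{s(1)},\dots,X_{s(n)})X_{s(1)}\cdots X_{s(n)}=X_1\cdots X_n$ in $S(\mathfrak{g})$;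 put $\Phi^a=\mathrm{Mult}\circ(id\otimes\varphi^a)\circ\Delta$, $\mathrm{Mult}$ being the multiplication of $S(\mathfrak g)$. $\Phi_c$ is the map $a\mapsto\Phi^a$ obtained from $\varphi=\varphi_c$, where $\varphi_0(t)=-t$ and $\varphi_c(t)=\frac{t}{e^{t/c}-1}$ for $c\in\mathbb{K}_0^\times$. For $\rho_1,\rho_2:\mathfrak{g}\to Hom(S(\mathfrak{g}),S(\mathfrak{g}))$, $(\rho_1,\rho_2)$ denotes the map $\mathfrak{g}\times\mathfrak{g}\ni(a_1,a_2)\mapsto\rho_1(a_1)+\rho_2(a_2)$, $\mathfrak{g}\times\mathfrak{g}$ being the direct product Lie superalgebra. A representation by coderivations is a morphism of Lie superalgebras into $Hom(S(\mathfrak{g}),S(\mathfrak{g}))$ whose values are coderivations. *)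

theory Defs
  imports "HOL-Combinatorics.Permutations" "HOL-Library.Poly_Mapping" "HOL-Library.Z2"
    "HOL-Algebra.QuotRing" "HOL-Algebra.Generated_Groups"
begin

text \<open>
  Parities are elements of the field \<^typ>\<open>bit\<close>. As usual in HOL-Algebra, an additive group is a
  \<^verbatim>\<open>ring\<close> record; the multiplicative fields of a record that is merely a group or a module carry
  no meaning (they are set to \<^term>\<open>undefined\<close>). The zero ring is a superring.
\<close>

section \<open>Superrings, supermodules, Lie superalgebras\<close>

record 'a superring = "'a ring" +
  gr :: "bit \<Rightarrow> 'a set"

record ('k, 'm) supermodule = "'m superring" +
  act :: "'m \<Rightarrow> 'k \<Rightarrow> 'm"  (infixl \<open>\<bullet>\<index>\<close> 70)

record ('k, 'g) lie_algebra = "('k, 'g) supermodule" +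
  brk :: "'g \<Rightarrow> 'g \<Rightarrow> 'g"

text \<open>\<open>neg_pow M e x\<close> is $(-1)^e x$.\<close>

definition neg_pow :: "('a, 'b) ring_scheme \<Rightarrow> bit \<Rightarrow> 'a \<Rightarrow> 'a"
  where "neg_pow M e x = (if e = 1 then \<ominus>\<^bsub>M\<^esub> x else x)"

locale graded_group = abelian_group M for M :: "('a, 'b) superring_scheme" (structure) +
  assumes gr_subgroup: "additive_subgroup (gr M i) M"
    and gr_sum: "gr M 0 <+> gr M 1 = carrier M"
    and gr_disjoint: "gr M 0 \<inter> gr M 1 = {\<zero>}"

text \<open>The homogeneous component of parity \<open>i\<close>.\<close>

definition prt :: "('a, 'b) superring_scheme \<Rightarrow> bit \<Rightarrow> 'a \<Rightarrow> 'a"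
  where "prt M i x = (THE y. y \<in> gr M i \<and> x \<ominus>\<^bsub>M\<^esub> y \<in> gr M (i + 1))"

locale commutative_superring = ring K + graded_group K for K :: "('k, 'b) superring_scheme" (structure) +
  assumes gr_mult: "a \<in> gr K i \<Longrightarrow> b \<in> gr K j \<Longrightarrow> a \<otimes> b \<in> gr K (i + j)"
    and gr_one: "\<one> \<in> gr K 0"
    and supercommutative: "a \<in> gr K i \<Longrightarrow> b \<in> gr K j \<Longrightarrow> a \<otimes> b = neg_pow K (i * j) (b \<otimes> a)"
    and odd_square: "a \<in> gr K 1 \<Longrightarrow> a \<otimes> a = \<zero>"

definition contains_rationals :: "('k, 'b) ring_scheme \<Rightarrow> bool"
  where "contains_rationals K \<longleftrightarrow> (\<forall>n::nat. n > 0 \<longrightarrow> [n] \<cdot>\<^bsub>K\<^esub> \<one>\<^bsub>K\<^esub> \<in> Units K)"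

definition even_units :: "('k, 'b) superring_scheme \<Rightarrow> 'k set"
  where "even_units K = Units (K\<lparr>carrier := gr K 0\<rparr>)"

locale graded_right_module =
  K: commutative_superring K + M: graded_group M
  for K :: "('k, 'b) superring_scheme" and M :: "('k, 'm, 'c) supermodule_scheme" +
  assumes act_closed: "m \<in> carrier M \<Longrightarrow> \<alpha> \<in> carrier K \<Longrightarrow> m \<bullet>\<^bsub>M\<^esub> \<alpha> \<in> carrier M"
    and act_add_left: "m \<in> carrier M \<Longrightarrow> m' \<in> carrier M \<Longrightarrow> \<alpha> \<in> carrier K \<Longrightarrow>
          (m \<oplus>\<^bsub>M\<^esub> m') \<bullet>\<^bsub>M\<^esub> \<alpha> = m \<bullet>\<^bsub>M\<^esub> \<alpha> \<oplus>\<^bsub>M\<^esub> m' \<bullet>\<^bsub>M\<^esub> \<alpha>"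
    and act_add_right: "m \<in> carrier M \<Longrightarrow> \<alpha> \<in> carrier K \<Longrightarrow> \<beta> \<in> carrier K \<Longrightarrow>
          m \<bullet>\<^bsub>M\<^esub> (\<alpha> \<oplus>\<^bsub>K\<^esub> \<beta>) = m \<bullet>\<^bsub>M\<^esub> \<alpha> \<oplus>\<^bsub>M\<^esub> m \<bullet>\<^bsub>M\<^esub> \<beta>"
    and act_mult: "m \<in> carrier M \<Longrightarrow> \<alpha> \<in> carrier K \<Longrightarrow> \<beta> \<in> carrier K \<Longrightarrow>
          m \<bullet>\<^bsub>M\<^esub> (\<alpha> \<otimes>\<^bsub>K\<^esub> \<beta>) = m \<bullet>\<^bsub>M\<^esub> \<alpha> \<bullet>\<^bsub>M\<^esub> \<beta>"
    and act_one: "m \<in> carrier M \<Longrightarrow> m \<bullet>\<^bsub>M\<^esub> \<one>\<^bsub>K\<^esub> = m"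
    and act_gr: "m \<in> gr M i \<Longrightarrow> \<alpha> \<in> gr K j \<Longrightarrow> m \<bullet>\<^bsub>M\<^esub> \<alpha> \<in> gr M (i + j)"

text \<open>$\alpha m := (-1)^{p(\alpha)p(m)} m\alpha$, extended biadditively.\<close>

definition lact :: "('k, 'b) superring_scheme \<Rightarrow> ('k, 'm, 'c) supermodule_scheme \<Rightarrow> 'k \<Rightarrow> 'm \<Rightarrow> 'm"
  where "lact K M \<alpha> m = (\<Oplus>\<^bsub>M\<^esub>i\<in>{0,1}. \<Oplus>\<^bsub>M\<^esub>j\<in>{0,1}. neg_pow M (i * j) (prt M j m \<bullet>\<^bsub>M\<^esub> prt K i \<alpha>))"

locale lie_superalgebra = graded_right_module K \<gg>
  for K :: "('k, 'b) superring_scheme" and \<gg> :: "('k, 'g, 'c) lie_algebra_scheme" +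
  assumes brk_even: "X \<in> gr \<gg> i \<Longrightarrow> Y \<in> gr \<gg> j \<Longrightarrow> brk \<gg> X Y \<in> gr \<gg> (i + j)"
    and brk_add_left: "X \<in> carrier \<gg> \<Longrightarrow> X' \<in> carrier \<gg> \<Longrightarrow> Y \<in> carrier \<gg> \<Longrightarrow>
          brk \<gg> (X \<oplus>\<^bsub>\<gg>\<^esub> X') Y = brk \<gg> X Y \<oplus>\<^bsub>\<gg>\<^esub> brk \<gg> X' Y"
    and brk_add_right: "X \<in> carrier \<gg> \<Longrightarrow> Y \<in> carrier \<gg> \<Longrightarrow> Y' \<in> carrier \<gg> \<Longrightarrow>
          brk \<gg> X (Y \<oplus>\<^bsub>\<gg>\<^esub> Y') = brk \<gg> X Y \<oplus>\<^bsub>\<gg>\<^esub> brk \<gg> X Y'"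
    and brk_act_right: "X \<in> carrier \<gg> \<Longrightarrow> Y \<in> carrier \<gg> \<Longrightarrow> \<alpha> \<in> carrier K \<Longrightarrow>
          brk \<gg> X (Y \<bullet>\<^bsub>\<gg>\<^esub> \<alpha>) = brk \<gg> X Y \<bullet>\<^bsub>\<gg>\<^esub> \<alpha>"
    and brk_act_middle: "X \<in> carrier \<gg> \<Longrightarrow> Y \<in> carrier \<gg> \<Longrightarrow> \<alpha> \<in> carrier K \<Longrightarrow>
          brk \<gg> (X \<bullet>\<^bsub>\<gg>\<^esub> \<alpha>) Y = brk \<gg> X (lact K \<gg> \<alpha> Y)"
    and brk_skew: "X \<in> gr \<gg> i \<Longrightarrow> Y \<in> gr \<gg> j \<Longrightarrow>
          brk \<gg> X Y = \<ominus>\<^bsub>\<gg>\<^esub> neg_pow \<gg> (i * j) (brk \<gg> Y X)"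
    and brk_even_self: "X \<in> gr \<gg> 0 \<Longrightarrow> brk \<gg> X X = \<zero>\<^bsub>\<gg>\<^esub>"
    and jacobi: "X \<in> gr \<gg> i \<Longrightarrow> Y \<in> gr \<gg> j \<Longrightarrow> Z \<in> gr \<gg> k \<Longrightarrow>
          brk \<gg> (brk \<gg> X Y) Z =
            brk \<gg> X (brk \<gg> Y Z) \<ominus>\<^bsub>\<gg>\<^esub> neg_pow \<gg> (i * j) (brk \<gg> Y (brk \<gg> X Z))"
    and brk_odd_self: "Y \<in> gr \<gg> 1 \<Longrightarrow> brk \<gg> Y (brk \<gg> Y Y) = \<zero>\<^bsub>\<gg>\<^esub>"

definition lie_prod :: "('k, 'g, 'c) lie_algebra_scheme \<Rightarrow> ('k, 'h, 'd) lie_algebra_scheme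
    \<Rightarrow> ('k, 'g \<times> 'h) lie_algebra"
  where "lie_prod \<gg> \<hh> =
    \<lparr>carrier = carrier \<gg> \<times> carrier \<hh>, mult = undefined, one = undefined,
     zero = (\<zero>\<^bsub>\<gg>\<^esub>, \<zero>\<^bsub>\<hh>\<^esub>), add = (\<lambda>(x, y) (x', y'). (x \<oplus>\<^bsub>\<gg>\<^esub> x', y \<oplus>\<^bsub>\<hh>\<^esub> y')),
     gr = (\<lambda>i. gr \<gg> i \<times> gr \<hh> i),
     act = (\<lambda>(x, y) \<alpha>. (x \<bullet>\<^bsub>\<gg>\<^esub> \<alpha>, y \<bullet>\<^bsub>\<hh>\<^esub> \<alpha>)),
     brk = (\<lambda>(x, y) (x', y'). (brk \<gg> x x', brk \<hh> y y'))\<rparr>"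


section \<open>Linear maps\<close>

definition linear_maps :: "('k, 'b) superring_scheme \<Rightarrow> ('k, 'm, 'c) supermodule_scheme
    \<Rightarrow> ('k, 'n, 'd) supermodule_scheme \<Rightarrow> ('m \<Rightarrow> 'n) set"
  where "linear_maps K M N = {F \<in> carrier M \<rightarrow> carrier N.
    (\<forall>x\<in>carrier M. \<forall>y\<in>carrier M. F (x \<oplus>\<^bsub>M\<^esub> y) = F x \<oplus>\<^bsub>N\<^esub> F y) \<and>
    (\<forall>x\<in>carrier M. \<forall>\<alpha>\<in>carrier K. F (x \<bullet>\<^bsub>M\<^esub> \<alpha>) = F x \<bullet>\<^bsub>N\<^esub> \<alpha>)}"

text \<open>
  Elements of $Hom(M,N)$ are extensional functions on the carrier of \<open>M\<close>. The right module
  structure $(F\alpha)(v) = F(\alpha v)$ is the one for which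
  $(\alpha F)(v) = \alpha F(v)$ with $\alpha F = (-1)^{p(\alpha)p(F)} F\alpha$.
\<close>

definition Hom :: "('k, 'b) superring_scheme \<Rightarrow> ('k, 'm, 'c) supermodule_scheme
    \<Rightarrow> ('k, 'n, 'd) supermodule_scheme \<Rightarrow> ('k, 'm \<Rightarrow> 'n) supermodule"
  where "Hom K M N =
    \<lparr>carrier = linear_maps K M N \<inter> extensional (carrier M), mult = undefined, one = undefined,
     zero = (\<lambda>x\<in>carrier M. \<zero>\<^bsub>N\<^esub>), add = (\<lambda>F G. \<lambda>x\<in>carrier M. F x \<oplus>\<^bsub>N\<^esub> G x),
     gr = (\<lambda>i. {F \<in> linear_maps K M N \<inter> extensional (carrier M). \<forall>j. F ` gr M j \<subseteq> gr N (i + j)}),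
     act = (\<lambda>F \<alpha>. \<lambda>x\<in>carrier M. F (lact K M \<alpha> x))\<rparr>"

text \<open>$Hom(M,M)$ with the bracket $[F,G]=F\circ G-(-1)^{p(F)p(G)}G\circ F$, extended biadditively.\<close>

definition End_lie :: "('k, 'b) superring_scheme \<Rightarrow> ('k, 'm, 'c) supermodule_scheme
    \<Rightarrow> ('k, 'm \<Rightarrow> 'm) lie_algebra"
  where "End_lie K M = (let H = Hom K M M in supermodule.extend H
    (lie_algebra.fields (\<lambda>F G. \<Oplus>\<^bsub>H\<^esub>i\<in>{0,1}. \<Oplus>\<^bsub>H\<^esub>j\<in>{0,1}.
      compose (carrier M) (prt H i F) (prt H j G) \<ominus>\<^bsub>H\<^esub>
      neg_pow H (i * j) (compose (carrier M) (prt H j G) (prt H i F)))))"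

definition lie_morphism :: "('k, 'b) superring_scheme \<Rightarrow> ('k, 'g, 'c) lie_algebra_scheme
    \<Rightarrow> ('k, 'h, 'd) lie_algebra_scheme \<Rightarrow> ('g \<Rightarrow> 'h) \<Rightarrow> bool"
  where "lie_morphism K \<gg> \<hh> f \<longleftrightarrow> f \<in> linear_maps K \<gg> \<hh> \<and> (\<forall>i. f ` gr \<gg> i \<subseteq> gr \<hh> i) \<and>
    (\<forall>X\<in>carrier \<gg>. \<forall>Y\<in>carrier \<gg>. f (brk \<gg> X Y) = brk \<hh> (f X) (f Y))"


section \<open>Tensor products\<close>

definition pair_group :: "'m set \<Rightarrow> 'n set \<Rightarrow> (('m \<times> 'n) \<Rightarrow>\<^sub>0 int) ring"
  where "pair_group A B = \<lparr>carrier = {x. Poly_Mapping.keys x \<subseteq> A \<times> B},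
    mult = undefined, one = undefined, zero = 0, add = (+)\<rparr>"

text \<open>
  $M\otimes N$ is the free abelian group on pairs modulo the following subgroup; the relations
  $m\alpha\otimes n = m\otimes\alpha n$ for homogeneous arguments imply those for arbitrary ones.
\<close>

definition tensor_rel :: "('k, 'b) superring_scheme \<Rightarrow> ('k, 'm, 'c) supermodule_scheme
    \<Rightarrow> ('k, 'n, 'd) supermodule_scheme \<Rightarrow> (('m \<times> 'n) \<Rightarrow>\<^sub>0 int) set"
  where "tensor_rel K M N = generate (add_monoid (pair_group (carrier M) (carrier N)))
    ({frag_of (m \<oplus>\<^bsub>M\<^esub> m', n) - frag_of (m, n) - frag_of (m', n) | m m' n.
        m \<in> carrier M \<and> m' \<in> carrier M \<and> n \<in> carrier N} \<union>
     {frag_of (m, n \<oplus>\<^bsub>N\<^esub> n') - frag_of (m, n) - frag_of (m, n') | m n n'.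
        m \<in> carrier M \<and> n \<in> carrier N \<and> n' \<in> carrier N} \<union>
     {frag_of (m \<bullet>\<^bsub>M\<^esub> \<alpha>, n) - frag_of (m, neg_pow N (i * j) (n \<bullet>\<^bsub>N\<^esub> \<alpha>)) | m \<alpha> n i j.
        m \<in> carrier M \<and> \<alpha> \<in> gr K i \<and> n \<in> gr N j})"

definition pure :: "('k, 'b) superring_scheme \<Rightarrow> ('k, 'm, 'c) supermodule_scheme
    \<Rightarrow> ('k, 'n, 'd) supermodule_scheme \<Rightarrow> 'm \<Rightarrow> 'n \<Rightarrow> (('m \<times> 'n) \<Rightarrow>\<^sub>0 int) set"
  where "pure K M N m n = tensor_rel K M N +>\<^bsub>pair_group (carrier M) (carrier N)\<^esub> frag_of (m, n)"

definition tensor_group :: "('k, 'b) superring_scheme \<Rightarrow> ('k, 'm, 'c) supermodule_scheme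
    \<Rightarrow> ('k, 'n, 'd) supermodule_scheme \<Rightarrow> (('m \<times> 'n) \<Rightarrow>\<^sub>0 int) set ring"
  where "tensor_group K M N = (let P = pair_group (carrier M) (carrier N) in
    \<lparr>carrier = a_rcosets\<^bsub>P\<^esub> (tensor_rel K M N), mult = undefined, one = undefined,
     zero = tensor_rel K M N, add = set_add P\<rparr>)"

text \<open>
  The additive map out of a tensor product that sends $m\otimes n$ to \<open>f m n\<close>; for a biadditive
  balanced \<open>f\<close> the choice of the representative is irrelevant.
\<close>

definition tensor_lift :: "('p, 'e) ring_scheme \<Rightarrow> ('m \<Rightarrow> 'n \<Rightarrow> 'p) \<Rightarrow> (('m \<times> 'n) \<Rightarrow>\<^sub>0 int) set \<Rightarrow> 'p"
  where "tensor_lift P f x = (let r = (SOME r. r \<in> x) in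
    finsum P (\<lambda>(m, n). [Poly_Mapping.lookup r (m, n)] \<cdot>\<^bsub>P\<^esub> f m n) (Poly_Mapping.keys r))"

text \<open>
  The multiplication $(a\otimes b)(a'\otimes b') = (-1)^{p(b)p(a')}aa'\otimes bb'$ is meaningful
  if \<open>M\<close> and \<open>N\<close> are superalgebras.
\<close>

definition tensor :: "('k, 'b) superring_scheme \<Rightarrow> ('k, 'm, 'c) supermodule_scheme
    \<Rightarrow> ('k, 'n, 'd) supermodule_scheme \<Rightarrow> ('k, (('m \<times> 'n) \<Rightarrow>\<^sub>0 int) set) supermodule"
  where "tensor K M N = (let T = tensor_group K M N in
    \<lparr>carrier = carrier T,
     mult = (\<lambda>x y. tensor_lift T (\<lambda>a b. tensor_lift T (\<lambda>a' b'.
        \<Oplus>\<^bsub>T\<^esub>i\<in>{0,1}. \<Oplus>\<^bsub>T\<^esub>j\<in>{0,1}.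
          neg_pow T (i * j) (pure K M N (a \<otimes>\<^bsub>M\<^esub> prt M j a') (prt N i b \<otimes>\<^bsub>N\<^esub> b'))) y) x),
     one = pure K M N \<one>\<^bsub>M\<^esub> \<one>\<^bsub>N\<^esub>,
     zero = zero T, add = add T,
     gr = (\<lambda>k. generate (add_monoid T) {pure K M N m n | m n i j.
        m \<in> gr M i \<and> n \<in> gr N j \<and> i + j = k}),
     act = (\<lambda>x \<alpha>. tensor_lift T (\<lambda>m n. pure K M N m (n \<bullet>\<^bsub>N\<^esub> \<alpha>)) x)\<rparr>)"

text \<open>$(F\otimes G)(v\otimes w)=(-1)^{p(G)p(v)}F(v)\otimes G(w)$\<close>

definition tensor_map :: "('k, 'b) superring_scheme
    \<Rightarrow> ('k, 'm, 'c) supermodule_scheme \<Rightarrow> ('k, 'n, 'd) supermodule_scheme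
    \<Rightarrow> ('k, 'm', 'e) supermodule_scheme \<Rightarrow> ('k, 'n', 'f) supermodule_scheme
    \<Rightarrow> ('m \<Rightarrow> 'm') \<Rightarrow> ('n \<Rightarrow> 'n')
    \<Rightarrow> (('m \<times> 'n) \<Rightarrow>\<^sub>0 int) set \<Rightarrow> (('m' \<times> 'n') \<Rightarrow>\<^sub>0 int) set"
  where "tensor_map K M N M' N' F G =
    (\<lambda>x\<in>carrier (tensor K M N). tensor_lift (tensor K M' N') (\<lambda>v w.
      \<Oplus>\<^bsub>tensor K M' N'\<^esub>i\<in>{0,1}. \<Oplus>\<^bsub>tensor K M' N'\<^esub>j\<in>{0,1}.
        neg_pow (tensor K M' N') (i * j)
          (pure K M' N' (F (prt M j v)) (prt (Hom K N N') i G w))) x)"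


section \<open>Tensor algebra and symmetric algebra\<close>

text \<open>The free ring $\mathbb Z\langle A\rangle$: finite $\mathbb Z$-linear combinations of words in \<open>A\<close>.\<close>

definition free_ring :: "'a set \<Rightarrow> ('a list \<Rightarrow>\<^sub>0 int) ring"
  where "free_ring A = \<lparr>carrier = {x. Poly_Mapping.keys x \<subseteq> lists A},
    mult = (\<lambda>x y. frag_extend (\<lambda>u. frag_extend (\<lambda>v. frag_of (u @ v)) y) x),
    one = frag_of [], zero = 0, add = (+)\<rparr>"

text \<open>
  The tensor algebra of the $\mathbb K$-bimodule $\mathfrak g$ is presented as the ring generated
  by the letters \<^term>\<open>Inl \<alpha>\<close> ($\alpha\in\mathbb K$) and \<^term>\<open>Inr X\<close> ($X\in\mathfrak g$), subject to
  the ring operations of $\mathbb K$ and the bimodule operations of $\mathfrak g$. By these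
  relations all scalars can be collected at the right end of a word $X_1\cdots X_n\alpha$, i.e.
  the words with \<open>n\<close> letters from $\mathfrak g$ span $\mathfrak g^{\otimes n}$ (and $\mathbb K$
  for \<open>n = 0\<close>).
\<close>

type_synonym ('k, 'g) tensor_elem = "(('k + 'g) list \<Rightarrow>\<^sub>0 int) set"

definition letter_ring :: "('k, 'b) superring_scheme \<Rightarrow> ('k, 'g, 'c) supermodule_scheme
    \<Rightarrow> (('k + 'g) list \<Rightarrow>\<^sub>0 int) ring"
  where "letter_ring K \<gg> = free_ring (Inl ` carrier K \<union> Inr ` carrier \<gg>)"

definition tensor_algebra_ideal :: "('k, 'b) superring_scheme \<Rightarrow> ('k, 'g, 'c) supermodule_scheme
    \<Rightarrow> (('k + 'g) list \<Rightarrow>\<^sub>0 int) set"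
  where "tensor_algebra_ideal K \<gg> = Idl\<^bsub>letter_ring K \<gg>\<^esub>
    ({frag_of [Inl \<one>\<^bsub>K\<^esub>] - frag_of []} \<union>
     {frag_of [Inl (\<alpha> \<oplus>\<^bsub>K\<^esub> \<beta>)] - frag_of [Inl \<alpha>] - frag_of [Inl \<beta>] | \<alpha> \<beta>.
        \<alpha> \<in> carrier K \<and> \<beta> \<in> carrier K} \<union>
     {frag_of [Inl (\<alpha> \<otimes>\<^bsub>K\<^esub> \<beta>)] - frag_of [Inl \<alpha>, Inl \<beta>] | \<alpha> \<beta>.
        \<alpha> \<in> carrier K \<and> \<beta> \<in> carrier K} \<union>
     {frag_of [Inr (X \<oplus>\<^bsub>\<gg>\<^esub> Y)] - frag_of [Inr X] - frag_of [Inr Y] | X Y.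
        X \<in> carrier \<gg> \<and> Y \<in> carrier \<gg>} \<union>
     {frag_of [Inr (X \<bullet>\<^bsub>\<gg>\<^esub> \<alpha>)] - frag_of [Inr X, Inl \<alpha>] | X \<alpha>.
        X \<in> carrier \<gg> \<and> \<alpha> \<in> carrier K} \<union>
     {frag_of [Inr (neg_pow \<gg> (i * j) (X \<bullet>\<^bsub>\<gg>\<^esub> \<alpha>))] - frag_of [Inl \<alpha>, Inr X] | X \<alpha> i j.
        \<alpha> \<in> gr K i \<and> X \<in> gr \<gg> j})"

definition tensor_word :: "('k, 'b) superring_scheme \<Rightarrow> ('k, 'g, 'c) supermodule_scheme
    \<Rightarrow> ('k + 'g) list \<Rightarrow> ('k, 'g) tensor_elem"
  where "tensor_word K \<gg> w = tensor_algebra_ideal K \<gg> +>\<^bsub>letter_ring K \<gg>\<^esub> frag_of w"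

fun letter_parity :: "('k, 'b) superring_scheme \<Rightarrow> ('k, 'g, 'c) supermodule_scheme
    \<Rightarrow> 'k + 'g \<Rightarrow> bit \<Rightarrow> bool"
  where
    "letter_parity K \<gg> (Inl \<alpha>) i \<longleftrightarrow> \<alpha> \<in> gr K i"
  | "letter_parity K \<gg> (Inr X) i \<longleftrightarrow> X \<in> gr \<gg> i"

definition tensor_algebra :: "('k, 'b) superring_scheme \<Rightarrow> ('k, 'g, 'c) supermodule_scheme
    \<Rightarrow> ('k, ('k, 'g) tensor_elem) supermodule"
  where "tensor_algebra K \<gg> = (let T = letter_ring K \<gg> Quot tensor_algebra_ideal K \<gg> in
    \<lparr>carrier = carrier T, mult = mult T, one = one T, zero = zero T, add = add T,
     gr = (\<lambda>k. generate (add_monoid T) {tensor_word K \<gg> w | w ps.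
        list_all2 (letter_parity K \<gg>) w ps \<and> sum_list ps = k}),
     act = (\<lambda>x \<alpha>. x \<otimes>\<^bsub>T\<^esub> tensor_word K \<gg> [Inl \<alpha>])\<rparr>)"

definition super_quot :: "('k, 'a, 'c) supermodule_scheme \<Rightarrow> 'a set \<Rightarrow> ('k, 'a set) supermodule"
  where "super_quot A I =
    \<lparr>carrier = carrier (A Quot I), mult = mult (A Quot I), one = one (A Quot I),
     zero = zero (A Quot I), add = add (A Quot I),
     gr = (\<lambda>i. (\<lambda>x. I +>\<^bsub>A\<^esub> x) ` gr A i),
     act = (\<lambda>X \<alpha>. \<Union>x\<in>X. I +>\<^bsub>A\<^esub> (x \<bullet>\<^bsub>A\<^esub> \<alpha>))\<rparr>"

definition sym_ideal :: "('k, 'b) superring_scheme \<Rightarrow> ('k, 'g, 'c) supermodule_scheme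
    \<Rightarrow> ('k, 'g) tensor_elem set"
  where "sym_ideal K \<gg> = (let T = tensor_algebra K \<gg>; \<iota> = (\<lambda>X. tensor_word K \<gg> [Inr X]) in Idl\<^bsub>T\<^esub>
    ({\<iota> v \<otimes>\<^bsub>T\<^esub> \<iota> w \<ominus>\<^bsub>T\<^esub> neg_pow T (i * j) (\<iota> w \<otimes>\<^bsub>T\<^esub> \<iota> v) | v w i j. v \<in> gr \<gg> i \<and> w \<in> gr \<gg> j} \<union>
     {\<iota> u \<otimes>\<^bsub>T\<^esub> \<iota> u | u. u \<in> gr \<gg> 1}))"

type_synonym ('k, 'g) sym_elem = "('k, 'g) tensor_elem set"

definition sym_algebra :: "('k, 'b) superring_scheme \<Rightarrow> ('k, 'g, 'c) supermodule_scheme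
    \<Rightarrow> ('k, ('k, 'g) sym_elem) supermodule"
  where "sym_algebra K \<gg> = super_quot (tensor_algebra K \<gg>) (sym_ideal K \<gg>)"

definition sym_incl :: "('k, 'b) superring_scheme \<Rightarrow> ('k, 'g, 'c) supermodule_scheme
    \<Rightarrow> 'g \<Rightarrow> ('k, 'g) sym_elem"
  where "sym_incl K \<gg> X = sym_ideal K \<gg> +>\<^bsub>tensor_algebra K \<gg>\<^esub> tensor_word K \<gg> [Inr X]"

definition superalgebra_morphism :: "('k, 'b) superring_scheme \<Rightarrow> ('k, 'm, 'c) supermodule_scheme
    \<Rightarrow> ('k, 'n, 'd) supermodule_scheme \<Rightarrow> ('m \<Rightarrow> 'n) \<Rightarrow> bool"
  where "superalgebra_morphism K A B f \<longleftrightarrow>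
    f \<in> linear_maps K A B \<and> (\<forall>i. f ` gr A i \<subseteq> gr B i) \<and> f \<in> ring_hom A B"

definition sym_tensor :: "('k, 'b) superring_scheme \<Rightarrow> ('k, 'g, 'c) supermodule_scheme
    \<Rightarrow> ('k, ((('k, 'g) sym_elem \<times> ('k, 'g) sym_elem) \<Rightarrow>\<^sub>0 int) set) supermodule"
  where "sym_tensor K \<gg> = tensor K (sym_algebra K \<gg>) (sym_algebra K \<gg>)"

definition coproduct :: "('k, 'b) superring_scheme \<Rightarrow> ('k, 'g, 'c) supermodule_scheme
    \<Rightarrow> ('k, 'g) sym_elem \<Rightarrow> ((('k, 'g) sym_elem \<times> ('k, 'g) sym_elem) \<Rightarrow>\<^sub>0 int) set"
  where "coproduct K \<gg> = (let S = sym_algebra K \<gg>; \<iota> = sym_incl K \<gg> in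
    THE D. superalgebra_morphism K S (sym_tensor K \<gg>) D \<and> D \<in> extensional (carrier S) \<and>
      (\<forall>X\<in>carrier \<gg>. D (\<iota> X) = pure K S S (\<iota> X) \<one>\<^bsub>S\<^esub> \<oplus>\<^bsub>sym_tensor K \<gg>\<^esub> pure K S S \<one>\<^bsub>S\<^esub> (\<iota> X)))"

definition sym_mult :: "('k, 'b) superring_scheme \<Rightarrow> ('k, 'g, 'c) supermodule_scheme
    \<Rightarrow> ((('k, 'g) sym_elem \<times> ('k, 'g) sym_elem) \<Rightarrow>\<^sub>0 int) set \<Rightarrow> ('k, 'g) sym_elem"
  where "sym_mult K \<gg> = tensor_lift (sym_algebra K \<gg>) (mult (sym_algebra K \<gg>))"

definition sym_tensor_map :: "('k, 'b) superring_scheme \<Rightarrow> ('k, 'g, 'c) supermodule_scheme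
    \<Rightarrow> (('k, 'g) sym_elem \<Rightarrow> ('k, 'g) sym_elem) \<Rightarrow> (('k, 'g) sym_elem \<Rightarrow> ('k, 'g) sym_elem)
    \<Rightarrow> ((('k, 'g) sym_elem \<times> ('k, 'g) sym_elem) \<Rightarrow>\<^sub>0 int) set
    \<Rightarrow> ((('k, 'g) sym_elem \<times> ('k, 'g) sym_elem) \<Rightarrow>\<^sub>0 int) set"
  where "sym_tensor_map K \<gg> = (let S = sym_algebra K \<gg> in tensor_map K S S S S)"

definition coderivation :: "('k, 'b) superring_scheme \<Rightarrow> ('k, 'g, 'c) supermodule_scheme
    \<Rightarrow> (('k, 'g) sym_elem \<Rightarrow> ('k, 'g) sym_elem) \<Rightarrow> bool"
  where "coderivation K \<gg> \<Phi> \<longleftrightarrow> (let S = sym_algebra K \<gg>; I = (\<lambda>x\<in>carrier S. x) in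
    \<Phi> \<in> carrier (Hom K S S) \<and>
    (\<forall>x\<in>carrier S. coproduct K \<gg> (\<Phi> x) =
      sym_tensor_map K \<gg> \<Phi> I (coproduct K \<gg> x) \<oplus>\<^bsub>sym_tensor K \<gg>\<^esub>
      sym_tensor_map K \<gg> I \<Phi> (coproduct K \<gg> x)))"


section \<open>The maps attached to a power series\<close>

text \<open>
  The parity of the sign of the permuted word $X_{s(0)},\dots,X_{s(n-1)}$ relative to
  $X_0,\dots,X_{n-1}$, where \<open>d\<close> lists the parities of the $X_i$: the number of inversions between
  odd letters.
\<close>

definition koszul :: "nat \<Rightarrow> (nat \<Rightarrow> bit) \<Rightarrow> (nat \<Rightarrow> nat) \<Rightarrow> bit"
  where "koszul n d s = (\<Sum>(i, j) \<in> {(i, j). i < j \<and> j < n \<and> s i > s j}. d (s i) * d (s j))"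

text \<open>
  \<open>phi_hom K \<gg> c i a\<close> is $\varphi^a$ for homogeneous \<open>a\<close> of parity \<open>i\<close> and
  $\varphi=\sum_n c_nt^n$; the case \<open>n = 0\<close> of the condition reads $\varphi^a(1)=c_0a$, and
  $c_n$, being even, may act from the right.
\<close>

definition phi_hom :: "('k, 'b) superring_scheme \<Rightarrow> ('k, 'g, 'c) lie_algebra_scheme
    \<Rightarrow> (nat \<Rightarrow> 'k) \<Rightarrow> bit \<Rightarrow> 'g \<Rightarrow> ('k, 'g) sym_elem \<Rightarrow> 'g"
  where "phi_hom K \<gg> c i a = (let S = sym_algebra K \<gg> in
    THE f. f \<in> carrier (Hom K S \<gg>) \<and>
      (\<forall>n X d. (\<forall>k<n. X k \<in> gr \<gg> (d k)) \<longrightarrow>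
        f (foldr (\<lambda>k y. sym_incl K \<gg> (X k) \<otimes>\<^bsub>S\<^esub> y) [0..<n] \<one>\<^bsub>S\<^esub>) =
        neg_pow \<gg> (i * (\<Sum>k<n. d k))
          ((\<Oplus>\<^bsub>\<gg>\<^esub>s\<in>{s. s permutes {..<n}}. neg_pow \<gg> (koszul n d s)
              (foldr (\<lambda>k y. brk \<gg> (X (s k)) y) [0..<n] a)) \<bullet>\<^bsub>\<gg>\<^esub> c n)))"

definition phi_map :: "('k, 'b) superring_scheme \<Rightarrow> ('k, 'g, 'c) lie_algebra_scheme
    \<Rightarrow> (nat \<Rightarrow> 'k) \<Rightarrow> 'g \<Rightarrow> ('k, 'g) sym_elem \<Rightarrow> 'g"
  where "phi_map K \<gg> c a =
    (\<Oplus>\<^bsub>Hom K (sym_algebra K \<gg>) \<gg>\<^esub>i\<in>{0,1}. phi_hom K \<gg> c i (prt \<gg> i a))"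

text \<open>
  $\Phi^a=\mathrm{Mult}\circ(id\otimes\varphi^a)\circ\Delta$, with $\varphi^a$ followed by
  $\mathfrak g\to S(\mathfrak g)$ so that \<open>Mult\<close> applies.
\<close>

definition Phi_map :: "('k, 'b) superring_scheme \<Rightarrow> ('k, 'g, 'c) lie_algebra_scheme
    \<Rightarrow> (nat \<Rightarrow> 'k) \<Rightarrow> 'g \<Rightarrow> ('k, 'g) sym_elem \<Rightarrow> ('k, 'g) sym_elem"
  where "Phi_map K \<gg> c a = (let S = sym_algebra K \<gg> in
    (\<lambda>x\<in>carrier S. sym_mult K \<gg> (sym_tensor_map K \<gg> (\<lambda>y\<in>carrier S. y)
      (compose (carrier S) (sym_incl K \<gg>) (phi_map K \<gg> c a)) (coproduct K \<gg> x))))"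

text \<open>The coefficients of $e^{t/c}-1$.\<close>

definition exp_minus_one :: "('k, 'b) ring_scheme \<Rightarrow> 'k \<Rightarrow> nat \<Rightarrow> 'k"
  where "exp_minus_one K c n = (if n = 0 then \<zero>\<^bsub>K\<^esub> else
    (inv\<^bsub>K\<^esub> c) [^]\<^bsub>K\<^esub> n \<otimes>\<^bsub>K\<^esub> inv\<^bsub>K\<^esub> ([(fact n :: nat)] \<cdot>\<^bsub>K\<^esub> \<one>\<^bsub>K\<^esub>))"

text \<open>
  The coefficients of $\varphi_c\in\mathbb K_0[[t]]$: for a unit \<open>c\<close>, $t/(e^{t/c}-1)$ is the
  power series whose product with $e^{t/c}-1$ is \<open>t\<close>.
\<close>

definition phi_series :: "('k, 'b) superring_scheme \<Rightarrow> 'k \<Rightarrow> nat \<Rightarrow> 'k"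
  where "phi_series K c =
    (if c = \<zero>\<^bsub>K\<^esub> then (\<lambda>n. if n = 1 then \<ominus>\<^bsub>K\<^esub> \<one>\<^bsub>K\<^esub> else \<zero>\<^bsub>K\<^esub>)
     else (THE b. range b \<subseteq> gr K 0 \<and>
       (\<forall>n. (\<Oplus>\<^bsub>K\<^esub>k\<in>{..n}. b k \<otimes>\<^bsub>K\<^esub> exp_minus_one K c (n - k)) = (if n = 1 then \<one>\<^bsub>K\<^esub> else \<zero>\<^bsub>K\<^esub>))))"

definition Phi :: "('k, 'b) superring_scheme \<Rightarrow> ('k, 'g, 'c) lie_algebra_scheme
    \<Rightarrow> 'k \<Rightarrow> 'g \<Rightarrow> ('k, 'g) sym_elem \<Rightarrow> ('k, 'g) sym_elem"
  where "Phi K \<gg> c = Phi_map K \<gg> (phi_series K c)"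

definition zero_rep :: "('k, 'b) superring_scheme \<Rightarrow> ('k, 'g, 'c) lie_algebra_scheme
    \<Rightarrow> 'g \<Rightarrow> ('k, 'g) sym_elem \<Rightarrow> ('k, 'g) sym_elem"
  where "zero_rep K \<gg> a = \<zero>\<^bsub>End_lie K (sym_algebra K \<gg>)\<^esub>"

definition pair_rep :: "('k, 'b) superring_scheme \<Rightarrow> ('k, 'g, 'c) lie_algebra_scheme
    \<Rightarrow> ('g \<Rightarrow> ('k, 'g) sym_elem \<Rightarrow> ('k, 'g) sym_elem)
    \<Rightarrow> ('g \<Rightarrow> ('k, 'g) sym_elem \<Rightarrow> ('k, 'g) sym_elem)
    \<Rightarrow> 'g \<times> 'g \<Rightarrow> ('k, 'g) sym_elem \<Rightarrow> ('k, 'g) sym_elem"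
  where "pair_rep K \<gg> \<rho>\<^sub>1 \<rho>\<^sub>2 = (\<lambda>(a\<^sub>1, a\<^sub>2). \<rho>\<^sub>1 a\<^sub>1 \<oplus>\<^bsub>End_lie K (sym_algebra K \<gg>)\<^esub> \<rho>\<^sub>2 a\<^sub>2)"

definition coderivation_rep :: "('k, 'b) superring_scheme \<Rightarrow> ('k, 'h, 'd) lie_algebra_scheme
    \<Rightarrow> ('k, 'g, 'c) lie_algebra_scheme
    \<Rightarrow> ('h \<Rightarrow> ('k, 'g) sym_elem \<Rightarrow> ('k, 'g) sym_elem) \<Rightarrow> bool"
  where "coderivation_rep K \<hh> \<gg> \<rho> \<longleftrightarrow> lie_morphism K \<hh> (End_lie K (sym_algebra K \<gg>)) \<rho> \<and>
    (\<forall>a\<in>carrier \<hh>. coderivation K \<gg> (\<rho> a))"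

end

theory Submission
  imports Defs "HOL-Computational_Algebra.Formal_Power_Series" "HOL-Computational_Algebra.Polynomial"
    "HOL-Combinatorics.Multiset_Permutations" "HOL-Library.Function_Algebras"
begin

text \<open>
  The convolution bracket $[F,G]=[\cdot,\cdot]\circ(F\otimes G)\circ\Delta$ makes
  $L=Hom(S(\mathfrak g),\mathfrak g)$ a Lie superalgebra. Every homogeneous $F\in L$ gives a coderivation
  $\Psi^F=\mathrm{Mult}\circ(id\otimes F)\circ\Delta$, and
  $[\Psi^F,\Psi^G]=\Psi^H$ for $H=F\circ\Psi^G-(-1)^{p(F)p(G)}G\circ\Psi^F$, so that all claims become
  identities in $L$. The projection $\pi:S(\mathfrak g)\to\mathfrak g$ is a generic even element of $L$:
  identifying $a\in\mathfrak g$ with the map $x\mapsto a\,\epsilon(x)$, $\epsilon$ the counit, one has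
  $\varphi^a=\varphi(\mathrm{ad}\,\pi)(a)$. As $\pi\circ\Psi^G=G$, $a\circ\Psi^G=0$ and composition with
  $\Psi^G$ obeys a Leibniz rule for the bracket of $L$, the element $H$ belonging to $\varphi^a$ and
  $\varphi^b$ is obtained from $[a,b]$ by a polynomial in the commuting operators $u$, $v$ by which
  $\mathrm{ad}\,\pi$ acts on $a$ and on $b$. It equals $\varphi^{[a,b]}$ because $f(t)=t/(e^t-1)$
  satisfies $f(u+v)(u f(v)+v f(u)+uv)=(u+v)f(u)f(v)$.

  Moreover $[\Phi^a,\Phi_0^b]=\Phi^{[a,b]}$ for the $\Phi$ of any power series $\varphi$. This settles
  $\Phi_0$, and, since $\varphi_{-d}=\varphi_0-\varphi_d$, it shows that $\Phi_d$ and $\Phi_{-d}$ commute.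
\<close>

section \<open>Parities and signs\<close>

text \<open>An element F of L is determined by its value at 1 and by its derivatives, the maps
  sending w to F(X w). Bracket, attached coderivation and composition each obey a Leibniz rule for
  these derivatives, inherited from Delta(X w) = Delta(X) Delta(w). Identities in L are therefore
  proved by induction on words, for all maps and all parities at once, and reduce to the base case
  at 1.

  The functional equation arises from difference quotients. Composing (ad pi)^n a with a
  coderivation leaves a geometric sum in ad pi, the difference quotient of t^n at u + v and u, whose
  denominator is v. For a series f the commutator becomes -(f(v) (f(u+v) - f(u)) / v + f(u) (f(u+v)
  - f(v)) / u); setting this equal to f(u+v) and multiplying by uv gives the equation. As u and v
  cannot be inverted as operators, the quotients are formed in polynomials over the rationals and
  then carried to K.

  A series in ad pi is an infinite sum. Elements of S have finite word length and (ad pi)^n a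
  vanishes on words shorter than n, so each identity is checked at one argument with truncated
  series.\<close>

lemma bit_char_2 [simp]:
  fixes e f :: bit
  shows "e + e = 0" "e + (e + f) = f" "e * e = e" "e * (e * f) = e * f"
  by (cases e; simp)+

declare add_bit_eq_xor [simp del] mult_bit_eq_and [simp del]

text \<open>The counterpart of \<open>neg_pow\<close> for an additive type. Its exponent stays a
  ring expression over \<open>bit\<close>, so that \<open>algebra_simps\<close> and
  \<open>bit_char_2\<close> decide whether two signs agree.\<close>

definition sg :: "bit \<Rightarrow> 'a::ab_group_add \<Rightarrow> 'a"
  where "sg e x = (if e = 1 then - x else x)"

lemma sg_0 [simp]: "sg 0 x = x" and sg_1 [simp]: "sg 1 x = - x"
  by (simp_all add: sg_def)

lemma sg_zero [simp]: "sg e 0 = 0"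
  by (simp add: sg_def)

lemma sg_sg [simp]: "sg e (sg f x) = sg (e + f) x"
  by (cases e; cases f; simp)

lemma sg_add: "sg e (x + y) = sg e x + sg e y"
  by (simp add: sg_def)

lemma sg_minus: "sg e (- x) = - sg e x"
  by (simp add: sg_def)

lemma sg_diff: "sg e (x - y) = sg e x - sg e y"
  by (simp add: sg_def)

lemma sg_sum: "sg e (sum f A) = (\<Sum>a\<in>A. sg e (f a))"
  by (simp add: sg_def sum_negf)

lemma sg_cancel [simp]: "sg e x = sg e y \<longleftrightarrow> x = y"
  by (simp add: sg_def)

lemma neg_pow_0 [simp]: "neg_pow M 0 x = x" and neg_pow_1 [simp]: "neg_pow M 1 x = \<ominus>\<^bsub>M\<^esub> x"
  by (simp_all add: neg_pow_def)

section \<open>Signs and elementary identities in abelian groups given by a carrier\<close>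

context abelian_group
begin

lemma a_inv_zero [simp]: "\<ominus> \<zero> = \<zero>"
  by (rule minus_equality) auto

lemma diff_eq_zero_iff: "x \<in> carrier G ==> y \<in> carrier G ==> x \<ominus> y = \<zero> \<longleftrightarrow> x = y"
  using minus_equality[of x "\<ominus> y"] by (auto simp: a_minus_def r_neg)

lemma diff_diff_eq_zero:
  assumes "y \<in> carrier G" "z \<in> carrier G"
  shows "(y \<oplus> z) \<ominus> y \<ominus> z = \<zero>"
proof -
  have "(y \<oplus> z) \<ominus> y \<ominus> z = (y \<oplus> (\<ominus> y)) \<oplus> (z \<oplus> (\<ominus> z))"
    using assms by (simp add: a_minus_def a_ac)
  also have "\<dots> = \<zero>" using assms by (simp add: r_neg)
  finally show ?thesis .
qed

lemma diff_diff_eq_zeroD: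
  assumes "x \<ominus> y \<ominus> z = \<zero>" "x \<in> carrier G" "y \<in> carrier G" "z \<in> carrier G"
  shows "x = y \<oplus> z"
proof -
  have "x \<ominus> y \<ominus> z = x \<ominus> (y \<oplus> z)" using assms by (simp add: a_minus_def minus_add a_ac)
  then show ?thesis using assms diff_eq_zero_iff[of x "y \<oplus> z"] by simp
qed

lemma add_diff_cancel4:
  assumes "y \<in> carrier G" "z \<in> carrier G" "w \<in> carrier G"
  shows "(y \<oplus> z \<ominus> w) \<oplus> (\<ominus> z) = y \<oplus> (\<ominus> w)"
proof -
  have "(y \<oplus> z \<ominus> w) \<oplus> (\<ominus> z) = (y \<oplus> (\<ominus> w)) \<oplus> (z \<oplus> (\<ominus> z))"
    using assms by (simp add: a_minus_def a_ac)
  also have "\<dots> = y \<oplus> (\<ominus> w)" using assms by (simp add: r_neg)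
  finally show ?thesis .
qed

lemma neg_pow_closed [simp, intro]: "x \<in> carrier G ==> neg_pow G e x \<in> carrier G"
  by (simp add: neg_pow_def)

lemma neg_pow_neg_pow [simp]: "x \<in> carrier G ==> neg_pow G e (neg_pow G f x) = neg_pow G (e + f) x"
  by (cases e; cases f; simp)

lemma neg_pow_add: "x \<in> carrier G ==> y \<in> carrier G ==> neg_pow G e (x \<oplus> y) = neg_pow G e x \<oplus> neg_pow G e y"
  by (cases e) (simp_all add: minus_add)

lemma neg_pow_zero [simp]: "neg_pow G e \<zero> = \<zero>"
  by (cases e) simp_all

lemma add_swap4:
  "a \<in> carrier G ==> b \<in> carrier G ==> c \<in> carrier G ==> d \<in> carrier G ==>
    (a \<oplus> b) \<oplus> (c \<oplus> d) = (a \<oplus> c) \<oplus> (b \<oplus> d)"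
  by (simp add: a_ac)

lemma finsum_bit:
  "f 0 \<in> carrier G ==> f 1 \<in> carrier G ==> (\<Oplus>i\<in>{0,1::bit}. f i) = f 0 \<oplus> f 1"
  by (subst finsum_insert) auto

lemma neg_pow_subgroup: "additive_subgroup H G ==> x \<in> H ==> neg_pow G e x \<in> H"
  by (simp add: neg_pow_def additive_subgroup.a_inv_closed abelian_group_axioms)

end

section \<open>Additive maps\<close>

text \<open>The records involved include groups whose multiplication is \<open>undefined\<close>, so
  additivity alone is recorded. It suffices to carry zero, signs and finite sums across a
  map.\<close>

definition additive_maps :: "('a, 'x) ring_scheme \<Rightarrow> ('b, 'y) ring_scheme \<Rightarrow> ('a \<Rightarrow> 'b) set"
  where "additive_maps G P = {f \<in> carrier G \<rightarrow> carrier P.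
    \<forall>x\<in>carrier G. \<forall>y\<in>carrier G. f (x \<oplus>\<^bsub>G\<^esub> y) = f x \<oplus>\<^bsub>P\<^esub> f y}"

lemma additive_mapsI:
  assumes "\<And>x. x \<in> carrier G ==> f x \<in> carrier P"
    and "\<And>x y. x \<in> carrier G ==> y \<in> carrier G ==> f (x \<oplus>\<^bsub>G\<^esub> y) = f x \<oplus>\<^bsub>P\<^esub> f y"
  shows "f \<in> additive_maps G P"
  using assms by (auto simp: additive_maps_def)

lemma additive_maps_closed: "f \<in> additive_maps G P ==> x \<in> carrier G ==> f x \<in> carrier P"
  and additive_maps_add: "f \<in> additive_maps G P ==> x \<in> carrier G ==> y \<in> carrier G ==>
    f (x \<oplus>\<^bsub>G\<^esub> y) = f x \<oplus>\<^bsub>P\<^esub> f y"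
  by (auto simp: additive_maps_def)

lemma additive_maps_zero:
  assumes "f \<in> additive_maps G P" "abelian_group G" "abelian_group P"
  shows "f \<zero>\<^bsub>G\<^esub> = \<zero>\<^bsub>P\<^esub>"
proof -
  interpret G: abelian_group G by fact
  interpret P: abelian_group P by fact
  have c: "f \<zero>\<^bsub>G\<^esub> \<in> carrier P" using assms(1) by (auto simp: additive_maps_def)
  have "f \<zero>\<^bsub>G\<^esub> \<oplus>\<^bsub>P\<^esub> f \<zero>\<^bsub>G\<^esub> = f \<zero>\<^bsub>G\<^esub>"
    using additive_maps_add[OF assms(1), of "\<zero>\<^bsub>G\<^esub>" "\<zero>\<^bsub>G\<^esub>"] by simp
  with c show ?thesis by (metis P.add.l_cancel_one)
qed

lemma additive_maps_a_inv:
  assumes "f \<in> additive_maps G P" "abelian_group G" "abelian_group P" "x \<in> carrier G"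
  shows "f (\<ominus>\<^bsub>G\<^esub> x) = \<ominus>\<^bsub>P\<^esub> f x"
proof -
  interpret G: abelian_group G by fact
  interpret P: abelian_group P by fact
  have c: "f x \<in> carrier P" "f (\<ominus>\<^bsub>G\<^esub> x) \<in> carrier P" using assms by (auto simp: additive_maps_def)
  have "f (\<ominus>\<^bsub>G\<^esub> x) \<oplus>\<^bsub>P\<^esub> f x = \<zero>\<^bsub>P\<^esub>"
    using additive_maps_add[OF assms(1), of "\<ominus>\<^bsub>G\<^esub> x" x] additive_maps_zero[OF assms(1-3)] assms(4)
    by (simp add: G.l_neg)
  with c show ?thesis by (metis P.minus_equality)
qed

lemma additive_maps_neg_pow:
  assumes "f \<in> additive_maps G P" "abelian_group G" "abelian_group P" "x \<in> carrier G"
  shows "f (neg_pow G e x) = neg_pow P e (f x)"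
  using additive_maps_a_inv[OF assms] by (simp add: neg_pow_def)

lemma additive_maps_finsum:
  assumes "f \<in> additive_maps G P" "abelian_group G" "abelian_group P"
    and "\<And>i. i \<in> A ==> g i \<in> carrier G"
  shows "f (finsum G g A) = finsum P (\<lambda>i. f (g i)) A"
proof -
  interpret G: abelian_group G by fact
  interpret P: abelian_group P by fact
  show ?thesis using assms(4)
  proof (induction A rule: infinite_finite_induct)
    case (insert i A)
    then show ?case
      using additive_maps_closed[OF assms(1)]
      by (subst G.finsum_insert) (auto simp: additive_maps_add[OF assms(1)] P.finsum_insert)
  qed (auto simp: additive_maps_zero[OF assms(1-3)])
qed

lemma additive_maps_comp:
  "f \<in> additive_maps G P ==> g \<in> additive_maps P Q ==> (\<lambda>x. g (f x)) \<in> additive_maps G Q"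
  by (auto simp: additive_maps_def Pi_iff)

lemma additive_maps_sum:
  assumes "abelian_group P" "f \<in> additive_maps G P" "g \<in> additive_maps G P"
  shows "(\<lambda>x. f x \<oplus>\<^bsub>P\<^esub> g x) \<in> additive_maps G P"
proof -
  interpret P: abelian_group P by fact
  show ?thesis using assms(2,3) by (auto simp: additive_maps_def Pi_iff P.add_swap4)
qed

lemma additive_maps_sgn:
  assumes "abelian_group P" "f \<in> additive_maps G P"
  shows "(\<lambda>x. neg_pow P e (f x)) \<in> additive_maps G P"
proof -
  interpret P: abelian_group P by fact
  show ?thesis using assms(2) by (auto simp: additive_maps_def Pi_iff P.neg_pow_add)
qed

text \<open>The operation performed by \<^const>\<open>tensor_lift\<close> on a representative.\<close>

definition fext :: "('p, 'e) ring_scheme \<Rightarrow> ('a \<Rightarrow> 'p) \<Rightarrow> ('a \<Rightarrow>\<^sub>0 int) \<Rightarrow> 'p"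
  where "fext P f x = finsum P (\<lambda>a. [Poly_Mapping.lookup x a] \<cdot>\<^bsub>P\<^esub> f a) (Poly_Mapping.keys x)"

context abelian_group
begin

text \<open>Brings two representatives to a common finite index set, on which their coefficients can
  be added.\<close>

lemma fext_superset:
  assumes "finite B" "Poly_Mapping.keys x \<subseteq> B" "\<And>a. a \<in> B ==> f a \<in> carrier G"
  shows "fext G f x = finsum G (\<lambda>a. [Poly_Mapping.lookup x a] \<cdot> f a) B"
  unfolding fext_def
  by (rule add.finprod_mono_neutral_cong_left) (use assms in \<open>auto simp: in_keys_iff add_pow_int_ge\<close>)

lemma fext_closed:
  assumes "\<And>a. a \<in> Poly_Mapping.keys x ==> f a \<in> carrier G"
  shows "fext G f x \<in> carrier G"
  unfolding fext_def by (rule finsum_closed) (use assms in auto)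

lemma fext_frag_of [simp]: "f a \<in> carrier G ==> fext G f (frag_of a) = f a"
  by (simp add: fext_def)

lemma fext_zero [simp]: "fext G f 0 = \<zero>"
  by (simp add: fext_def)

lemma fext_add:
  assumes "\<And>a. a \<in> A ==> f a \<in> carrier G" "Poly_Mapping.keys x \<subseteq> A" "Poly_Mapping.keys y \<subseteq> A"
  shows "fext G f (x + y) = fext G f x \<oplus> fext G f y"
proof -
  let ?B = "Poly_Mapping.keys x \<union> Poly_Mapping.keys y"
  have B: "\<And>a. a \<in> ?B ==> f a \<in> carrier G" using assms by auto
  have "fext G f (x + y) = finsum G (\<lambda>a. [Poly_Mapping.lookup (x + y) a] \<cdot> f a) ?B"
    by (rule fext_superset) (use B keys_add[of x y] in auto)
  also have "\<dots> = finsum G (\<lambda>a. [Poly_Mapping.lookup x a] \<cdot> f a \<oplus> [Poly_Mapping.lookup y a] \<cdot> f a) ?B"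
    by (rule finsum_cong') (use B in \<open>auto simp: lookup_add add.int_pow_mult\<close>)
  also have "\<dots> = finsum G (\<lambda>a. [Poly_Mapping.lookup x a] \<cdot> f a) ?B \<oplus>
      finsum G (\<lambda>a. [Poly_Mapping.lookup y a] \<cdot> f a) ?B"
    by (rule finsum_addf) (use B in auto)
  also have "\<dots> = fext G f x \<oplus> fext G f y"
    using fext_superset[of ?B x f] fext_superset[of ?B y f] B by simp
  finally show ?thesis .
qed

lemma fext_uminus:
  assumes "\<And>a. a \<in> A ==> f a \<in> carrier G" "Poly_Mapping.keys x \<subseteq> A"
  shows "fext G f (- x) = \<ominus> fext G f x"
proof -
  have "fext G f x \<in> carrier G" "fext G f (- x) \<in> carrier G"
    using assms by (auto intro!: fext_closed)
  moreover have "fext G f (- x) \<oplus> fext G f x = \<zero>"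
    using fext_add[of A f "- x" x] assms by (simp add: keys_minus)
  ultimately show ?thesis by (metis minus_equality)
qed

lemma fext_diff:
  assumes "\<And>a. a \<in> A ==> f a \<in> carrier G" "Poly_Mapping.keys x \<subseteq> A" "Poly_Mapping.keys y \<subseteq> A"
  shows "fext G f (x - y) = fext G f x \<ominus> fext G f y"
  using fext_add[of A f x "- y"] fext_uminus[of A f y] assms
  by (simp add: keys_minus a_minus_def)

end

section \<open>A group type containing all abelian groups on a given type\<close>

text \<open>
  The product of all abelian groups whose carrier lies in \<^typ>\<open>'a\<close> is an instance of
  \<^class>\<open>ab_group_add\<close> containing each of them as a direct summand. It makes the big-operator
  calculus of \<^const>\<open>sum\<close> available for groups given by a carrier.
\<close>

typedef 'a amb = "{f :: 'a monoid \<Rightarrow> 'a. \<forall>R. if comm_group R then f R \<in> carrier R else f R = undefined}"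
proof
  show "(\<lambda>R. if comm_group R then \<one>\<^bsub>R\<^esub> else undefined) \<in>
    {f :: 'a monoid \<Rightarrow> 'a. \<forall>R. if comm_group R then f R \<in> carrier R else f R = undefined}"
    by (auto intro: monoid.one_closed simp: comm_group_def comm_monoid_def)
qed

lemma Rep_amb_closed: "comm_group R ==> Rep_amb x R \<in> carrier R"
  using Rep_amb[of x] by (auto split: if_splits)

lemma amb_eqI: "(\<And>R. comm_group R ==> Rep_amb x R = Rep_amb y R) ==> x = y"
proof -
  assume *: "\<And>R. comm_group R ==> Rep_amb x R = Rep_amb y R"
  have "Rep_amb x R = Rep_amb y R" for R
    using * Rep_amb[of x] Rep_amb[of y] by (cases "comm_group R") (auto dest!: spec[of _ R])
  then show ?thesis by (simp add: Rep_amb_inject[symmetric] fun_eq_iff)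
qed

lemma Rep_Abs_amb:
  assumes "\<And>R. comm_group R ==> f R \<in> carrier R" "comm_group R"
  shows "Rep_amb (Abs_amb (\<lambda>R. if comm_group R then f R else undefined)) R = f R"
  using assms by (subst Abs_amb_inverse) auto

instantiation amb :: (type) ab_group_add
begin

definition "0 = Abs_amb (\<lambda>R. if comm_group R then \<one>\<^bsub>R\<^esub> else undefined)"
definition "x + y = Abs_amb (\<lambda>R. if comm_group R then Rep_amb x R \<otimes>\<^bsub>R\<^esub> Rep_amb y R else undefined)"
definition "- x = Abs_amb (\<lambda>R. if comm_group R then inv\<^bsub>R\<^esub> Rep_amb x R else undefined)"
definition "x - y = x + (- y :: 'a amb)"

lemma Rep_amb_zero: "comm_group R ==> Rep_amb 0 R = \<one>\<^bsub>R\<^esub>"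
  unfolding zero_amb_def
  by (rule Rep_Abs_amb) (auto intro: monoid.one_closed simp: comm_group_def comm_monoid_def)

lemma Rep_amb_add: "comm_group R ==> Rep_amb (x + y) R = Rep_amb x R \<otimes>\<^bsub>R\<^esub> Rep_amb y R"
  unfolding plus_amb_def
  by (rule Rep_Abs_amb)
    (auto intro!: monoid.m_closed Rep_amb_closed simp: comm_group.axioms(1) comm_monoid.axioms(1))

lemma Rep_amb_uminus: "comm_group R ==> Rep_amb (- x) R = inv\<^bsub>R\<^esub> Rep_amb x R"
  unfolding uminus_amb_def
  by (rule Rep_Abs_amb) (auto intro!: group.inv_closed Rep_amb_closed simp: comm_group.axioms(2))

instance
proof
  fix a b c :: "'a amb"
  show "a + b + c = a + (b + c)"
  proof (rule amb_eqI)
    fix R :: "'a monoid" assume "comm_group R"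
    then interpret R: comm_group R .
    show "Rep_amb (a + b + c) R = Rep_amb (a + (b + c)) R"
      using \<open>comm_group R\<close> by (simp add: Rep_amb_add Rep_amb_closed R.m_assoc)
  qed
  show "a + b = b + a"
  proof (rule amb_eqI)
    fix R :: "'a monoid" assume "comm_group R"
    then interpret R: comm_group R .
    show "Rep_amb (a + b) R = Rep_amb (b + a) R"
      using \<open>comm_group R\<close> by (simp add: Rep_amb_add Rep_amb_closed R.m_comm)
  qed
  show "0 + a = a"
  proof (rule amb_eqI)
    fix R :: "'a monoid" assume "comm_group R"
    then interpret R: comm_group R .
    show "Rep_amb (0 + a) R = Rep_amb a R"
      using \<open>comm_group R\<close> by (simp add: Rep_amb_add Rep_amb_zero Rep_amb_closed)
  qed
  show "- a + a = 0"
  proof (rule amb_eqI)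
    fix R :: "'a monoid" assume "comm_group R"
    then interpret R: comm_group R .
    show "Rep_amb (- a + a) R = Rep_amb 0 R"
      using \<open>comm_group R\<close> by (simp add: Rep_amb_add Rep_amb_zero Rep_amb_uminus Rep_amb_closed)
  qed
qed (simp add: minus_amb_def)

end

text \<open>The factors of \<open>amb\<close> are indexed by bare monoid records: the addition of G
  becomes a multiplication and the further fields of G are dropped.\<close>

definition add_grp :: "('a, 'b) ring_scheme \<Rightarrow> 'a monoid"
  where "add_grp G = \<lparr>carrier = carrier G, monoid.mult = add G, one = zero G\<rparr>"

lemma add_grp_simps [simp]:
  "carrier (add_grp G) = carrier G" "x \<otimes>\<^bsub>add_grp G\<^esub> y = x \<oplus>\<^bsub>G\<^esub> y" "\<one>\<^bsub>add_grp G\<^esub> = \<zero>\<^bsub>G\<^esub>"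
  by (simp_all add: add_grp_def)

text \<open>\<open>val\<close> is the projection of \<open>amb\<close> to the factor belonging to G,
  and \<open>emb\<close> is the inclusion of that factor with neutral entries elsewhere. Thus
  \<open>val\<close> inverts \<open>emb\<close> on the carrier, while \<open>emb\<close> after
  \<open>val\<close> forgets all other factors.\<close>

definition val :: "('a, 'b) ring_scheme \<Rightarrow> 'a amb \<Rightarrow> 'a"
  where "val G x = Rep_amb x (add_grp G)"

definition emb :: "('a, 'b) ring_scheme \<Rightarrow> 'a \<Rightarrow> 'a amb"
  where "emb G x = Abs_amb (\<lambda>R. if comm_group R then if R = add_grp G then x else \<one>\<^bsub>R\<^esub> else undefined)"

text \<open>A type of abelian groups seen as a record, so that tensor lifts may take values in it
  and their finite sums turn into \<open>sum\<close>.\<close>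

definition univ_group :: "'p::ab_group_add ring"
  where "univ_group = \<lparr>carrier = UNIV, mult = undefined, one = undefined, zero = 0, add = (+)\<rparr>"

lemma univ_group_simps [simp]:
  "carrier univ_group = UNIV" "x \<oplus>\<^bsub>univ_group\<^esub> y = x + y" "\<zero>\<^bsub>univ_group\<^esub> = 0"
  by (simp_all add: univ_group_def)

lemma univ_group_abelian: "abelian_group (univ_group :: 'p::ab_group_add ring)"
  by (rule abelian_groupI) (auto simp: algebra_simps intro: exI[of _ "- _"] left_minus)

interpretation univ: abelian_group univ_group
  by (rule univ_group_abelian)

lemma univ_a_inv [simp]: "\<ominus>\<^bsub>univ_group\<^esub> x = - x"
  by (rule univ.minus_equality) auto

lemma univ_neg_pow [simp]: "neg_pow univ_group e x = sg e x"
  by (simp add: neg_pow_def sg_def)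

lemma univ_finsum [simp]: "finsum univ_group f A = sum f A"
  by (induction A rule: infinite_finite_induct) (auto simp: univ.finsum_insert)

context abelian_group
begin

lemma comm_group_add_grp: "comm_group (add_grp G)"
  by (rule comm_groupI) (auto simp: a_ac intro: exI[of _ "\<ominus> _"] l_neg)

lemma val_closed [simp, intro]: "val G x \<in> carrier G"
  using Rep_amb_closed[OF comm_group_add_grp, of x] by (simp add: val_def)

lemma val_add [simp]: "val G (x + y) = val G x \<oplus> val G y"
  using Rep_amb_add[OF comm_group_add_grp, of x y] by (simp add: val_def)

lemma val_zero [simp]: "val G 0 = \<zero>"
  using Rep_amb_zero[OF comm_group_add_grp] by (simp add: val_def)

lemma val_additive: "val G \<in> additive_maps univ_group G"
  by (rule additive_mapsI) auto

lemma val_uminus [simp]: "val G (- x) = \<ominus> val G x"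
  using additive_maps_a_inv[OF val_additive univ_group_abelian abelian_group_axioms, of x] by simp

lemma val_sg [simp]: "val G (sg e x) = neg_pow G e (val G x)"
  by (simp add: sg_def neg_pow_def)

lemma val_sum: "val G (sum f A) = finsum G (\<lambda>i. val G (f i)) A"
  using additive_maps_finsum[OF val_additive univ_group_abelian abelian_group_axioms, of A f] by simp

lemma Rep_amb_emb:
  assumes "x \<in> carrier G" "comm_group R"
  shows "Rep_amb (emb G x) R = (if R = add_grp G then x else \<one>\<^bsub>R\<^esub>)"
  unfolding emb_def
  by (rule Rep_Abs_amb)
    (use assms in \<open>auto intro: monoid.one_closed simp: comm_group_def comm_monoid_def\<close>)

lemma val_emb [simp]: "x \<in> carrier G ==> val G (emb G x) = x"
  using Rep_amb_emb[OF _ comm_group_add_grp] by (simp add: val_def)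

lemma emb_inject: "emb G x = emb G y ==> x \<in> carrier G ==> y \<in> carrier G ==> x = y"
  by (metis val_emb)

lemma emb_add:
  assumes "x \<in> carrier G" "y \<in> carrier G"
  shows "emb G (x \<oplus> y) = emb G x + emb G y"
proof (rule amb_eqI)
  fix R :: "'a monoid" assume "comm_group R"
  then interpret R: comm_group R .
  show "Rep_amb (emb G (x \<oplus> y)) R = Rep_amb (emb G x + emb G y) R"
    using \<open>comm_group R\<close> assms by (auto simp: Rep_amb_add Rep_amb_emb)
qed

lemma emb_additive: "emb G \<in> additive_maps G univ_group"
  by (rule additive_mapsI) (auto simp: emb_add)

lemma emb_zero [simp]: "emb G \<zero> = 0"
  using additive_maps_zero[OF emb_additive abelian_group_axioms univ_group_abelian] by simp

lemma emb_a_inv: "x \<in> carrier G ==> emb G (\<ominus> x) = - emb G x"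
  using additive_maps_a_inv[OF emb_additive abelian_group_axioms univ_group_abelian] by simp

lemma emb_neg_pow: "x \<in> carrier G ==> emb G (neg_pow G e x) = sg e (emb G x)"
  by (simp add: neg_pow_def sg_def emb_a_inv)

end

section \<open>Graded groups and modules\<close>

text \<open>For two decompositions with first components y and w, the difference of y and w lies in
  both parts. The hypotheses speak of the two parts directly because the lemma is also applied to
  \<open>Hom\<close>, which is not interpreted as a \<open>graded_group\<close>.\<close>

lemma prt_eqI:
  assumes "abelian_group M" "\<And>i. additive_subgroup (gr M i) M" "gr M 0 \<inter> gr M 1 = {\<zero>\<^bsub>M\<^esub>}"
    and y: "y \<in> gr M i" and z: "z \<in> gr M (i + 1)"
  shows "prt M i (y \<oplus>\<^bsub>M\<^esub> z) = y"
proof -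
  interpret abelian_group M by fact
  have sub: "gr M j \<subseteq> carrier M" for j using assms(2) by (rule additive_subgroup.a_subset)
  have dis: "x = \<zero>\<^bsub>M\<^esub>" if "x \<in> gr M i" "x \<in> gr M (i + 1)" for x
    using that assms(3) by (cases i) auto
  have yz: "y \<in> carrier M" "z \<in> carrier M" using y z sub by auto
  show ?thesis unfolding prt_def
  proof (rule the_equality)
    have "y \<oplus>\<^bsub>M\<^esub> z \<ominus>\<^bsub>M\<^esub> y = z" using yz by (simp add: a_minus_def a_comm[of y] add.m_assoc r_neg)
    with y z show "y \<in> gr M i \<and> y \<oplus>\<^bsub>M\<^esub> z \<ominus>\<^bsub>M\<^esub> y \<in> gr M (i + 1)" by simp
  next
    fix w assume w: "w \<in> gr M i \<and> y \<oplus>\<^bsub>M\<^esub> z \<ominus>\<^bsub>M\<^esub> w \<in> gr M (i + 1)"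
    then have wc: "w \<in> carrier M" using sub by auto
    have "(y \<oplus>\<^bsub>M\<^esub> z \<ominus>\<^bsub>M\<^esub> w) \<oplus>\<^bsub>M\<^esub> (\<ominus>\<^bsub>M\<^esub> z) \<in> gr M (i + 1)"
      using w z by (intro additive_subgroup.a_closed[OF assms(2)] additive_subgroup.a_inv_closed[OF assms(2)])
        (auto intro: abelian_group_axioms)
    moreover have "(y \<oplus>\<^bsub>M\<^esub> z \<ominus>\<^bsub>M\<^esub> w) \<oplus>\<^bsub>M\<^esub> (\<ominus>\<^bsub>M\<^esub> z) = y \<oplus>\<^bsub>M\<^esub> (\<ominus>\<^bsub>M\<^esub> w)"
      using yz wc by (intro add_diff_cancel4)
    moreover have "y \<oplus>\<^bsub>M\<^esub> (\<ominus>\<^bsub>M\<^esub> w) \<in> gr M i"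
      using w y by (intro additive_subgroup.a_closed[OF assms(2)] additive_subgroup.a_inv_closed[OF assms(2)])
        (auto intro: abelian_group_axioms)
    ultimately have "y \<oplus>\<^bsub>M\<^esub> (\<ominus>\<^bsub>M\<^esub> w) = \<zero>\<^bsub>M\<^esub>" using dis by auto
    then show "w = y" using yz wc diff_eq_zero_iff[of y w] by (simp add: a_minus_def)
  qed
qed

text \<open>The operator multiplying a homogeneous x by (-1)^(e p(x)), extended additively: the
  Koszul sign for moving an object of parity e past x.\<close>

definition twist :: "('a, 'b) superring_scheme \<Rightarrow> bit \<Rightarrow> 'a \<Rightarrow> 'a"
  where "twist M e x = prt M 0 x \<oplus>\<^bsub>M\<^esub> neg_pow M e (prt M 1 x)"

section \<open>Homogeneous components and parity twists\<close>

context graded_group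
begin

lemma gr_closed [simp, intro]: "x \<in> gr M i ==> x \<in> carrier M"
  using additive_subgroup.a_subset[OF gr_subgroup] by blast

lemma gr_zero [simp, intro]: "\<zero> \<in> gr M i"
  by (rule additive_subgroup.zero_closed[OF gr_subgroup])

lemma gr_add [intro]: "x \<in> gr M i ==> y \<in> gr M i ==> x \<oplus> y \<in> gr M i"
  by (rule additive_subgroup.a_closed[OF gr_subgroup])

lemma gr_neg_pow [intro]: "x \<in> gr M i ==> neg_pow M e x \<in> gr M i"
  by (rule neg_pow_subgroup[OF gr_subgroup])

lemma gr_a_inv [intro]: "x \<in> gr M i ==> \<ominus> x \<in> gr M i"
  using gr_neg_pow[of x i 1] by simp

lemma gr_both: "x \<in> gr M i ==> x \<in> gr M (i + 1) ==> x = \<zero>"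
  using gr_disjoint by (cases i) auto

lemma gr_split:
  assumes "x \<in> carrier M"
  obtains y z where "y \<in> gr M i" "z \<in> gr M (i + 1)" "x = y \<oplus> z"
proof -
  obtain y z where yz: "y \<in> gr M 0" "z \<in> gr M 1" "x = y \<oplus> z"
    using assms gr_sum unfolding set_add_def' by blast
  then have "x = z \<oplus> y" by (simp add: a_comm)
  with yz that show ?thesis by (cases i) auto
qed

lemma prt_plus: "y \<in> gr M i ==> z \<in> gr M (i + 1) ==> prt M i (y \<oplus> z) = y"
  by (rule prt_eqI[OF abelian_group_axioms gr_subgroup gr_disjoint])

lemma prt_gr [simp, intro]: "x \<in> carrier M ==> prt M i x \<in> gr M i"
  by (metis gr_split prt_plus)

lemma prt_closed [simp, intro]: "x \<in> carrier M ==> prt M i x \<in> carrier M"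
  using prt_gr by blast

lemma prt_sum_general: "x \<in> carrier M ==> prt M i x \<oplus> prt M (i + 1) x = x"
proof -
  assume "x \<in> carrier M"
  then obtain y z where *: "y \<in> gr M i" "z \<in> gr M (i + 1)" "x = y \<oplus> z" by (rule gr_split)
  then have "prt M i x = y" by (simp add: prt_plus)
  moreover have "prt M (i + 1) x = z" using prt_plus[of z "i + 1" y] * by (simp add: a_comm add.assoc)
  ultimately show ?thesis using * by simp
qed

lemma prt_sum: "x \<in> carrier M ==> prt M 0 x \<oplus> prt M 1 x = x"
  using prt_sum_general[of x 0] by simp

lemma prt_same [simp]: "x \<in> gr M i ==> prt M i x = x"
  using prt_plus[of x i \<zero>] by simp

lemma prt_other [simp]: "x \<in> gr M i ==> prt M (i + 1) x = \<zero>"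
  using prt_plus[of \<zero> "i + 1" x] by (simp add: add.assoc)

lemma prt_homogeneous: "x \<in> gr M i ==> prt M j x = (if j = i then x else \<zero>)"
  using prt_same[of x i] prt_other[of x i] by (cases i; cases j) auto

lemma prt_add:
  assumes "x \<in> carrier M" "y \<in> carrier M"
  shows "prt M i (x \<oplus> y) = prt M i x \<oplus> prt M i y"
proof -
  have "x \<oplus> y = (prt M i x \<oplus> prt M (i + 1) x) \<oplus> (prt M i y \<oplus> prt M (i + 1) y)"
    using assms by (simp add: prt_sum_general)
  also have "\<dots> = (prt M i x \<oplus> prt M i y) \<oplus> (prt M (i + 1) x \<oplus> prt M (i + 1) y)"
    using assms by (intro add_swap4) auto
  finally show ?thesis using assms by (simp add: prt_plus gr_add)
qed

lemma prt_additive: "prt M i \<in> additive_maps M M"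
  by (rule additive_mapsI) (auto simp: prt_add)

lemma twist_closed [simp, intro]: "x \<in> carrier M ==> twist M e x \<in> carrier M"
  by (simp add: twist_def)

lemma twist_gr [simp]: "x \<in> gr M i ==> twist M e x = neg_pow M (e * i) x"
  by (cases i) (auto simp: twist_def prt_homogeneous)

lemma twist_0 [simp]: "x \<in> carrier M ==> twist M 0 x = x"
  by (simp add: twist_def prt_sum)

lemma twist_add: "x \<in> carrier M ==> y \<in> carrier M ==> twist M e (x \<oplus> y) = twist M e x \<oplus> twist M e y"
  unfolding twist_def by (simp add: prt_add neg_pow_add add_swap4)

lemma twist_additive: "twist M e \<in> additive_maps M M"
  by (rule additive_mapsI) (auto simp: twist_add)

lemma twist_neg_pow: "x \<in> carrier M ==> twist M e (neg_pow M f x) = neg_pow M f (twist M e x)"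
  by (rule additive_maps_neg_pow[OF twist_additive abelian_group_axioms abelian_group_axioms])

lemma gr_induct [consumes 1, case_names gr add]:
  assumes "x \<in> carrier M" and "\<And>i y. y \<in> gr M i ==> P y"
    and "\<And>y z. y \<in> carrier M ==> z \<in> carrier M ==> P y ==> P z ==> P (y \<oplus> z)"
  shows "P x"
  by (metis assms gr_split gr_closed)

lemma twist_twist: "x \<in> carrier M ==> twist M e (twist M f x) = twist M (e + f) x"
proof (induction x rule: gr_induct)
  case (gr i y)
  then show ?case by (simp add: twist_neg_pow distrib_right add.commute)
next
  case (add y z)
  then show ?case by (simp add: twist_add)
qed

lemma additive_maps_eqI:
  assumes "f \<in> additive_maps M P" "g \<in> additive_maps M P" "x \<in> carrier M"
    and "\<And>i y. y \<in> gr M i ==> f y = g y"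
  shows "f x = g x"
  using assms(3)
proof (induction x rule: gr_induct)
  case (gr i y)
  then show ?case by (rule assms(4))
next
  case (add y z)
  then show ?case by (simp add: additive_maps_add[OF assms(1)] additive_maps_add[OF assms(2)])
qed

end

context graded_right_module
begin

lemma K_ab: "abelian_group K" and M_ab: "abelian_group M"
  by (fact K.abelian_group_axioms M.abelian_group_axioms)+

lemma act_additive: "\<alpha> \<in> carrier K ==> (\<lambda>m. m \<bullet>\<^bsub>M\<^esub> \<alpha>) \<in> additive_maps M M"
  by (rule additive_mapsI) (auto simp: act_closed act_add_left)

lemma act_additive_right: "m \<in> carrier M ==> (\<lambda>\<alpha>. m \<bullet>\<^bsub>M\<^esub> \<alpha>) \<in> additive_maps K M"
  by (rule additive_mapsI) (auto simp: act_closed act_add_right)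

lemma act_zero_left [simp]: "\<alpha> \<in> carrier K ==> \<zero>\<^bsub>M\<^esub> \<bullet>\<^bsub>M\<^esub> \<alpha> = \<zero>\<^bsub>M\<^esub>"
  by (rule additive_maps_zero[OF act_additive M_ab M_ab])

lemma act_zero_right [simp]: "m \<in> carrier M ==> m \<bullet>\<^bsub>M\<^esub> \<zero>\<^bsub>K\<^esub> = \<zero>\<^bsub>M\<^esub>"
  by (rule additive_maps_zero[OF act_additive_right K_ab M_ab])

lemma act_neg_pow_left: "m \<in> carrier M ==> \<alpha> \<in> carrier K ==>
    neg_pow M e m \<bullet>\<^bsub>M\<^esub> \<alpha> = neg_pow M e (m \<bullet>\<^bsub>M\<^esub> \<alpha>)"
  by (rule additive_maps_neg_pow[OF act_additive M_ab M_ab])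

lemma act_neg_pow_right: "m \<in> carrier M ==> \<alpha> \<in> carrier K ==>
    m \<bullet>\<^bsub>M\<^esub> neg_pow K e \<alpha> = neg_pow M e (m \<bullet>\<^bsub>M\<^esub> \<alpha>)"
  by (rule additive_maps_neg_pow[OF act_additive_right K_ab M_ab])

lemma twist_act:
  assumes "m \<in> carrier M" "\<alpha> \<in> gr K k"
  shows "twist M e (m \<bullet>\<^bsub>M\<^esub> \<alpha>) = neg_pow M (e * k) (twist M e m \<bullet>\<^bsub>M\<^esub> \<alpha>)"
  using assms(1)
proof (induction m rule: M.gr_induct)
  case (gr i m)
  then have "m \<bullet>\<^bsub>M\<^esub> \<alpha> \<in> gr M (i + k)" using assms(2) by (rule act_gr)
  with gr assms(2) show ?case by (simp add: act_neg_pow_left act_closed distrib_left add.commute)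
next
  case (add y z)
  then show ?case using assms(2)
    by (simp add: act_add_left M.twist_add act_closed M.neg_pow_add)
qed

lemma lact_gr:
  assumes "m \<in> gr M j" "\<alpha> \<in> gr K i"
  shows "lact K M \<alpha> m = neg_pow M (i * j) (m \<bullet>\<^bsub>M\<^esub> \<alpha>)"
proof -
  have c: "prt M j' m \<bullet>\<^bsub>M\<^esub> prt K i' \<alpha> \<in> carrier M" for i' j'
    using assms by (intro act_closed) auto
  have "m \<bullet>\<^bsub>M\<^esub> \<alpha> \<in> carrier M" using assms by (intro act_closed) auto
  then show ?thesis using assms unfolding lact_def
    by (subst M.finsum_bit; (subst M.finsum_bit)?)
      (use c in \<open>auto simp: M.finsum_bit M.prt_homogeneous K.prt_homogeneous neg_pow_def\<close>)
qed

lemma lact_closed [intro]: "m \<in> carrier M ==> \<alpha> \<in> carrier K ==> lact K M \<alpha> m \<in> carrier M"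
  unfolding lact_def by (auto intro!: M.finsum_closed act_closed)

text \<open>With \<open>twist\<close> the sum over four pairs of parities shrinks to two terms that
  are visibly additive in m and in \<alpha>.\<close>

lemma lact_prt:
  assumes "m \<in> carrier M" "\<alpha> \<in> carrier K"
  shows "lact K M \<alpha> m = m \<bullet>\<^bsub>M\<^esub> prt K 0 \<alpha> \<oplus>\<^bsub>M\<^esub> twist M 1 m \<bullet>\<^bsub>M\<^esub> prt K 1 \<alpha>"
proof -
  have c: "prt M j m \<bullet>\<^bsub>M\<^esub> prt K i \<alpha> \<in> carrier M" for i j
    using assms by (intro act_closed) auto
  have "m \<bullet>\<^bsub>M\<^esub> prt K 0 \<alpha> = prt M 0 m \<bullet>\<^bsub>M\<^esub> prt K 0 \<alpha> \<oplus>\<^bsub>M\<^esub> prt M 1 m \<bullet>\<^bsub>M\<^esub> prt K 0 \<alpha>"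
    using assms act_add_left[of "prt M 0 m" "prt M 1 m" "prt K 0 \<alpha>"] by (simp add: M.prt_sum)
  moreover have "twist M 1 m \<bullet>\<^bsub>M\<^esub> prt K 1 \<alpha> =
      prt M 0 m \<bullet>\<^bsub>M\<^esub> prt K 1 \<alpha> \<oplus>\<^bsub>M\<^esub> neg_pow M 1 (prt M 1 m \<bullet>\<^bsub>M\<^esub> prt K 1 \<alpha>)"
    using assms act_neg_pow_left[of "prt M 1 m" "prt K 1 \<alpha>" 1] by (simp add: twist_def act_add_left)
  ultimately show ?thesis
    using c by (simp add: lact_def M.finsum_bit M.add_swap4)
qed

lemma lact_additive: "\<alpha> \<in> carrier K ==> lact K M \<alpha> \<in> additive_maps M M"
proof (rule additive_mapsI)
  fix x y assume "\<alpha> \<in> carrier K" "x \<in> carrier M" "y \<in> carrier M"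
  then show "lact K M \<alpha> (x \<oplus>\<^bsub>M\<^esub> y) = lact K M \<alpha> x \<oplus>\<^bsub>M\<^esub> lact K M \<alpha> y"
    by (simp add: lact_prt act_add_left M.twist_add act_closed M.add_swap4)
qed auto

lemma lact_add_scalar:
  "\<alpha> \<in> carrier K ==> \<beta> \<in> carrier K ==> m \<in> carrier M ==>
    lact K M (\<alpha> \<oplus>\<^bsub>K\<^esub> \<beta>) m = lact K M \<alpha> m \<oplus>\<^bsub>M\<^esub> lact K M \<beta> m"
  by (simp add: lact_prt act_add_right K.prt_add act_closed M.add_swap4)

end

section \<open>Tensor products\<close>

text \<open>The sign in the last clause is the one in the left action \<alpha> n = (-1)^(p(\<alpha>)
  p(n)) n \<alpha>, so the clause says that \<alpha> crosses from m to n. The target P is a mere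
  group, hence linearity is not expressed.\<close>

definition balanced :: "('k, 'b) superring_scheme \<Rightarrow> ('k, 'm, 'c) supermodule_scheme
    \<Rightarrow> ('k, 'n, 'd) supermodule_scheme \<Rightarrow> ('p, 'e) ring_scheme \<Rightarrow> ('m \<Rightarrow> 'n \<Rightarrow> 'p) set"
  where "balanced K M N P = {f.
    (\<forall>m\<in>carrier M. f m \<in> additive_maps N P) \<and>
    (\<forall>n\<in>carrier N. (\<lambda>m. f m n) \<in> additive_maps M P) \<and>
    (\<forall>m\<in>carrier M. \<forall>n j \<alpha> i. n \<in> gr N j \<longrightarrow> \<alpha> \<in> gr K i \<longrightarrow>
      f (m \<bullet>\<^bsub>M\<^esub> \<alpha>) n = neg_pow P (i * j) (f m (n \<bullet>\<^bsub>N\<^esub> \<alpha>)))}"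

lemma balancedI:
  assumes "\<And>m. m \<in> carrier M ==> f m \<in> additive_maps N P"
    and "\<And>n. n \<in> carrier N ==> (\<lambda>m. f m n) \<in> additive_maps M P"
    and "\<And>m n j \<alpha> i. m \<in> carrier M ==> n \<in> gr N j ==> \<alpha> \<in> gr K i ==>
      f (m \<bullet>\<^bsub>M\<^esub> \<alpha>) n = neg_pow P (i * j) (f m (n \<bullet>\<^bsub>N\<^esub> \<alpha>))"
  shows "f \<in> balanced K M N P"
  using assms by (auto simp: balanced_def)

lemma balanced_right: "f \<in> balanced K M N P ==> m \<in> carrier M ==> f m \<in> additive_maps N P"
  and balanced_left: "f \<in> balanced K M N P ==> n \<in> carrier N ==> (\<lambda>m. f m n) \<in> additive_maps M P"
  and balanced_scalar: "f \<in> balanced K M N P ==> m \<in> carrier M ==> n \<in> gr N j ==> \<alpha> \<in> gr K i ==>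
    f (m \<bullet>\<^bsub>M\<^esub> \<alpha>) n = neg_pow P (i * j) (f m (n \<bullet>\<^bsub>N\<^esub> \<alpha>))"
  by (auto simp: balanced_def)

lemma balanced_closed: "f \<in> balanced K M N P ==> m \<in> carrier M ==> n \<in> carrier N ==> f m n \<in> carrier P"
  using balanced_right additive_maps_closed by metis

lemma balanced_comp:
  assumes "f \<in> balanced K M N P" "g \<in> additive_maps P Q" "abelian_group P" "abelian_group Q"
    "graded_right_module K N"
  shows "(\<lambda>m n. g (f m n)) \<in> balanced K M N Q"
proof -
  interpret N: graded_right_module K N by fact
  show ?thesis
  proof (rule balancedI)
    show "(\<lambda>n. g (f m n)) \<in> additive_maps N Q" if "m \<in> carrier M" for m
      by (rule additive_maps_comp[OF balanced_right[OF assms(1) that] assms(2)])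
    show "(\<lambda>m. g (f m n)) \<in> additive_maps M Q" if "n \<in> carrier N" for n
      by (rule additive_maps_comp[OF balanced_left[OF assms(1) that] assms(2)])
    fix m n j \<alpha> i assume *: "m \<in> carrier M" "n \<in> gr N j" "\<alpha> \<in> gr K i"
    then have "f m (n \<bullet>\<^bsub>N\<^esub> \<alpha>) \<in> carrier P"
      by (intro balanced_closed[OF assms(1)] N.act_closed) auto
    then show "g (f (m \<bullet>\<^bsub>M\<^esub> \<alpha>) n) = neg_pow Q (i * j) (g (f m (n \<bullet>\<^bsub>N\<^esub> \<alpha>)))"
      by (simp add: balanced_scalar[OF assms(1) *] additive_maps_neg_pow[OF assms(2-4)])
  qed
qed

locale tensor_product = M: graded_right_module K M + N: graded_right_module K N
  for K :: "('k, 'b) superring_scheme" and M :: "('k, 'm, 'c) supermodule_scheme"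
    and N :: "('k, 'n, 'd) supermodule_scheme"
begin

section \<open>The tensor product as a quotient of the free group on pairs, and its universal
  property\<close>

abbreviation "FG \<equiv> pair_group (carrier M) (carrier N)"
abbreviation "TG \<equiv> tensor_group K M N"

lemma FG_simps [simp]:
  "carrier FG = {x. Poly_Mapping.keys x \<subseteq> carrier M \<times> carrier N}" "x \<oplus>\<^bsub>FG\<^esub> y = x + y" "\<zero>\<^bsub>FG\<^esub> = 0"
  by (simp_all add: pair_group_def)

lemma FG_abelian: "abelian_group FG"
proof (rule abelian_groupI)
  fix x assume "x \<in> carrier FG"
  then show "\<exists>y\<in>carrier FG. y \<oplus>\<^bsub>FG\<^esub> x = \<zero>\<^bsub>FG\<^esub>" by (intro bexI[of _ "- x"]) auto
next
  fix x y assume "x \<in> carrier FG" "y \<in> carrier FG"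
  then show "x \<oplus>\<^bsub>FG\<^esub> y \<in> carrier FG" using keys_add[of x y] by auto
qed (simp_all add: ac_simps)

sublocale FG: abelian_group FG by (rule FG_abelian)

lemma FG_a_inv: "x \<in> carrier FG ==> \<ominus>\<^bsub>FG\<^esub> x = - x"
  by (rule FG.minus_equality) auto

definition rels where "rels =
    {frag_of (m \<oplus>\<^bsub>M\<^esub> m', n) - frag_of (m, n) - frag_of (m', n) | m m' n.
        m \<in> carrier M \<and> m' \<in> carrier M \<and> n \<in> carrier N} \<union>
     {frag_of (m, n \<oplus>\<^bsub>N\<^esub> n') - frag_of (m, n) - frag_of (m, n') | m n n'.
        m \<in> carrier M \<and> n \<in> carrier N \<and> n' \<in> carrier N} \<union>
     {frag_of (m \<bullet>\<^bsub>M\<^esub> \<alpha>, n) - frag_of (m, neg_pow N (i * j) (n \<bullet>\<^bsub>N\<^esub> \<alpha>)) | m \<alpha> n i j.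
        m \<in> carrier M \<and> \<alpha> \<in> gr K i \<and> n \<in> gr N j}"

lemma tensor_rel_eq: "tensor_rel K M N = generate (add_monoid FG) rels"
  by (simp add: tensor_rel_def rels_def)

lemma rels_carrier: "rels \<subseteq> carrier FG"
proof -
  have *: "x - y \<in> carrier FG" if "x \<in> carrier FG" "y \<in> carrier FG" for x y
    using that keys_diff[of x y] by auto
  have f: "frag_of (m, n) \<in> carrier FG" if "m \<in> carrier M" "n \<in> carrier N" for m n
    using that by simp
  show ?thesis unfolding rels_def
    by (auto simp del: FG_simps intro!: * f M.act_closed N.act_closed)
qed

lemma rel_subgroup: "additive_subgroup (tensor_rel K M N) FG"
  unfolding tensor_rel_eq
  by (rule additive_subgroupI, rule group.generate_is_subgroup[OF FG.a_group]) (use rels_carrier in simp)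

sublocale rel: abelian_subgroup "tensor_rel K M N" FG
  by (rule abelian_subgroupI3[OF rel_subgroup FG.abelian_group_axioms])

lemma TG_simps:
  "carrier TG = a_rcosets\<^bsub>FG\<^esub> (tensor_rel K M N)" "\<zero>\<^bsub>TG\<^esub> = tensor_rel K M N"
  "x \<oplus>\<^bsub>TG\<^esub> y = x <+>\<^bsub>FG\<^esub> y"
  by (simp_all add: tensor_group_def Let_def)

lemma TG_abelian: "abelian_group TG"
  using rel.a_factorgroup_is_comm_group
  by (intro comm_group_abelian_groupI) (simp add: tensor_group_def Let_def A_FactGroup_def')

sublocale TG: abelian_group TG by (rule TG_abelian)

abbreviation "cls \<equiv> \<lambda>x. tensor_rel K M N +>\<^bsub>FG\<^esub> x"

lemma cls_additive: "cls \<in> additive_maps FG TG"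
  by (rule additive_mapsI) (simp_all add: TG_simps FG.a_rcosetsI[OF rel.a_subset] rel.a_rcos_sum)

lemma cls_zero: "x \<in> tensor_rel K M N ==> cls x = \<zero>\<^bsub>TG\<^esub>"
  unfolding TG_simps by (rule rel.a_rcos_const)

lemma pure_cls: "pure K M N m n = cls (frag_of (m, n))"
  by (simp add: pure_def)

lemma pure_closed [intro, simp]: "m \<in> carrier M ==> n \<in> carrier N ==> pure K M N m n \<in> carrier TG"
  unfolding pure_cls by (rule additive_maps_closed[OF cls_additive]) simp

lemma cls_diff:
  assumes "x \<in> carrier FG" "y \<in> carrier FG"
  shows "cls (x - y) = cls x \<ominus>\<^bsub>TG\<^esub> cls y"
proof -
  have "cls (x \<oplus>\<^bsub>FG\<^esub> (\<ominus>\<^bsub>FG\<^esub> y)) = cls x \<oplus>\<^bsub>TG\<^esub> cls (\<ominus>\<^bsub>FG\<^esub> y)"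
    using assms by (intro additive_maps_add[OF cls_additive] FG.a_inv_closed)
  also have "cls (\<ominus>\<^bsub>FG\<^esub> y) = \<ominus>\<^bsub>TG\<^esub> cls y"
    using assms by (intro additive_maps_a_inv[OF cls_additive FG_abelian TG_abelian])
  finally show ?thesis using assms(2) by (simp only: FG_a_inv a_minus_def FG_simps) simp
qed

lemma rels_zero: "x \<in> rels ==> cls x = \<zero>\<^bsub>TG\<^esub>"
  by (rule cls_zero) (simp add: tensor_rel_eq generate.incl)

lemma pure_add_left:
  assumes "m \<in> carrier M" "m' \<in> carrier M" "n \<in> carrier N"
  shows "pure K M N (m \<oplus>\<^bsub>M\<^esub> m') n = pure K M N m n \<oplus>\<^bsub>TG\<^esub> pure K M N m' n"
proof -
  have "cls (frag_of (m \<oplus>\<^bsub>M\<^esub> m', n) - frag_of (m, n) - frag_of (m', n)) = \<zero>\<^bsub>TG\<^esub>"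
    by (rule rels_zero) (use assms in \<open>auto simp: rels_def\<close>)
  moreover have "frag_of (m \<oplus>\<^bsub>M\<^esub> m', n) - frag_of (m, n) \<in> carrier FG"
    using assms keys_diff[of "frag_of (m \<oplus>\<^bsub>M\<^esub> m', n)" "frag_of (m, n)"] by auto
  ultimately have "pure K M N (m \<oplus>\<^bsub>M\<^esub> m') n \<ominus>\<^bsub>TG\<^esub> pure K M N m n \<ominus>\<^bsub>TG\<^esub> pure K M N m' n = \<zero>\<^bsub>TG\<^esub>"
    using assms by (simp add: cls_diff pure_cls)
  then show ?thesis by (rule TG.diff_diff_eq_zeroD) (use assms in auto)
qed

lemma pure_add_right:
  assumes "m \<in> carrier M" "n' \<in> carrier N" "n \<in> carrier N"
  shows "pure K M N m (n \<oplus>\<^bsub>N\<^esub> n') = pure K M N m n \<oplus>\<^bsub>TG\<^esub> pure K M N m n'"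
proof -
  have "cls (frag_of (m, n \<oplus>\<^bsub>N\<^esub> n') - frag_of (m, n) - frag_of (m, n')) = \<zero>\<^bsub>TG\<^esub>"
    by (rule rels_zero) (use assms in \<open>auto simp: rels_def\<close>)
  moreover have "frag_of (m, n \<oplus>\<^bsub>N\<^esub> n') - frag_of (m, n) \<in> carrier FG"
    using assms keys_diff[of "frag_of (m, n \<oplus>\<^bsub>N\<^esub> n')" "frag_of (m, n)"] by auto
  ultimately have "pure K M N m (n \<oplus>\<^bsub>N\<^esub> n') \<ominus>\<^bsub>TG\<^esub> pure K M N m n \<ominus>\<^bsub>TG\<^esub> pure K M N m n' = \<zero>\<^bsub>TG\<^esub>"
    using assms by (simp add: cls_diff pure_cls)
  then show ?thesis by (rule TG.diff_diff_eq_zeroD) (use assms in auto)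
qed

lemma pure_scalar:
  assumes "m \<in> carrier M" "n \<in> gr N j" "\<alpha> \<in> gr K i"
  shows "pure K M N (m \<bullet>\<^bsub>M\<^esub> \<alpha>) n = pure K M N m (neg_pow N (i * j) (n \<bullet>\<^bsub>N\<^esub> \<alpha>))"
proof -
  have c: "m \<bullet>\<^bsub>M\<^esub> \<alpha> \<in> carrier M" "neg_pow N (i * j) (n \<bullet>\<^bsub>N\<^esub> \<alpha>) \<in> carrier N" "n \<in> carrier N"
    using assms by (auto intro!: M.act_closed N.act_closed)
  have "cls (frag_of (m \<bullet>\<^bsub>M\<^esub> \<alpha>, n) - frag_of (m, neg_pow N (i * j) (n \<bullet>\<^bsub>N\<^esub> \<alpha>))) = \<zero>\<^bsub>TG\<^esub>"
    by (rule rels_zero) (use assms in \<open>auto simp: rels_def\<close>)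
  then have "pure K M N (m \<bullet>\<^bsub>M\<^esub> \<alpha>) n \<ominus>\<^bsub>TG\<^esub> pure K M N m (neg_pow N (i * j) (n \<bullet>\<^bsub>N\<^esub> \<alpha>)) = \<zero>\<^bsub>TG\<^esub>"
    using assms c by (simp add: cls_diff pure_cls)
  then show ?thesis using assms c by (simp add: TG.diff_eq_zero_iff)
qed

lemma pure_balanced: "pure K M N \<in> balanced K M N TG"
proof (rule balancedI)
  show r: "pure K M N m \<in> additive_maps N TG" if "m \<in> carrier M" for m
    using that by (intro additive_mapsI) (auto simp: pure_add_right)
  show "(\<lambda>m. pure K M N m n) \<in> additive_maps M TG" if "n \<in> carrier N" for n
    using that by (intro additive_mapsI) (auto simp: pure_add_left)
  fix m n j \<alpha> i assume *: "m \<in> carrier M" "n \<in> gr N j" "\<alpha> \<in> gr K i"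
  then show "pure K M N (m \<bullet>\<^bsub>M\<^esub> \<alpha>) n = neg_pow TG (i * j) (pure K M N m (n \<bullet>\<^bsub>N\<^esub> \<alpha>))"
    by (simp add: pure_scalar N.act_closed additive_maps_neg_pow[OF r N.M_ab TG_abelian])
qed

lemma carrier_TG_cls: "x \<in> carrier TG ==> \<exists>r\<in>carrier FG. x = cls r"
  by (auto simp: TG_simps A_RCOSETS_def')

lemma TG_induct [consumes 1, case_names pure add]:
  assumes x: "x \<in> carrier TG"
    and p: "\<And>i m j n. m \<in> gr M i ==> n \<in> gr N j ==> P (pure K M N m n)"
    and a: "\<And>x y. x \<in> carrier TG ==> y \<in> carrier TG ==> P x ==> P y ==> P (x \<oplus>\<^bsub>TG\<^esub> y)"
  shows "P x"
proof -
  have pure: "P (pure K M N m n)" if "m \<in> carrier M" "n \<in> carrier N" for m n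
    using that(1)
  proof (induction m rule: M.M.gr_induct)
    case (gr i m)
    from that(2) show ?case
    proof (induction n rule: N.M.gr_induct)
      case (gr j n)
      with \<open>m \<in> gr M i\<close> show ?case by (rule p)
    next
      case (add y z)
      with \<open>m \<in> gr M i\<close> show ?case by (auto simp: pure_add_right intro!: a)
    qed
  next
    case (add y z)
    with that(2) show ?case by (auto simp: pure_add_left intro!: a)
  qed
  have z: "P \<zero>\<^bsub>TG\<^esub>"
    using pure[of "\<zero>\<^bsub>M\<^esub>" "\<zero>\<^bsub>N\<^esub>"] additive_maps_zero[OF balanced_right[OF pure_balanced] N.M_ab TG_abelian, of "\<zero>\<^bsub>M\<^esub>"]
    by simp
  have neg: "P (\<ominus>\<^bsub>TG\<^esub> pure K M N m n)" if "m \<in> carrier M" "n \<in> carrier N" for m n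
    using pure[of m "\<ominus>\<^bsub>N\<^esub> n"] additive_maps_a_inv[OF balanced_right[OF pure_balanced] N.M_ab TG_abelian] that
    by simp
  \<comment> \<open>The claim for -r is carried along because \<open>frag_induction\<close> builds
    elements by differences, whereas P is only known to be stable under sums.\<close>
  have *: "P (cls r) \<and> P (cls (- r)) \<and> r \<in> carrier FG" if "Poly_Mapping.keys r \<subseteq> carrier M \<times> carrier N" for r
    using that
  proof (induction r rule: frag_induction)
    case zero
    then show ?case using z additive_maps_zero[OF cls_additive FG_abelian TG_abelian] by simp
  next
    case (one x)
    then obtain m n where x: "x = (m, n)" "m \<in> carrier M" "n \<in> carrier N" by auto
    then have "cls (- frag_of x) = \<ominus>\<^bsub>TG\<^esub> cls (frag_of x)"
      using additive_maps_a_inv[OF cls_additive FG_abelian TG_abelian, of "frag_of x"] FG_a_inv[of "frag_of x"] by simp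
    with x pure neg show ?case by (simp add: pure_cls)
  next
    case (diff a' b')
    then have m: "- a' \<in> carrier FG" "- b' \<in> carrier FG" "a' \<in> carrier FG" "b' \<in> carrier FG" by auto
    have "P (cls (a' + - b'))" "P (cls (- a' + b'))"
      using diff a additive_maps_add[OF cls_additive m(3,2)] additive_maps_add[OF cls_additive m(1,4)]
        additive_maps_closed[OF cls_additive m(1)] additive_maps_closed[OF cls_additive m(2)]
        additive_maps_closed[OF cls_additive m(3)] additive_maps_closed[OF cls_additive m(4)] by auto
    moreover have "a' - b' \<in> carrier FG" using keys_diff[of a' b'] m(3,4) by auto
    ultimately show ?case by simp
  qed
  from carrier_TG_cls[OF x] * show ?thesis by auto
qed

text \<open>A balanced map kills each of the three kinds of generating relations, hence the subgroup
  they generate. This is what makes \<open>tensor_lift\<close> independent of the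
  representative.\<close>

lemma fext_rel:
  assumes P: "abelian_group P" and f: "f \<in> balanced K M N P" and x: "x \<in> tensor_rel K M N"
  shows "fext P (\<lambda>(m, n). f m n) x = \<zero>\<^bsub>P\<^esub>"
proof -
  interpret P: abelian_group P by fact
  let ?f = "\<lambda>(m, n). f m n"
  have fc: "\<And>a. a \<in> carrier M \<times> carrier N ==> ?f a \<in> carrier P"
    by (auto intro: balanced_closed[OF f])
  have sub: "Poly_Mapping.keys (frag_of (m, n)) \<subseteq> carrier M \<times> carrier N" if "m \<in> carrier M" "n \<in> carrier N" for m n
    using that by simp
  have subd: "Poly_Mapping.keys (x - y) \<subseteq> carrier M \<times> carrier N"
    if "Poly_Mapping.keys x \<subseteq> carrier M \<times> carrier N" "Poly_Mapping.keys y \<subseteq> carrier M \<times> carrier N"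
    for x y :: "('m \<times> 'n) \<Rightarrow>\<^sub>0 int"
    using that keys_diff[of x y] by blast
  note d = P.fext_diff[of "carrier M \<times> carrier N" ?f, OF fc]
  have rel: "fext P ?f x = \<zero>\<^bsub>P\<^esub>" if "x \<in> rels" for x
    using that unfolding rels_def
  proof (elim UnE CollectE exE conjE)
    fix m m' n assume *: "x = frag_of (m \<oplus>\<^bsub>M\<^esub> m', n) - frag_of (m, n) - frag_of (m', n)"
      "m \<in> carrier M" "m' \<in> carrier M" "n \<in> carrier N"
    then have "f (m \<oplus>\<^bsub>M\<^esub> m') n = f m n \<oplus>\<^bsub>P\<^esub> f m' n" using additive_maps_add[OF balanced_left[OF f]] by simp
    with * show ?thesis using balanced_closed[OF f]
      by (simp add: d subd P.diff_diff_eq_zero)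
  next
    fix m n n' assume *: "x = frag_of (m, n \<oplus>\<^bsub>N\<^esub> n') - frag_of (m, n) - frag_of (m, n')"
      "m \<in> carrier M" "n \<in> carrier N" "n' \<in> carrier N"
    then have "f m (n \<oplus>\<^bsub>N\<^esub> n') = f m n \<oplus>\<^bsub>P\<^esub> f m n'" using additive_maps_add[OF balanced_right[OF f]] by simp
    with * show ?thesis using balanced_closed[OF f]
      by (simp add: d subd P.diff_diff_eq_zero)
  next
    fix m \<alpha> n i j assume *: "x = frag_of (m \<bullet>\<^bsub>M\<^esub> \<alpha>, n) - frag_of (m, neg_pow N (i * j) (n \<bullet>\<^bsub>N\<^esub> \<alpha>))"
      "m \<in> carrier M" "\<alpha> \<in> gr K i" "n \<in> gr N j"
    then have c: "m \<bullet>\<^bsub>M\<^esub> \<alpha> \<in> carrier M" "neg_pow N (i * j) (n \<bullet>\<^bsub>N\<^esub> \<alpha>) \<in> carrier N" "n \<in> carrier N"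
      "n \<bullet>\<^bsub>N\<^esub> \<alpha> \<in> carrier N"
      by (auto intro!: M.act_closed N.act_closed)
    have "f (m \<bullet>\<^bsub>M\<^esub> \<alpha>) n = f m (neg_pow N (i * j) (n \<bullet>\<^bsub>N\<^esub> \<alpha>))"
      using * c balanced_scalar[OF f *(2,4,3)]
        additive_maps_neg_pow[OF balanced_right[OF f] N.M_ab P, of m "n \<bullet>\<^bsub>N\<^esub> \<alpha>"] by simp
    with * c show ?thesis using balanced_closed[OF f]
      by (simp add: d subd P.diff_eq_zero_iff)
  qed
  have "fext P ?f x = \<zero>\<^bsub>P\<^esub> \<and> x \<in> carrier FG" using x unfolding tensor_rel_eq
  proof (induction x rule: generate.induct)
    case (incl h)
    then show ?case using rel rels_carrier by auto
  next
    case (inv h)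
    have h: "h \<in> carrier FG" using inv rels_carrier by auto
    then have "inv\<^bsub>add_monoid FG\<^esub> h = - h" using FG_a_inv[OF h] by (simp add: a_inv_def)
    moreover have "fext P ?f (- h) = \<ominus>\<^bsub>P\<^esub> fext P ?f h" using h by (intro P.fext_uminus[OF fc]) auto
    ultimately show ?case using rel[OF inv] h by simp
  next
    case (eng h1 h2)
    then show ?case using P.fext_add[where x = h1 and y = h2, OF fc] keys_add[of h1 h2] by auto
  qed simp
  then show ?thesis by simp
qed

text \<open>The representative picked by \<open>SOME\<close> differs from r by a relation, and
  relations evaluate to zero.\<close>

lemma tensor_lift_cls:
  assumes P: "abelian_group P" and f: "f \<in> balanced K M N P" and r: "r \<in> carrier FG"
  shows "tensor_lift P f (cls r) = fext P (\<lambda>(m, n). f m n) r"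
proof -
  interpret P: abelian_group P by fact
  let ?f = "\<lambda>(m, n). f m n"
  let ?s = "SOME s. s \<in> cls r"
  have fc: "\<And>a. a \<in> carrier M \<times> carrier N ==> ?f a \<in> carrier P"
    by (auto intro: balanced_closed[OF f])
  have "?s \<in> cls r" using rel.a_rcos_self[OF r] by (metis someI)
  then obtain h where h: "h \<in> tensor_rel K M N" "?s = h + r" by (auto simp: a_r_coset_def')
  have "h \<in> carrier FG" using h rel.a_Hcarr by blast
  with r h have "fext P ?f ?s = fext P ?f h \<oplus>\<^bsub>P\<^esub> fext P ?f r"
    by (simp add: P.fext_add[OF fc])
  also have "\<dots> = fext P ?f r"
  proof -
    have "fext P ?f r \<in> carrier P" by (rule P.fext_closed, rule fc) (use r in auto)
    then show ?thesis using fext_rel[OF P f h(1)] by simp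
  qed
  finally show ?thesis by (simp add: tensor_lift_def Let_def fext_def case_prod_unfold)
qed

lemma tensor_lift_additive:
  assumes P: "abelian_group P" and f: "f \<in> balanced K M N P"
  shows "tensor_lift P f \<in> additive_maps TG P"
proof (rule additive_mapsI)
  interpret P: abelian_group P by fact
  let ?f = "\<lambda>(m, n). f m n"
  have fc: "\<And>a. a \<in> carrier M \<times> carrier N ==> ?f a \<in> carrier P"
    by (auto intro: balanced_closed[OF f])
  show "tensor_lift P f x \<in> carrier P" if x: "x \<in> carrier TG" for x
  proof -
    obtain r where r: "r \<in> carrier FG" "x = cls r" using carrier_TG_cls[OF x] by blast
    then have "fext P ?f r \<in> carrier P" by (intro P.fext_closed fc) auto
    with r show ?thesis by (simp only: tensor_lift_cls[OF P f r(1)])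
  qed
  fix x y assume "x \<in> carrier TG" "y \<in> carrier TG"
  then obtain r s where rs: "r \<in> carrier FG" "s \<in> carrier FG" "x = cls r" "y = cls s"
    using carrier_TG_cls by metis
  then have "x \<oplus>\<^bsub>TG\<^esub> y = cls (r + s)" "r + s \<in> carrier FG"
    using additive_maps_add[OF cls_additive rs(1,2)] keys_add[of r s] by auto
  with rs show "tensor_lift P f (x \<oplus>\<^bsub>TG\<^esub> y) = tensor_lift P f x \<oplus>\<^bsub>P\<^esub> tensor_lift P f y"
    using tensor_lift_cls[OF P f] P.fext_add[where x = r and y = s, OF fc] by simp
qed

lemma tensor_lift_pure:
  assumes P: "abelian_group P" and f: "f \<in> balanced K M N P" and "m \<in> carrier M" "n \<in> carrier N"
  shows "tensor_lift P f (pure K M N m n) = f m n"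
  unfolding pure_cls using assms(3,4) balanced_closed[OF f]
  by (subst tensor_lift_cls[OF P f]) (simp_all add: abelian_group.fext_frag_of[OF P])

lemma TG_additive_eqI:
  assumes "x \<in> carrier TG" "F \<in> additive_maps TG P" "G \<in> additive_maps TG P"
    and "\<And>i m j n. m \<in> gr M i ==> n \<in> gr N j ==> F (pure K M N m n) = G (pure K M N m n)"
  shows "F x = G x"
  using assms(1)
proof (induction x rule: TG_induct)
  case (pure i m j n)
  then show ?case by (rule assms(4))
next
  case (add x y)
  then show ?case by (simp add: additive_maps_add[OF assms(2)] additive_maps_add[OF assms(3)])
qed

end

section \<open>Superalgebras and their tensor products\<close>

locale superalgebra = graded_right_module K M + M: ring M
  for K :: "('k, 'b) superring_scheme" and M :: "('k, 'm, 'c) supermodule_scheme" +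
  assumes mult_gr: "x \<in> gr M i ==> y \<in> gr M j ==> x \<otimes>\<^bsub>M\<^esub> y \<in> gr M (i + j)"
    and one_gr: "\<one>\<^bsub>M\<^esub> \<in> gr M 0"
    and mult_act: "x \<in> carrier M ==> y \<in> carrier M ==> \<alpha> \<in> carrier K ==>
      x \<otimes>\<^bsub>M\<^esub> (y \<bullet>\<^bsub>M\<^esub> \<alpha>) = (x \<otimes>\<^bsub>M\<^esub> y) \<bullet>\<^bsub>M\<^esub> \<alpha>"
    and act_mult_left: "x \<in> carrier M ==> y \<in> gr M j ==> \<alpha> \<in> gr K i ==>
      (x \<bullet>\<^bsub>M\<^esub> \<alpha>) \<otimes>\<^bsub>M\<^esub> y = neg_pow M (i * j) ((x \<otimes>\<^bsub>M\<^esub> y) \<bullet>\<^bsub>M\<^esub> \<alpha>)"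
begin

lemma mult_additive_left: "y \<in> carrier M ==> (\<lambda>x. x \<otimes>\<^bsub>M\<^esub> y) \<in> additive_maps M M"
  by (rule additive_mapsI) (auto simp: M.l_distr)

lemma mult_additive_right: "x \<in> carrier M ==> (\<lambda>y. x \<otimes>\<^bsub>M\<^esub> y) \<in> additive_maps M M"
  by (rule additive_mapsI) (auto simp: M.r_distr)

lemma neg_pow_mult_left: "x \<in> carrier M ==> y \<in> carrier M ==>
    neg_pow M e x \<otimes>\<^bsub>M\<^esub> y = neg_pow M e (x \<otimes>\<^bsub>M\<^esub> y)"
  by (simp add: neg_pow_def M.l_minus)

lemma neg_pow_mult_right: "x \<in> carrier M ==> y \<in> carrier M ==>
    x \<otimes>\<^bsub>M\<^esub> neg_pow M e y = neg_pow M e (x \<otimes>\<^bsub>M\<^esub> y)"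
  by (simp add: neg_pow_def M.r_minus)

lemma twist_mult:
  assumes "x \<in> gr M i" "y \<in> carrier M"
  shows "twist M e (x \<otimes>\<^bsub>M\<^esub> y) = neg_pow M (e * i) (x \<otimes>\<^bsub>M\<^esub> twist M e y)"
  using assms(2)
proof (induction y rule: M.gr_induct)
  case (gr j y)
  then have "x \<otimes>\<^bsub>M\<^esub> y \<in> gr M (i + j)" using assms(1) by (intro mult_gr)
  with gr assms(1) show ?case by (simp add: distrib_left neg_pow_mult_right)
next
  case (add y z)
  then show ?case using assms(1)
    by (simp add: M.r_distr M.twist_add M.neg_pow_add)
qed

end

lemma finsum_group_cong:
  assumes "carrier P = carrier Q" "add P = add Q" "zero P = zero Q"
  shows "finsum P = finsum Q"
  by (intro ext) (simp add: finsum_def finprod_def assms)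

lemma abelian_group_cong:
  assumes "carrier P = carrier Q" "add P = add Q" "zero P = zero Q" "abelian_group P"
  shows "abelian_group Q"
proof -
  interpret P: abelian_group P by fact
  show ?thesis
  proof (rule abelian_groupI)
    fix x assume "x \<in> carrier Q"
    then have "x \<in> carrier P" using assms(1) by simp
    then have "\<ominus>\<^bsub>P\<^esub> x \<in> carrier P" "\<ominus>\<^bsub>P\<^esub> x \<oplus>\<^bsub>P\<^esub> x = \<zero>\<^bsub>P\<^esub>" by (simp_all add: P.l_neg)
    then show "\<exists>y\<in>carrier Q. y \<oplus>\<^bsub>Q\<^esub> x = \<zero>\<^bsub>Q\<^esub>" using assms by auto
  qed (use P.a_closed P.zero_closed P.a_assoc P.a_comm P.l_zero assms in auto)
qed

text \<open>\<open>tensor_group\<close> and \<open>tensor\<close> are different records with the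
  same carrier, zero and addition. All additive notions agree for them, so the additive theory is
  developed once, on \<open>tensor_group\<close>.\<close>

lemma add_monoid_cong:
  assumes "carrier P = carrier Q" "add P = add Q" "zero P = zero Q"
  shows "a_inv P = a_inv Q" "finsum P = finsum Q" "neg_pow P = neg_pow Q" "tensor_lift P = tensor_lift Q"
    "additive_maps G P = additive_maps G Q" "additive_maps P G = additive_maps Q G"
    "abelian_group P \<longleftrightarrow> abelian_group Q"
proof -
  show a: "a_inv P = a_inv Q"
    by (rule ext) (simp add: a_inv_def m_inv_def assms)
  show "finsum P = finsum Q" by (rule finsum_group_cong[OF assms])
  show "neg_pow P = neg_pow Q" using a by (simp add: neg_pow_def fun_eq_iff)
  have "[k] \<cdot>\<^bsub>P\<^esub> x = [k] \<cdot>\<^bsub>Q\<^esub> x" for k :: int and x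
    using assms by (simp add: add_pow_def int_pow_def nat_pow_def m_inv_def Let_def)
  then show "tensor_lift P = tensor_lift Q"
    by (intro ext) (simp add: tensor_lift_def finsum_group_cong[OF assms])
  show "additive_maps G P = additive_maps G Q" "additive_maps P G = additive_maps Q G"
    using assms by (simp_all add: additive_maps_def)
  show "abelian_group P \<longleftrightarrow> abelian_group Q"
    using abelian_group_cong[of P Q] abelian_group_cong[of Q P] assms by auto
qed

locale superalgebra_tensor = A: superalgebra K A + B: superalgebra K B
  for K :: "('k, 'b) superring_scheme" and A :: "('k, 'm, 'c) supermodule_scheme"
    and B :: "('k, 'n, 'd) supermodule_scheme"
begin

section \<open>The ring structure on the tensor product of two superalgebras\<close>

sublocale tensor_product K A B ..

abbreviation "T \<equiv> tensor K A B"
abbreviation "pur \<equiv> pure K A B"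

lemma T_simps [simp]: "carrier T = carrier TG" "add T = add TG" "zero T = zero TG"
  by (simp_all add: tensor_def Let_def)

lemmas T_TG = add_monoid_cong[OF T_simps]

lemma T_abelian: "abelian_group T"
  using TG_abelian by (simp add: T_TG)

text \<open>The product of two pure tensors with its four terms collected by the parity of b; the
  sum over the parity of a' is absorbed by \<open>twist\<close>.\<close>

definition q where "q a b a' b' =
  pur (a \<otimes>\<^bsub>A\<^esub> a') (prt B 0 b \<otimes>\<^bsub>B\<^esub> b') \<oplus>\<^bsub>TG\<^esub> pur (a \<otimes>\<^bsub>A\<^esub> twist A 1 a') (prt B 1 b \<otimes>\<^bsub>B\<^esub> b')"

lemma pure_neg_pow_left: "m \<in> carrier A ==> n \<in> carrier B ==> pur (neg_pow A e m) n = neg_pow TG e (pur m n)"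
  by (rule additive_maps_neg_pow[OF balanced_left[OF pure_balanced] A.M_ab TG_abelian])

lemma pure_neg_pow_right: "m \<in> carrier A ==> n \<in> carrier B ==> pur m (neg_pow B e n) = neg_pow TG e (pur m n)"
  by (rule additive_maps_neg_pow[OF balanced_right[OF pure_balanced] B.M_ab TG_abelian])

lemma pure_zero [simp]: "m \<in> carrier A ==> pur m \<zero>\<^bsub>B\<^esub> = \<zero>\<^bsub>TG\<^esub>" "n \<in> carrier B ==> pur \<zero>\<^bsub>A\<^esub> n = \<zero>\<^bsub>TG\<^esub>"
  using additive_maps_zero[OF balanced_right[OF pure_balanced] B.M_ab TG_abelian]
    additive_maps_zero[OF balanced_left[OF pure_balanced] A.M_ab TG_abelian] by simp_all

lemma q_eq:
  assumes "a \<in> carrier A" "a' \<in> carrier A" "b \<in> carrier B" "b' \<in> carrier B"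
  shows "(\<Oplus>\<^bsub>TG\<^esub>i\<in>{0,1}. \<Oplus>\<^bsub>TG\<^esub>j\<in>{0,1}.
          neg_pow TG (i * j) (pure K A B (a \<otimes>\<^bsub>A\<^esub> prt A j a') (prt B i b \<otimes>\<^bsub>B\<^esub> b'))) = q a b a' b'"
proof -
  have "pur (a \<otimes>\<^bsub>A\<^esub> a') y = pur (a \<otimes>\<^bsub>A\<^esub> prt A 0 a') y \<oplus>\<^bsub>TG\<^esub> pur (a \<otimes>\<^bsub>A\<^esub> prt A 1 a') y"
    if "y \<in> carrier B" for y
  proof -
    have "a \<otimes>\<^bsub>A\<^esub> a' = a \<otimes>\<^bsub>A\<^esub> (prt A 0 a' \<oplus>\<^bsub>A\<^esub> prt A 1 a')" using assms by (simp add: A.M.prt_sum)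
    then show ?thesis using assms that by (simp add: A.M.r_distr pure_add_left)
  qed
  moreover have "pur (a \<otimes>\<^bsub>A\<^esub> twist A 1 a') y =
      pur (a \<otimes>\<^bsub>A\<^esub> prt A 0 a') y \<oplus>\<^bsub>TG\<^esub> neg_pow TG 1 (pur (a \<otimes>\<^bsub>A\<^esub> prt A 1 a') y)"
    if "y \<in> carrier B" for y
    using assms that pure_neg_pow_left[of "a \<otimes>\<^bsub>A\<^esub> prt A 1 a'" y 1]
    by (simp add: twist_def A.M.r_distr pure_add_left A.M.r_minus)
  ultimately show ?thesis using assms by (simp add: TG.finsum_bit q_def TG.add_swap4)
qed

lemma q_gr:
  assumes "a \<in> carrier A" "a' \<in> gr A j" "b \<in> gr B i" "b' \<in> carrier B"
  shows "q a b a' b' = neg_pow TG (i * j) (pur (a \<otimes>\<^bsub>A\<^esub> a') (b \<otimes>\<^bsub>B\<^esub> b'))"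
  unfolding q_def using assms
  by (cases i) (auto simp: B.M.prt_homogeneous A.neg_pow_mult_right pure_neg_pow_left)

text \<open>For the component of b of parity i, the scalar of parity k picks up i k from the twist
  of a' and k (i + l) on passing the product with b'. The terms i k cancel and leave the sign for b'
  alone.\<close>

lemma q_balanced:
  assumes "a \<in> carrier A" "b \<in> carrier B"
  shows "q a b \<in> balanced K A B TG"
proof (rule balancedI)
  show "q a b a' \<in> additive_maps B TG" if "a' \<in> carrier A" for a'
    using assms that by (intro additive_mapsI) (auto simp: q_def B.M.r_distr pure_add_right TG.add_swap4)
  show "(\<lambda>a'. q a b a' b') \<in> additive_maps A TG" if "b' \<in> carrier B" for b'
    using assms that
    by (intro additive_mapsI) (auto simp: q_def A.M.r_distr A.M.twist_add pure_add_left TG.add_swap4)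
  fix a' b' l \<alpha> k assume *: "a' \<in> carrier A" "b' \<in> gr B l" "\<alpha> \<in> gr K k"
  have "pur (a \<otimes>\<^bsub>A\<^esub> twist A i (a' \<bullet>\<^bsub>A\<^esub> \<alpha>)) (prt B i b \<otimes>\<^bsub>B\<^esub> b') =
      neg_pow TG (k * l) (pur (a \<otimes>\<^bsub>A\<^esub> twist A i a') (prt B i b \<otimes>\<^bsub>B\<^esub> (b' \<bullet>\<^bsub>B\<^esub> \<alpha>)))" for i
  proof -
    have bb: "prt B i b \<otimes>\<^bsub>B\<^esub> b' \<in> gr B (i + l)" using assms * by (intro B.mult_gr) auto
    have aa: "a \<otimes>\<^bsub>A\<^esub> twist A i a' \<in> carrier A" using assms * by simp
    have \<alpha>: "\<alpha> \<in> carrier K" using * by auto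
    have "a \<otimes>\<^bsub>A\<^esub> twist A i (a' \<bullet>\<^bsub>A\<^esub> \<alpha>) = neg_pow A (i * k) ((a \<otimes>\<^bsub>A\<^esub> twist A i a') \<bullet>\<^bsub>A\<^esub> \<alpha>)"
      using assms * \<alpha> by (simp add: A.twist_act A.neg_pow_mult_right A.act_closed A.mult_act)
    then have "pur (a \<otimes>\<^bsub>A\<^esub> twist A i (a' \<bullet>\<^bsub>A\<^esub> \<alpha>)) (prt B i b \<otimes>\<^bsub>B\<^esub> b') =
        neg_pow TG (i * k) (pur ((a \<otimes>\<^bsub>A\<^esub> twist A i a') \<bullet>\<^bsub>A\<^esub> \<alpha>) (prt B i b \<otimes>\<^bsub>B\<^esub> b'))"
      using bb aa \<alpha> by (auto simp: pure_neg_pow_left A.act_closed)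
    also have "\<dots> = neg_pow TG (i * k + k * (i + l)) (pur (a \<otimes>\<^bsub>A\<^esub> twist A i a') ((prt B i b \<otimes>\<^bsub>B\<^esub> b') \<bullet>\<^bsub>B\<^esub> \<alpha>))"
      using bb aa \<alpha> * balanced_scalar[OF pure_balanced aa bb *(3)] by (simp add: B.act_closed)
    finally show ?thesis using assms * \<alpha> by (simp add: distrib_left mult.commute[of k i] B.mult_act)
  qed
  from this[of 0] this[of 1] show "q a b (a' \<bullet>\<^bsub>A\<^esub> \<alpha>) b' = neg_pow TG (k * l) (q a b a' (b' \<bullet>\<^bsub>B\<^esub> \<alpha>))"
    using assms * by (simp add: q_def TG.neg_pow_add A.act_closed B.act_closed)
qed

lemma T_mult: "x \<otimes>\<^bsub>T\<^esub> y = tensor_lift TG (\<lambda>a b. tensor_lift TG (\<lambda>a' b'.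
    \<Oplus>\<^bsub>TG\<^esub>i\<in>{0,1}. \<Oplus>\<^bsub>TG\<^esub>j\<in>{0,1}.
      neg_pow TG (i * j) (pure K A B (a \<otimes>\<^bsub>A\<^esub> prt A j a') (prt B i b \<otimes>\<^bsub>B\<^esub> b'))) y) x"
  by (simp add: tensor_def Let_def)

lemma balanced_cong:
  assumes "f \<in> balanced K A B P" "\<And>m n. m \<in> carrier A ==> n \<in> carrier B ==> f m n = g m n"
  shows "g \<in> balanced K A B P"
  using assms by (auto simp: balanced_def additive_maps_def Pi_iff A.act_closed B.act_closed)

text \<open>A lift evaluates its map only on pairs from the carriers. This matters because the
  formula in the definition of \<open>tensor\<close> is known to equal \<open>q\<close> only
  there.\<close>

lemma tensor_lift_cong:
  assumes "abelian_group P" "f \<in> balanced K A B P" "\<And>m n. m \<in> carrier A ==> n \<in> carrier B ==> f m n = g m n"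
    and "x \<in> carrier TG"
  shows "tensor_lift P f x = tensor_lift P g x"
proof -
  have "g \<in> balanced K A B P"
    by (rule balanced_cong[OF assms(2,3)])
  moreover obtain r where r: "r \<in> carrier FG" "x = cls r" using carrier_TG_cls[OF assms(4)] by blast
  moreover have "fext P (\<lambda>(m, n). f m n) r = fext P (\<lambda>(m, n). g m n) r"
  proof -
    interpret P: abelian_group P by fact
    show ?thesis unfolding fext_def
      by (rule P.finsum_cong') (use r assms(3) balanced_closed[OF \<open>g \<in> _\<close>] in \<open>auto simp: subset_iff\<close>)
  qed
  ultimately show ?thesis by (simp only: tensor_lift_cls[OF assms(1,2)] tensor_lift_cls[OF assms(1)])
qed

lemma inner_additive: "a \<in> carrier A ==> b \<in> carrier B ==> tensor_lift TG (q a b) \<in> additive_maps TG TG"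
  by (rule tensor_lift_additive[OF TG_abelian q_balanced])

lemma inner_pure: "a \<in> carrier A ==> b \<in> carrier B ==> a' \<in> carrier A ==> b' \<in> carrier B ==>
    tensor_lift TG (q a b) (pur a' b') = q a b a' b'"
  by (rule tensor_lift_pure[OF TG_abelian q_balanced])

text \<open>All three conditions are additive in y, so it suffices to take y pure and homogeneous.
  The scalar leaves a, passes a', b and b', and re-enters behind b; there its parity k already
  counts in the product sign, and the remaining exponent is k l.\<close>

lemma outer_balanced:
  assumes y: "y \<in> carrier TG"
  shows "(\<lambda>a b. tensor_lift TG (q a b) y) \<in> balanced K A B TG"
proof (rule balancedI)
  show "(\<lambda>b. tensor_lift TG (q a b) y) \<in> additive_maps B TG" if a: "a \<in> carrier A" for a
  proof (rule additive_mapsI)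
    show "tensor_lift TG (q a b) y \<in> carrier TG" if "b \<in> carrier B" for b
      using additive_maps_closed[OF inner_additive[OF a that] y] .
    fix b b' assume b: "b \<in> carrier B" "b' \<in> carrier B"
    show "tensor_lift TG (q a (b \<oplus>\<^bsub>B\<^esub> b')) y = tensor_lift TG (q a b) y \<oplus>\<^bsub>TG\<^esub> tensor_lift TG (q a b') y"
    proof (rule TG_additive_eqI[OF y])
      show "tensor_lift TG (q a (b \<oplus>\<^bsub>B\<^esub> b')) \<in> additive_maps TG TG"
        using a b by (intro inner_additive) auto
      show "(\<lambda>y. tensor_lift TG (q a b) y \<oplus>\<^bsub>TG\<^esub> tensor_lift TG (q a b') y) \<in> additive_maps TG TG"
        using a b by (intro additive_maps_sum TG_abelian inner_additive)
    qed (use a b in \<open>simp add: inner_pure, simp add: q_def B.M.prt_add B.M.l_distr pure_add_right TG.add_swap4\<close>)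
  qed
  show "(\<lambda>a. tensor_lift TG (q a b) y) \<in> additive_maps A TG" if b: "b \<in> carrier B" for b
  proof (rule additive_mapsI)
    show "tensor_lift TG (q a b) y \<in> carrier TG" if "a \<in> carrier A" for a
      using additive_maps_closed[OF inner_additive[OF that b] y] .
    fix a a' assume a: "a \<in> carrier A" "a' \<in> carrier A"
    show "tensor_lift TG (q (a \<oplus>\<^bsub>A\<^esub> a') b) y = tensor_lift TG (q a b) y \<oplus>\<^bsub>TG\<^esub> tensor_lift TG (q a' b) y"
    proof (rule TG_additive_eqI[OF y])
      show "tensor_lift TG (q (a \<oplus>\<^bsub>A\<^esub> a') b) \<in> additive_maps TG TG"
        using a b by (intro inner_additive) auto
      show "(\<lambda>y. tensor_lift TG (q a b) y \<oplus>\<^bsub>TG\<^esub> tensor_lift TG (q a' b) y) \<in> additive_maps TG TG"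
        using a b by (intro additive_maps_sum TG_abelian inner_additive)
    qed (use a b in \<open>simp add: inner_pure, simp add: q_def A.M.l_distr pure_add_left TG.add_swap4\<close>)
  qed
  fix a b l \<alpha> k assume *: "a \<in> carrier A" "b \<in> gr B l" "\<alpha> \<in> gr K k"
  then have c: "\<alpha> \<in> carrier K" "b \<in> carrier B" "a \<bullet>\<^bsub>A\<^esub> \<alpha> \<in> carrier A" "b \<bullet>\<^bsub>B\<^esub> \<alpha> \<in> carrier B"
    by (auto intro!: A.act_closed B.act_closed)
  show "tensor_lift TG (q (a \<bullet>\<^bsub>A\<^esub> \<alpha>) b) y = neg_pow TG (k * l) (tensor_lift TG (q a (b \<bullet>\<^bsub>B\<^esub> \<alpha>)) y)"
  proof (rule TG_additive_eqI[OF y])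
    show "tensor_lift TG (q (a \<bullet>\<^bsub>A\<^esub> \<alpha>) b) \<in> additive_maps TG TG"
      using c by (intro inner_additive) auto
    show "(\<lambda>y. neg_pow TG (k * l) (tensor_lift TG (q a (b \<bullet>\<^bsub>B\<^esub> \<alpha>)) y)) \<in> additive_maps TG TG"
      using c * by (intro additive_maps_sgn TG_abelian inner_additive)
    fix j a' m b' assume h: "a' \<in> gr A j" "b' \<in> gr B m"
    have bb: "b \<otimes>\<^bsub>B\<^esub> b' \<in> gr B (l + m)" using * h by (intro B.mult_gr)
    have aa: "a \<otimes>\<^bsub>A\<^esub> a' \<in> carrier A" using * h by auto
    have "tensor_lift TG (q (a \<bullet>\<^bsub>A\<^esub> \<alpha>) b) (pur a' b') = neg_pow TG (l * j) (pur ((a \<bullet>\<^bsub>A\<^esub> \<alpha>) \<otimes>\<^bsub>A\<^esub> a') (b \<otimes>\<^bsub>B\<^esub> b'))"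
      using c * h by (simp add: inner_pure q_gr)
    also have "\<dots> = neg_pow TG (l * j + k * j) (pur ((a \<otimes>\<^bsub>A\<^esub> a') \<bullet>\<^bsub>A\<^esub> \<alpha>) (b \<otimes>\<^bsub>B\<^esub> b'))"
      using c * h by (simp add: A.act_mult_left pure_neg_pow_left A.act_closed)
    also have "\<dots> = neg_pow TG (l * j + k * j + k * (l + m)) (pur (a \<otimes>\<^bsub>A\<^esub> a') ((b \<otimes>\<^bsub>B\<^esub> b') \<bullet>\<^bsub>B\<^esub> \<alpha>))"
      using bb aa c balanced_scalar[OF pure_balanced aa bb *(3)] by (simp add: B.act_closed)
    also have "\<dots> = neg_pow TG (k * l + (l + k) * j + k * m) (pur (a \<otimes>\<^bsub>A\<^esub> a') ((b \<otimes>\<^bsub>B\<^esub> b') \<bullet>\<^bsub>B\<^esub> \<alpha>))"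
      by (simp add: algebra_simps)
    also have "\<dots> = neg_pow TG (k * l + (l + k) * j) (pur (a \<otimes>\<^bsub>A\<^esub> a') ((b \<bullet>\<^bsub>B\<^esub> \<alpha>) \<otimes>\<^bsub>B\<^esub> b'))"
      using * h c aa by (simp add: B.act_mult_left pure_neg_pow_right B.act_closed)
    also have "\<dots> = neg_pow TG (k * l) (tensor_lift TG (q a (b \<bullet>\<^bsub>B\<^esub> \<alpha>)) (pur a' b'))"
    proof -
      have "b \<bullet>\<^bsub>B\<^esub> \<alpha> \<in> gr B (l + k)" using * by (intro B.act_gr)
      then show ?thesis using * h c by (simp add: inner_pure q_gr)
    qed
    finally show "tensor_lift TG (q (a \<bullet>\<^bsub>A\<^esub> \<alpha>) b) (pur a' b') =
        neg_pow TG (k * l) (tensor_lift TG (q a (b \<bullet>\<^bsub>B\<^esub> \<alpha>)) (pur a' b'))" .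
  qed
qed

lemma T_mult_q:
  assumes "x \<in> carrier TG" "y \<in> carrier TG"
  shows "x \<otimes>\<^bsub>T\<^esub> y = tensor_lift TG (\<lambda>a b. tensor_lift TG (q a b) y) x"
  unfolding T_mult
proof (rule tensor_lift_cong[OF TG_abelian outer_balanced[OF assms(2)] _ assms(1), symmetric])
  fix a b assume "a \<in> carrier A" "b \<in> carrier B"
  then show "tensor_lift TG (q a b) y = tensor_lift TG (\<lambda>a' b'.
    \<Oplus>\<^bsub>TG\<^esub>i\<in>{0,1}. \<Oplus>\<^bsub>TG\<^esub>j\<in>{0,1}.
      neg_pow TG (i * j) (pure K A B (a \<otimes>\<^bsub>A\<^esub> prt A j a') (prt B i b \<otimes>\<^bsub>B\<^esub> b'))) y"
    by (intro tensor_lift_cong[OF TG_abelian q_balanced _ assms(2)] q_eq[symmetric])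
qed

lemma T_mult_additive_left: "y \<in> carrier TG ==> (\<lambda>x. x \<otimes>\<^bsub>T\<^esub> y) \<in> additive_maps TG TG"
  using tensor_lift_additive[OF TG_abelian outer_balanced, of y]
  by (auto simp: additive_maps_def T_mult_q)

lemma T_mult_pure_left:
  "a \<in> carrier A ==> b \<in> carrier B ==> y \<in> carrier TG ==> pur a b \<otimes>\<^bsub>T\<^esub> y = tensor_lift TG (q a b) y"
  using tensor_lift_pure[OF TG_abelian outer_balanced, of y] by (simp add: T_mult_q)

lemma T_mult_pure: "a \<in> carrier A ==> b \<in> carrier B ==> a' \<in> carrier A ==> b' \<in> carrier B ==>
    pur a b \<otimes>\<^bsub>T\<^esub> pur a' b' = q a b a' b'"
  by (simp add: T_mult_pure_left inner_pure)

lemma T_mult_pure_gr: "a \<in> carrier A ==> b \<in> gr B i ==> a' \<in> gr A j ==> b' \<in> carrier B ==>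
    pur a b \<otimes>\<^bsub>T\<^esub> pur a' b' = neg_pow TG (i * j) (pur (a \<otimes>\<^bsub>A\<^esub> a') (b \<otimes>\<^bsub>B\<^esub> b'))"
  by (simp add: T_mult_pure q_gr)

lemma T_mult_additive_right:
  assumes "x \<in> carrier TG"
  shows "(\<lambda>y. x \<otimes>\<^bsub>T\<^esub> y) \<in> additive_maps TG TG"
proof (rule additive_mapsI)
  show "x \<otimes>\<^bsub>T\<^esub> y \<in> carrier TG" if "y \<in> carrier TG" for y
    using additive_maps_closed[OF T_mult_additive_left[OF that] assms] .
  fix y z assume yz: "y \<in> carrier TG" "z \<in> carrier TG"
  then have yz': "y \<oplus>\<^bsub>TG\<^esub> z \<in> carrier TG" by simp
  show "x \<otimes>\<^bsub>T\<^esub> (y \<oplus>\<^bsub>TG\<^esub> z) = x \<otimes>\<^bsub>T\<^esub> y \<oplus>\<^bsub>TG\<^esub> x \<otimes>\<^bsub>T\<^esub> z"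
    by (rule TG_additive_eqI[OF assms T_mult_additive_left[OF yz']
          additive_maps_sum[OF TG_abelian T_mult_additive_left[OF yz(1)] T_mult_additive_left[OF yz(2)]]])
      (use yz in \<open>auto simp: T_mult_pure_left additive_maps_add[OF inner_additive]\<close>)
qed

lemma T_mult_closed [simp, intro]: "x \<in> carrier TG ==> y \<in> carrier TG ==> x \<otimes>\<^bsub>T\<^esub> y \<in> carrier TG"
  using additive_maps_closed[OF T_mult_additive_left] by blast

lemma T_neg_pow_left: "x \<in> carrier TG ==> y \<in> carrier TG ==>
    neg_pow TG e x \<otimes>\<^bsub>T\<^esub> y = neg_pow TG e (x \<otimes>\<^bsub>T\<^esub> y)"
  by (rule additive_maps_neg_pow[OF T_mult_additive_left TG_abelian TG_abelian])

lemma T_neg_pow_right: "x \<in> carrier TG ==> y \<in> carrier TG ==>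
    x \<otimes>\<^bsub>T\<^esub> neg_pow TG e y = neg_pow TG e (x \<otimes>\<^bsub>T\<^esub> y)"
  by (rule additive_maps_neg_pow[OF T_mult_additive_right TG_abelian TG_abelian])

lemma T_one: "\<one>\<^bsub>T\<^esub> = pur \<one>\<^bsub>A\<^esub> \<one>\<^bsub>B\<^esub>"
  by (simp add: tensor_def Let_def)

text \<open>On homogeneous pure tensors both bracketings carry the exponent j1 i2 + j1 i3 + j2
  i3.\<close>

lemma T_assoc:
  assumes "x \<in> carrier TG" "y \<in> carrier TG" "z \<in> carrier TG"
  shows "x \<otimes>\<^bsub>T\<^esub> y \<otimes>\<^bsub>T\<^esub> z = x \<otimes>\<^bsub>T\<^esub> (y \<otimes>\<^bsub>T\<^esub> z)"
  using assms(1)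
proof (induction x rule: TG_induct)
  case (pure i1 a1 j1 b1)
  from assms(2) show ?case
  proof (induction y rule: TG_induct)
    case (pure i2 a2 j2 b2)
    from assms(3) show ?case
    proof (induction z rule: TG_induct)
      case (pure i3 a3 j3 b3)
      have c: "a1 \<otimes>\<^bsub>A\<^esub> a2 \<in> carrier A" "b2 \<otimes>\<^bsub>B\<^esub> b3 \<in> carrier B" "b1 \<otimes>\<^bsub>B\<^esub> b2 \<in> gr B (j1 + j2)"
          "a2 \<otimes>\<^bsub>A\<^esub> a3 \<in> gr A (i2 + i3)"
        using \<open>a1 \<in> _\<close> \<open>b1 \<in> _\<close> \<open>a2 \<in> _\<close> \<open>b2 \<in> _\<close> pure by (auto intro!: A.mult_gr B.mult_gr)
      have "pur a1 b1 \<otimes>\<^bsub>T\<^esub> pur a2 b2 \<otimes>\<^bsub>T\<^esub> pur a3 b3 = neg_pow TG (j1 * i2 + (j1 + j2) * i3)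
          (pur (a1 \<otimes>\<^bsub>A\<^esub> a2 \<otimes>\<^bsub>A\<^esub> a3) (b1 \<otimes>\<^bsub>B\<^esub> b2 \<otimes>\<^bsub>B\<^esub> b3))"
        using \<open>a1 \<in> _\<close> \<open>b1 \<in> _\<close> \<open>a2 \<in> _\<close> \<open>b2 \<in> _\<close> pure c
        by (auto simp: T_mult_pure_gr T_neg_pow_left)
      moreover have "pur a1 b1 \<otimes>\<^bsub>T\<^esub> (pur a2 b2 \<otimes>\<^bsub>T\<^esub> pur a3 b3) = neg_pow TG (j2 * i3 + j1 * (i2 + i3))
          (pur (a1 \<otimes>\<^bsub>A\<^esub> (a2 \<otimes>\<^bsub>A\<^esub> a3)) (b1 \<otimes>\<^bsub>B\<^esub> (b2 \<otimes>\<^bsub>B\<^esub> b3)))"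
        using \<open>a1 \<in> _\<close> \<open>b1 \<in> _\<close> \<open>a2 \<in> _\<close> \<open>b2 \<in> _\<close> pure c
        by (auto simp: T_mult_pure_gr T_neg_pow_right)
      ultimately show ?case
        using \<open>a1 \<in> _\<close> \<open>b1 \<in> _\<close> \<open>a2 \<in> _\<close> \<open>b2 \<in> _\<close> pure
        by (simp add: A.M.m_assoc B.M.m_assoc algebra_simps)
    next
      case (add x y)
      then show ?case using \<open>a1 \<in> _\<close> \<open>b1 \<in> _\<close> \<open>a2 \<in> _\<close> \<open>b2 \<in> _\<close>
        by (simp add: additive_maps_add[OF T_mult_additive_right])
    qed
  next
    case (add x y)
    then show ?case using \<open>a1 \<in> _\<close> \<open>b1 \<in> _\<close> assms(3)
      by (simp add: additive_maps_add[OF T_mult_additive_right] additive_maps_add[OF T_mult_additive_left])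
  qed
next
  case (add x y)
  then show ?case using assms(2,3) by (simp add: additive_maps_add[OF T_mult_additive_left])
qed

lemma T_ring: "ring T"
proof (rule ringI)
  show "abelian_group T" by (rule T_abelian)
  have one: "\<one>\<^bsub>T\<^esub> \<in> carrier TG" by (simp add: T_one)
  have l: "\<one>\<^bsub>T\<^esub> \<otimes>\<^bsub>T\<^esub> x = x" if "x \<in> carrier TG" for x using that
  proof (induction x rule: TG_induct)
    case (pure i m j n)
    then show ?case using T_mult_pure_gr[OF _ B.one_gr] by (simp add: T_one)
  next
    case (add x y)
    then show ?case using one by (simp add: additive_maps_add[OF T_mult_additive_right])
  qed
  have r: "x \<otimes>\<^bsub>T\<^esub> \<one>\<^bsub>T\<^esub> = x" if "x \<in> carrier TG" for x using that
  proof (induction x rule: TG_induct)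
    case (pure i m j n)
    then show ?case using T_mult_pure_gr[OF _ _ A.one_gr] by (simp add: T_one)
  next
    case (add x y)
    then show ?case using one by (simp add: additive_maps_add[OF T_mult_additive_left])
  qed
  show "Group.monoid T"
    by (rule monoidI) (auto simp: T_assoc l r one)
qed (auto simp: additive_maps_add[OF T_mult_additive_left] additive_maps_add[OF T_mult_additive_right])

lemma T_gr: "gr T k = generate (add_monoid TG) {pur m n | m n i j. m \<in> gr A i \<and> n \<in> gr B j \<and> i + j = k}"
  by (simp add: tensor_def Let_def)

lemma T_gr_subgroup: "additive_subgroup (gr T k) TG"
  unfolding T_gr
  by (rule additive_subgroupI, rule group.generate_is_subgroup[OF TG.a_group]) auto

lemma T_gr_pure: "m \<in> gr A i ==> n \<in> gr B j ==> pur m n \<in> gr T (i + j)"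
  unfolding T_gr by (rule generate.incl) auto

lemma T_gr_induct [consumes 1, case_names pure add]:
  assumes x: "x \<in> gr T k"
    and p: "\<And>i m j n. m \<in> gr A i ==> n \<in> gr B j ==> i + j = k ==> P (pur m n)"
    and a: "\<And>x y. x \<in> gr T k ==> y \<in> gr T k ==> P x ==> P y ==> P (x \<oplus>\<^bsub>TG\<^esub> y)"
  shows "P x"
  using x unfolding T_gr
proof (induction x rule: generate.induct)
  case one
  have "P (pur \<zero>\<^bsub>A\<^esub> \<zero>\<^bsub>B\<^esub>)" by (rule p[of _ k _ 0]) auto
  then show ?case by simp
next
  case (incl h)
  then show ?case using p by auto
next
  case (inv h)
  then obtain m n i j where h: "h = pur m n" "m \<in> gr A i" "n \<in> gr B j" "i + j = k" by auto
  then have "P (pur (neg_pow A 1 m) n)" by (intro p) auto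
  moreover have "inv\<^bsub>add_monoid TG\<^esub> h = pur (neg_pow A 1 m) n"
    using h pure_neg_pow_left[of m n 1] by (simp add: a_inv_def m_inv_def)
  ultimately show ?case by simp
next
  case (eng x y)
  then show ?case using a[unfolded T_gr, of x y] by simp
qed

lemma T_gr_mult: "x \<in> gr T k ==> y \<in> gr T l ==> x \<otimes>\<^bsub>T\<^esub> y \<in> gr T (k + l)"
proof (induction x rule: T_gr_induct)
  case (pure i m j n)
  from pure(4) show ?case
  proof (induction y rule: T_gr_induct)
    case (pure i' m' j' n')
    have "pur (m \<otimes>\<^bsub>A\<^esub> m') (n \<otimes>\<^bsub>B\<^esub> n') \<in> gr T ((i + i') + (j + j'))"
      using pure \<open>m \<in> _\<close> \<open>n \<in> _\<close> by (intro T_gr_pure A.mult_gr B.mult_gr)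
    also have "(i + i') + (j + j') = k + l" using pure \<open>i + j = k\<close> by (simp add: ac_simps)
    finally show ?case using pure \<open>m \<in> _\<close> \<open>n \<in> _\<close>
      by (auto simp: T_mult_pure_gr intro!: TG.neg_pow_subgroup T_gr_subgroup)
  next
    case (add x y)
    then show ?case using \<open>m \<in> _\<close> \<open>n \<in> _\<close> additive_subgroup.a_Hcarr[OF T_gr_subgroup]
      by (simp add: additive_maps_add[OF T_mult_additive_right] additive_subgroup.a_closed[OF T_gr_subgroup])
  qed
next
  case (add x x')
  then show ?case using additive_subgroup.a_Hcarr[OF T_gr_subgroup]
    by (simp add: additive_maps_add[OF T_mult_additive_left] additive_subgroup.a_closed[OF T_gr_subgroup])
qed

lemma T_act: "x \<bullet>\<^bsub>T\<^esub> \<alpha> = tensor_lift TG (\<lambda>m n. pur m (n \<bullet>\<^bsub>B\<^esub> \<alpha>)) x"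
  by (simp add: tensor_def Let_def)

text \<open>Moving \<beta> past n \<alpha> counts the parity of \<alpha> too; exchanging \<alpha>
  and \<beta> by supercommutativity of K removes exactly that excess.\<close>

lemma act_balanced:
  assumes "\<alpha> \<in> carrier K"
  shows "(\<lambda>m n. pur m (n \<bullet>\<^bsub>B\<^esub> \<alpha>)) \<in> balanced K A B TG"
proof (rule balancedI)
  show "(\<lambda>n. pur m (n \<bullet>\<^bsub>B\<^esub> \<alpha>)) \<in> additive_maps B TG" if "m \<in> carrier A" for m
    using assms that by (intro additive_maps_comp[OF B.act_additive] balanced_right[OF pure_balanced])
  show "(\<lambda>m. pur m (n \<bullet>\<^bsub>B\<^esub> \<alpha>)) \<in> additive_maps A TG" if "n \<in> carrier B" for n
    using assms that by (intro balanced_left[OF pure_balanced] B.act_closed)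
  fix m n j \<beta> i assume *: "m \<in> carrier A" "n \<in> gr B j" "\<beta> \<in> gr K i"
  have c: "n \<in> carrier B" "\<beta> \<in> carrier K" "m \<bullet>\<^bsub>A\<^esub> \<beta> \<in> carrier A" "n \<bullet>\<^bsub>B\<^esub> \<beta> \<in> carrier B"
    using * by (auto intro!: A.act_closed B.act_closed)
  show "pur (m \<bullet>\<^bsub>A\<^esub> \<beta>) (n \<bullet>\<^bsub>B\<^esub> \<alpha>) = neg_pow TG (i * j) (pur m (n \<bullet>\<^bsub>B\<^esub> \<beta> \<bullet>\<^bsub>B\<^esub> \<alpha>))"
  proof (rule A.K.additive_maps_eqI[OF _ _ assms])
    show "(\<lambda>\<alpha>. pur (m \<bullet>\<^bsub>A\<^esub> \<beta>) (n \<bullet>\<^bsub>B\<^esub> \<alpha>)) \<in> additive_maps K TG"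
      using c by (intro additive_maps_comp[OF B.act_additive_right] balanced_right[OF pure_balanced])
    show "(\<lambda>\<alpha>. neg_pow TG (i * j) (pur m (n \<bullet>\<^bsub>B\<^esub> \<beta> \<bullet>\<^bsub>B\<^esub> \<alpha>))) \<in> additive_maps K TG"
      using c * by (intro additive_maps_sgn TG_abelian additive_maps_comp[OF B.act_additive_right]
          balanced_right[OF pure_balanced])
    fix k \<alpha> assume \<alpha>: "\<alpha> \<in> gr K k"
    have n\<alpha>: "n \<bullet>\<^bsub>B\<^esub> \<alpha> \<in> gr B (j + k)" using * \<alpha> by (intro B.act_gr)
    have "pur (m \<bullet>\<^bsub>A\<^esub> \<beta>) (n \<bullet>\<^bsub>B\<^esub> \<alpha>) = neg_pow TG (i * (j + k)) (pur m (n \<bullet>\<^bsub>B\<^esub> \<alpha> \<bullet>\<^bsub>B\<^esub> \<beta>))"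
      by (rule balanced_scalar[OF pure_balanced *(1) n\<alpha> *(3)])
    also have "n \<bullet>\<^bsub>B\<^esub> \<alpha> \<bullet>\<^bsub>B\<^esub> \<beta> = neg_pow B (k * i) (n \<bullet>\<^bsub>B\<^esub> \<beta> \<bullet>\<^bsub>B\<^esub> \<alpha>)"
      using c \<alpha> A.K.supercommutative[OF \<alpha> *(3)] by (auto simp: B.act_mult[symmetric] B.act_neg_pow_right)
    also have "pur m \<dots> = neg_pow TG (k * i) (pur m (n \<bullet>\<^bsub>B\<^esub> \<beta> \<bullet>\<^bsub>B\<^esub> \<alpha>))"
      using c * \<alpha> by (intro pure_neg_pow_right B.act_closed) auto
    finally show "pur (m \<bullet>\<^bsub>A\<^esub> \<beta>) (n \<bullet>\<^bsub>B\<^esub> \<alpha>) = neg_pow TG (i * j) (pur m (n \<bullet>\<^bsub>B\<^esub> \<beta> \<bullet>\<^bsub>B\<^esub> \<alpha>))"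
      using c * \<alpha> by (simp add: distrib_left mult.commute[of k i] B.act_closed add.assoc)
  qed
qed

text \<open>The module action is right multiplication by a scalar placed in the second factor. A
  ring morphism into the tensor product is therefore linear as soon as it sends scalars
  there.\<close>

lemma T_act_mult_one:
  assumes "x \<in> carrier TG" "\<alpha> \<in> carrier K"
  shows "x \<otimes>\<^bsub>T\<^esub> pur \<one>\<^bsub>A\<^esub> (\<one>\<^bsub>B\<^esub> \<bullet>\<^bsub>B\<^esub> \<alpha>) = x \<bullet>\<^bsub>T\<^esub> \<alpha>"
  unfolding T_act
proof (rule TG_additive_eqI[OF assms(1) T_mult_additive_left tensor_lift_additive[OF TG_abelian act_balanced[OF assms(2)]]])
  show "pur \<one>\<^bsub>A\<^esub> (\<one>\<^bsub>B\<^esub> \<bullet>\<^bsub>B\<^esub> \<alpha>) \<in> carrier TG" using assms by (auto intro!: B.act_closed)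
  fix i m j n assume "m \<in> gr A i" "n \<in> gr B j"
  then show "pur m n \<otimes>\<^bsub>T\<^esub> pur \<one>\<^bsub>A\<^esub> (\<one>\<^bsub>B\<^esub> \<bullet>\<^bsub>B\<^esub> \<alpha>) = tensor_lift TG (\<lambda>m n. pur m (n \<bullet>\<^bsub>B\<^esub> \<alpha>)) (pur m n)"
    using assms(2) T_mult_pure_gr[OF _ _ A.one_gr, of m n j "\<one>\<^bsub>B\<^esub> \<bullet>\<^bsub>B\<^esub> \<alpha>"]
    by (simp add: tensor_lift_pure[OF TG_abelian act_balanced] B.act_closed B.mult_act)
qed

end

section \<open>Free rings and presentations\<close>

lemma frag_extend_plus: "frag_extend (\<lambda>u. f u + g u) x = frag_extend f x + frag_extend g x"
  by (simp add: frag_extend_def frag_cmul_distrib2 sum.distrib)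

lemma frag_extend_minus_fun: "frag_extend (\<lambda>u. f u - g u) x = frag_extend f x - frag_extend g x"
  using frag_extend_plus[of "\<lambda>u. f u - g u" g x] by simp

lemma frag_induct_UNIV [case_names zero one diff]:
  assumes "P 0" "\<And>x. P (frag_of x)" "\<And>a b. P a ==> P b ==> P (a - b)"
  shows "P c"
  by (rule frag_induction[of c UNIV]) (use assms in auto)

lemma free_ring_simps [simp]:
  "carrier (free_ring A) = {x. Poly_Mapping.keys x \<subseteq> lists A}"
  "x \<oplus>\<^bsub>free_ring A\<^esub> y = x + y" "\<zero>\<^bsub>free_ring A\<^esub> = 0" "\<one>\<^bsub>free_ring A\<^esub> = frag_of []"
  by (simp_all add: free_ring_def)

lemma free_ring_mult:
  "x \<otimes>\<^bsub>free_ring A\<^esub> y = frag_extend (\<lambda>u. frag_extend (\<lambda>v. frag_of (u @ v)) y) x"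
  by (simp add: free_ring_def)

lemma free_ring_mult_of [simp]: "frag_of u \<otimes>\<^bsub>free_ring A\<^esub> frag_of v = frag_of (u @ v)"
  by (simp add: free_ring_mult)

lemma free_ring_mult_distrib:
  "(x + x') \<otimes>\<^bsub>free_ring A\<^esub> y = x \<otimes>\<^bsub>free_ring A\<^esub> y + x' \<otimes>\<^bsub>free_ring A\<^esub> y"
  "(x - x') \<otimes>\<^bsub>free_ring A\<^esub> y = x \<otimes>\<^bsub>free_ring A\<^esub> y - x' \<otimes>\<^bsub>free_ring A\<^esub> y"
  "x \<otimes>\<^bsub>free_ring A\<^esub> (y + y') = x \<otimes>\<^bsub>free_ring A\<^esub> y + x \<otimes>\<^bsub>free_ring A\<^esub> y'"
  "x \<otimes>\<^bsub>free_ring A\<^esub> (y - y') = x \<otimes>\<^bsub>free_ring A\<^esub> y - x \<otimes>\<^bsub>free_ring A\<^esub> y'"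
  "0 \<otimes>\<^bsub>free_ring A\<^esub> y = 0" "x \<otimes>\<^bsub>free_ring A\<^esub> 0 = 0"
  by (simp_all add: free_ring_mult frag_extend_add frag_extend_diff frag_extend_plus frag_extend_minus_fun
      frag_extend_eq_0)

lemma free_ring_assoc: "x \<otimes>\<^bsub>free_ring A\<^esub> y \<otimes>\<^bsub>free_ring A\<^esub> z = x \<otimes>\<^bsub>free_ring A\<^esub> (y \<otimes>\<^bsub>free_ring A\<^esub> z)"
proof (induction x rule: frag_induct_UNIV)
  case (one u)
  show ?case
  proof (induction y rule: frag_induct_UNIV)
    case (one v)
    show ?case
      by (induction z rule: frag_induct_UNIV) (simp_all add: free_ring_mult_distrib)
  qed (simp_all add: free_ring_mult_distrib)
qed (simp_all add: free_ring_mult_distrib)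

lemma free_ring_is_ring: "ring (free_ring A)"
proof (rule ringI)
  show "abelian_group (free_ring A)"
  proof (rule abelian_groupI)
    fix x assume "x \<in> carrier (free_ring A)"
    then show "\<exists>y\<in>carrier (free_ring A). y \<oplus>\<^bsub>free_ring A\<^esub> x = \<zero>\<^bsub>free_ring A\<^esub>"
      by (intro bexI[of _ "- x"]) auto
  next
    fix x y assume "x \<in> carrier (free_ring A)" "y \<in> carrier (free_ring A)"
    then show "x \<oplus>\<^bsub>free_ring A\<^esub> y \<in> carrier (free_ring A)" using keys_add[of x y] by auto
  qed (simp_all add: ac_simps)
  show "Group.monoid (free_ring A)"
  proof (rule monoidI)
    fix x y assume "x \<in> carrier (free_ring A)" "y \<in> carrier (free_ring A)"
    then have xy: "Poly_Mapping.keys x \<subseteq> lists A" "Poly_Mapping.keys y \<subseteq> lists A" by auto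
    have "Poly_Mapping.keys (frag_extend (\<lambda>v. frag_of (u @ v)) y) \<subseteq> lists A" if "u \<in> lists A" for u
      using keys_frag_extend[of "\<lambda>v. frag_of (u @ v)" y] that xy(2) by fastforce
    with xy(1) have "Poly_Mapping.keys (x \<otimes>\<^bsub>free_ring A\<^esub> y) \<subseteq> lists A"
      unfolding free_ring_mult
      by (intro order.trans[OF keys_frag_extend]) blast
    then show "x \<otimes>\<^bsub>free_ring A\<^esub> y \<in> carrier (free_ring A)" by simp
  next
    fix x show "\<one>\<^bsub>free_ring A\<^esub> \<otimes>\<^bsub>free_ring A\<^esub> x = x" "x \<otimes>\<^bsub>free_ring A\<^esub> \<one>\<^bsub>free_ring A\<^esub> = x"
      by (simp_all add: free_ring_mult frag_expansion[symmetric])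
  qed (simp_all add: free_ring_assoc)
qed (simp_all add: free_ring_mult_distrib)

definition wd :: "('r, 'e) ring_scheme \<Rightarrow> ('a \<Rightarrow> 'r) \<Rightarrow> 'a list \<Rightarrow> 'r"
  where "wd R h w = foldr (\<lambda>l y. h l \<otimes>\<^bsub>R\<^esub> y) w \<one>\<^bsub>R\<^esub>"

lemma wd_simps [simp]: "wd R h [] = \<one>\<^bsub>R\<^esub>" "wd R h (l # w) = h l \<otimes>\<^bsub>R\<^esub> wd R h w"
  by (simp_all add: wd_def)

context ring
begin

lemma wd_closed: "(\<And>l. l \<in> set w ==> h l \<in> carrier R) ==> wd R h w \<in> carrier R"
  by (induction w) auto

lemma wd_append:
  "(\<And>l. l \<in> set u \<union> set v ==> h l \<in> carrier R) ==> wd R h (u @ v) = wd R h u \<otimes> wd R h v"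
  by (induction u) (auto simp: m_assoc wd_closed)

text \<open>Words are multiplied by concatenation, so \<open>wd\<close> is multiplicative on them;
  two nested inductions over differences extend this to linear combinations.\<close>

lemma free_ring_hom:
  assumes h: "\<And>a. a \<in> A ==> h a \<in> carrier R"
  shows "fext R (wd R h) \<in> ring_hom (free_ring A) R"
proof -
  have w: "wd R h u \<in> carrier R" if "u \<in> lists A" for u using that h by (intro wd_closed) auto
  have cl: "fext R (wd R h) x \<in> carrier R" if "Poly_Mapping.keys x \<subseteq> lists A" for x
    by (rule fext_closed, rule w, rule subsetD[OF that])
  interpret F: ring "free_ring A" by (rule free_ring_is_ring)
  have ad: "fext R (wd R h) (x + y) = fext R (wd R h) x \<oplus> fext R (wd R h) y"
    if "Poly_Mapping.keys x \<subseteq> lists A" "Poly_Mapping.keys y \<subseteq> lists A" for x y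
    by (rule fext_add[of "lists A", OF w that])
  have di: "fext R (wd R h) (x - y) = fext R (wd R h) x \<ominus> fext R (wd R h) y"
    if "Poly_Mapping.keys x \<subseteq> lists A" "Poly_Mapping.keys y \<subseteq> lists A" for x y
    by (rule fext_diff[of "lists A", OF w that])
  have kd: "Poly_Mapping.keys (x - y) \<subseteq> lists A"
    if "Poly_Mapping.keys x \<subseteq> lists A" "Poly_Mapping.keys y \<subseteq> lists A" for x y :: "'c list \<Rightarrow>\<^sub>0 int"
    using keys_diff[of x y] that by blast
  have km: "Poly_Mapping.keys (x \<otimes>\<^bsub>free_ring A\<^esub> y) \<subseteq> lists A"
    if "Poly_Mapping.keys x \<subseteq> lists A" "Poly_Mapping.keys y \<subseteq> lists A" for x y
    using F.m_closed[of x y] that by simp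
  have mu: "fext R (wd R h) (x \<otimes>\<^bsub>free_ring A\<^esub> y) = fext R (wd R h) x \<otimes> fext R (wd R h) y"
    if "Poly_Mapping.keys x \<subseteq> lists A" "Poly_Mapping.keys y \<subseteq> lists A" for x y
  proof -
    have "fext R (wd R h) (x \<otimes>\<^bsub>free_ring A\<^esub> y) = fext R (wd R h) x \<otimes> fext R (wd R h) y \<and>
        Poly_Mapping.keys x \<subseteq> lists A"
      using that(1)
    proof (induction x rule: frag_induction)
      case (one u)
      have "fext R (wd R h) (frag_of u \<otimes>\<^bsub>free_ring A\<^esub> y) = wd R h u \<otimes> fext R (wd R h) y \<and>
          Poly_Mapping.keys y \<subseteq> lists A"
        using that(2)
      proof (induction y rule: frag_induction)
        case (one v)
        have "wd R h (u @ v) = wd R h u \<otimes> wd R h v" using \<open>u \<in> _\<close> one h by (intro wd_append) auto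
        then show ?case using \<open>u \<in> _\<close> one w[of v] w[of "u @ v"] by simp
      next
        case (diff a b)
        then have "fext R (wd R h) (frag_of u \<otimes>\<^bsub>free_ring A\<^esub> (a - b)) =
            fext R (wd R h) (frag_of u \<otimes>\<^bsub>free_ring A\<^esub> a) \<ominus> fext R (wd R h) (frag_of u \<otimes>\<^bsub>free_ring A\<^esub> b)"
          unfolding free_ring_mult_distrib using \<open>u \<in> _\<close> by (intro di km) auto
        with diff \<open>u \<in> _\<close> show ?case using w[of u] cl[of a] cl[of b]
          by (simp add: di kd a_minus_def r_distr r_minus)
      qed (use \<open>u \<in> _\<close> w[of u] in \<open>simp_all add: free_ring_mult_distrib\<close>)
      then show ?case using one w[of u] by simp
    next
      case (diff a b)
      then have "fext R (wd R h) ((a - b) \<otimes>\<^bsub>free_ring A\<^esub> y) =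
          fext R (wd R h) (a \<otimes>\<^bsub>free_ring A\<^esub> y) \<ominus> fext R (wd R h) (b \<otimes>\<^bsub>free_ring A\<^esub> y)"
        unfolding free_ring_mult_distrib using that(2) by (intro di km) auto
      with diff show ?case using cl[of a] cl[of b] cl[OF that(2)]
        by (simp add: di kd a_minus_def l_distr l_minus)
    qed (use cl[OF that(2)] in \<open>simp_all add: free_ring_mult_distrib\<close>)
    then show ?thesis by simp
  qed
  show ?thesis by (rule ring_hom_memI) (use cl ad mu in auto)
qed

end

lemma ring_cong:
  assumes "carrier P = carrier Q" "mult P = mult Q" "one P = one Q" "zero P = zero Q" "add P = add Q" "ring P"
  shows "ring Q"
proof -
  interpret P: ring P by fact
  have "abelian_group Q" by (rule abelian_group_cong[OF assms(1,5,4) P.abelian_group_axioms])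
  moreover have "Group.monoid Q"
    by (rule monoidI) (use P.m_closed P.one_closed P.m_assoc P.l_one P.r_one assms in auto)
  ultimately show ?thesis
    by (rule ringI) (use P.l_distr P.r_distr assms in auto)
qed

lemma ring_hom_genideal:
  assumes "ring R" "ring R'" "H \<in> ring_hom R R'" "X \<subseteq> carrier R" "\<And>x. x \<in> X ==> H x = \<zero>\<^bsub>R'\<^esub>"
    and "x \<in> Idl\<^bsub>R\<^esub> X"
  shows "H x = \<zero>\<^bsub>R'\<^esub>"
proof -
  interpret h: ring_hom_ring R R' H by (rule ring_hom_ringI2) fact+
  have "Idl\<^bsub>R\<^esub> X \<subseteq> a_kernel R R' H"
  proof (rule h.R.genideal_minimal[OF h.kernel_is_ideal])
    show "X \<subseteq> a_kernel R R' H" unfolding a_kernel_def'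
      by (intro subsetI CollectI conjI assms(5) subsetD[OF assms(4)])
  qed
  with assms(6) have "x \<in> a_kernel R R' H" by (rule subsetD[rotated])
  then show ?thesis unfolding a_kernel_def' by (elim CollectE conjE)
qed

lemma quot_lift:
  assumes "ideal I R" "ring R'" "H \<in> ring_hom R R'" "\<And>x. x \<in> I ==> H x = \<zero>\<^bsub>R'\<^esub>"
  obtains h where "h \<in> ring_hom (R Quot I) R'" "\<And>x. x \<in> carrier R ==> h (I +>\<^bsub>R\<^esub> x) = H x"
proof -
  interpret I: ideal I R by fact
  interpret R': ring R' by fact
  interpret hh: ring_hom_ring R R' H by (rule ring_hom_ringI2) (unfold_locales, fact)
  define h where "h X = H (SOME x. x \<in> X)" for X
  have h: "h (I +>\<^bsub>R\<^esub> x) = H x" if x: "x \<in> carrier R" for x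
  proof -
    have "(SOME y. y \<in> I +>\<^bsub>R\<^esub> x) \<in> I +>\<^bsub>R\<^esub> x" using I.a_rcos_self[OF x] by (metis someI)
    then obtain i where "i \<in> I" "(SOME y. y \<in> I +>\<^bsub>R\<^esub> x) = i \<oplus>\<^bsub>R\<^esub> x" by (auto simp: a_r_coset_def')
    then show ?thesis using x assms(4) I.a_Hcarr by (simp add: h_def)
  qed
  have "h \<in> ring_hom (R Quot I) R'"
  proof (rule ring_hom_memI)
    fix X Y assume "X \<in> carrier (R Quot I)" "Y \<in> carrier (R Quot I)"
    then obtain x y where xy: "x \<in> carrier R" "y \<in> carrier R" "X = I +>\<^bsub>R\<^esub> x" "Y = I +>\<^bsub>R\<^esub> y"
      by (auto simp: FactRing_simps)
    then show "h (X \<otimes>\<^bsub>R Quot I\<^esub> Y) = h X \<otimes>\<^bsub>R'\<^esub> h Y" "h (X \<oplus>\<^bsub>R Quot I\<^esub> Y) = h X \<oplus>\<^bsub>R'\<^esub> h Y" "h X \<in> carrier R'"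
      by (simp_all add: FactRing_def I.rcoset_mult_add I.a_rcos_sum h)
  qed (simp add: FactRing_def h)
  with h that show thesis by blast
qed

section \<open>The symmetric algebra\<close>

lemma (in ring) neg_pow_mult:
  assumes "x \<in> carrier R" "y \<in> carrier R"
  shows "neg_pow R e x \<otimes> y = neg_pow R e (x \<otimes> y)" "x \<otimes> neg_pow R e y = neg_pow R e (x \<otimes> y)"
  using assms by (simp_all add: neg_pow_def l_minus r_minus)

context commutative_superring
begin

lemma twist_mult_ring:
  assumes "a \<in> carrier K" "b \<in> carrier K"
  shows "twist K e (a \<otimes> b) = twist K e a \<otimes> twist K e b"
  using assms(1)
proof (induction a rule: gr_induct)
  case (gr i a)
  from assms(2) show ?case
  proof (induction b rule: gr_induct)
    case (gr j b)
    then have "a \<otimes> b \<in> gr K (i + j)" using \<open>a \<in> gr K i\<close> by (intro gr_mult)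
    with gr \<open>a \<in> gr K i\<close> show ?case
      by (auto simp: neg_pow_def l_minus r_minus distrib_left)
  next
    case (add y z)
    then show ?case using \<open>a \<in> gr K i\<close> by (simp add: r_distr twist_add del: twist_gr)
  qed
next
  case (add y z)
  then show ?case using assms(2) by (simp add: l_distr twist_add)
qed

end

text \<open>The rationals enter the construction of S through 1/2, which keeps the even and the odd
  part of S apart.\<close>

locale sym_alg = graded_right_module K \<gg>
  for K :: "('k, 'b) superring_scheme" and \<gg> :: "('k, 'g, 'c) supermodule_scheme" +
  assumes rationals: "contains_rationals K"
begin

section \<open>S as a twofold quotient of a free ring\<close>

abbreviation "L \<equiv> letter_ring K \<gg>"
abbreviation "TI \<equiv> tensor_algebra_ideal K \<gg>"
abbreviation "TA \<equiv> tensor_algebra K \<gg>"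
abbreviation "J \<equiv> sym_ideal K \<gg>"
abbreviation "S \<equiv> sym_algebra K \<gg>"
abbreviation Smult (infixl \<open>\<odot>\<close> 70) where "x \<odot> y \<equiv> x \<otimes>\<^bsub>S\<^esub> y"
abbreviation Kmult (infixl \<open>\<star>\<close> 70) where "x \<star> y \<equiv> x \<otimes>\<^bsub>K\<^esub> y"
abbreviation gact (infixl \<open>\<triangleleft>\<close> 70) where "x \<triangleleft> \<alpha> \<equiv> x \<bullet>\<^bsub>\<gg>\<^esub> \<alpha>"
abbreviation Sone (\<open>\<one>\<^sub>S\<close>) where "\<one>\<^sub>S \<equiv> \<one>\<^bsub>S\<^esub>"
abbreviation "letters \<equiv> Inl ` carrier K \<union> Inr ` carrier \<gg>"

definition trels where "trels =
    {frag_of [Inl \<one>\<^bsub>K\<^esub>] - frag_of []} \<union>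
     {frag_of [Inl (\<alpha> \<oplus>\<^bsub>K\<^esub> \<beta>)] - frag_of [Inl \<alpha>] - frag_of [Inl \<beta>] | \<alpha> \<beta>.
        \<alpha> \<in> carrier K \<and> \<beta> \<in> carrier K} \<union>
     {frag_of [Inl (\<alpha> \<star> \<beta>)] - frag_of [Inl \<alpha>, Inl \<beta>] | \<alpha> \<beta>.
        \<alpha> \<in> carrier K \<and> \<beta> \<in> carrier K} \<union>
     {frag_of [Inr (X \<oplus>\<^bsub>\<gg>\<^esub> Y)] - frag_of [Inr X] - frag_of [Inr Y] | X Y.
        X \<in> carrier \<gg> \<and> Y \<in> carrier \<gg>} \<union>
     {frag_of [Inr (X \<triangleleft> \<alpha>)] - frag_of [Inr X, Inl \<alpha>] | X \<alpha>.
        X \<in> carrier \<gg> \<and> \<alpha> \<in> carrier K} \<union>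
     {frag_of [Inr (neg_pow \<gg> (i * j) (X \<triangleleft> \<alpha>))] - frag_of [Inl \<alpha>, Inr X] | X \<alpha> i j.
        \<alpha> \<in> gr K i \<and> X \<in> gr \<gg> j}"

lemma TI_eq: "TI = Idl\<^bsub>L\<^esub> trels"
  by (simp add: tensor_algebra_ideal_def trels_def)

lemma L_carrier: "carrier L = {x. Poly_Mapping.keys x \<subseteq> lists letters}"
  and L_simps [simp]: "x \<oplus>\<^bsub>L\<^esub> y = x + y" "\<zero>\<^bsub>L\<^esub> = 0" "\<one>\<^bsub>L\<^esub> = frag_of []"
  "frag_of u \<otimes>\<^bsub>L\<^esub> frag_of v = frag_of (u @ v)"
  by (simp_all add: letter_ring_def)

sublocale L: ring L unfolding letter_ring_def by (rule free_ring_is_ring)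

lemma L_of: "set w \<subseteq> letters ==> frag_of w \<in> carrier L"
  by (auto simp: L_carrier)

lemma L_diff: "x \<in> carrier L ==> y \<in> carrier L ==> x - y \<in> carrier L"
  using keys_diff[of x y] by (auto simp: L_carrier)

lemma trels_carrier: "trels \<subseteq> carrier L"
  unfolding trels_def by (auto simp: image_iff M.neg_pow_closed act_closed intro!: L_diff L_of)

sublocale TI: ideal TI L unfolding TI_eq by (rule L.genideal_ideal[OF trels_carrier])

lemma TA_simps [simp]:
  "carrier TA = carrier (L Quot TI)" "mult TA = mult (L Quot TI)" "one TA = one (L Quot TI)"
  "zero TA = zero (L Quot TI)" "add TA = add (L Quot TI)"
  by (simp_all add: tensor_algebra_def Let_def)

sublocale TA: ring TA
  by (rule ring_cong[OF _ _ _ _ _ TI.quotient_is_ring]) simp_all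

lemma p1_hom: "(\<lambda>x. TI +>\<^bsub>L\<^esub> x) \<in> ring_hom L TA"
  using TI.rcos_ring_hom by (simp add: ring_hom_def)

definition srels where "srels =
    {tensor_word K \<gg> [Inr v] \<otimes>\<^bsub>TA\<^esub> tensor_word K \<gg> [Inr w] \<ominus>\<^bsub>TA\<^esub>
      neg_pow TA (i * j) (tensor_word K \<gg> [Inr w] \<otimes>\<^bsub>TA\<^esub> tensor_word K \<gg> [Inr v]) | v w i j.
      v \<in> gr \<gg> i \<and> w \<in> gr \<gg> j} \<union>
     {tensor_word K \<gg> [Inr u] \<otimes>\<^bsub>TA\<^esub> tensor_word K \<gg> [Inr u] | u. u \<in> gr \<gg> 1}"

lemma J_eq: "J = Idl\<^bsub>TA\<^esub> srels"
  by (simp only: sym_ideal_def srels_def Let_def)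

lemma tensor_word_closed: "set w \<subseteq> letters ==> tensor_word K \<gg> w \<in> carrier TA"
  unfolding tensor_word_def by (rule ring_hom_closed[OF p1_hom L_of])

lemma Inr_closed [simp]: "X \<in> carrier \<gg> ==> tensor_word K \<gg> [Inr X] \<in> carrier TA"
  and Inl_closed [simp]: "\<alpha> \<in> carrier K ==> tensor_word K \<gg> [Inl \<alpha>] \<in> carrier TA"
  by (rule tensor_word_closed, simp)+

lemma srels_carrier: "srels \<subseteq> carrier TA"
  unfolding srels_def
  by (auto simp del: TA_simps intro!: TA.minus_closed TA.neg_pow_closed TA.m_closed Inr_closed)

sublocale J: ideal J TA unfolding J_eq by (rule TA.genideal_ideal[OF srels_carrier])

lemma S_simps [simp]:
  "carrier S = carrier (TA Quot J)" "mult S = mult (TA Quot J)" "one S = one (TA Quot J)"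
  "zero S = zero (TA Quot J)" "add S = add (TA Quot J)"
  by (simp_all add: sym_algebra_def super_quot_def)

sublocale S: ring S
  by (rule ring_cong[OF _ _ _ _ _ J.quotient_is_ring]) simp_all

declare S_simps [simp del] TA_simps [simp del]

definition proj where "proj x = J +>\<^bsub>TA\<^esub> (TI +>\<^bsub>L\<^esub> x)"

lemma p2_hom: "(\<lambda>x. J +>\<^bsub>TA\<^esub> x) \<in> ring_hom TA S"
  using J.rcos_ring_hom by (simp add: ring_hom_def S_simps)

lemma proj_hom: "proj \<in> ring_hom L S"
  unfolding proj_def using ring_hom_trans[OF p1_hom p2_hom] by (simp add: comp_def)

sublocale proj: ring_hom_ring L S proj
  by (rule ring_hom_ringI2[OF L.ring_axioms S.ring_axioms proj_hom])

lemma proj_surj: "x \<in> carrier S ==> \<exists>r\<in>carrier L. x = proj r"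
proof -
  assume "x \<in> carrier S"
  then obtain t where t: "t \<in> carrier TA" "x = J +>\<^bsub>TA\<^esub> t"
    by (auto simp: S_simps FactRing_def A_RCOSETS_def')
  then obtain r where "r \<in> carrier L" "t = TI +>\<^bsub>L\<^esub> r"
    by (auto simp: TA_simps FactRing_def A_RCOSETS_def')
  with t show ?thesis by (auto simp: proj_def)
qed

section \<open>Scalars and generators of S and the relations between them\<close>

definition \<kappa> where "\<kappa> \<alpha> = proj (frag_of [Inl \<alpha>])"
abbreviation "\<iota> \<equiv> sym_incl K \<gg>"

lemma \<iota>_eq: "\<iota> X = proj (frag_of [Inr X])"
  by (simp add: sym_incl_def proj_def tensor_word_def)

lemma \<kappa>_closed [simp, intro]: "\<alpha> \<in> carrier K ==> \<kappa> \<alpha> \<in> carrier S"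
  and \<iota>_closed [simp, intro]: "X \<in> carrier \<gg> ==> \<iota> X \<in> carrier S"
  by (auto simp: \<kappa>_def \<iota>_eq intro!: proj.hom_closed L_of)

lemma L_a_inv: "x \<in> carrier L ==> \<ominus>\<^bsub>L\<^esub> x = - x"
  by (rule L.minus_equality) (auto simp: L_carrier)

lemma proj_diff: "x \<in> carrier L ==> y \<in> carrier L ==> proj (x - y) = proj x \<ominus>\<^bsub>S\<^esub> proj y"
  using proj.hom_add[of x "\<ominus>\<^bsub>L\<^esub> y"] proj.hom_a_inv[of y] L.a_inv_closed[of y] by (simp add: L_a_inv S.minus_eq)

lemma proj_append: "set u \<subseteq> letters ==> set v \<subseteq> letters ==> proj (frag_of (u @ v)) = proj (frag_of u) \<odot> proj (frag_of v)"
  using proj.hom_mult[OF L_of L_of, of u v] by simp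

lemma proj_trels: "x \<in> trels ==> proj x = \<zero>\<^bsub>S\<^esub>"
proof -
  assume x: "x \<in> trels"
  then have xc: "x \<in> carrier L" using trels_carrier by auto
  have "x \<in> TI" unfolding TI_eq using L.genideal_self[OF trels_carrier] x by auto
  then have "TI +>\<^bsub>L\<^esub> x = \<zero>\<^bsub>TA\<^esub>" by (simp add: TI.a_rcos_const TA_simps FactRing_def)
  then show ?thesis
    using ring_hom_zero[OF p2_hom TA.ring_axioms S.ring_axioms] by (simp add: proj_def)
qed

lemma proj_srels: "x \<in> srels ==> J +>\<^bsub>TA\<^esub> x = \<zero>\<^bsub>S\<^esub>"
proof -
  assume x: "x \<in> srels"
  have "x \<in> J" unfolding J_eq using TA.genideal_self[OF srels_carrier] x by auto
  then show ?thesis by (simp add: J.a_rcos_const S_simps FactRing_def)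
qed

lemma proj_Cons_Inl: "\<alpha> \<in> carrier K ==> set w \<subseteq> letters ==> proj (frag_of (Inl \<alpha> # w)) = \<kappa> \<alpha> \<odot> proj (frag_of w)"
  and proj_Cons_Inr: "X \<in> carrier \<gg> ==> set w \<subseteq> letters ==> proj (frag_of (Inr X # w)) = \<iota> X \<odot> proj (frag_of w)"
  using proj_append[of "[Inl \<alpha>]" w] proj_append[of "[Inr X]" w] by (simp_all add: \<kappa>_def \<iota>_eq)

lemma proj_Nil [simp]: "proj (frag_of []) = \<one>\<^sub>S"
  using proj.hom_one by simp

lemma \<kappa>_one [simp]: "\<kappa> \<one>\<^bsub>K\<^esub> = \<one>\<^sub>S"
proof -
  have "proj (frag_of [Inl \<one>\<^bsub>K\<^esub>] - frag_of []) = \<zero>\<^bsub>S\<^esub>" by (rule proj_trels) (auto simp: trels_def)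
  then show ?thesis
    by (subst (asm) proj_diff) (auto intro!: L_of simp: \<kappa>_def[symmetric] S.diff_eq_zero_iff)
qed

lemma \<kappa>_add: assumes "\<alpha> \<in> carrier K" "\<beta> \<in> carrier K" shows "\<kappa> (\<alpha> \<oplus>\<^bsub>K\<^esub> \<beta>) = \<kappa> \<alpha> \<oplus>\<^bsub>S\<^esub> \<kappa> \<beta>"
proof -
  have "proj (frag_of [Inl (\<alpha> \<oplus>\<^bsub>K\<^esub> \<beta>)] - frag_of [Inl \<alpha>] - frag_of [Inl \<beta>]) = \<zero>\<^bsub>S\<^esub>"
    by (rule proj_trels) (unfold trels_def, use assms in blast)
  then have "\<kappa> (\<alpha> \<oplus>\<^bsub>K\<^esub> \<beta>) \<ominus>\<^bsub>S\<^esub> \<kappa> \<alpha> \<ominus>\<^bsub>S\<^esub> \<kappa> \<beta> = \<zero>\<^bsub>S\<^esub>"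
    using assms by (simp add: proj_diff L_diff L_of \<kappa>_def)
  then show ?thesis by (rule S.diff_diff_eq_zeroD) (use assms in auto)
qed

lemma \<kappa>_mult: assumes "\<alpha> \<in> carrier K" "\<beta> \<in> carrier K" shows "\<kappa> (\<alpha> \<star> \<beta>) = \<kappa> \<alpha> \<odot> \<kappa> \<beta>"
proof -
  have "proj (frag_of [Inl (\<alpha> \<star> \<beta>)] - frag_of [Inl \<alpha>, Inl \<beta>]) = \<zero>\<^bsub>S\<^esub>"
    by (rule proj_trels) (unfold trels_def, use assms in blast)
  then have "\<kappa> (\<alpha> \<star> \<beta>) \<ominus>\<^bsub>S\<^esub> \<kappa> \<alpha> \<odot> \<kappa> \<beta> = \<zero>\<^bsub>S\<^esub>"
    using assms proj_Cons_Inl[of \<alpha> "[Inl \<beta>]"] by (simp add: proj_diff L_diff L_of \<kappa>_def)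
  then show ?thesis using assms by (simp add: S.diff_eq_zero_iff)
qed

lemma \<iota>_add: assumes "X \<in> carrier \<gg>" "Y \<in> carrier \<gg>" shows "\<iota> (X \<oplus>\<^bsub>\<gg>\<^esub> Y) = \<iota> X \<oplus>\<^bsub>S\<^esub> \<iota> Y"
proof -
  have "proj (frag_of [Inr (X \<oplus>\<^bsub>\<gg>\<^esub> Y)] - frag_of [Inr X] - frag_of [Inr Y]) = \<zero>\<^bsub>S\<^esub>"
    by (rule proj_trels) (unfold trels_def, use assms in blast)
  then have "\<iota> (X \<oplus>\<^bsub>\<gg>\<^esub> Y) \<ominus>\<^bsub>S\<^esub> \<iota> X \<ominus>\<^bsub>S\<^esub> \<iota> Y = \<zero>\<^bsub>S\<^esub>"
    using assms by (simp add: proj_diff L_diff L_of \<iota>_eq)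
  then show ?thesis by (rule S.diff_diff_eq_zeroD) (use assms in auto)
qed

lemma \<iota>_act_\<kappa>: assumes "X \<in> carrier \<gg>" "\<alpha> \<in> carrier K" shows "\<iota> (X \<triangleleft> \<alpha>) = \<iota> X \<odot> \<kappa> \<alpha>"
proof -
  have "proj (frag_of [Inr (X \<triangleleft> \<alpha>)] - frag_of [Inr X, Inl \<alpha>]) = \<zero>\<^bsub>S\<^esub>"
    by (rule proj_trels) (unfold trels_def, use assms in blast)
  then have "\<iota> (X \<triangleleft> \<alpha>) \<ominus>\<^bsub>S\<^esub> \<iota> X \<odot> \<kappa> \<alpha> = \<zero>\<^bsub>S\<^esub>"
    using assms proj_Cons_Inr[of X "[Inl \<alpha>]"] by (simp add: proj_diff L_diff L_of \<iota>_eq \<kappa>_def act_closed)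
  then show ?thesis using assms by (simp add: S.diff_eq_zero_iff act_closed)
qed

lemma \<iota>_additive: "\<iota> \<in> additive_maps \<gg> S" and \<kappa>_additive: "\<kappa> \<in> additive_maps K S"
  by (auto intro!: additive_mapsI simp: \<iota>_add \<kappa>_add)

lemma S_ab: "abelian_group S" by unfold_locales

lemma \<iota>_neg_pow: "X \<in> carrier \<gg> ==> \<iota> (neg_pow \<gg> e X) = neg_pow S e (\<iota> X)"
  by (rule additive_maps_neg_pow[OF \<iota>_additive M_ab S_ab])

lemma \<kappa>_neg_pow: "X \<in> carrier K ==> \<kappa> (neg_pow K e X) = neg_pow S e (\<kappa> X)"
  by (rule additive_maps_neg_pow[OF \<kappa>_additive K_ab S_ab])

lemma \<kappa>_\<iota>: assumes "\<alpha> \<in> gr K i" "X \<in> gr \<gg> j"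
  shows "\<kappa> \<alpha> \<odot> \<iota> X = neg_pow S (i * j) (\<iota> X \<odot> \<kappa> \<alpha>)"
proof -
  have c: "X \<in> carrier \<gg>" "\<alpha> \<in> carrier K" using assms by auto
  have "proj (frag_of [Inr (neg_pow \<gg> (i * j) (X \<triangleleft> \<alpha>))] - frag_of [Inl \<alpha>, Inr X]) = \<zero>\<^bsub>S\<^esub>"
    by (rule proj_trels) (unfold trels_def, use assms in blast)
  then have "\<iota> (neg_pow \<gg> (i * j) (X \<triangleleft> \<alpha>)) \<ominus>\<^bsub>S\<^esub> \<kappa> \<alpha> \<odot> \<iota> X = \<zero>\<^bsub>S\<^esub>"
    using c proj_Cons_Inl[of \<alpha> "[Inr X]"] by (simp add: proj_diff L_diff L_of \<iota>_eq \<kappa>_def act_closed)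
  then show ?thesis using c by (simp add: S.diff_eq_zero_iff act_closed \<iota>_neg_pow \<iota>_act_\<kappa>)
qed

lemma \<iota>_comm: assumes "X \<in> gr \<gg> i" "Y \<in> gr \<gg> j"
  shows "\<iota> X \<odot> \<iota> Y = neg_pow S (i * j) (\<iota> Y \<odot> \<iota> X)"
proof -
  let ?t = "\<lambda>X. tensor_word K \<gg> [Inr X]"
  have c: "X \<in> carrier \<gg>" "Y \<in> carrier \<gg>" using assms by auto
  interpret q: ring_hom_ring TA S "\<lambda>x. J +>\<^bsub>TA\<^esub> x"
    by (rule ring_hom_ringI2[OF TA.ring_axioms S.ring_axioms p2_hom])
  have tt: "J +>\<^bsub>TA\<^esub> ?t X = \<iota> X" for X by (simp add: sym_incl_def)
  have "J +>\<^bsub>TA\<^esub> (?t X \<otimes>\<^bsub>TA\<^esub> ?t Y \<ominus>\<^bsub>TA\<^esub> neg_pow TA (i * j) (?t Y \<otimes>\<^bsub>TA\<^esub> ?t X)) = \<zero>\<^bsub>S\<^esub>"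
    by (rule proj_srels) (unfold srels_def, use assms in blast)
  moreover have "J +>\<^bsub>TA\<^esub> neg_pow TA e x = neg_pow S e (J +>\<^bsub>TA\<^esub> x)" if "x \<in> carrier TA" for e x
    unfolding neg_pow_def using that by (auto intro: q.hom_a_inv)
  ultimately have "\<iota> X \<odot> \<iota> Y \<ominus>\<^bsub>S\<^esub> neg_pow S (i * j) (\<iota> Y \<odot> \<iota> X) = \<zero>\<^bsub>S\<^esub>"
    using c by (simp only: TA.minus_eq S.minus_eq tt q.hom_add q.hom_mult q.hom_a_inv
        TA.m_closed TA.neg_pow_closed TA.a_inv_closed Inr_closed)
  then show ?thesis using c by (subst (asm) S.diff_eq_zero_iff) auto
qed

lemma \<iota>_odd_square: assumes "X \<in> gr \<gg> 1" shows "\<iota> X \<odot> \<iota> X = \<zero>\<^bsub>S\<^esub>"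
proof -
  have c: "X \<in> carrier \<gg>" using assms by auto
  interpret q: ring_hom_ring TA S "\<lambda>x. J +>\<^bsub>TA\<^esub> x"
    by (rule ring_hom_ringI2[OF TA.ring_axioms S.ring_axioms p2_hom])
  have "J +>\<^bsub>TA\<^esub> (tensor_word K \<gg> [Inr X] \<otimes>\<^bsub>TA\<^esub> tensor_word K \<gg> [Inr X]) = \<zero>\<^bsub>S\<^esub>"
    by (rule proj_srels) (unfold srels_def, use assms in blast)
  then show ?thesis using c by (simp only: q.hom_mult Inr_closed sym_incl_def)
qed

text \<open>The elements that are sums of words with at most n homogeneous generators followed by
  one scalar. The filtration yields the induction principle for S and later bounds the number of
  terms of a power series that matter at a given element.\<close>

inductive fil :: "nat \<Rightarrow> ('k, 'g) sym_elem \<Rightarrow> bool" where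
  fil_scalar: "\<alpha> \<in> carrier K ==> fil n (\<kappa> \<alpha>)"
| fil_mult: "X \<in> gr \<gg> i ==> fil n w ==> fil (Suc n) (\<iota> X \<odot> w)"
| fil_add: "fil n x ==> fil n y ==> fil n (x \<oplus>\<^bsub>S\<^esub> y)"

lemma fil_closed: "fil n x ==> x \<in> carrier S"
  by (induction rule: fil.induct) auto

lemma fil_mono: "fil n x ==> n \<le> m ==> fil m x"
proof (induction arbitrary: m rule: fil.induct)
  case (fil_mult X i n w)
  then obtain m' where "m = Suc m'" "n \<le> m'" by (cases m) auto
  with fil_mult show ?case by (auto intro: fil.fil_mult)
qed (auto intro: fil.intros)

text \<open>A scalar on the left passes a homogeneous generator at the price of a sign, which is
  absorbed in the scalar; so all scalars can be collected at the right end.\<close>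

lemma fil_kappa: "fil n x ==> \<alpha> \<in> carrier K ==> fil n (\<kappa> \<alpha> \<odot> x)"
proof (induction arbitrary: \<alpha> rule: fil.induct)
  case (fil_scalar \<beta> n)
  then show ?case by (auto simp: \<kappa>_mult[symmetric] intro!: fil.fil_scalar)
next
  case (fil_mult X j n w)
  have w: "w \<in> carrier S" using fil_mult fil_closed by auto
  from \<open>\<alpha> \<in> carrier K\<close> show ?case
  proof (induction \<alpha> rule: K.gr_induct)
    case (gr i \<alpha>)
    have "\<kappa> \<alpha> \<odot> (\<iota> X \<odot> w) = (\<kappa> \<alpha> \<odot> \<iota> X) \<odot> w"
      using gr fil_mult w by (simp add: S.m_assoc)
    also have "\<dots> = \<iota> X \<odot> (\<kappa> (neg_pow K (i * j) \<alpha>) \<odot> w)"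
      using gr fil_mult w
      by (simp add: \<kappa>_\<iota> S.m_assoc \<kappa>_neg_pow S.neg_pow_mult)
    finally show ?case using fil_mult gr by (auto intro!: fil.fil_mult)
  next
    case (add y z)
    then show ?case using fil_mult w by (auto simp: \<kappa>_add S.l_distr intro!: fil.fil_add)
  qed
next
  case (fil_add n x y)
  then show ?case using fil_closed[of n x] fil_closed[of n y] by (auto simp: S.r_distr intro!: fil.fil_add)
qed

lemma fil_iota: "X \<in> carrier \<gg> ==> fil n x ==> fil (Suc n) (\<iota> X \<odot> x)"
proof (induction X rule: M.gr_induct)
  case (gr i y)
  then show ?case by (auto intro: fil.fil_mult)
next
  case (add y z)
  then show ?case using fil_closed[of n x] by (auto simp: \<iota>_add S.l_distr intro!: fil.fil_add)
qed

lemma fil_zero: "fil n \<zero>\<^bsub>S\<^esub>"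
  using fil_scalar[of "\<zero>\<^bsub>K\<^esub>" n] additive_maps_zero[OF \<kappa>_additive K_ab S_ab] by simp

lemma fil_neg: assumes "fil n x" shows "fil n (\<ominus>\<^bsub>S\<^esub> x)"
proof -
  have "\<kappa> (\<ominus>\<^bsub>K\<^esub> \<one>\<^bsub>K\<^esub>) = \<ominus>\<^bsub>S\<^esub> \<one>\<^sub>S" using \<kappa>_neg_pow[of "\<one>\<^bsub>K\<^esub>" 1] by simp
  then show ?thesis using fil_kappa[OF assms, of "\<ominus>\<^bsub>K\<^esub> \<one>\<^bsub>K\<^esub>"] fil_closed[OF assms] by (simp add: S.l_minus)
qed

lemma fil_word: "set w \<subseteq> letters ==> fil (length w) (proj (frag_of w))"
proof (induction w)
  case Nil
  then show ?case using fil_scalar[of "\<one>\<^bsub>K\<^esub>" 0] by simp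
next
  case (Cons l w)
  then show ?case
    by (auto simp: proj_Cons_Inl proj_Cons_Inr intro!: fil_iota fil_mono[OF fil_kappa])
qed

lemma ex_fil: "x \<in> carrier S ==> \<exists>n. fil n x"
proof -
  assume "x \<in> carrier S"
  then obtain r where r: "r \<in> carrier L" "x = proj r" using proj_surj by blast
  then have "Poly_Mapping.keys r \<subseteq> lists letters" by (simp add: L_carrier)
  then have "(\<exists>n. fil n (proj r)) \<and> r \<in> carrier L"
  proof (induction r rule: frag_induction)
    case zero
    then show ?case using fil_zero proj.hom_zero L.zero_closed by auto
  next
    case (one w)
    then have "set w \<subseteq> letters" by auto
    then show ?case using fil_word L_of by blast
  next
    case (diff a b)
    then obtain m n where "fil m (proj a)" "fil n (proj b)" "a \<in> carrier L" "b \<in> carrier L" by auto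
    then have "fil (max m n) (proj a)" "fil (max m n) (\<ominus>\<^bsub>S\<^esub> proj b)" "a \<in> carrier L" "b \<in> carrier L"
      by (auto intro: fil_mono fil_neg)
    then show ?case using fil_add by (auto simp: proj_diff L_diff S.minus_eq)
  qed
  with r show ?thesis by simp
qed

lemma S_induct [consumes 1, case_names scalar mult add]:
  assumes "x \<in> carrier S" and "\<And>\<alpha>. \<alpha> \<in> carrier K ==> P (\<kappa> \<alpha>)"
    and "\<And>X i w. X \<in> gr \<gg> i ==> w \<in> carrier S ==> P w ==> P (\<iota> X \<odot> w)"
    and "\<And>x y. x \<in> carrier S ==> y \<in> carrier S ==> P x ==> P y ==> P (x \<oplus>\<^bsub>S\<^esub> y)"
  shows "P x"
proof -
  obtain n where "fil n x" using ex_fil assms(1) by blast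
  then show ?thesis by (induction rule: fil.induct) (auto intro: assms(2-) fil_closed)
qed

text \<open>The assignment on letters extends to the free ring and then descends through both
  quotients, because the assumed equations are the generating relations of the two ideals.\<close>

theorem S_universal:
  assumes R: "ring R" and h: "\<And>\<alpha>. \<alpha> \<in> carrier K ==> hk \<alpha> \<in> carrier R" "\<And>X. X \<in> carrier \<gg> ==> hg X \<in> carrier R"
    and "hk \<one>\<^bsub>K\<^esub> = \<one>\<^bsub>R\<^esub>"
    and "\<And>\<alpha> \<beta>. \<alpha> \<in> carrier K ==> \<beta> \<in> carrier K ==> hk (\<alpha> \<oplus>\<^bsub>K\<^esub> \<beta>) = hk \<alpha> \<oplus>\<^bsub>R\<^esub> hk \<beta>"
    and "\<And>\<alpha> \<beta>. \<alpha> \<in> carrier K ==> \<beta> \<in> carrier K ==> hk (\<alpha> \<star> \<beta>) = hk \<alpha> \<otimes>\<^bsub>R\<^esub> hk \<beta>"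
    and "\<And>X Y. X \<in> carrier \<gg> ==> Y \<in> carrier \<gg> ==> hg (X \<oplus>\<^bsub>\<gg>\<^esub> Y) = hg X \<oplus>\<^bsub>R\<^esub> hg Y"
    and "\<And>X \<alpha>. X \<in> carrier \<gg> ==> \<alpha> \<in> carrier K ==> hg (X \<triangleleft> \<alpha>) = hg X \<otimes>\<^bsub>R\<^esub> hk \<alpha>"
    and "\<And>X \<alpha> i j. \<alpha> \<in> gr K i ==> X \<in> gr \<gg> j ==> hg (neg_pow \<gg> (i * j) (X \<triangleleft> \<alpha>)) = hk \<alpha> \<otimes>\<^bsub>R\<^esub> hg X"
    and "\<And>X Y i j. X \<in> gr \<gg> i ==> Y \<in> gr \<gg> j ==> hg X \<otimes>\<^bsub>R\<^esub> hg Y = neg_pow R (i * j) (hg Y \<otimes>\<^bsub>R\<^esub> hg X)"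
    and "\<And>X. X \<in> gr \<gg> 1 ==> hg X \<otimes>\<^bsub>R\<^esub> hg X = \<zero>\<^bsub>R\<^esub>"
  obtains f where "f \<in> ring_hom S R" "\<And>\<alpha>. \<alpha> \<in> carrier K ==> f (\<kappa> \<alpha>) = hk \<alpha>"
    "\<And>X. X \<in> carrier \<gg> ==> f (\<iota> X) = hg X"
proof -
  interpret R: ring R by fact
  let ?h = "case_sum hk hg"
  let ?H = "fext R (wd R ?h)"
  have hc: "?h l \<in> carrier R" if "l \<in> letters" for l using that h by auto
  have H: "?H \<in> ring_hom L R" unfolding letter_ring_def by (rule R.free_ring_hom) (rule hc)
  interpret H: ring_hom_ring L R ?H by (rule ring_hom_ringI2[OF L.ring_axioms R H])
  have Hof: "?H (frag_of w) = wd R ?h w" if "set w \<subseteq> letters" for w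
    by (rule R.fext_frag_of, rule R.wd_closed) (use that hc in blast)
  have wdc: "wd R ?h w \<in> carrier R" if "set w \<subseteq> letters" for w
    by (rule R.wd_closed) (use that hc in blast)
  have Hd: "?H (x - y) = ?H x \<ominus>\<^bsub>R\<^esub> ?H y" if "x \<in> carrier L" "y \<in> carrier L" for x y
  proof -
    have "?H (x \<oplus>\<^bsub>L\<^esub> \<ominus>\<^bsub>L\<^esub> y) = ?H x \<ominus>\<^bsub>R\<^esub> ?H y" using that by (simp only: H.hom_add H.hom_a_inv L.a_inv_closed R.minus_eq)
    then show ?thesis using that by (simp add: L_a_inv)
  qed
  have 0: "?H x = \<zero>\<^bsub>R\<^esub>" if "x \<in> trels" for x
    using that unfolding trels_def
    by (auto simp: Hd Hof L_of L_diff h act_closed assms(4-9) R.diff_eq_zero_iff R.diff_diff_eq_zero)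
  obtain h1 where h1: "h1 \<in> ring_hom (L Quot TI) R" "\<And>x. x \<in> carrier L ==> h1 (TI +>\<^bsub>L\<^esub> x) = ?H x"
    by (rule quot_lift[OF TI.ideal_axioms R H ring_hom_genideal[OF L.ring_axioms R H trels_carrier 0]])
      (auto simp: TI_eq)
  have h1': "h1 \<in> ring_hom TA R" using h1(1) by (simp add: ring_hom_def TA_simps)
  interpret h1: ring_hom_ring TA R h1 by (rule ring_hom_ringI2[OF TA.ring_axioms R h1'])
  have h1t: "h1 (tensor_word K \<gg> [Inr X]) = hg X" if "X \<in> carrier \<gg>" for X
    using that h by (simp add: tensor_word_def h1(2) L_of Hof)
  have 1: "h1 x = \<zero>\<^bsub>R\<^esub>" if "x \<in> srels" for x
    using that unfolding srels_def
  proof (elim UnE CollectE exE conjE)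
    fix v w i j
    assume *: "x = tensor_word K \<gg> [Inr v] \<otimes>\<^bsub>TA\<^esub> tensor_word K \<gg> [Inr w] \<ominus>\<^bsub>TA\<^esub>
      neg_pow TA (i * j) (tensor_word K \<gg> [Inr w] \<otimes>\<^bsub>TA\<^esub> tensor_word K \<gg> [Inr v])"
      "v \<in> gr \<gg> i" "w \<in> gr \<gg> j"
    then have c: "v \<in> carrier \<gg>" "w \<in> carrier \<gg>" by auto
    have "h1 (neg_pow TA e x) = neg_pow R e (h1 x)" if "x \<in> carrier TA" for e x
      unfolding neg_pow_def using that by (auto intro: h1.hom_a_inv)
    then have "h1 x = hg v \<otimes>\<^bsub>R\<^esub> hg w \<ominus>\<^bsub>R\<^esub> neg_pow R (i * j) (hg w \<otimes>\<^bsub>R\<^esub> hg v)"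
      using c unfolding *(1) by (simp only: TA.minus_eq R.minus_eq h1t h1.hom_add h1.hom_mult h1.hom_a_inv
        TA.m_closed TA.neg_pow_closed TA.a_inv_closed Inr_closed)
    also have "\<dots> = \<zero>\<^bsub>R\<^esub>" using assms(10)[OF *(2,3)] c h by (subst R.diff_eq_zero_iff) auto
    finally show ?thesis .
  next
    fix u assume "x = tensor_word K \<gg> [Inr u] \<otimes>\<^bsub>TA\<^esub> tensor_word K \<gg> [Inr u]" "u \<in> gr \<gg> 1"
    then show ?thesis using assms(11) by (auto simp: h1t)
  qed
  obtain h2 where h2: "h2 \<in> ring_hom (TA Quot J) R" "\<And>x. x \<in> carrier TA ==> h2 (J +>\<^bsub>TA\<^esub> x) = h1 x"
    by (rule quot_lift[OF J.ideal_axioms R h1' ring_hom_genideal[OF TA.ring_axioms R h1' srels_carrier 1]])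
      (auto simp: J_eq)
  show thesis
  proof (rule that)
    show "h2 \<in> ring_hom S R" using h2(1) by (simp add: ring_hom_def S_simps)
    have *: "h2 (proj x) = ?H x" if "x \<in> carrier L" for x
      using that h2(2)[OF ring_hom_closed[OF p1_hom that]] h1(2) by (simp add: proj_def)
    show "h2 (\<kappa> \<alpha>) = hk \<alpha>" if "\<alpha> \<in> carrier K" for \<alpha>
      using that h by (simp add: * \<kappa>_def L_of Hof)
    show "h2 (\<iota> X) = hg X" if "X \<in> carrier \<gg>" for X
      using that h by (simp add: * \<iota>_eq L_of Hof)
  qed
qed

section \<open>The parity grading of S\<close>

lemma gr_TA: "gr TA k = generate (add_monoid (L Quot TI))
    {tensor_word K \<gg> w | w ps. list_all2 (letter_parity K \<gg>) w ps \<and> sum_list ps = k}"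
  by (simp add: tensor_algebra_def Let_def)

lemma gr_S_eq: "gr S k = (\<lambda>x. J +>\<^bsub>TA\<^esub> x) ` gr TA k"
  by (simp add: sym_algebra_def super_quot_def)

lemma word_letters: "list_all2 (letter_parity K \<gg>) w ps ==> set w \<subseteq> letters"
proof (induction w ps rule: list_all2_induct)
  case (Cons l w i ps)
  then show ?case by (cases l) auto
qed simp

lemma gr_S_word: "list_all2 (letter_parity K \<gg>) w ps ==> proj (frag_of w) \<in> gr S (sum_list ps)"
proof -
  assume "list_all2 (letter_parity K \<gg>) w ps"
  then have "tensor_word K \<gg> w \<in> gr TA (sum_list ps)"
    unfolding gr_TA by (intro generate.incl) auto
  then show ?thesis unfolding gr_S_eq by (auto simp: proj_def tensor_word_def)
qed

interpretation q: ring_hom_ring TA S "\<lambda>x. J +>\<^bsub>TA\<^esub> x"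
  by (rule ring_hom_ringI2[OF TA.ring_axioms S.ring_axioms p2_hom])

lemma a_inv_TA: "inv\<^bsub>add_monoid (L Quot TI)\<^esub> x = \<ominus>\<^bsub>TA\<^esub> x"
  by (simp add: a_inv_def m_inv_def TA_simps)

lemma gr_TA_closed: "x \<in> gr TA k ==> x \<in> carrier TA"
  unfolding gr_TA
proof (induction rule: generate.induct)
  case one
  then show ?case using TA.zero_closed by (simp add: TA_simps)
next
  case (incl h)
  then show ?case using word_letters tensor_word_closed by blast
next
  case (inv h)
  then have "h \<in> carrier TA" using word_letters tensor_word_closed by blast
  then show ?case unfolding a_inv_TA by simp
next
  case (eng h1 h2)
  then show ?case using TA.a_closed[of h1 h2] by (simp add: TA_simps)
qed

text \<open>The graded part is the image of a generated subgroup, and \<open>generate\<close>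
  inserts inverses of generators; hence the separate case of a negated word.\<close>

lemma gr_S_raw_induct [consumes 1, case_names word neg add zero]:
  assumes "x \<in> gr S k"
    and w: "\<And>w ps. list_all2 (letter_parity K \<gg>) w ps ==> sum_list ps = k ==> P (proj (frag_of w))"
    and n: "\<And>w ps. list_all2 (letter_parity K \<gg>) w ps ==> sum_list ps = k ==> P (\<ominus>\<^bsub>S\<^esub> proj (frag_of w))"
    and a: "\<And>x y. x \<in> gr S k ==> y \<in> gr S k ==> x \<in> carrier S ==> y \<in> carrier S ==> P x ==> P y ==> P (x \<oplus>\<^bsub>S\<^esub> y)"
    and z: "P \<zero>\<^bsub>S\<^esub>"
  shows "P x"
proof -
  obtain t where t: "t \<in> gr TA k" "x = J +>\<^bsub>TA\<^esub> t" using assms(1) unfolding gr_S_eq by blast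
  have "P (J +>\<^bsub>TA\<^esub> t)" using t(1) unfolding gr_TA
  proof (induction rule: generate.induct)
    case one
    then show ?case using z q.hom_zero by (simp add: TA_simps)
  next
    case (incl h)
    then obtain w ps where h: "h = tensor_word K \<gg> w" "list_all2 (letter_parity K \<gg>) w ps" "sum_list ps = k" by auto
    then show ?case using assms(2)[OF h(2,3)] by (simp add: proj_def tensor_word_def)
  next
    case (inv h)
    then obtain w ps where h: "h = tensor_word K \<gg> w" "list_all2 (letter_parity K \<gg>) w ps" "sum_list ps = k" by auto
    then have "h \<in> carrier TA" using word_letters tensor_word_closed by blast
    then have "J +>\<^bsub>TA\<^esub> (\<ominus>\<^bsub>TA\<^esub> h) = \<ominus>\<^bsub>S\<^esub> proj (frag_of w)"
      using h(1) by (simp add: proj_def tensor_word_def)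
    then show ?case unfolding a_inv_TA using n[OF h(2,3)] by simp
  next
    case (eng t1 t2)
    then have t: "t1 \<in> gr TA k" "t2 \<in> gr TA k" unfolding gr_TA by auto
    then have c: "t1 \<in> carrier TA" "t2 \<in> carrier TA" using gr_TA_closed by auto
    then have "J +>\<^bsub>TA\<^esub> (t1 \<oplus>\<^bsub>TA\<^esub> t2) = (J +>\<^bsub>TA\<^esub> t1) \<oplus>\<^bsub>S\<^esub> (J +>\<^bsub>TA\<^esub> t2)" by (rule q.hom_add)
    moreover have "P ((J +>\<^bsub>TA\<^esub> t1) \<oplus>\<^bsub>S\<^esub> (J +>\<^bsub>TA\<^esub> t2))"
      by (rule a) (use t c eng(3,4) q.hom_closed in \<open>unfold gr_S_eq, auto\<close>)
    ultimately show ?case by (simp add: TA_simps)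
  qed
  with t show ?thesis by simp
qed

lemma gr_S_subgroup: "additive_subgroup (gr S k) S"
proof (rule additive_subgroupI, rule S.a_group[THEN group.subgroupI])
  have z: "\<zero>\<^bsub>L Quot TI\<^esub> \<in> gr TA k" unfolding gr_TA using generate.one[of "add_monoid (L Quot TI)"] by simp
  have "J +>\<^bsub>TA\<^esub> \<zero>\<^bsub>TA\<^esub> = \<zero>\<^bsub>S\<^esub>" by (rule q.hom_zero)
  show "gr S k \<subseteq> carrier (add_monoid S)"
    using gr_TA_closed q.hom_closed by (auto simp: gr_S_eq)
  show "gr S k \<noteq> {}" using z by (auto simp: gr_S_eq)
  have neg: "\<ominus>\<^bsub>TA\<^esub> t \<in> gr TA k" if "t \<in> gr TA k" for t
    using that unfolding gr_TA
  proof (induction rule: generate.induct)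
    case one
    then show ?case using z TA.a_inv_zero by (simp add: TA_simps gr_TA)
  next
    case (incl h)
    then show ?case using generate.inv[OF incl, of "add_monoid (L Quot TI)"] by (simp only: a_inv_TA)
  next
    case (inv h)
    then have "h \<in> carrier TA" using word_letters tensor_word_closed by blast
    then show ?case unfolding a_inv_TA using generate.incl[OF inv, of "add_monoid (L Quot TI)"] by simp
  next
    case (eng t1 t2)
    then have c: "t1 \<in> carrier TA" "t2 \<in> carrier TA" using gr_TA_closed[of _ k] unfolding gr_TA by auto
    have "\<ominus>\<^bsub>TA\<^esub> (t1 \<oplus>\<^bsub>TA\<^esub> t2) = \<ominus>\<^bsub>TA\<^esub> t1 \<oplus>\<^bsub>TA\<^esub> \<ominus>\<^bsub>TA\<^esub> t2" using c by (simp add: TA.minus_add)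
    then show ?case using generate.eng[OF eng(3,4)] by (simp add: TA_simps)
  qed
  show "inv\<^bsub>add_monoid S\<^esub> x \<in> gr S k" if x: "x \<in> gr S k" for x
  proof -
    obtain t where t: "t \<in> gr TA k" "x = J +>\<^bsub>TA\<^esub> t" using x unfolding gr_S_eq by blast
    then have "\<ominus>\<^bsub>S\<^esub> x = J +>\<^bsub>TA\<^esub> (\<ominus>\<^bsub>TA\<^esub> t)" using gr_TA_closed q.hom_a_inv by simp
    then show ?thesis using neg[OF t(1)] by (simp add: gr_S_eq a_inv_def)
  qed
  show "x \<otimes>\<^bsub>add_monoid S\<^esub> y \<in> gr S k" if xy: "x \<in> gr S k" "y \<in> gr S k" for x y
  proof -
    obtain t u where t: "t \<in> gr TA k" "x = J +>\<^bsub>TA\<^esub> t" "u \<in> gr TA k" "y = J +>\<^bsub>TA\<^esub> u"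
      using xy unfolding gr_S_eq by blast
    then have "x \<oplus>\<^bsub>S\<^esub> y = J +>\<^bsub>TA\<^esub> (t \<oplus>\<^bsub>TA\<^esub> u)" using gr_TA_closed q.hom_add by simp
    moreover have "t \<oplus>\<^bsub>TA\<^esub> u \<in> gr TA k"
      using t(1,3) generate.eng[of t "add_monoid (L Quot TI)"] unfolding gr_TA by (simp add: TA_simps)
    ultimately show ?thesis by (simp add: gr_S_eq)
  qed
qed

lemma gr_S_closed: "x \<in> gr S k ==> x \<in> carrier S"
  using additive_subgroup.a_Hcarr[OF gr_S_subgroup] .

lemma gr_S_add: "x \<in> gr S k ==> y \<in> gr S k ==> x \<oplus>\<^bsub>S\<^esub> y \<in> gr S k"
  by (rule additive_subgroup.a_closed[OF gr_S_subgroup])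

lemma gr_S_kappa: "\<alpha> \<in> gr K i ==> \<kappa> \<alpha> \<in> gr S i"
  using gr_S_word[of "[Inl \<alpha>]" "[i]"] by (simp add: \<kappa>_def)

lemma gr_S_neg_pow: "x \<in> gr S k ==> neg_pow S e x \<in> gr S k"
  by (rule S.neg_pow_subgroup[OF gr_S_subgroup])

lemma gr_S_iota_mult: "x \<in> gr S k ==> X \<in> gr \<gg> i ==> \<iota> X \<odot> x \<in> gr S (i + k)"
proof (induction x rule: gr_S_raw_induct)
  case (word w ps)
  then show ?case using gr_S_word[of "Inr X # w" "i # ps"] by (auto simp: proj_Cons_Inr word_letters)
next
  case (neg w ps)
  then have "proj (frag_of w) \<in> carrier S" using word_letters by (intro proj.hom_closed L_of)
  moreover have "neg_pow S 1 (\<iota> X \<odot> proj (frag_of w)) \<in> gr S (i + k)"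
    using gr_S_word[of "Inr X # w" "i # ps"] neg by (intro gr_S_neg_pow) (auto simp: proj_Cons_Inr word_letters)
  ultimately show ?case using neg by (simp add: S.r_minus)
next
  case (add x y)
  then show ?case by (auto simp: S.r_distr intro: gr_S_add)
qed (auto simp: additive_subgroup.zero_closed[OF gr_S_subgroup])

text \<open>Another description of \<open>gr S k\<close>, identified with it in
  \<open>gr_S_iff\<close>. Words have letters of both kinds in any order; here all scalars are
  collected at the end, which gives an induction rule of the same shape as
  \<open>S_induct\<close>.\<close>

inductive hmg :: "bit \<Rightarrow> ('k, 'g) sym_elem \<Rightarrow> bool" where
  hmg_scalar: "\<alpha> \<in> gr K k ==> hmg k (\<kappa> \<alpha>)"
| hmg_mult: "X \<in> gr \<gg> i ==> hmg j w ==> hmg (i + j) (\<iota> X \<odot> w)"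
| hmg_add: "hmg k x ==> hmg k y ==> hmg k (x \<oplus>\<^bsub>S\<^esub> y)"

lemma hmg_gr: "hmg k x ==> x \<in> gr S k"
  by (induction rule: hmg.induct) (auto intro: gr_S_kappa gr_S_iota_mult gr_S_add)

lemma hmg_kappa: "hmg j x ==> \<alpha> \<in> gr K i ==> hmg (i + j) (\<kappa> \<alpha> \<odot> x)"
proof (induction arbitrary: \<alpha> rule: hmg.induct)
  case (hmg_scalar \<beta> k)
  then have "\<alpha> \<star> \<beta> \<in> gr K (i + k)" by (intro K.gr_mult)
  then have "hmg (i + k) (\<kappa> (\<alpha> \<star> \<beta>))" by (rule hmg.hmg_scalar)
  then show ?case using hmg_scalar by (auto simp: \<kappa>_mult)
next
  case (hmg_mult X j k w)
  then have w: "w \<in> carrier S" using hmg_gr gr_S_closed by blast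
  have "\<kappa> \<alpha> \<odot> (\<iota> X \<odot> w) = (\<kappa> \<alpha> \<odot> \<iota> X) \<odot> w"
    using hmg_mult w by (simp add: S.m_assoc)
  also have "\<dots> = \<iota> X \<odot> (\<kappa> (neg_pow K (i * j) \<alpha>) \<odot> w)"
    using hmg_mult w by (simp add: \<kappa>_\<iota> S.m_assoc \<kappa>_neg_pow S.neg_pow_mult)
  finally have e: "\<kappa> \<alpha> \<odot> (\<iota> X \<odot> w) = \<iota> X \<odot> (\<kappa> (neg_pow K (i * j) \<alpha>) \<odot> w)" .
  have "hmg (i + k) (\<kappa> (neg_pow K (i * j) \<alpha>) \<odot> w)" using hmg_mult by auto
  then have "hmg (j + (i + k)) (\<iota> X \<odot> (\<kappa> (neg_pow K (i * j) \<alpha>) \<odot> w))" using hmg_mult by (intro hmg.hmg_mult)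
  then show ?case unfolding e by (simp add: ac_simps)
next
  case (hmg_add k x y)
  then have "x \<in> carrier S" "y \<in> carrier S" using hmg_gr gr_S_closed by blast+
  with hmg_add show ?case by (auto simp: S.r_distr intro!: hmg.hmg_add)
qed

lemma hmg_neg: assumes "hmg k x" shows "hmg k (\<ominus>\<^bsub>S\<^esub> x)"
proof -
  have "\<kappa> (\<ominus>\<^bsub>K\<^esub> \<one>\<^bsub>K\<^esub>) = \<ominus>\<^bsub>S\<^esub> \<one>\<^sub>S" using \<kappa>_neg_pow[of "\<one>\<^bsub>K\<^esub>" 1] by simp
  moreover have "\<ominus>\<^bsub>K\<^esub> \<one>\<^bsub>K\<^esub> \<in> gr K 0" using K.gr_one by auto
  ultimately show ?thesis using hmg_kappa[OF assms, of "\<ominus>\<^bsub>K\<^esub> \<one>\<^bsub>K\<^esub>" 0] hmg_gr[OF assms] gr_S_closed by (simp add: S.l_minus)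
qed

lemma hmg_word: "list_all2 (letter_parity K \<gg>) w ps ==> hmg (sum_list ps) (proj (frag_of w))"
proof (induction w ps rule: list_all2_induct)
  case Nil
  then show ?case using hmg_scalar[OF K.gr_one] by simp
next
  case (Cons l w i ps)
  then have w: "set w \<subseteq> letters" using word_letters by blast
  show ?case
  proof (cases l)
    case (Inl \<alpha>)
    with Cons w hmg_kappa[of "sum_list ps" "proj (frag_of w)" \<alpha> i] show ?thesis by (auto simp: proj_Cons_Inl)
  next
    case (Inr X)
    with Cons w hmg.hmg_mult[of X i "sum_list ps" "proj (frag_of w)"] show ?thesis by (auto simp: proj_Cons_Inr)
  qed
qed

lemma gr_S_iff: "x \<in> gr S k \<longleftrightarrow> hmg k x"
proof
  assume "x \<in> gr S k"
  then show "hmg k x"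
  proof (induction rule: gr_S_raw_induct)
    case zero
    have "hmg k (\<kappa> \<zero>\<^bsub>K\<^esub>)" by (rule hmg_scalar) auto
    then show ?case using additive_maps_zero[OF \<kappa>_additive K_ab S_ab] by simp
  qed (use hmg_word hmg_neg in \<open>auto intro: hmg_add\<close>)
qed (rule hmg_gr)

lemma gr_S_induct [consumes 1, case_names scalar mult add]:
  assumes "x \<in> gr S k" "\<And>k \<alpha>. \<alpha> \<in> gr K k ==> P k (\<kappa> \<alpha>)"
    and "\<And>X i j w. X \<in> gr \<gg> i ==> w \<in> gr S j ==> P j w ==> P (i + j) (\<iota> X \<odot> w)"
    and "\<And>k x y. x \<in> gr S k ==> y \<in> gr S k ==> P k x ==> P k y ==> P k (x \<oplus>\<^bsub>S\<^esub> y)"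
  shows "P k x"
  using assms(1) unfolding gr_S_iff
  by (induction rule: hmg.induct) (auto intro: assms(2-) simp: gr_S_iff)

lemma gr_S_sum: "gr S 0 <+>\<^bsub>S\<^esub> gr S 1 = carrier S"
proof
  show "gr S 0 <+>\<^bsub>S\<^esub> gr S 1 \<subseteq> carrier S"
    unfolding set_add_def' using gr_S_closed by blast
  have "\<exists>y\<in>gr S 0. \<exists>z\<in>gr S 1. x = y \<oplus>\<^bsub>S\<^esub> z" if "x \<in> carrier S" for x using that
  proof (induction x rule: S_induct)
    case (scalar \<alpha>)
    then have "\<kappa> \<alpha> = \<kappa> (prt K 0 \<alpha>) \<oplus>\<^bsub>S\<^esub> \<kappa> (prt K 1 \<alpha>)" by (simp add: \<kappa>_add[symmetric] K.prt_sum)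
    with scalar show ?case by (blast intro: gr_S_kappa K.prt_gr)
  next
    case (mult X i w)
    then obtain y z where yz: "y \<in> gr S 0" "z \<in> gr S 1" "w = y \<oplus>\<^bsub>S\<^esub> z" by blast
    then have "\<iota> X \<odot> w = \<iota> X \<odot> y \<oplus>\<^bsub>S\<^esub> \<iota> X \<odot> z"
      using mult gr_S_closed by (auto simp: S.r_distr)
    moreover have "\<iota> X \<odot> y \<in> gr S i" "\<iota> X \<odot> z \<in> gr S (i + 1)"
      using gr_S_iota_mult[OF yz(1) mult(1)] gr_S_iota_mult[OF yz(2) mult(1)] by auto
    moreover have "\<iota> X \<odot> y \<oplus>\<^bsub>S\<^esub> \<iota> X \<odot> z = \<iota> X \<odot> z \<oplus>\<^bsub>S\<^esub> \<iota> X \<odot> y"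
      using mult yz gr_S_closed by (intro S.a_comm) auto
    ultimately show ?case by (cases i) auto
  next
    case (add x x')
    then obtain y z y' z' where yz: "y \<in> gr S 0" "z \<in> gr S 1" "x = y \<oplus>\<^bsub>S\<^esub> z"
      "y' \<in> gr S 0" "z' \<in> gr S 1" "x' = y' \<oplus>\<^bsub>S\<^esub> z'" by blast
    then have "x \<oplus>\<^bsub>S\<^esub> x' = (y \<oplus>\<^bsub>S\<^esub> y') \<oplus>\<^bsub>S\<^esub> (z \<oplus>\<^bsub>S\<^esub> z')" using gr_S_closed by (simp add: S.add_swap4)
    with yz show ?case by (blast intro: gr_S_add)
  qed
  then show "carrier S \<subseteq> gr S 0 <+>\<^bsub>S\<^esub> gr S 1" unfolding set_add_def' by blast
qed

text \<open>x is the product of x + x with the inverse of 2 in K.\<close>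

lemma S_two_torsion_free:
  assumes "x \<in> carrier S" "x \<oplus>\<^bsub>S\<^esub> x = \<zero>\<^bsub>S\<^esub>"
  shows "x = \<zero>\<^bsub>S\<^esub>"
proof -
  have u: "[(2::nat)] \<cdot>\<^bsub>K\<^esub> \<one>\<^bsub>K\<^esub> \<in> Units K" using rationals unfolding contains_rationals_def by auto
  have two: "[(2::nat)] \<cdot>\<^bsub>K\<^esub> \<one>\<^bsub>K\<^esub> = \<one>\<^bsub>K\<^esub> \<oplus>\<^bsub>K\<^esub> \<one>\<^bsub>K\<^esub>"
    by (simp add: numeral_2_eq_2 K.add.nat_pow_Suc)
  from u obtain v where v: "v \<in> carrier K" "(\<one>\<^bsub>K\<^esub> \<oplus>\<^bsub>K\<^esub> \<one>\<^bsub>K\<^esub>) \<star> v = \<one>\<^bsub>K\<^esub>"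
    unfolding two using K.Units_r_inv_ex by blast
  have "x = x \<odot> \<kappa> ((\<one>\<^bsub>K\<^esub> \<oplus>\<^bsub>K\<^esub> \<one>\<^bsub>K\<^esub>) \<star> v)" using assms v by simp
  also have "\<dots> = (x \<oplus>\<^bsub>S\<^esub> x) \<odot> \<kappa> v"
    using assms(1) v(1) by (simp add: \<kappa>_mult \<kappa>_add S.l_distr S.r_distr)
  finally show ?thesis using assms v by simp
qed

text \<open>The universal property is applied to scalars and generators twisted by their own parity.
  The resulting automorphism separates the two parts of the grading.\<close>

lemma S_parity_automorphism:
  obtains f where "f \<in> ring_hom S S" "\<And>i x. x \<in> gr S i ==> f x = neg_pow S i x"
proof -
  obtain f where f: "f \<in> ring_hom S S" "\<And>\<alpha>. \<alpha> \<in> carrier K ==> f (\<kappa> \<alpha>) = \<kappa> (twist K 1 \<alpha>)"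
    "\<And>X. X \<in> carrier \<gg> ==> f (\<iota> X) = \<iota> (twist \<gg> 1 X)"
  proof (rule S_universal[of S "\<lambda>\<alpha>. \<kappa> (twist K 1 \<alpha>)" "\<lambda>X. \<iota> (twist \<gg> 1 X)"])
    show "ring S" by (rule S.ring_axioms)
    show "\<kappa> (twist K 1 \<one>\<^bsub>K\<^esub>) = \<one>\<^sub>S" using K.gr_one by simp
    fix X \<alpha> assume X: "X \<in> carrier \<gg>" "\<alpha> \<in> carrier K"
    have "twist \<gg> 1 (X \<triangleleft> \<alpha>) = twist \<gg> 1 X \<triangleleft> twist K 1 \<alpha>" using X(2)
    proof (induction \<alpha> rule: K.gr_induct)
      case (gr i y)
      then show ?case using X(1) by (auto simp: twist_act act_neg_pow_right)
    next
      case (add y z)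
      then show ?case using X(1) by (simp add: act_add_right M.twist_add K.twist_add act_closed)
    qed
    with X show "\<iota> (twist \<gg> 1 (X \<triangleleft> \<alpha>)) = \<iota> (twist \<gg> 1 X) \<odot> \<kappa> (twist K 1 \<alpha>)"
      by (simp add: \<iota>_act_\<kappa>)
  next
    fix X \<alpha> i j assume X: "\<alpha> \<in> gr K i" "X \<in> gr \<gg> j"
    then have c: "\<alpha> \<in> carrier K" "X \<in> carrier \<gg>" "X \<triangleleft> \<alpha> \<in> gr \<gg> (j + i)" by (auto intro: act_gr)
    then have "twist \<gg> 1 (neg_pow \<gg> (i * j) (X \<triangleleft> \<alpha>)) = neg_pow \<gg> (i * j + (i + j)) (X \<triangleleft> \<alpha>)"
      by (simp add: M.twist_neg_pow ac_simps)
    with X c show "\<iota> (twist \<gg> 1 (neg_pow \<gg> (i * j) (X \<triangleleft> \<alpha>))) = \<kappa> (twist K 1 \<alpha>) \<odot> \<iota> (twist \<gg> 1 X)"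
      by (simp add: \<iota>_neg_pow \<kappa>_neg_pow S.neg_pow_mult \<iota>_act_\<kappa> \<kappa>_\<iota> act_closed ac_simps)
  next
    fix X Y i j assume X: "X \<in> gr \<gg> i" "Y \<in> gr \<gg> j"
    then show "\<iota> (twist \<gg> 1 X) \<odot> \<iota> (twist \<gg> 1 Y) = neg_pow S (i * j) (\<iota> (twist \<gg> 1 Y) \<odot> \<iota> (twist \<gg> 1 X))"
      by (intro \<iota>_comm) auto
  next
    fix X assume "X \<in> gr \<gg> 1"
    then show "\<iota> (twist \<gg> 1 X) \<odot> \<iota> (twist \<gg> 1 X) = \<zero>\<^bsub>S\<^esub>" by (intro \<iota>_odd_square) auto
  qed (auto simp: K.twist_mult_ring K.twist_add M.twist_add \<kappa>_add \<kappa>_mult \<iota>_add)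
  interpret f: ring_hom_ring S S f by (rule ring_hom_ringI2[OF S.ring_axioms S.ring_axioms f(1)])
  have "f x = neg_pow S i x" if "x \<in> gr S i" for i x
    using that
  proof (induction rule: gr_S_induct)
    case (scalar k \<alpha>)
    then show ?case by (auto simp: f(2) \<kappa>_neg_pow)
  next
    case (mult X i j w)
    then have "w \<in> carrier S" "X \<in> carrier \<gg>" using gr_S_closed by auto
    with mult show ?case by (simp add: f(3) S.neg_pow_mult \<iota>_neg_pow ac_simps)
  next
    case (add k x y)
    then show ?case using gr_S_closed by (simp add: S.neg_pow_add)
  qed
  with f(1) that show thesis by blast
qed

lemma S_graded: "graded_group S"
proof (intro graded_group.intro graded_group_axioms.intro S_ab)
  show "additive_subgroup (gr S i) S" for i by (rule gr_S_subgroup)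
  show "gr S 0 <+>\<^bsub>S\<^esub> gr S 1 = carrier S" by (rule gr_S_sum)
  obtain f where f: "f \<in> ring_hom S S" "\<And>i x. x \<in> gr S i ==> f x = neg_pow S i x"
    using S_parity_automorphism by blast
  \<comment> \<open>An element of both parts is fixed and negated by the parity automorphism, so its
    double vanishes.\<close>
  have "x = \<zero>\<^bsub>S\<^esub>" if x: "x \<in> gr S 0" "x \<in> gr S 1" for x
  proof (rule S_two_torsion_free)
    show c: "x \<in> carrier S" using x gr_S_closed by blast
    have "x = \<ominus>\<^bsub>S\<^esub> x" using f(2)[OF x(1)] f(2)[OF x(2)] by simp
    then have "x \<oplus>\<^bsub>S\<^esub> x = x \<oplus>\<^bsub>S\<^esub> \<ominus>\<^bsub>S\<^esub> x" by simp
    with c show "x \<oplus>\<^bsub>S\<^esub> x = \<zero>\<^bsub>S\<^esub>" by (simp add: S.r_neg)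
  qed
  then show "gr S 0 \<inter> gr S 1 = {\<zero>\<^bsub>S\<^esub>}" using additive_subgroup.zero_closed[OF gr_S_subgroup] by blast
qed

text \<open>The action on a quotient is defined as a union over all representatives. Each of them
  contributes the same coset, namely the product of x with the class of the letter of
  \<alpha>.\<close>

lemma S_act: assumes "x \<in> carrier S" "\<alpha> \<in> carrier K" shows "x \<bullet>\<^bsub>S\<^esub> \<alpha> = x \<odot> \<kappa> \<alpha>"
proof -
  have "x \<in> a_rcosets\<^bsub>TA\<^esub> J"
    using assms(1) by (simp only: S_simps FactRing_def partial_object.select_convs)
  then obtain t where t: "t \<in> carrier TA" "x = J +>\<^bsub>TA\<^esub> t"
    unfolding A_RCOSETS_def' by blast
  let ?a = "tensor_word K \<gg> [Inl \<alpha>]"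
  have act: "act TA y \<alpha> = y \<otimes>\<^bsub>TA\<^esub> ?a" for y by (simp add: tensor_algebra_def Let_def TA_simps)
  have ka: "\<kappa> \<alpha> = J +>\<^bsub>TA\<^esub> ?a" by (simp add: \<kappa>_def proj_def tensor_word_def)
  have "J +>\<^bsub>TA\<^esub> (y \<otimes>\<^bsub>TA\<^esub> ?a) = x \<odot> \<kappa> \<alpha>" if y: "y \<in> x" for y
  proof -
    from y t have "J +>\<^bsub>TA\<^esub> y = x" "y \<in> carrier TA"
      using J.a_repr_independence'[of y t] J.a_elemrcos_carrier[of t y] by auto
    then show ?thesis using assms(2) by (simp add: ka)
  qed
  moreover have "x \<noteq> {}" using t J.a_rcos_self by blast
  moreover have "act S x \<alpha> = (\<Union>y\<in>x. J +>\<^bsub>TA\<^esub> (act TA y \<alpha>))"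
    by (simp add: sym_algebra_def super_quot_def)
  ultimately show ?thesis by (simp add: act)
qed

lemma kappa_comm: "x \<in> gr S j ==> \<alpha> \<in> gr K i ==> \<kappa> \<alpha> \<odot> x = neg_pow S (i * j) (x \<odot> \<kappa> \<alpha>)"
proof (induction rule: gr_S_induct)
  case (scalar j \<beta>)
  then have "\<kappa> (\<alpha> \<star> \<beta>) = \<kappa> (neg_pow K (i * j) (\<beta> \<star> \<alpha>))" by (simp only: K.supercommutative[of \<alpha> i \<beta> j])
  with scalar show ?case by (simp add: \<kappa>_mult \<kappa>_neg_pow K.gr_closed)
next
  case (mult X l j w)
  then have w: "w \<in> carrier S" "X \<in> carrier \<gg>" "\<alpha> \<in> carrier K" using gr_S_closed by auto
  have "\<kappa> \<alpha> \<odot> (\<iota> X \<odot> w) = (\<kappa> \<alpha> \<odot> \<iota> X) \<odot> w" using w by (simp add: S.m_assoc)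
  also have "\<dots> = neg_pow S (i * l) (\<iota> X \<odot> (\<kappa> \<alpha> \<odot> w))"
    using w by (simp add: \<kappa>_\<iota>[OF mult(4,1)] S.neg_pow_mult S.m_assoc)
  also have "\<dots> = neg_pow S (i * (l + j)) ((\<iota> X \<odot> w) \<odot> \<kappa> \<alpha>)"
    using w mult by (simp add: S.neg_pow_mult S.m_assoc distrib_left)
  finally show ?case .
next
  case (add k x y)
  then have "x \<in> carrier S" "y \<in> carrier S" "\<alpha> \<in> carrier K" using gr_S_closed by auto
  with add show ?case by (simp add: S.r_distr S.l_distr S.neg_pow_add)
qed

lemma S_mult_gr: "x \<in> gr S i ==> y \<in> gr S j ==> x \<odot> y \<in> gr S (i + j)"
proof (induction rule: gr_S_induct)
  case (scalar k \<alpha>)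
  then show ?case using hmg_kappa[of j y \<alpha> k] by (simp add: gr_S_iff)
next
  case (mult X i k w)
  then have "\<iota> X \<odot> (w \<odot> y) \<in> gr S (i + (k + j))" by (intro gr_S_iota_mult)
  moreover have "w \<in> carrier S" "y \<in> carrier S" "X \<in> carrier \<gg>" using mult gr_S_closed by auto
  ultimately show ?case by (simp add: S.m_assoc add.assoc)
next
  case (add k x y')
  then show ?case using gr_S_closed by (simp add: S.l_distr gr_S_add)
qed

lemma S_superalgebra: "superalgebra K S"
proof -
  show ?thesis
  proof (intro superalgebra.intro graded_right_module.intro graded_right_module_axioms.intro superalgebra_axioms.intro
      K.commutative_superring_axioms S_graded S.ring_axioms)
    fix x y \<alpha> \<beta> assume "x \<in> carrier S" "\<alpha> \<in> carrier K"
    note c = this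
    show "x \<bullet>\<^bsub>S\<^esub> \<alpha> \<in> carrier S" using c by (simp add: S_act)
    show "y \<in> carrier S ==> (x \<oplus>\<^bsub>S\<^esub> y) \<bullet>\<^bsub>S\<^esub> \<alpha> = x \<bullet>\<^bsub>S\<^esub> \<alpha> \<oplus>\<^bsub>S\<^esub> y \<bullet>\<^bsub>S\<^esub> \<alpha>" using c by (simp add: S_act S.l_distr)
    show "\<beta> \<in> carrier K ==> x \<bullet>\<^bsub>S\<^esub> (\<alpha> \<oplus>\<^bsub>K\<^esub> \<beta>) = x \<bullet>\<^bsub>S\<^esub> \<alpha> \<oplus>\<^bsub>S\<^esub> x \<bullet>\<^bsub>S\<^esub> \<beta>"
      using c by (simp add: S_act \<kappa>_add S.r_distr)
    show "\<beta> \<in> carrier K ==> x \<bullet>\<^bsub>S\<^esub> (\<alpha> \<star> \<beta>) = x \<bullet>\<^bsub>S\<^esub> \<alpha> \<bullet>\<^bsub>S\<^esub> \<beta>"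
      using c by (simp add: S_act \<kappa>_mult S.m_assoc)
    show "y \<in> carrier S ==> x \<odot> (y \<bullet>\<^bsub>S\<^esub> \<alpha>) = (x \<odot> y) \<bullet>\<^bsub>S\<^esub> \<alpha>"
      using c by (simp add: S_act S.m_assoc)
  next
    fix x assume "x \<in> carrier S"
    then show "x \<bullet>\<^bsub>S\<^esub> \<one>\<^bsub>K\<^esub> = x" by (simp add: S_act)
  next
    fix x \<alpha> i j assume "x \<in> gr S i" "\<alpha> \<in> gr K j"
    then show "x \<bullet>\<^bsub>S\<^esub> \<alpha> \<in> gr S (i + j)" using gr_S_closed by (auto simp: S_act intro: S_mult_gr gr_S_kappa)
  next
    fix x y \<alpha> i j assume *: "x \<in> carrier S" "y \<in> gr S j" "\<alpha> \<in> gr K i"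
    then have c: "y \<in> carrier S" "\<alpha> \<in> carrier K" using gr_S_closed by auto
    then have "(x \<bullet>\<^bsub>S\<^esub> \<alpha>) \<odot> y = x \<odot> (\<kappa> \<alpha> \<odot> y)" using * by (simp add: S_act S.m_assoc)
    also have "\<dots> = neg_pow S (i * j) ((x \<odot> y) \<bullet>\<^bsub>S\<^esub> \<alpha>)"
      using * c by (simp add: kappa_comm S.neg_pow_mult S_act S.m_assoc)
    finally show "(x \<bullet>\<^bsub>S\<^esub> \<alpha>) \<odot> y = neg_pow S (i * j) ((x \<odot> y) \<bullet>\<^bsub>S\<^esub> \<alpha>)" .
  qed (use S_mult_gr gr_S_kappa[OF K.gr_one] in auto)
qed

section \<open>The coproduct\<close>

sublocale SA: superalgebra K S by (rule S_superalgebra)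
sublocale TT: superalgebra_tensor K S S by (intro superalgebra_tensor.intro S_superalgebra)

lemma sym_tensor_eq: "sym_tensor K \<gg> = TT.T"
  by (simp add: sym_tensor_def)

abbreviation "pur \<equiv> pure K S S"
abbreviation "TG \<equiv> TT.TG"
abbreviation Tmult (infixl \<open>\<bowtie>\<close> 70) where "x \<bowtie> y \<equiv> x \<otimes>\<^bsub>TT.T\<^esub> y"
abbreviation Tadd (infixl \<open>\<boxplus>\<close> 65) where "x \<boxplus> y \<equiv> x \<oplus>\<^bsub>TG\<^esub> y"

lemma one_gr_S: "\<one>\<^sub>S \<in> gr S 0" by (rule SA.one_gr)

lemma iota_gr: "X \<in> gr \<gg> i ==> \<iota> X \<in> gr S i"
  using gr_S_iota_mult[OF one_gr_S, of X i] by auto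

text \<open>The unit is even, so a homogeneous scalar crosses the tensor sign without a sign;
  additivity gives the general case.\<close>

lemma pur_scalar_one:
  assumes "x \<in> carrier S" "\<alpha> \<in> carrier K"
  shows "pur (x \<odot> \<kappa> \<alpha>) \<one>\<^sub>S = pur x (\<kappa> \<alpha>)"
proof (rule K.additive_maps_eqI[OF _ _ assms(2)])
  show "(\<lambda>\<alpha>. pur (x \<odot> \<kappa> \<alpha>) \<one>\<^sub>S) \<in> additive_maps K TG"
    by (rule additive_maps_comp[OF additive_maps_comp[OF \<kappa>_additive SA.mult_additive_right]
          balanced_left[OF TT.pure_balanced]]) (use assms in auto)
  show "(\<lambda>\<alpha>. pur x (\<kappa> \<alpha>)) \<in> additive_maps K TG"
    by (rule additive_maps_comp[OF \<kappa>_additive balanced_right[OF TT.pure_balanced]]) (use assms in auto)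
  fix i \<alpha> assume "\<alpha> \<in> gr K i"
  then show "pur (x \<odot> \<kappa> \<alpha>) \<one>\<^sub>S = pur x (\<kappa> \<alpha>)"
    using TT.pure_scalar[OF assms(1) one_gr_S, of \<alpha> i] assms by (simp add: S_act K.gr_closed)
qed

definition dX where "dX X = pur (\<iota> X) \<one>\<^sub>S \<boxplus> pur \<one>\<^sub>S (\<iota> X)"

lemma dX_closed [simp, intro]: "X \<in> carrier \<gg> ==> dX X \<in> carrier TG"
  unfolding dX_def by auto

interpretation TR: ring TT.T by (rule TT.T_ring)

text \<open>The summand with X in the second factor has to pass u, which twists u by the parity of
  X. All recursions for maps built from the coproduct start from this formula.\<close>

lemma dX_pure:
  assumes "X \<in> gr \<gg> i" "u \<in> carrier S" "v \<in> carrier S"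
  shows "dX X \<bowtie> pur u v = pur (\<iota> X \<odot> u) v \<boxplus> pur (twist S i u) (\<iota> X \<odot> v)"
proof -
  have X: "X \<in> carrier \<gg>" "\<iota> X \<in> gr S i" using assms iota_gr by auto
  have "pur (\<iota> X) \<one>\<^sub>S \<bowtie> pur u v = pur (\<iota> X \<odot> u) v"
    using assms X by (simp add: TT.T_mult_pure TT.q_def SA.M.prt_homogeneous[OF one_gr_S])
  moreover have "pur \<one>\<^sub>S (\<iota> X) \<bowtie> pur u v = pur (twist S i u) (\<iota> X \<odot> v)"
    using assms X by (cases i) (simp_all add: TT.T_mult_pure TT.q_def SA.M.prt_homogeneous[OF X(2)])
  ultimately show ?thesis using assms X
    by (simp add: dX_def additive_maps_add[OF TT.T_mult_additive_left])
qed

text \<open>\<open>S_universal\<close> with scalars sent to the second factor and generators to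
  \<open>dX\<close>. In the product of \<open>dX X\<close> and \<open>dX Y\<close> the mixed terms
  are, up to sign, X \<otimes> Y and Y \<otimes> X, which trade places when X and Y do; for X = Y
  odd they cancel.\<close>

lemma ex_coproduct:
  obtains D where "superalgebra_morphism K S TT.T D" "D \<in> extensional (carrier S)"
    "\<And>X. X \<in> carrier \<gg> ==> D (\<iota> X) = dX X"
proof -
  have ng: "neg_pow TT.T = neg_pow TG" by (simp add: TT.T_TG)
  obtain f where f: "f \<in> ring_hom S TT.T" "\<And>\<alpha>. \<alpha> \<in> carrier K ==> f (\<kappa> \<alpha>) = pur \<one>\<^sub>S (\<kappa> \<alpha>)"
    "\<And>X. X \<in> carrier \<gg> ==> f (\<iota> X) = dX X"
  proof (rule S_universal[of TT.T "\<lambda>\<alpha>. pur \<one>\<^sub>S (\<kappa> \<alpha>)" dX])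
    show "ring TT.T" by (rule TT.T_ring)
    show "pur \<one>\<^sub>S (\<kappa> \<one>\<^bsub>K\<^esub>) = \<one>\<^bsub>TT.T\<^esub>" by (simp add: TT.T_one)
    fix \<alpha> \<beta> assume ab: "\<alpha> \<in> carrier K" "\<beta> \<in> carrier K"
    then show "pur \<one>\<^sub>S (\<kappa> (\<alpha> \<oplus>\<^bsub>K\<^esub> \<beta>)) = pur \<one>\<^sub>S (\<kappa> \<alpha>) \<oplus>\<^bsub>TT.T\<^esub> pur \<one>\<^sub>S (\<kappa> \<beta>)"
      by (simp add: \<kappa>_add TT.pure_add_right)
    show "pur \<one>\<^sub>S (\<kappa> (\<alpha> \<star> \<beta>)) = pur \<one>\<^sub>S (\<kappa> \<alpha>) \<bowtie> pur \<one>\<^sub>S (\<kappa> \<beta>)"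
    proof -
      have "\<kappa> \<alpha> \<odot> \<kappa> \<beta> = (prt S 0 (\<kappa> \<alpha>) \<oplus>\<^bsub>S\<^esub> prt S 1 (\<kappa> \<alpha>)) \<odot> \<kappa> \<beta>"
        using ab by (simp add: SA.M.prt_sum)
      also have "\<dots> = prt S 0 (\<kappa> \<alpha>) \<odot> \<kappa> \<beta> \<oplus>\<^bsub>S\<^esub> prt S 1 (\<kappa> \<alpha>) \<odot> \<kappa> \<beta>"
        using ab by (simp add: S.l_distr)
      finally show ?thesis
        using ab by (simp add: TT.T_mult_pure TT.q_def \<kappa>_mult SA.M.twist_gr[OF one_gr_S] TT.pure_add_right)
    qed
  next
    fix X Y assume XY: "X \<in> carrier \<gg>" "Y \<in> carrier \<gg>"
    then show "dX (X \<oplus>\<^bsub>\<gg>\<^esub> Y) = dX X \<oplus>\<^bsub>TT.T\<^esub> dX Y"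
      by (simp add: dX_def \<iota>_add TT.pure_add_left TT.pure_add_right TT.TG.add_swap4)
  next
    fix X \<alpha> assume X: "X \<in> carrier \<gg>" "\<alpha> \<in> carrier K"
    have "pur (\<iota> X) \<one>\<^sub>S \<bowtie> pur \<one>\<^sub>S (\<kappa> \<alpha>) = pur (\<iota> X) (\<kappa> \<alpha>)"
      using X by (simp add: TT.T_mult_pure_gr[OF _ one_gr_S one_gr_S])
    moreover have "pur \<one>\<^sub>S (\<iota> X) \<bowtie> pur \<one>\<^sub>S (\<kappa> \<alpha>) = pur \<one>\<^sub>S (\<iota> X \<odot> \<kappa> \<alpha>)"
      using X TT.T_act_mult_one[of "pur \<one>\<^sub>S (\<iota> X)" \<alpha>]
      by (simp add: S_act TT.T_act tensor_product.tensor_lift_pure[OF TT.tensor_product_axioms TT.TG_abelian TT.act_balanced])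
    ultimately show "dX (X \<triangleleft> \<alpha>) = dX X \<bowtie> pur \<one>\<^sub>S (\<kappa> \<alpha>)"
      using X by (simp add: dX_def additive_maps_add[OF TT.T_mult_additive_left] \<iota>_act_\<kappa> pur_scalar_one)
  next
    fix X \<alpha> i j assume X: "\<alpha> \<in> gr K i" "X \<in> gr \<gg> j"
    then have c: "\<alpha> \<in> carrier K" "X \<in> carrier \<gg>" "\<kappa> \<alpha> \<in> gr S i" "\<iota> X \<in> gr S j" by (auto intro: gr_S_kappa iota_gr)
    have "pur \<one>\<^sub>S (\<kappa> \<alpha>) \<bowtie> pur (\<iota> X) \<one>\<^sub>S = neg_pow TG (i * j) (pur (\<iota> X) (\<kappa> \<alpha>))"
      using c by (simp add: TT.T_mult_pure_gr[OF _ c(3,4)])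
    moreover have "pur \<one>\<^sub>S (\<kappa> \<alpha>) \<bowtie> pur \<one>\<^sub>S (\<iota> X) = neg_pow TG (i * j) (pur \<one>\<^sub>S (\<iota> X \<odot> \<kappa> \<alpha>))"
      using c X by (simp add: TT.T_mult_pure_gr[OF _ c(3) one_gr_S] \<kappa>_\<iota> TT.pure_neg_pow_right)
    ultimately have r: "pur \<one>\<^sub>S (\<kappa> \<alpha>) \<bowtie> dX X =
        neg_pow TG (i * j) (pur (\<iota> X) (\<kappa> \<alpha>)) \<boxplus> neg_pow TG (i * j) (pur \<one>\<^sub>S (\<iota> X \<odot> \<kappa> \<alpha>))"
      using c by (simp add: dX_def additive_maps_add[OF TT.T_mult_additive_right])
    have "dX (neg_pow \<gg> (i * j) (X \<triangleleft> \<alpha>)) = pur (neg_pow S (i * j) (\<iota> X \<odot> \<kappa> \<alpha>)) \<one>\<^sub>S \<boxplus>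
        pur \<one>\<^sub>S (neg_pow S (i * j) (\<iota> X \<odot> \<kappa> \<alpha>))"
      using c by (simp add: dX_def \<iota>_neg_pow \<iota>_act_\<kappa> act_closed)
    then show "dX (neg_pow \<gg> (i * j) (X \<triangleleft> \<alpha>)) = pur \<one>\<^sub>S (\<kappa> \<alpha>) \<bowtie> dX X"
      using c r by (simp add: TT.pure_neg_pow_left TT.pure_neg_pow_right pur_scalar_one)
  next
    fix X Y i j assume X: "X \<in> gr \<gg> i" "Y \<in> gr \<gg> j"
    then have c: "X \<in> carrier \<gg>" "Y \<in> carrier \<gg>" "\<iota> X \<in> gr S i" "\<iota> Y \<in> gr S j" by (auto intro: iota_gr)
    have e: "dX X \<bowtie> dX Y = (pur (\<iota> X \<odot> \<iota> Y) \<one>\<^sub>S \<boxplus> neg_pow TG (i * j) (pur (\<iota> Y) (\<iota> X))) \<boxplus>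
        (pur (\<iota> X) (\<iota> Y) \<boxplus> pur \<one>\<^sub>S (\<iota> X \<odot> \<iota> Y))"
      if "X \<in> gr \<gg> i" "Y \<in> gr \<gg> j" "X \<in> carrier \<gg>" "Y \<in> carrier \<gg>" "\<iota> X \<in> gr S i" "\<iota> Y \<in> gr S j" for X Y i j
      using that one_gr_S unfolding dX_def[of Y]
      by (simp add: additive_maps_add[OF TT.T_mult_additive_right] dX_pure TT.pure_neg_pow_left)
    have "neg_pow TG (i * j) (dX Y \<bowtie> dX X) = (pur (\<iota> X \<odot> \<iota> Y) \<one>\<^sub>S \<boxplus> pur (\<iota> X) (\<iota> Y)) \<boxplus>
        (neg_pow TG (i * j) (pur (\<iota> Y) (\<iota> X)) \<boxplus> pur \<one>\<^sub>S (\<iota> X \<odot> \<iota> Y))"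
      using c unfolding e[OF X(2,1) c(2,1,4,3)] \<iota>_comm[OF X]
      by (simp add: TT.TG.neg_pow_add TT.pure_neg_pow_left TT.pure_neg_pow_right mult.commute[of j i])
    then show "dX X \<bowtie> dX Y = neg_pow TT.T (i * j) (dX Y \<bowtie> dX X)"
      unfolding ng e[OF X c] using c by (simp add: TT.TG.add_swap4)
  next
    fix X assume X: "X \<in> gr \<gg> 1"
    then have c: "X \<in> carrier \<gg>" "\<iota> X \<in> gr S 1" by (auto intro: iota_gr)
    have "dX X \<bowtie> dX X = (pur (\<iota> X \<odot> \<iota> X) \<one>\<^sub>S \<boxplus> neg_pow TG 1 (pur (\<iota> X) (\<iota> X))) \<boxplus>
        (pur (\<iota> X) (\<iota> X) \<boxplus> pur \<one>\<^sub>S (\<iota> X \<odot> \<iota> X))"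
      using c X one_gr_S unfolding dX_def[of X, THEN arg_cong[where f = "\<lambda>y. dX X \<bowtie> y"]]
      using TT.pure_neg_pow_left[of "\<iota> X" "\<iota> X" 1]
      by (simp add: additive_maps_add[OF TT.T_mult_additive_right] dX_pure)
    then show "dX X \<bowtie> dX X = \<zero>\<^bsub>TT.T\<^esub>"
      using c X by (simp add: \<iota>_odd_square TT.TG.l_neg)
  qed (auto simp: TT.T_simps)
  interpret f: ring_hom_ring S TT.T f by (rule ring_hom_ringI2[OF S.ring_axioms TT.T_ring f(1)])
  let ?D = "restrict f (carrier S)"
  have gr: "f x \<in> gr TT.T i" if "x \<in> gr S i" for x i
    using that
  proof (induction rule: gr_S_induct)
    case (scalar k \<alpha>)
    then show ?case using TT.T_gr_pure[OF one_gr_S gr_S_kappa[OF scalar]] by (auto simp: f(2))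
  next
    case (mult X i j w)
    then have "dX X \<in> gr TT.T i"
      using TT.T_gr_pure[OF iota_gr[OF mult(1)] one_gr_S] TT.T_gr_pure[OF one_gr_S iota_gr[OF mult(1)]]
      unfolding dX_def by (auto intro!: additive_subgroup.a_closed[OF TT.T_gr_subgroup])
    with mult have "dX X \<bowtie> f w \<in> gr TT.T (i + j)" by (intro TT.T_gr_mult)
    then show ?case using mult gr_S_closed f.hom_mult[of "\<iota> X" w] f(3)[of X] by auto
  next
    case (add k x y)
    then show ?case using gr_S_closed f.hom_add[of x y]
      by (auto simp: TT.T_simps intro!: additive_subgroup.a_closed[OF TT.T_gr_subgroup])
  qed
  have "superalgebra_morphism K S TT.T ?D"
    unfolding superalgebra_morphism_def
  proof (intro conjI allI)
    show "?D \<in> linear_maps K S TT.T"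
    proof -
      have "f (x \<bullet>\<^bsub>S\<^esub> \<alpha>) = f x \<bullet>\<^bsub>TT.T\<^esub> \<alpha>" if "x \<in> carrier S" "\<alpha> \<in> carrier K" for x \<alpha>
      proof -
        have "f (x \<bullet>\<^bsub>S\<^esub> \<alpha>) = f x \<bowtie> pur \<one>\<^sub>S (\<kappa> \<alpha>)"
          using that f.hom_mult[of x "\<kappa> \<alpha>"] by (simp add: S_act f(2))
        also have "\<dots> = f x \<bullet>\<^bsub>TT.T\<^esub> \<alpha>"
          using TT.T_act_mult_one[of "f x" \<alpha>] that f.hom_closed[of x] by (simp add: S_act)
        finally show ?thesis .
      qed
      then show ?thesis
        using f.hom_closed f.hom_add by (auto simp: linear_maps_def SA.act_closed)
    qed
    show "?D ` gr S i \<subseteq> gr TT.T i" for i using gr gr_S_closed by auto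
    show "?D \<in> ring_hom S TT.T" using f(1) by (simp add: ring_hom_def Pi_iff)
  qed
  moreover have "?D \<in> extensional (carrier S)" by auto
  ultimately show thesis by (rule that) (use f in auto)
qed

text \<open>A candidate is determined on scalars by linearity and its value at 1, and on products by
  multiplicativity. So the description by \<open>THE\<close> has exactly one solution.\<close>

lemma coproduct_props:
  shows coproduct_morphism: "superalgebra_morphism K S TT.T (coproduct K \<gg>)"
    and coproduct_iota: "X \<in> carrier \<gg> ==> coproduct K \<gg> (\<iota> X) = dX X"
proof -
  let ?P = "\<lambda>D. superalgebra_morphism K S TT.T D \<and> D \<in> extensional (carrier S) \<and>
    (\<forall>X\<in>carrier \<gg>. D (\<iota> X) = dX X)"
  have e: "coproduct K \<gg> = (THE D. ?P D)"
    by (simp add: coproduct_def Let_def sym_tensor_eq dX_def TT.T_simps)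
  obtain D where D: "?P D" using ex_coproduct by metis
  have "D' = D" if D': "?P D'" for D'
  proof (rule extensionalityI[of _ "carrier S"])
    fix x assume "x \<in> carrier S"
    then show "D' x = D x"
    proof (induction x rule: S_induct)
      case (scalar \<alpha>)
      have "E (\<one>\<^sub>S \<bullet>\<^bsub>S\<^esub> \<alpha>) = \<one>\<^bsub>TT.T\<^esub> \<bullet>\<^bsub>TT.T\<^esub> \<alpha>" if "?P E" for E
        using that scalar by (auto simp: superalgebra_morphism_def linear_maps_def ring_hom_def)
      from this[OF D] this[OF D'] show ?case using scalar by (simp add: S_act)
    next
      case (mult X i w)
      then have X: "X \<in> carrier \<gg>" by auto
      have "E (\<iota> X \<odot> w) = dX X \<bowtie> E w" if "?P E" for E
        using that mult X by (auto simp: superalgebra_morphism_def ring_hom_def)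
      from this[OF D] this[OF D'] show ?case using mult by simp
    next
      case (add x y)
      have "E (x \<oplus>\<^bsub>S\<^esub> y) = E x \<oplus>\<^bsub>TT.T\<^esub> E y" if "?P E" for E
        using that add by (auto simp: superalgebra_morphism_def ring_hom_def)
      from this[OF D] this[OF D'] show ?case using add by simp
    qed
  qed (use D D' in auto)
  then have "?P (coproduct K \<gg>)" unfolding e by (rule theI[where P = ?P, OF D])
  then show "superalgebra_morphism K S TT.T (coproduct K \<gg>)"
    "X \<in> carrier \<gg> ==> coproduct K \<gg> (\<iota> X) = dX X" by auto
qed

abbreviation "\<Delta> \<equiv> coproduct K \<gg>"

lemma \<Delta>_ring_hom: "\<Delta> \<in> ring_hom S TT.T" and \<Delta>_linear: "\<Delta> \<in> linear_maps K S TT.T"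
  and \<Delta>_gr: "x \<in> gr S i ==> \<Delta> x \<in> gr TT.T i"
  using coproduct_morphism by (auto simp: superalgebra_morphism_def)

lemma \<Delta>_additive: "\<Delta> \<in> additive_maps S TG"
  using \<Delta>_ring_hom by (auto simp: ring_hom_def additive_maps_def TT.T_simps)

lemma \<Delta>_closed [simp, intro]: "x \<in> carrier S ==> \<Delta> x \<in> carrier TG"
  by (rule additive_maps_closed[OF \<Delta>_additive])

lemma \<Delta>_one [simp]: "\<Delta> \<one>\<^sub>S = pur \<one>\<^sub>S \<one>\<^sub>S"
  using \<Delta>_ring_hom by (simp add: ring_hom_def TT.T_one)

lemma \<Delta>_scalar: "x \<in> carrier S ==> \<alpha> \<in> carrier K ==> \<Delta> (x \<odot> \<kappa> \<alpha>) = \<Delta> x \<bullet>\<^bsub>TT.T\<^esub> \<alpha>"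
  using \<Delta>_linear by (auto simp: linear_maps_def S_act)

lemma \<Delta>_mult: "X \<in> carrier \<gg> ==> w \<in> carrier S ==> \<Delta> (\<iota> X \<odot> w) = dX X \<bowtie> \<Delta> w"
  using \<Delta>_ring_hom coproduct_iota by (auto simp: ring_hom_def)

text \<open>The shifted map is the lift of f composed with the scalar action on pure tensors; its
  balancedness is inherited from this composition, without a new sign computation.\<close>

lemma act_tensor_lift:
  assumes P: "abelian_group P" and f: "f \<in> balanced K S S P" and y: "y \<in> carrier TG" and \<alpha>: "\<alpha> \<in> carrier K"
  shows "tensor_lift P f (y \<bullet>\<^bsub>TT.T\<^esub> \<alpha>) = tensor_lift P (\<lambda>u v. f u (v \<odot> \<kappa> \<alpha>)) y"
    and "(\<lambda>u v. f u (v \<odot> \<kappa> \<alpha>)) \<in> balanced K S S P"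
proof -
  let ?g = "\<lambda>u v. f u (v \<odot> \<kappa> \<alpha>)"
  have act: "\<And>y. y \<bullet>\<^bsub>TT.T\<^esub> \<alpha> = tensor_lift TG (\<lambda>m n. pur m (n \<bullet>\<^bsub>S\<^esub> \<alpha>)) y" by (simp add: TT.T_act)
  have actad: "(\<lambda>y. y \<bullet>\<^bsub>TT.T\<^esub> \<alpha>) \<in> additive_maps TG TG"
    unfolding act by (rule TT.tensor_lift_additive[OF TT.TG_abelian TT.act_balanced[OF \<alpha>]])
  have pm: "tensor_lift P f (pur m n \<bullet>\<^bsub>TT.T\<^esub> \<alpha>) = ?g m n" if "m \<in> carrier S" "n \<in> carrier S" for m n
    using that \<alpha> unfolding act
    by (simp add: TT.tensor_lift_pure[OF TT.TG_abelian TT.act_balanced] SA.act_closed TT.tensor_lift_pure[OF P f])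
      (simp add: S_act)
  have b: "(\<lambda>m n. tensor_lift P f (pur m n \<bullet>\<^bsub>TT.T\<^esub> \<alpha>)) \<in> balanced K S S P"
    by (rule balanced_comp[OF TT.pure_balanced additive_maps_comp[OF actad TT.tensor_lift_additive[OF P f]]
          TT.TG_abelian P SA.graded_right_module_axioms])
  show gb: "?g \<in> balanced K S S P"
    using b pm by (rule TT.balanced_cong)
  show "tensor_lift P f (y \<bullet>\<^bsub>TT.T\<^esub> \<alpha>) = tensor_lift P ?g y"
    by (rule TT.TG_additive_eqI[OF y additive_maps_comp[OF actad TT.tensor_lift_additive[OF P f]]
          TT.tensor_lift_additive[OF P gb]])
      (simp add: pm gr_S_closed TT.tensor_lift_pure[OF P gb])
qed

text \<open>Since Delta(X w) is \<open>dX X\<close> times Delta(w), a lift evaluated at Delta(X w)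
  splits into two lifts evaluated at Delta(w): X joins the first or the second tensor factor. This
  is the common source of the recursions for bracket and coderivation.\<close>

lemma dX_tensor_lift:
  assumes P: "abelian_group P" and f: "f \<in> balanced K S S P" and y: "y \<in> carrier TG" and X: "X \<in> gr \<gg> i"
  shows "(\<lambda>u v. f (\<iota> X \<odot> u) v) \<in> balanced K S S P"
    and "(\<lambda>u v. f (twist S i u) (\<iota> X \<odot> v)) \<in> balanced K S S P"
    and "tensor_lift P f (dX X \<bowtie> y) = tensor_lift P (\<lambda>u v. f (\<iota> X \<odot> u) v) y \<oplus>\<^bsub>P\<^esub>
      tensor_lift P (\<lambda>u v. f (twist S i u) (\<iota> X \<odot> v)) y"
proof -
  have Xc: "X \<in> carrier \<gg>" using X by auto
  show b1: "(\<lambda>u v. f (\<iota> X \<odot> u) v) \<in> balanced K S S P"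
  proof (rule balancedI)
    show "f (\<iota> X \<odot> m) \<in> additive_maps S P" if "m \<in> carrier S" for m
      using that Xc by (intro balanced_right[OF f]) auto
    show "(\<lambda>m. f (\<iota> X \<odot> m) n) \<in> additive_maps S P" if "n \<in> carrier S" for n
      using that Xc by (intro additive_maps_comp[OF SA.mult_additive_right balanced_left[OF f]]) auto
    fix m n j \<alpha> k assume *: "m \<in> carrier S" "n \<in> gr S j" "\<alpha> \<in> gr K k"
    then show "f (\<iota> X \<odot> (m \<bullet>\<^bsub>S\<^esub> \<alpha>)) n = neg_pow P (k * j) (f (\<iota> X \<odot> m) (n \<bullet>\<^bsub>S\<^esub> \<alpha>))"
      using balanced_scalar[OF f _ *(2,3), of "\<iota> X \<odot> m"] Xc by (auto simp: SA.mult_act)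
  qed
  show b2: "(\<lambda>u v. f (twist S i u) (\<iota> X \<odot> v)) \<in> balanced K S S P"
  proof (rule balancedI)
    interpret P: abelian_group P by (rule P)
    show "(\<lambda>n. f (twist S i m) (\<iota> X \<odot> n)) \<in> additive_maps S P" if "m \<in> carrier S" for m
      using that Xc by (intro additive_maps_comp[OF SA.mult_additive_right balanced_right[OF f]]) auto
    show "(\<lambda>m. f (twist S i m) (\<iota> X \<odot> n)) \<in> additive_maps S P" if "n \<in> carrier S" for n
      using that Xc by (intro additive_maps_comp[OF SA.M.twist_additive balanced_left[OF f]]) auto
    fix m n j \<alpha> k assume *: "m \<in> carrier S" "n \<in> gr S j" "\<alpha> \<in> gr K k"
    then have c: "n \<in> carrier S" "\<alpha> \<in> carrier K" using gr_S_closed by auto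
    have Xn: "\<iota> X \<odot> n \<in> gr S (i + j)" using * X by (intro gr_S_iota_mult)
    have "f (twist S i (m \<bullet>\<^bsub>S\<^esub> \<alpha>)) (\<iota> X \<odot> n) = neg_pow P (i * k) (f (twist S i m \<bullet>\<^bsub>S\<^esub> \<alpha>) (\<iota> X \<odot> n))"
      using * c Xc by (simp add: SA.twist_act additive_maps_neg_pow[OF balanced_left[OF f] S_ab P] SA.act_closed)
    also have "\<dots> = neg_pow P (i * k + k * (i + j)) (f (twist S i m) ((\<iota> X \<odot> n) \<bullet>\<^bsub>S\<^esub> \<alpha>))"
      using * c Xc balanced_closed[OF f] by (simp add: balanced_scalar[OF f _ Xn *(3)] SA.act_closed)
    also have "\<dots> = neg_pow P (k * j) (f (twist S i m) (\<iota> X \<odot> (n \<bullet>\<^bsub>S\<^esub> \<alpha>)))"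
      using * c Xc by (simp add: SA.mult_act distrib_left mult.commute[of k i])
    finally show "f (twist S i (m \<bullet>\<^bsub>S\<^esub> \<alpha>)) (\<iota> X \<odot> n) =
        neg_pow P (k * j) (f (twist S i m) (\<iota> X \<odot> (n \<bullet>\<^bsub>S\<^esub> \<alpha>)))" .
  qed
  show "tensor_lift P f (dX X \<bowtie> y) = tensor_lift P (\<lambda>u v. f (\<iota> X \<odot> u) v) y \<oplus>\<^bsub>P\<^esub>
      tensor_lift P (\<lambda>u v. f (twist S i u) (\<iota> X \<odot> v)) y"
  proof (rule TT.TG_additive_eqI[OF y])
    show "(\<lambda>y. tensor_lift P f (dX X \<bowtie> y)) \<in> additive_maps TG P"
      using Xc by (intro additive_maps_comp[OF TT.T_mult_additive_right TT.tensor_lift_additive[OF P f]]) auto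
    show "(\<lambda>y. tensor_lift P (\<lambda>u v. f (\<iota> X \<odot> u) v) y \<oplus>\<^bsub>P\<^esub>
      tensor_lift P (\<lambda>u v. f (twist S i u) (\<iota> X \<odot> v)) y) \<in> additive_maps TG P"
      by (intro additive_maps_sum P TT.tensor_lift_additive b1 b2)
    fix l m j n assume "m \<in> gr S l" "n \<in> gr S j"
    then have mn: "m \<in> carrier S" "n \<in> carrier S" using gr_S_closed by auto
    then show "tensor_lift P f (dX X \<bowtie> pur m n) = tensor_lift P (\<lambda>u v. f (\<iota> X \<odot> u) v) (pur m n) \<oplus>\<^bsub>P\<^esub>
      tensor_lift P (\<lambda>u v. f (twist S i u) (\<iota> X \<odot> v)) (pur m n)"
      using Xc by (simp add: dX_pure[OF X] TT.tensor_lift_pure[OF P b1] TT.tensor_lift_pure[OF P b2]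
          additive_maps_add[OF TT.tensor_lift_additive[OF P f]] TT.tensor_lift_pure[OF P f])
  qed
qed

end

section \<open>Groups of linear maps\<close>

context tensor_product
begin

abbreviation "HM \<equiv> Hom K M N"

lemma Hom_simps:
  "carrier HM = linear_maps K M N \<inter> extensional (carrier M)" "\<zero>\<^bsub>HM\<^esub> = (\<lambda>x\<in>carrier M. \<zero>\<^bsub>N\<^esub>)"
  "F \<oplus>\<^bsub>HM\<^esub> G = (\<lambda>x\<in>carrier M. F x \<oplus>\<^bsub>N\<^esub> G x)" "F \<bullet>\<^bsub>HM\<^esub> \<alpha> = (\<lambda>x\<in>carrier M. F (lact K M \<alpha> x))"
  "gr HM i = {F \<in> carrier HM. \<forall>j. F ` gr M j \<subseteq> gr N (i + j)}"
  by (simp_all add: Hom_def)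

lemma HomI:
  assumes "\<And>x. x \<in> carrier M ==> f x \<in> carrier N"
    "\<And>x y. x \<in> carrier M ==> y \<in> carrier M ==> f (x \<oplus>\<^bsub>M\<^esub> y) = f x \<oplus>\<^bsub>N\<^esub> f y"
    "\<And>x \<alpha>. x \<in> carrier M ==> \<alpha> \<in> carrier K ==> f (x \<bullet>\<^bsub>M\<^esub> \<alpha>) = f x \<bullet>\<^bsub>N\<^esub> \<alpha>"
  shows "restrict f (carrier M) \<in> carrier HM"
  using assms by (auto simp: Hom_simps linear_maps_def M.act_closed)

lemma Hom_closed: "F \<in> carrier HM ==> x \<in> carrier M ==> F x \<in> carrier N"
  and Hom_additive: "F \<in> carrier HM ==> F \<in> additive_maps M N"
  and Hom_act: "F \<in> carrier HM ==> x \<in> carrier M ==> \<alpha> \<in> carrier K ==> F (x \<bullet>\<^bsub>M\<^esub> \<alpha>) = F x \<bullet>\<^bsub>N\<^esub> \<alpha>"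
  and Hom_extensional: "F \<in> carrier HM ==> F \<in> extensional (carrier M)"
  by (auto simp: Hom_simps linear_maps_def additive_maps_def)

lemma Hom_eqI:
  "F \<in> carrier HM ==> G \<in> carrier HM ==> (\<And>x. x \<in> carrier M ==> F x = G x) ==> F = G"
  using Hom_extensional extensionalityI by metis

lemma Hom_grI:
  "restrict f (carrier M) \<in> carrier HM ==> (\<And>j x. x \<in> gr M j ==> f x \<in> gr N (i + j)) ==> restrict f (carrier M) \<in> gr HM i"
  by (auto simp: Hom_simps(5))

lemma Hom_gr: "F \<in> gr HM i ==> x \<in> gr M j ==> F x \<in> gr N (i + j)"
  and Hom_gr_closed: "F \<in> gr HM i ==> F \<in> carrier HM"
  by (auto simp: Hom_simps(5))

lemma Hom_sum_closed: "F \<in> carrier HM ==> G \<in> carrier HM ==> F \<oplus>\<^bsub>HM\<^esub> G \<in> carrier HM"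
  unfolding Hom_simps(3)
  by (rule HomI) (auto simp: Hom_closed additive_maps_add[OF Hom_additive] Hom_act N.M.add_swap4 N.act_add_left)

lemma Hom_uminus_closed: "F \<in> carrier HM ==> (\<lambda>x\<in>carrier M. \<ominus>\<^bsub>N\<^esub> F x) \<in> carrier HM"
  by (rule HomI) (auto simp: Hom_closed additive_maps_add[OF Hom_additive] Hom_act N.M.minus_add
      additive_maps_a_inv[OF N.act_additive N.M_ab N.M_ab])

lemma Hom_abelian: "abelian_group HM"
proof (rule abelian_groupI)
  show "\<zero>\<^bsub>HM\<^esub> \<in> carrier HM" unfolding Hom_simps(2) by (rule HomI) auto
next
  fix F G P assume FG: "F \<in> carrier HM" "G \<in> carrier HM" "P \<in> carrier HM"
  show "F \<oplus>\<^bsub>HM\<^esub> G \<oplus>\<^bsub>HM\<^esub> P = F \<oplus>\<^bsub>HM\<^esub> (G \<oplus>\<^bsub>HM\<^esub> P)"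
    using FG by (auto simp: Hom_simps(3) Hom_closed N.M.a_assoc intro!: restrict_ext)
next
  fix F assume F: "F \<in> carrier HM"
  then show "\<exists>G\<in>carrier HM. G \<oplus>\<^bsub>HM\<^esub> F = \<zero>\<^bsub>HM\<^esub>"
    by (intro bexI[OF _ Hom_uminus_closed[OF F]]) (auto simp: Hom_simps(2,3) Hom_closed N.M.l_neg intro!: restrict_ext)
  have "\<zero>\<^bsub>HM\<^esub> \<oplus>\<^bsub>HM\<^esub> F = restrict F (carrier M)"
    using F by (auto simp: Hom_simps(2,3) Hom_closed intro!: restrict_ext)
  then show "\<zero>\<^bsub>HM\<^esub> \<oplus>\<^bsub>HM\<^esub> F = F" using Hom_extensional[OF F] by (simp add: extensional_restrict)
qed (auto simp: Hom_sum_closed, auto simp: Hom_simps(3) Hom_closed N.M.a_comm intro!: restrict_ext)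

lemma Hom_a_inv: assumes "F \<in> carrier HM" shows "\<ominus>\<^bsub>HM\<^esub> F = (\<lambda>x\<in>carrier M. \<ominus>\<^bsub>N\<^esub> F x)"
proof (rule abelian_group.minus_equality[OF Hom_abelian _ assms Hom_uminus_closed[OF assms]])
  show "(\<lambda>x\<in>carrier M. \<ominus>\<^bsub>N\<^esub> F x) \<oplus>\<^bsub>HM\<^esub> F = \<zero>\<^bsub>HM\<^esub>"
    using assms by (auto simp: Hom_simps(2,3) Hom_closed N.M.l_neg intro!: restrict_ext)
qed

lemma Hom_neg_pow_apply: "F \<in> carrier HM ==> x \<in> carrier M ==> neg_pow HM e F x = neg_pow N e (F x)"
  by (cases e) (simp_all add: Hom_a_inv)

lemma Hom_zero_gr: "\<zero>\<^bsub>HM\<^esub> \<in> gr HM i"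
  unfolding Hom_simps(2) by (rule Hom_grI) (auto intro!: HomI)

lemma Hom_gr_subgroup: "additive_subgroup (gr HM i) HM"
proof (rule additive_subgroupI, rule abelian_group.a_group[OF Hom_abelian, THEN group.subgroupI])
  show "gr HM i \<subseteq> carrier (add_monoid HM)" using Hom_gr_closed by auto
  show "gr HM i \<noteq> {}" using Hom_zero_gr by blast
  fix F G assume F: "F \<in> gr HM i" and G: "G \<in> gr HM i"
  show "inv\<^bsub>add_monoid HM\<^esub> F \<in> gr HM i"
    unfolding a_inv_def[symmetric] Hom_a_inv[OF Hom_gr_closed[OF F]]
    by (rule Hom_grI[OF Hom_uminus_closed[OF Hom_gr_closed[OF F]]]) (use Hom_gr[OF F] in auto)
  show "F \<otimes>\<^bsub>add_monoid HM\<^esub> G \<in> gr HM i"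
    using Hom_sum_closed[OF Hom_gr_closed[OF F] Hom_gr_closed[OF G]] Hom_gr[OF F] Hom_gr[OF G]
    unfolding monoid.simps Hom_simps(3) by (intro Hom_grI) auto
qed

lemma Hom_gr_add: "F \<in> gr HM i ==> G \<in> gr HM i ==> F \<oplus>\<^bsub>HM\<^esub> G \<in> gr HM i"
  by (rule additive_subgroup.a_closed[OF Hom_gr_subgroup])

text \<open>Parity components are computed for maps presented as an even plus an odd map, the form
  in which all maps below arise. A map in both parts sends each homogeneous element into both parts
  of N, hence to zero.\<close>

lemma prt_Hom:
  assumes "F \<in> gr HM 0" "G \<in> gr HM 1"
  shows "prt HM 0 (F \<oplus>\<^bsub>HM\<^esub> G) = F" "prt HM 1 (F \<oplus>\<^bsub>HM\<^esub> G) = G"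
proof -
  interpret H: abelian_group HM by (rule Hom_abelian)
  have "gr HM 0 \<inter> gr HM 1 \<subseteq> {\<zero>\<^bsub>HM\<^esub>}"
  proof
    fix F assume F: "F \<in> gr HM 0 \<inter> gr HM 1"
    then have Fc: "F \<in> carrier HM" using Hom_gr_closed by blast
    have "F = \<zero>\<^bsub>HM\<^esub>"
    proof (rule Hom_eqI[OF Fc H.zero_closed])
      fix x assume "x \<in> carrier M"
      then have "F x = \<zero>\<^bsub>N\<^esub>"
      proof (induction x rule: M.M.gr_induct)
        case (gr i x)
        then show ?case using F Hom_gr[of F 0 x i] Hom_gr[of F 1 x i] N.M.gr_both[of "F x" i] by (simp add: add.commute)
      next
        case (add y z)
        then show ?case by (simp add: additive_maps_add[OF Hom_additive[OF Fc]])
      qed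
      then show "F x = \<zero>\<^bsub>HM\<^esub> x" using \<open>x \<in> carrier M\<close> by (simp add: Hom_simps(2))
    qed
    then show "F \<in> {\<zero>\<^bsub>HM\<^esub>}" by simp
  qed
  then have dis: "gr HM 0 \<inter> gr HM 1 = {\<zero>\<^bsub>HM\<^esub>}" using Hom_zero_gr by blast
  note p = prt_eqI[OF Hom_abelian Hom_gr_subgroup dis]
  show "prt HM 0 (F \<oplus>\<^bsub>HM\<^esub> G) = F" using p[OF assms(1), of G] assms(2) by simp
  show "prt HM 1 (F \<oplus>\<^bsub>HM\<^esub> G) = G" using p[OF assms(2), of F] assms H.a_comm[of F G] Hom_gr_closed by simp
qed

lemma balanced_sum:
  assumes P: "abelian_group P" and f: "f \<in> balanced K M N P" and g: "g \<in> balanced K M N P"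
  shows "(\<lambda>m n. f m n \<oplus>\<^bsub>P\<^esub> g m n) \<in> balanced K M N P"
proof (rule balancedI)
  fix m n j \<alpha> i assume *: "m \<in> carrier M" "n \<in> gr N j" "\<alpha> \<in> gr K i"
  then have "n \<bullet>\<^bsub>N\<^esub> \<alpha> \<in> carrier N" by (intro N.act_closed) auto
  then show "f (m \<bullet>\<^bsub>M\<^esub> \<alpha>) n \<oplus>\<^bsub>P\<^esub> g (m \<bullet>\<^bsub>M\<^esub> \<alpha>) n = neg_pow P (i * j) (f m (n \<bullet>\<^bsub>N\<^esub> \<alpha>) \<oplus>\<^bsub>P\<^esub> g m (n \<bullet>\<^bsub>N\<^esub> \<alpha>))"
    using * balanced_closed[OF f] balanced_closed[OF g]
    by (simp add: balanced_scalar[OF f *] balanced_scalar[OF g *] abelian_group.neg_pow_add[OF P])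
qed (intro additive_maps_sum P balanced_right[OF f] balanced_right[OF g] balanced_left[OF f] balanced_left[OF g]; assumption)+

lemma tensor_lift_sum:
  assumes P: "abelian_group P" and f: "f \<in> balanced K M N P" and g: "g \<in> balanced K M N P" and x: "x \<in> carrier TG"
  shows "tensor_lift P (\<lambda>m n. f m n \<oplus>\<^bsub>P\<^esub> g m n) x = tensor_lift P f x \<oplus>\<^bsub>P\<^esub> tensor_lift P g x"
  by (rule TG_additive_eqI[OF x tensor_lift_additive[OF P balanced_sum[OF assms(1-3)]]
        additive_maps_sum[OF P tensor_lift_additive[OF P f] tensor_lift_additive[OF P g]]])
    (simp add: tensor_lift_pure[OF P balanced_sum[OF assms(1-3)]] tensor_lift_pure[OF P f] tensor_lift_pure[OF P g] M.M.gr_closed N.M.gr_closed)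

end

section \<open>The convolution Lie superalgebra\<close>

lemma sg_fun_apply [simp]: "sg e F x = sg e (F x)" for F :: "'a \<Rightarrow> 'b::ab_group_add"
  by (simp add: sg_def)

lemma sum_fun_apply: "sum F A x = (\<Sum>i\<in>A. F i x)" for F :: "'i \<Rightarrow> 'a \<Rightarrow> 'b::ab_group_add"
  by (induction A rule: infinite_finite_induct) auto

locale lie_sym = lie_superalgebra K \<gg>
  for K :: "('k, 'b) superring_scheme" and \<gg> :: "('k, 'g, 'c) lie_algebra_scheme" +
  assumes contains_rationals: "contains_rationals K"
begin

sublocale sym_alg K \<gg> by unfold_locales (rule contains_rationals)

lemma brk_closed [simp, intro]:
  assumes "X \<in> carrier \<gg>" "Y \<in> carrier \<gg>"
  shows "brk \<gg> X Y \<in> carrier \<gg>"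
  using assms(1)
proof (induction X rule: M.gr_induct)
  case (gr i X)
  from assms(2) show ?case
  proof (induction Y rule: M.gr_induct)
    case (gr j Y)
    then show ?case using brk_even[OF \<open>X \<in> gr \<gg> i\<close>] by blast
  next
    case (add y z)
    then show ?case using \<open>X \<in> gr \<gg> i\<close> by (simp add: brk_add_right M.gr_closed)
  qed
next
  case (add y z)
  then show ?case using assms(2) by (simp add: brk_add_left)
qed

lemma brk_additive_right: "X \<in> carrier \<gg> ==> brk \<gg> X \<in> additive_maps \<gg> \<gg>"
  and brk_additive_left: "Y \<in> carrier \<gg> ==> (\<lambda>X. brk \<gg> X Y) \<in> additive_maps \<gg> \<gg>"
  by (auto intro!: additive_mapsI simp: brk_add_left brk_add_right)

text \<open>Bracket, scalar action and grading of \<gg> transported to \<open>amb\<close>. Since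
  \<open>val\<close> always lands in the carrier, the bracket is biadditive and the action by a
  fixed scalar of K is additive on the whole type.\<close>

definition hbr where "hbr x y = emb \<gg> (brk \<gg> (val \<gg> x) (val \<gg> y))"
definition hact where "hact x \<alpha> = emb \<gg> (val \<gg> x \<triangleleft> \<alpha>)"
definition hgr where "hgr i = emb \<gg> ` gr \<gg> i"

lemma hbr_add_left: "hbr (x + x') y = hbr x y + hbr x' y"
  and hbr_add_right: "hbr x (y + y') = hbr x y + hbr x y'"
  by (simp_all add: hbr_def brk_add_left brk_add_right M.emb_add)

lemma hbr_zero [simp]: "hbr 0 y = 0" "hbr x 0 = 0"
  using hbr_add_left[of 0 0 y] hbr_add_right[of x 0 0] by simp_all

lemma hbr_minus: "hbr (- x) y = - hbr x y" "hbr x (- y) = - hbr x y"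
  using hbr_add_left[of x "- x" y] hbr_add_right[of x y "- y"] by (simp_all add: eq_neg_iff_add_eq_0 add.commute)

lemma hbr_sg: "hbr (sg e x) y = sg e (hbr x y)" "hbr x (sg e y) = sg e (hbr x y)"
  by (simp_all add: sg_def hbr_minus)

lemma hact_add: "\<alpha> \<in> carrier K ==> hact (x + y) \<alpha> = hact x \<alpha> + hact y \<alpha>"
  by (simp add: hact_def act_add_left M.emb_add act_closed)

lemma hact_zero [simp]: "\<alpha> \<in> carrier K ==> hact 0 \<alpha> = 0"
  using hact_add[of \<alpha> 0 0] by simp

lemma hact_minus: "\<alpha> \<in> carrier K ==> hact (- x) \<alpha> = - hact x \<alpha>"
  using hact_add[of \<alpha> x "- x"] by (simp add: eq_neg_iff_add_eq_0 add.commute)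

lemma hact_sg: "\<alpha> \<in> carrier K ==> hact (sg e x) \<alpha> = sg e (hact x \<alpha>)"
  by (simp add: sg_def hact_minus)

lemma hact_sum: "\<alpha> \<in> carrier K ==> hact (sum f A) \<alpha> = (\<Sum>i\<in>A. hact (f i) \<alpha>)"
  by (induction A rule: infinite_finite_induct) (auto simp: hact_add)

lemma hact_add_scalar: "\<alpha> \<in> carrier K ==> \<beta> \<in> carrier K ==> hact x (\<alpha> \<oplus>\<^bsub>K\<^esub> \<beta>) = hact x \<alpha> + hact x \<beta>"
  by (simp add: hact_def act_add_right M.emb_add act_closed)

lemma hact_hact: "\<alpha> \<in> carrier K ==> \<beta> \<in> carrier K ==> hact (hact x \<alpha>) \<beta> = hact x (\<alpha> \<star> \<beta>)"
  by (simp add: hact_def act_mult act_closed)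

lemma hbr_hact_right: "\<alpha> \<in> carrier K ==> hbr x (hact y \<alpha>) = hact (hbr x y) \<alpha>"
  by (simp add: hbr_def hact_def brk_act_right act_closed)

lemma hgr_emb: "x \<in> hgr i ==> val \<gg> x \<in> gr \<gg> i \<and> emb \<gg> (val \<gg> x) = x"
  by (auto simp: hgr_def)

lemma hbr_hact_left:
  assumes "y \<in> hgr j" "\<alpha> \<in> gr K i"
  shows "hbr (hact x \<alpha>) y = sg (i * j) (hact (hbr x y) \<alpha>)"
proof -
  have "val \<gg> y \<in> gr \<gg> j" using hgr_emb[OF assms(1)] by simp
  then have "brk \<gg> (val \<gg> x \<triangleleft> \<alpha>) (val \<gg> y) = neg_pow \<gg> (i * j) (brk \<gg> (val \<gg> x) (val \<gg> y) \<triangleleft> \<alpha>)"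
    using assms(2) additive_maps_neg_pow[OF brk_additive_right M_ab M_ab, of "val \<gg> x" "val \<gg> y \<triangleleft> \<alpha>"]
    by (simp add: brk_act_middle K.gr_closed M.gr_closed lact_gr brk_act_right act_closed)
  then show ?thesis using assms(2)
    by (simp add: hbr_def hact_def act_closed K.gr_closed M.emb_neg_pow)
qed

lemma hgr_add: "x \<in> hgr i ==> y \<in> hgr i ==> x + y \<in> hgr i"
  by (force simp: hgr_def M.emb_add[symmetric])

lemma hgr_sg: "x \<in> hgr i ==> sg e x \<in> hgr i"
  by (force simp: hgr_def M.emb_neg_pow[symmetric])

lemma hgr_0 [simp]: "0 \<in> hgr i"
  unfolding hgr_def using M.emb_zero M.gr_zero by (metis image_eqI)

lemma hbr_hgr: "x \<in> hgr i ==> y \<in> hgr j ==> hbr x y \<in> hgr (i + j)"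
  by (auto simp: hgr_def hbr_def intro!: imageI brk_even)

lemma hact_hgr: "x \<in> hgr i ==> \<alpha> \<in> gr K j ==> hact x \<alpha> \<in> hgr (i + j)"
  by (auto simp: hgr_def hact_def intro!: imageI act_gr)

lemma hbr_skew: "x \<in> hgr i ==> y \<in> hgr j ==> hbr x y = - sg (i * j) (hbr y x)"
proof -
  assume "x \<in> hgr i" "y \<in> hgr j"
  then have "val \<gg> x \<in> gr \<gg> i" "val \<gg> y \<in> gr \<gg> j" using hgr_emb by auto
  then show ?thesis using brk_skew[of "val \<gg> x" i "val \<gg> y" j]
    by (simp add: hbr_def M.emb_a_inv M.emb_neg_pow)
qed

lemma hbr_jacobi:
  assumes "x \<in> hgr i" "y \<in> hgr j" "z \<in> hgr k"
  shows "hbr x (hbr y z) = hbr (hbr x y) z + sg (i * j) (hbr y (hbr x z))"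
proof -
  have "val \<gg> x \<in> gr \<gg> i" "val \<gg> y \<in> gr \<gg> j" "val \<gg> z \<in> gr \<gg> k" using assms hgr_emb by auto
  then have "hbr (hbr x y) z = hbr x (hbr y z) - sg (i * j) (hbr y (hbr x z))"
    using jacobi[of "val \<gg> x" i "val \<gg> y" j "val \<gg> z" k]
    by (simp add: hbr_def M.minus_eq M.emb_add M.emb_a_inv M.emb_neg_pow)
  then show ?thesis by simp
qed

text \<open>
  \<open>Lm q\<close> is the part of parity \<open>q\<close> of $Hom(S(\mathfrak g),\mathfrak g)$. Its elements take values in
  \<^typ>\<open>'g amb\<close> and vanish outside the carrier, so that sums of them are sums of functions.
\<close>

definition Lm :: "bit \<Rightarrow> (('k, 'g) sym_elem \<Rightarrow> 'g amb) set"
  where "Lm q = {F. (\<forall>x. x \<notin> carrier S \<longrightarrow> F x = 0) \<and>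
    (\<forall>x\<in>carrier S. \<forall>y\<in>carrier S. F (x \<oplus>\<^bsub>S\<^esub> y) = F x + F y) \<and>
    (\<forall>x\<in>carrier S. \<forall>\<alpha>\<in>carrier K. F (x \<odot> \<kappa> \<alpha>) = hact (F x) \<alpha>) \<and>
    (\<forall>j. \<forall>x\<in>gr S j. F x \<in> hgr (q + j))}"

lemma LmI:
  assumes "\<And>x. x \<notin> carrier S ==> F x = 0"
    and "\<And>x y. x \<in> carrier S ==> y \<in> carrier S ==> F (x \<oplus>\<^bsub>S\<^esub> y) = F x + F y"
    and "\<And>x \<alpha>. x \<in> carrier S ==> \<alpha> \<in> carrier K ==> F (x \<odot> \<kappa> \<alpha>) = hact (F x) \<alpha>"
    and "\<And>j x. x \<in> gr S j ==> F x \<in> hgr (q + j)"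
  shows "F \<in> Lm q"
  using assms by (auto simp: Lm_def)

lemma Lm_outside: "F \<in> Lm q ==> x \<notin> carrier S ==> F x = 0"
  and Lm_add: "F \<in> Lm q ==> x \<in> carrier S ==> y \<in> carrier S ==> F (x \<oplus>\<^bsub>S\<^esub> y) = F x + F y"
  and Lm_scalar: "F \<in> Lm q ==> x \<in> carrier S ==> \<alpha> \<in> carrier K ==> F (x \<odot> \<kappa> \<alpha>) = hact (F x) \<alpha>"
  and Lm_gr: "F \<in> Lm q ==> x \<in> gr S j ==> F x \<in> hgr (q + j)"
  by (auto simp: Lm_def)

lemma Lm_one: "F \<in> Lm q ==> F \<one>\<^sub>S \<in> hgr q"
  using Lm_gr[OF _ one_gr_S, of F q] by simp

lemma Lm_additive: "F \<in> Lm q ==> F \<in> additive_maps S univ_group"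
  by (rule additive_mapsI) (auto simp: Lm_add)

lemma Lm_neg_pow: "F \<in> Lm q ==> x \<in> carrier S ==> F (neg_pow S e x) = sg e (F x)"
  using additive_maps_neg_pow[OF Lm_additive S_ab univ_group_abelian] by simp

text \<open>On homogeneous arguments the grading condition puts the value into the image of
  \<open>emb\<close>, and additivity extends this to all arguments.\<close>

lemma Lm_emb: assumes "F \<in> Lm q" shows "emb \<gg> (val \<gg> (F x)) = F x"
proof (cases "x \<in> carrier S")
  case True
  then show ?thesis
  proof (induction x rule: SA.M.gr_induct)
    case (gr i y)
    then show ?case using hgr_emb[OF Lm_gr[OF assms gr]] by simp
  next
    case (add y z)
    then show ?case by (simp add: Lm_add[OF assms] M.emb_add)
  qed
qed (simp add: Lm_outside[OF assms])

lemma Lm_0 [simp]: "0 \<in> Lm q"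
  by (rule LmI) auto

lemma Lm_plus: "F \<in> Lm q ==> G \<in> Lm q ==> F + G \<in> Lm q"
  by (rule LmI) (auto simp: Lm_outside Lm_add Lm_scalar hact_add hgr_add Lm_gr)

lemma Lm_sg: "F \<in> Lm q ==> sg e F \<in> Lm q"
  by (rule LmI) (auto simp: Lm_outside Lm_add Lm_scalar hact_sg sg_add hgr_sg Lm_gr)

lemma Lm_uminus: "F \<in> Lm q ==> - F \<in> Lm q"
  using Lm_sg[of F q 1] by simp

lemma Lm_diff: "F \<in> Lm q ==> G \<in> Lm q ==> F - G \<in> Lm q"
  using Lm_plus[OF _ Lm_uminus, of F q G] by simp

lemma Lm_sum: "(\<And>i. i \<in> A ==> F i \<in> Lm q) ==> sum F A \<in> Lm q"
  by (induction A rule: infinite_finite_induct) (auto intro: Lm_plus)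

text \<open>For right linear maps the scalars can be treated like an operation: it remains to
  consider 1, left multiplication by a generator, and sums.\<close>

lemma S_lin_induct [consumes 1, case_names one scalar mult add]:
  assumes "x \<in> carrier S" "P \<one>\<^sub>S"
    and "\<And>x \<alpha>. x \<in> carrier S ==> \<alpha> \<in> carrier K ==> P x ==> P (x \<odot> \<kappa> \<alpha>)"
    and "\<And>X i w. X \<in> gr \<gg> i ==> w \<in> carrier S ==> P w ==> P (\<iota> X \<odot> w)"
    and "\<And>x y. x \<in> carrier S ==> y \<in> carrier S ==> P x ==> P y ==> P (x \<oplus>\<^bsub>S\<^esub> y)"
  shows "P x"
  using assms(1)
proof (induction x rule: S_induct)
  case (scalar \<alpha>)
  then show ?case using assms(3)[of "\<one>\<^sub>S" \<alpha>] assms(2) by simp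
qed (use assms in auto)

text \<open>The derivative of F in direction X. It shifts the parity by that of X; together with the
  value at 1 the derivatives determine F, so rules for \<open>lX\<close> turn into identities in L
  by induction on words.\<close>

definition lX :: "'g \<Rightarrow> (('k, 'g) sym_elem \<Rightarrow> 'g amb) \<Rightarrow> ('k, 'g) sym_elem \<Rightarrow> 'g amb"
  where "lX X F = (\<lambda>w. if w \<in> carrier S then F (\<iota> X \<odot> w) else 0)"

lemma lX_apply: "w \<in> carrier S ==> F (\<iota> X \<odot> w) = lX X F w"
  by (simp add: lX_def)

lemma lX_linear: "lX X (F + G) = lX X F + lX X G" "lX X (sg e F) = sg e (lX X F)" "lX X (- F) = - lX X F"
  "lX X 0 = 0"
  by (auto simp: lX_def fun_eq_iff)

lemma lX_Lm: "F \<in> Lm q ==> X \<in> gr \<gg> i ==> lX X F \<in> Lm (q + i)"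
proof (rule LmI)
  fix j x assume "F \<in> Lm q" "X \<in> gr \<gg> i" "x \<in> gr S j"
  then show "lX X F x \<in> hgr (q + i + j)"
    using Lm_gr[of F q "\<iota> X \<odot> x" "i + j"] gr_S_closed
    by (auto simp: lX_def add.assoc intro: gr_S_iota_mult)
qed (auto simp: lX_def Lm_add S.r_distr S.m_assoc[symmetric] Lm_scalar M.gr_closed)

text \<open>
  The bracket $[F,G]=[\cdot,\cdot]\circ(F\otimes G)\circ\Delta$ is written \<open>cb q F G\<close>, with \<open>q\<close> the
  parity of \<open>G\<close>.
\<close>

definition cbf where "cbf q F G = (\<lambda>u v. hbr (F (twist S q u)) (G v))"

definition cb :: "bit \<Rightarrow> (('k, 'g) sym_elem \<Rightarrow> 'g amb) \<Rightarrow> (('k, 'g) sym_elem \<Rightarrow> 'g amb) \<Rightarrow>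
    ('k, 'g) sym_elem \<Rightarrow> 'g amb"
  where "cb q F G = (\<lambda>x. if x \<in> carrier S then tensor_lift univ_group (cbf q F G) (\<Delta> x) else 0)"

lemma cbf_balanced:
  assumes F: "F \<in> Lm p" and G: "G \<in> Lm q"
  shows "cbf q F G \<in> balanced K S S univ_group"
proof (rule balancedI)
  show "cbf q F G m \<in> additive_maps S univ_group" if "m \<in> carrier S" for m
    by (rule additive_mapsI) (auto simp: cbf_def Lm_add[OF G] hbr_add_right)
  show "(\<lambda>m. cbf q F G m n) \<in> additive_maps S univ_group" if "n \<in> carrier S" for n
    by (rule additive_mapsI) (auto simp: cbf_def Lm_add[OF F] hbr_add_left SA.M.twist_add)
  fix m n j \<alpha> i assume *: "m \<in> carrier S" "n \<in> gr S j" "\<alpha> \<in> gr K i"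
  then have c: "n \<in> carrier S" "\<alpha> \<in> carrier K" using gr_S_closed by auto
  have "F (twist S q (m \<bullet>\<^bsub>S\<^esub> \<alpha>)) = sg (q * i) (hact (F (twist S q m)) \<alpha>)"
    using * c unfolding SA.twist_act[OF *(1,3)]
    by (simp add: S_act Lm_neg_pow[OF F] Lm_scalar[OF F])
  moreover have "hbr (hact (F (twist S q m)) \<alpha>) (G n) = sg (i * (q + j)) (hact (hbr (F (twist S q m)) (G n)) \<alpha>)"
    by (rule hbr_hact_left[OF Lm_gr[OF G *(2)] *(3)])
  ultimately show "cbf q F G (m \<bullet>\<^bsub>S\<^esub> \<alpha>) n = neg_pow univ_group (i * j) (cbf q F G m (n \<bullet>\<^bsub>S\<^esub> \<alpha>))"
    using c by (simp add: cbf_def hbr_sg S_act Lm_scalar[OF G] hbr_hact_right distrib_left mult.commute[of q i])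
qed

lemma cb_one: assumes "F \<in> Lm p" "G \<in> Lm q" shows "cb q F G \<one>\<^sub>S = hbr (F \<one>\<^sub>S) (G \<one>\<^sub>S)"
  using TT.tensor_lift_pure[OF univ_group_abelian cbf_balanced[OF assms], of "\<one>\<^sub>S" "\<one>\<^sub>S"]
  by (simp add: cb_def) (simp add: cbf_def SA.M.twist_gr[OF one_gr_S])

text \<open>X joins the argument of F or that of G. In the first case G has to pass X, which gives
  the exponent q i. In the second case X passes the argument of F; that twist by i merges with the
  twist by q into the one for the parity q + i of the derivative of G.\<close>

lemma cb_lX:
  assumes F: "F \<in> Lm p" and G: "G \<in> Lm q" and X: "X \<in> gr \<gg> i"
  shows "lX X (cb q F G) = sg (q * i) (cb q (lX X F) G) + cb (q + i) F (lX X G)"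
proof
  fix w
  show "lX X (cb q F G) w = (sg (q * i) (cb q (lX X F) G) + cb (q + i) F (lX X G)) w"
  proof (cases "w \<in> carrier S")
    case True
    have Xc: "X \<in> carrier \<gg>" using X by auto
    note b = cbf_balanced[OF F G]
    note d = dX_tensor_lift[OF univ_group_abelian b \<Delta>_closed[OF True] X]
    have b1: "cbf q (lX X F) G \<in> balanced K S S univ_group" by (rule cbf_balanced[OF lX_Lm[OF F X] G])
    have "lX X (cb q F G) w = tensor_lift univ_group (cbf q F G) (dX X \<bowtie> \<Delta> w)"
      using True Xc by (simp add: lX_def cb_def \<Delta>_mult)
    also have "\<dots> = tensor_lift univ_group (\<lambda>u v. cbf q F G (\<iota> X \<odot> u) v) (\<Delta> w) +
        tensor_lift univ_group (\<lambda>u v. cbf q F G (twist S i u) (\<iota> X \<odot> v)) (\<Delta> w)"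
      using d(3) by simp
    also have "tensor_lift univ_group (\<lambda>u v. cbf q F G (twist S i u) (\<iota> X \<odot> v)) (\<Delta> w) = cb (q + i) F (lX X G) w"
    proof -
      have "tensor_lift univ_group (\<lambda>u v. cbf q F G (twist S i u) (\<iota> X \<odot> v)) (\<Delta> w) =
          tensor_lift univ_group (cbf (q + i) F (lX X G)) (\<Delta> w)"
        by (rule TT.tensor_lift_cong[OF univ_group_abelian d(2)])
          (use True in \<open>auto simp: cbf_def SA.M.twist_twist lX_def\<close>)
      then show ?thesis using True by (simp add: cb_def)
    qed
    also have "tensor_lift univ_group (\<lambda>u v. cbf q F G (\<iota> X \<odot> u) v) (\<Delta> w) = sg (q * i) (cb q (lX X F) G w)"
    proof -
      have "tensor_lift univ_group (\<lambda>u v. cbf q F G (\<iota> X \<odot> u) v) (\<Delta> w) =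
          neg_pow univ_group (q * i) (tensor_lift univ_group (cbf q (lX X F) G) (\<Delta> w))"
      proof (rule TT.TG_additive_eqI[OF \<Delta>_closed[OF True] TT.tensor_lift_additive[OF univ_group_abelian d(1)]
            additive_maps_sgn[OF univ_group_abelian TT.tensor_lift_additive[OF univ_group_abelian b1]]])
        fix l m j n assume "m \<in> gr S l" "n \<in> gr S j"
        then have mn: "m \<in> carrier S" "n \<in> carrier S" using gr_S_closed by auto
        then show "tensor_lift univ_group (\<lambda>u v. cbf q F G (\<iota> X \<odot> u) v) (pur m n) =
          neg_pow univ_group (q * i) (tensor_lift univ_group (cbf q (lX X F) G) (pur m n))"
          using Xc by (simp add: TT.tensor_lift_pure[OF univ_group_abelian d(1)]
              TT.tensor_lift_pure[OF univ_group_abelian b1])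
            (simp add: cbf_def lX_def SA.twist_mult[OF iota_gr[OF X]] Lm_neg_pow[OF F] hbr_sg)
      qed
      then show ?thesis using True by (simp add: cb_def)
    qed
    finally show ?thesis by simp
  next
    case False
    then show ?thesis by (simp add: lX_def cb_def)
  qed
qed

lemma cb_Lm: assumes F: "F \<in> Lm p" and G: "G \<in> Lm q" shows "cb q F G \<in> Lm (p + q)"
proof (rule LmI)
  note b = cbf_balanced[OF F G]
  note ad = TT.tensor_lift_additive[OF univ_group_abelian b]
  show "cb q F G x = 0" if "x \<notin> carrier S" for x using that by (simp add: cb_def)
  show "cb q F G (x \<oplus>\<^bsub>S\<^esub> y) = cb q F G x + cb q F G y" if "x \<in> carrier S" "y \<in> carrier S" for x y
    using that by (simp add: cb_def additive_maps_add[OF \<Delta>_additive] additive_maps_add[OF ad])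
  show "cb q F G (x \<odot> \<kappa> \<alpha>) = hact (cb q F G x) \<alpha>" if x: "x \<in> carrier S" and \<alpha>: "\<alpha> \<in> carrier K" for x \<alpha>
  proof -
    note a = act_tensor_lift[OF univ_group_abelian b \<Delta>_closed[OF x] \<alpha>]
    have "tensor_lift univ_group (\<lambda>u v. cbf q F G u (v \<odot> \<kappa> \<alpha>)) (\<Delta> x) = hact (tensor_lift univ_group (cbf q F G) (\<Delta> x)) \<alpha>"
    proof (rule TT.TG_additive_eqI[OF \<Delta>_closed[OF x] TT.tensor_lift_additive[OF univ_group_abelian a(2)]])
      show "(\<lambda>y. hact (tensor_lift univ_group (cbf q F G) y) \<alpha>) \<in> additive_maps TG univ_group"
        by (rule additive_maps_comp[OF ad]) (auto intro!: additive_mapsI simp: hact_add \<alpha>)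
      fix l m j n assume "m \<in> gr S l" "n \<in> gr S j"
      then have "m \<in> carrier S" "n \<in> carrier S" using gr_S_closed by auto
      then show "tensor_lift univ_group (\<lambda>u v. cbf q F G u (v \<odot> \<kappa> \<alpha>)) (pur m n) =
          hact (tensor_lift univ_group (cbf q F G) (pur m n)) \<alpha>"
        using \<alpha> by (simp add: TT.tensor_lift_pure[OF univ_group_abelian a(2)] TT.tensor_lift_pure[OF univ_group_abelian b])
          (simp add: cbf_def Lm_scalar[OF G] hbr_hact_right)
    qed
    then show ?thesis using x \<alpha> by (simp add: cb_def \<Delta>_scalar a(1))
  qed
  show "cb q F G x \<in> hgr (p + q + j)" if x: "x \<in> gr S j" for j x
  proof -
    have "tensor_lift univ_group (cbf q F G) y \<in> hgr (p + q + j)" if "y \<in> gr TT.T j" for y using that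
    proof (induction y rule: TT.T_gr_induct)
      case (pure l m k n)
      then have "m \<in> carrier S" "n \<in> carrier S" "twist S q m \<in> gr S l" using gr_S_closed by auto
      then have "hbr (F (twist S q m)) (G n) \<in> hgr ((p + l) + (q + k))"
        using pure by (intro hbr_hgr Lm_gr[OF F] Lm_gr[OF G])
      moreover have "(p + l) + (q + k) = p + q + j" using pure by (simp add: ac_simps)
      ultimately show ?case using \<open>m \<in> carrier S\<close> \<open>n \<in> carrier S\<close>
        by (simp add: TT.tensor_lift_pure[OF univ_group_abelian b]) (simp add: cbf_def)
    next
      case (add x y)
      then have "x \<in> carrier TG" "y \<in> carrier TG" using additive_subgroup.a_Hcarr[OF TT.T_gr_subgroup] by blast+
      with add show ?case by (simp add: additive_maps_add[OF ad] hgr_add)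
    qed
    then show ?thesis using x gr_S_closed \<Delta>_gr[OF x] by (simp add: cb_def)
  qed
qed

lemma cb_add_left:
  assumes F: "F \<in> Lm p" "F' \<in> Lm p" and G: "G \<in> Lm q"
  shows "cb q (F + F') G = cb q F G + cb q F' G"
proof
  fix x
  note b = cbf_balanced[OF F(1) G] cbf_balanced[OF F(2) G] cbf_balanced[OF Lm_plus[OF F] G]
  have "tensor_lift univ_group (cbf q (F + F') G) y = tensor_lift univ_group (cbf q F G) y \<oplus>\<^bsub>univ_group\<^esub>
      tensor_lift univ_group (cbf q F' G) y" if "y \<in> carrier TG" for y
    by (rule TT.TG_additive_eqI[OF that TT.tensor_lift_additive[OF univ_group_abelian b(3)] additive_maps_sum
          [OF univ_group_abelian TT.tensor_lift_additive[OF univ_group_abelian b(1)]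
          TT.tensor_lift_additive[OF univ_group_abelian b(2)]]])
      (simp add: gr_S_closed TT.tensor_lift_pure[OF univ_group_abelian b(1)]
        TT.tensor_lift_pure[OF univ_group_abelian b(2)] TT.tensor_lift_pure[OF univ_group_abelian b(3)],
        simp add: cbf_def hbr_add_left)
  then show "cb q (F + F') G x = (cb q F G + cb q F' G) x" by (simp add: cb_def)
qed

lemma cb_add_right:
  assumes F: "F \<in> Lm p" and G: "G \<in> Lm q" "G' \<in> Lm q"
  shows "cb q F (G + G') = cb q F G + cb q F G'"
proof
  fix x
  note b = cbf_balanced[OF F G(1)] cbf_balanced[OF F G(2)] cbf_balanced[OF F Lm_plus[OF G]]
  have "tensor_lift univ_group (cbf q F (G + G')) y = tensor_lift univ_group (cbf q F G) y \<oplus>\<^bsub>univ_group\<^esub>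
      tensor_lift univ_group (cbf q F G') y" if "y \<in> carrier TG" for y
    by (rule TT.TG_additive_eqI[OF that TT.tensor_lift_additive[OF univ_group_abelian b(3)] additive_maps_sum
          [OF univ_group_abelian TT.tensor_lift_additive[OF univ_group_abelian b(1)]
          TT.tensor_lift_additive[OF univ_group_abelian b(2)]]])
      (simp add: gr_S_closed TT.tensor_lift_pure[OF univ_group_abelian b(1)]
        TT.tensor_lift_pure[OF univ_group_abelian b(2)] TT.tensor_lift_pure[OF univ_group_abelian b(3)],
        simp add: cbf_def hbr_add_right)
  then show "cb q F (G + G') x = (cb q F G + cb q F G') x" by (simp add: cb_def)
qed

lemma cb_zero: "F \<in> Lm p ==> cb q F 0 = 0" "G \<in> Lm q ==> cb q 0 G = 0"
  using cb_add_right[of F p 0 q 0] cb_add_left[of 0 p 0 G q] by simp_all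

lemma cb_minus:
  assumes "F \<in> Lm p" "G \<in> Lm q"
  shows "cb q (- F) G = - cb q F G" "cb q F (- G) = - cb q F G"
proof -
  have "cb q F G + cb q (- F) G = 0" using cb_add_left[OF assms(1) Lm_uminus[OF assms(1)] assms(2)] cb_zero assms by simp
  then show "cb q (- F) G = - cb q F G" by (metis neg_eq_iff_add_eq_0 minus_unique)
  have "cb q F G + cb q F (- G) = 0" using cb_add_right[OF assms(1) assms(2) Lm_uminus[OF assms(2)]] cb_zero assms by simp
  then show "cb q F (- G) = - cb q F G" by (metis neg_eq_iff_add_eq_0 minus_unique)
qed

lemma cb_sg:
  assumes "F \<in> Lm p" "G \<in> Lm q"
  shows "cb q (sg e F) G = sg e (cb q F G)" "cb q F (sg e G) = sg e (cb q F G)"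
  using cb_minus[OF assms] by (simp_all add: sg_def)

lemma cb_sum_left:
  assumes "\<And>i. i \<in> A ==> F i \<in> Lm p" "G \<in> Lm q"
  shows "cb q (sum F A) G = (\<Sum>i\<in>A. cb q (F i) G)"
  using assms(1)
proof (induction A rule: infinite_finite_induct)
  case (insert i A)
  have "cb q (F i + sum F A) G = cb q (F i) G + cb q (sum F A) G"
    by (rule cb_add_left[OF _ Lm_sum assms(2)]) (use insert in auto)
  moreover have "cb q (sum F A) G = (\<Sum>i\<in>A. cb q (F i) G)" using insert by auto
  ultimately show ?case unfolding sum.insert[OF insert.hyps] by (simp only:)
qed (use cb_zero(2)[OF assms(2)] in auto)

lemma cb_sum_right:
  assumes "\<And>i. i \<in> A ==> G i \<in> Lm q" "F \<in> Lm p"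
  shows "cb q F (sum G A) = (\<Sum>i\<in>A. cb q F (G i))"
  using assms(1)
proof (induction A rule: infinite_finite_induct)
  case (insert i A)
  have "cb q F (G i + sum G A) = cb q F (G i) + cb q F (sum G A)"
    by (rule cb_add_right[OF assms(2) _ Lm_sum]) (use insert in auto)
  moreover have "cb q F (sum G A) = (\<Sum>i\<in>A. cb q F (G i))" using insert by auto
  ultimately show ?case unfolding sum.insert[OF insert.hyps] by (simp only:)
qed (use cb_zero(1)[OF assms(2)] in auto)

text \<open>Induction on the word with F, G and their parities left free, since the step replaces
  them by derivatives. The Leibniz rule exchanges its two terms when F and G are exchanged; at 1 the
  claim is skewness in \<gg>.\<close>

lemma cb_skew:
  assumes "F \<in> Lm p" "G \<in> Lm q"
  shows "cb q F G = - sg (p * q) (cb p G F)"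
proof
  fix x
  show "cb q F G x = (- sg (p * q) (cb p G F)) x"
  proof (cases "x \<in> carrier S")
    case True
    then show ?thesis using assms
    proof (induction x arbitrary: F G p q rule: S_lin_induct)
      case one
      then show ?case using hbr_skew[OF Lm_one[OF one(1)] Lm_one[OF one(2)]] by (simp add: cb_one)
    next
      case (scalar x \<alpha>)
      show ?case using scalar(1,2)
        by (simp add: Lm_scalar[OF cb_Lm[OF scalar(4,5)]] Lm_scalar[OF cb_Lm[OF scalar(5,4)]]
            scalar(3)[OF scalar(4,5)] hact_minus hact_sg)
    next
      case (mult X i w)
      have l: "lX X F \<in> Lm (p + i)" "lX X G \<in> Lm (q + i)" using mult lX_Lm by auto
      show ?case using mult(2) mult(3)[OF l(1) mult(5)] mult(3)[OF mult(4) l(2)]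
        by (simp add: lX_apply cb_lX[OF mult(4,5,1)] cb_lX[OF mult(5,4,1)] sg_add sg_minus algebra_simps)
    next
      case (add x y)
      show ?case
        by (simp add: Lm_add[OF cb_Lm[OF add(5,6)] add(1,2)] Lm_add[OF cb_Lm[OF add(6,5)] add(1,2)]
            add(3)[OF add(5,6)] add(4)[OF add(5,6)] sg_add)
    qed
  qed (simp add: cb_def)
qed

text \<open>Each of the three double brackets has one derivative term for each of H, F and G, and
  for each of these the three terms form an instance of the claim on a shorter word. The Jacobi
  identity of \<gg> enters only at 1.\<close>

lemma cb_jacobi:
  assumes "H \<in> Lm r" "F \<in> Lm p" "G \<in> Lm q"
  shows "cb (p + q) H (cb q F G) = cb q (cb p H F) G + sg (r * p) (cb (r + q) F (cb q H G))"
proof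
  fix x
  show "cb (p + q) H (cb q F G) x = (cb q (cb p H F) G + sg (r * p) (cb (r + q) F (cb q H G))) x"
  proof (cases "x \<in> carrier S")
    case True
    then show ?thesis using assms
    proof (induction x arbitrary: H F G r p q rule: S_lin_induct)
      case one
      then show ?case using hbr_jacobi[OF Lm_one[OF one(1)] Lm_one[OF one(2)] Lm_one[OF one(3)]]
        by (simp add: cb_one cb_Lm cb_one[OF _ cb_Lm] cb_one[OF cb_Lm])
    next
      case (scalar x \<alpha>)
      note L = cb_Lm[OF scalar(4) cb_Lm[OF scalar(5,6)]] cb_Lm[OF cb_Lm[OF scalar(4,5)] scalar(6)]
        cb_Lm[OF scalar(5) cb_Lm[OF scalar(4,6)]]
      show ?case using scalar(3)[OF scalar(4-6)] scalar(1,2)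
        by (simp add: Lm_scalar[OF L(1)] Lm_scalar[OF L(2)] Lm_scalar[OF L(3)] hact_add hact_sg)
    next
      case (mult X i w)
      note H = mult(4) and F = mult(5) and G = mult(6)
      note l = lX_Lm[OF H mult(1)] lX_Lm[OF F mult(1)] lX_Lm[OF G mult(1)]
      have A1: "cb q (lX X F) G \<in> Lm (p + q + i)" "cb (q + i) F (lX X G) \<in> Lm (p + q + i)"
        using cb_Lm[OF l(2) G] cb_Lm[OF F l(3)] by (simp_all add: ac_simps)
      have e1: "lX X (cb (p + q) H (cb q F G)) = sg ((p + q) * i) (cb (p + q) (lX X H) (cb q F G)) +
          (sg (q * i) (cb (p + q + i) H (cb q (lX X F) G)) + cb (p + q + i) H (cb (q + i) F (lX X G)))"
        unfolding cb_lX[OF H cb_Lm[OF F G] mult(1)] cb_lX[OF F G mult(1)]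
          cb_add_right[OF H Lm_sg[OF A1(1)] A1(2)] cb_sg(2)[OF H A1(1)] ..
      have A2: "cb p (lX X H) F \<in> Lm (r + p + i)" "cb (p + i) H (lX X F) \<in> Lm (r + p + i)"
        using cb_Lm[OF l(1) F] cb_Lm[OF H l(2)] by (simp_all add: ac_simps)
      have e2: "lX X (cb q (cb p H F) G) = sg (q * i) (sg (p * i) (cb q (cb p (lX X H) F) G) + cb q (cb (p + i) H (lX X F)) G)
          + cb (q + i) (cb p H F) (lX X G)"
        unfolding cb_lX[OF cb_Lm[OF H F] G mult(1)] cb_lX[OF H F mult(1)]
          cb_add_left[OF Lm_sg[OF A2(1)] A2(2) G] cb_sg(1)[OF A2(1) G] ..
      have A3: "cb q (lX X H) G \<in> Lm (r + q + i)" "cb (q + i) H (lX X G) \<in> Lm (r + q + i)"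
        using cb_Lm[OF l(1) G] cb_Lm[OF H l(3)] by (simp_all add: ac_simps)
      have e3: "lX X (cb (r + q) F (cb q H G)) = sg ((r + q) * i) (cb (r + q) (lX X F) (cb q H G)) +
          (sg (q * i) (cb (r + q + i) F (cb q (lX X H) G)) + cb (r + q + i) F (cb (q + i) H (lX X G)))"
        unfolding cb_lX[OF F cb_Lm[OF H G] mult(1)] cb_lX[OF H G mult(1)]
          cb_add_right[OF F Lm_sg[OF A3(1)] A3(2)] cb_sg(2)[OF F A3(1)] ..
      show ?case using mult(3)[OF l(1) F G] mult(3)[OF H l(2) G] mult(3)[OF H F l(3)]
        unfolding plus_fun_apply sg_fun_apply unfolding lX_apply[OF mult(2)] e1 e2 e3
        by (simp add: sg_add algebra_simps)
    next
      case (add x y)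
      note L = cb_Lm[OF add(5) cb_Lm[OF add(6,7)]] cb_Lm[OF cb_Lm[OF add(5,6)] add(7)]
        cb_Lm[OF add(6) cb_Lm[OF add(5,7)]]
      show ?case using add(3)[OF add(5-7)] add(4)[OF add(5-7)] add(1,2)
        by (simp add: Lm_add[OF L(1)] Lm_add[OF L(2)] Lm_add[OF L(3)] sg_add)
    qed
  qed (simp add: cb_def)
qed

section \<open>The coderivation attached to a linear map\<close>

definition psf where "psf q \<psi> = (\<lambda>u v. twist S q u \<odot> \<iota> (val \<gg> (\<psi> v)))"

text \<open>$\mathrm{Mult}\circ(id\otimes\psi)\circ\Delta$ for \<open>\<psi>\<close> of parity \<open>q\<close>.\<close>

definition Ps where "Ps q \<psi> x = tensor_lift S (psf q \<psi>) (\<Delta> x)"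

lemma val_gr: "\<psi> \<in> Lm q ==> x \<in> gr S j ==> val \<gg> (\<psi> x) \<in> gr \<gg> (q + j)"
  using hgr_emb[OF Lm_gr] by blast

lemma psf_balanced:
  assumes \<psi>: "\<psi> \<in> Lm q"
  shows "psf q \<psi> \<in> balanced K S S S"
proof (rule balancedI)
  show "psf q \<psi> m \<in> additive_maps S S" if "m \<in> carrier S" for m
    using that by (intro additive_mapsI) (auto simp: psf_def Lm_add[OF \<psi>] \<iota>_add S.r_distr)
  show "(\<lambda>m. psf q \<psi> m n) \<in> additive_maps S S" if "n \<in> carrier S" for n
    using that by (intro additive_mapsI) (auto simp: psf_def S.l_distr SA.M.twist_add)
  fix m n j \<alpha> i assume *: "m \<in> carrier S" "n \<in> gr S j" "\<alpha> \<in> gr K i"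
  then have c: "n \<in> carrier S" "\<alpha> \<in> carrier K" using gr_S_closed by auto
  let ?Y = "val \<gg> (\<psi> n)"
  have Y: "\<iota> ?Y \<in> gr S (q + j)" using val_gr[OF \<psi> *(2)] by (rule iota_gr)
  have "val \<gg> (\<psi> (n \<odot> \<kappa> \<alpha>)) = ?Y \<triangleleft> \<alpha>"
    using c by (simp add: Lm_scalar[OF \<psi>] hact_def act_closed)
  then have e: "psf q \<psi> m (n \<bullet>\<^bsub>S\<^esub> \<alpha>) = (twist S q m \<odot> \<iota> ?Y) \<bullet>\<^bsub>S\<^esub> \<alpha>"
    using c * by (simp add: psf_def S_act \<iota>_act_\<kappa> S.m_assoc)
  have "psf q \<psi> (m \<bullet>\<^bsub>S\<^esub> \<alpha>) n = neg_pow S (q * i) ((twist S q m \<bullet>\<^bsub>S\<^esub> \<alpha>) \<odot> \<iota> ?Y)"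
    using * c by (simp add: psf_def SA.twist_act SA.neg_pow_mult_left SA.act_closed)
  also have "(twist S q m \<bullet>\<^bsub>S\<^esub> \<alpha>) \<odot> \<iota> ?Y = neg_pow S (i * (q + j)) ((twist S q m \<odot> \<iota> ?Y) \<bullet>\<^bsub>S\<^esub> \<alpha>)"
    using * by (intro SA.act_mult_left[OF _ Y]) auto
  finally show "psf q \<psi> (m \<bullet>\<^bsub>S\<^esub> \<alpha>) n = neg_pow S (i * j) (psf q \<psi> m (n \<bullet>\<^bsub>S\<^esub> \<alpha>))"
    using * c unfolding e by (simp add: SA.act_closed distrib_left mult.commute[of q i])
qed

lemma Ps_additive: "\<psi> \<in> Lm q ==> Ps q \<psi> \<in> additive_maps S S"
  unfolding Ps_def[abs_def]
  by (rule additive_maps_comp[OF \<Delta>_additive TT.tensor_lift_additive[OF S_ab psf_balanced]])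

lemma Ps_closed [simp, intro]: "\<psi> \<in> Lm q ==> x \<in> carrier S ==> Ps q \<psi> x \<in> carrier S"
  by (rule additive_maps_closed[OF Ps_additive])

lemma Ps_add: "\<psi> \<in> Lm q ==> x \<in> carrier S ==> y \<in> carrier S ==> Ps q \<psi> (x \<oplus>\<^bsub>S\<^esub> y) = Ps q \<psi> x \<oplus>\<^bsub>S\<^esub> Ps q \<psi> y"
  by (rule additive_maps_add[OF Ps_additive])

lemma Ps_neg_pow: "\<psi> \<in> Lm q ==> x \<in> carrier S ==> Ps q \<psi> (neg_pow S e x) = neg_pow S e (Ps q \<psi> x)"
  by (rule additive_maps_neg_pow[OF Ps_additive S_ab S_ab])

lemma Ps_one: "\<psi> \<in> Lm q ==> Ps q \<psi> \<one>\<^sub>S = \<iota> (val \<gg> (\<psi> \<one>\<^sub>S))"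
  using TT.tensor_lift_pure[OF S_ab psf_balanced, of \<psi> q "\<one>\<^sub>S" "\<one>\<^sub>S"]
  by (simp add: Ps_def) (simp add: psf_def SA.M.twist_gr[OF one_gr_S])

lemma Ps_scalar:
  assumes \<psi>: "\<psi> \<in> Lm q" and x: "x \<in> carrier S" and \<alpha>: "\<alpha> \<in> carrier K"
  shows "Ps q \<psi> (x \<odot> \<kappa> \<alpha>) = Ps q \<psi> x \<odot> \<kappa> \<alpha>"
proof -
  note b = psf_balanced[OF \<psi>]
  note a = act_tensor_lift[OF S_ab b \<Delta>_closed[OF x] \<alpha>]
  have "tensor_lift S (\<lambda>u v. psf q \<psi> u (v \<odot> \<kappa> \<alpha>)) (\<Delta> x) = tensor_lift S (psf q \<psi>) (\<Delta> x) \<odot> \<kappa> \<alpha>"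
  proof (rule TT.TG_additive_eqI[OF \<Delta>_closed[OF x] TT.tensor_lift_additive[OF S_ab a(2)]
        additive_maps_comp[OF TT.tensor_lift_additive[OF S_ab b] SA.mult_additive_left]])
    show "\<kappa> \<alpha> \<in> carrier S" using \<alpha> by simp
    fix l m j n assume "m \<in> gr S l" "n \<in> gr S j"
    then have "m \<in> carrier S" "n \<in> carrier S" using gr_S_closed by auto
    then show "tensor_lift S (\<lambda>u v. psf q \<psi> u (v \<odot> \<kappa> \<alpha>)) (pur m n) = tensor_lift S (psf q \<psi>) (pur m n) \<odot> \<kappa> \<alpha>"
      using \<alpha> by (simp add: TT.tensor_lift_pure[OF S_ab a(2)] TT.tensor_lift_pure[OF S_ab b])
        (simp add: psf_def Lm_scalar[OF \<psi>] hact_def act_closed \<iota>_act_\<kappa> S.m_assoc)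
  qed
  then show ?thesis using x \<alpha> by (simp add: Ps_def \<Delta>_scalar a(1))
qed

text \<open>X joins the first tensor factor and stays in front of the product, or it joins the
  second and is fed to \<psi>.\<close>

lemma Ps_mult:
  assumes \<psi>: "\<psi> \<in> Lm q" and X: "X \<in> gr \<gg> i" and w: "w \<in> carrier S"
  shows "Ps q \<psi> (\<iota> X \<odot> w) = neg_pow S (q * i) (\<iota> X \<odot> Ps q \<psi> w) \<oplus>\<^bsub>S\<^esub> Ps (q + i) (lX X \<psi>) w"
proof -
  have Xc: "X \<in> carrier \<gg>" using X by auto
  note b = psf_balanced[OF \<psi>]
  note d = dX_tensor_lift[OF S_ab b \<Delta>_closed[OF w] X]
  have "tensor_lift S (\<lambda>u v. psf q \<psi> (twist S i u) (\<iota> X \<odot> v)) (\<Delta> w) = Ps (q + i) (lX X \<psi>) w"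
    unfolding Ps_def
    by (rule TT.tensor_lift_cong[OF S_ab d(2)])
      (use w in \<open>auto simp: psf_def SA.M.twist_twist lX_def\<close>)
  moreover have "tensor_lift S (\<lambda>u v. psf q \<psi> (\<iota> X \<odot> u) v) (\<Delta> w) =
      neg_pow S (q * i) (\<iota> X \<odot> tensor_lift S (psf q \<psi>) (\<Delta> w))"
  proof (rule TT.TG_additive_eqI[OF \<Delta>_closed[OF w] TT.tensor_lift_additive[OF S_ab d(1)]
        additive_maps_sgn[OF S_ab additive_maps_comp[OF TT.tensor_lift_additive[OF S_ab b] SA.mult_additive_right]]])
    show "\<iota> X \<in> carrier S" using Xc by simp
    fix l m j n assume "m \<in> gr S l" "n \<in> gr S j"
    then have "m \<in> carrier S" "n \<in> carrier S" using gr_S_closed by auto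
    then show "tensor_lift S (\<lambda>u v. psf q \<psi> (\<iota> X \<odot> u) v) (pur m n) =
        neg_pow S (q * i) (\<iota> X \<odot> tensor_lift S (psf q \<psi>) (pur m n))"
      using Xc by (simp add: TT.tensor_lift_pure[OF S_ab d(1)] TT.tensor_lift_pure[OF S_ab b])
        (simp add: psf_def SA.twist_mult[OF iota_gr[OF X]] S.m_assoc SA.neg_pow_mult_left)
  qed
  ultimately show ?thesis using d(3) Xc w by (simp add: Ps_def \<Delta>_mult)
qed

lemma Ps_gr: "x \<in> gr S j ==> \<psi> \<in> Lm q ==> Ps q \<psi> x \<in> gr S (q + j)"
proof (induction arbitrary: \<psi> q rule: gr_S_induct)
  case (scalar k \<alpha>)
  then have "Ps q \<psi> (\<kappa> \<alpha>) = Ps q \<psi> \<one>\<^sub>S \<odot> \<kappa> \<alpha>"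
    using Ps_scalar[of \<psi> q "\<one>\<^sub>S" \<alpha>] by (simp add: K.gr_closed)
  moreover have "Ps q \<psi> \<one>\<^sub>S \<in> gr S q" using scalar val_gr[OF scalar(2) one_gr_S] by (simp add: Ps_one iota_gr)
  ultimately show ?case using scalar by (auto intro: S_mult_gr gr_S_kappa)
next
  case (mult X i j w)
  have "\<iota> X \<odot> Ps q \<psi> w \<in> gr S (i + (q + j))" using mult by (intro gr_S_iota_mult)
  moreover have "Ps (q + i) (lX X \<psi>) w \<in> gr S (q + i + j)" using mult lX_Lm by blast
  ultimately show ?case using mult gr_S_closed
    by (auto simp: Ps_mult ac_simps intro!: gr_S_add gr_S_neg_pow)
next
  case (add k x y)
  then show ?case using gr_S_closed by (simp add: Ps_add gr_S_add)
qed

lemma Ps_plus: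
  assumes "\<psi> \<in> Lm q" "\<psi>' \<in> Lm q" "x \<in> carrier S"
  shows "Ps q (\<psi> + \<psi>') x = Ps q \<psi> x \<oplus>\<^bsub>S\<^esub> Ps q \<psi>' x"
  unfolding Ps_def
proof (rule TT.TG_additive_eqI[OF \<Delta>_closed[OF assms(3)]])
  note b = psf_balanced[OF assms(1)] psf_balanced[OF assms(2)] psf_balanced[OF Lm_plus[OF assms(1,2)]]
  show "tensor_lift S (psf q (\<psi> + \<psi>')) \<in> additive_maps TG S"
    by (rule TT.tensor_lift_additive[OF S_ab b(3)])
  show "(\<lambda>x. tensor_lift S (psf q \<psi>) x \<oplus>\<^bsub>S\<^esub> tensor_lift S (psf q \<psi>') x) \<in> additive_maps TG S"
    by (intro additive_maps_sum S_ab TT.tensor_lift_additive b)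
  fix l m j n assume "m \<in> gr S l" "n \<in> gr S j"
  then have "m \<in> carrier S" "n \<in> carrier S" using gr_S_closed by auto
  then show "tensor_lift S (psf q (\<psi> + \<psi>')) (pur m n) = tensor_lift S (psf q \<psi>) (pur m n) \<oplus>\<^bsub>S\<^esub> tensor_lift S (psf q \<psi>') (pur m n)"
    by (simp add: TT.tensor_lift_pure[OF S_ab b(1)] TT.tensor_lift_pure[OF S_ab b(2)] TT.tensor_lift_pure[OF S_ab b(3)])
      (simp add: psf_def \<iota>_add S.r_distr)
qed

abbreviation "em \<equiv> emb S"

text \<open>Values of \<open>Ps\<close> moved into \<open>amb\<close>, where the signs and sums of
  long identities can be normalised as in an abelian group type.\<close>

definition PsE where "PsE q \<psi> x = em (Ps q \<psi> x)"

lemma PsE_plus: "\<psi> \<in> Lm q ==> \<psi>' \<in> Lm q ==> x \<in> carrier S ==> PsE q (\<psi> + \<psi>') x = PsE q \<psi> x + PsE q \<psi>' x"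
  by (simp add: PsE_def Ps_plus S.emb_add)

lemma PsE_zero: "x \<in> carrier S ==> PsE q 0 x = 0"
  using PsE_plus[of 0 q 0 x] by simp

lemma PsE_uminus: "\<psi> \<in> Lm q ==> x \<in> carrier S ==> PsE q (- \<psi>) x = - PsE q \<psi> x"
  using PsE_plus[of \<psi> q "- \<psi>" x] Lm_uminus[of \<psi> q] PsE_zero[of x q]
  by (simp add: eq_neg_iff_add_eq_0 add.commute)

lemma PsE_sg: "\<psi> \<in> Lm q ==> x \<in> carrier S ==> PsE q (sg e \<psi>) x = sg e (PsE q \<psi> x)"
  by (simp add: sg_def PsE_uminus)

lemma PsE_diff: "\<psi> \<in> Lm q ==> \<psi>' \<in> Lm q ==> x \<in> carrier S ==> PsE q (\<psi> - \<psi>') x = PsE q \<psi> x - PsE q \<psi>' x"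
  using PsE_plus[OF _ Lm_uminus, of \<psi> q \<psi>' x] PsE_uminus[of \<psi>' q x] by simp

text \<open>\<open>rc F q \<psi>\<close> is the composition of \<open>F\<close> with the coderivation attached to \<open>\<psi>\<close>.\<close>

definition rc :: "(('k, 'g) sym_elem \<Rightarrow> 'g amb) \<Rightarrow> bit \<Rightarrow> (('k, 'g) sym_elem \<Rightarrow> 'g amb) \<Rightarrow>
    ('k, 'g) sym_elem \<Rightarrow> 'g amb"
  where "rc F q \<psi> = (\<lambda>x. if x \<in> carrier S then F (Ps q \<psi> x) else 0)"

lemma rc_Lm: "F \<in> Lm p ==> \<psi> \<in> Lm q ==> rc F q \<psi> \<in> Lm (p + q)"
  by (rule LmI) (auto simp: rc_def Ps_add Lm_add Ps_scalar Lm_scalar gr_S_closed add.assoc intro!: Lm_gr Ps_gr)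

lemma rc_linear: "rc (F + F') q \<psi> = rc F q \<psi> + rc F' q \<psi>" "rc (sg e F) q \<psi> = sg e (rc F q \<psi>)"
  "rc (- F) q \<psi> = - rc F q \<psi>" "rc 0 q \<psi> = 0"
  by (auto simp: rc_def fun_eq_iff)

lemma rc_sum: "rc (sum F A) q \<psi> = (\<Sum>i\<in>A. rc (F i) q \<psi>)"
  by (auto simp: rc_def fun_eq_iff sum_fun_apply)

text \<open>Product rule for a composition: X either stays outside the coderivation and is met by F,
  or it is absorbed by \<psi>.\<close>

lemma rc_lX:
  assumes F: "F \<in> Lm p" and \<psi>: "\<psi> \<in> Lm q" and X: "X \<in> gr \<gg> i"
  shows "lX X (rc F q \<psi>) = sg (q * i) (rc (lX X F) q \<psi>) + rc F (q + i) (lX X \<psi>)"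
proof
  fix w
  have Xc: "X \<in> carrier \<gg>" using X by auto
  show "lX X (rc F q \<psi>) w = (sg (q * i) (rc (lX X F) q \<psi>) + rc F (q + i) (lX X \<psi>)) w"
    using lX_Lm[OF \<psi> X] \<psi> Xc
    by (auto simp: lX_def rc_def Ps_mult[OF \<psi> X] Lm_add[OF F] Lm_neg_pow[OF F])
qed

text \<open>Composition with an attached coderivation is a derivation of the bracket of L. Applying
  \<open>cb_lX\<close> and \<open>rc_lX\<close> to a word X w produces the claim at w with X
  differentiating F, G or \<psi>.\<close>

lemma rc_cb:
  assumes "F \<in> Lm p" "G \<in> Lm s" "\<psi> \<in> Lm q"
  shows "rc (cb s F G) q \<psi> = cb (s + q) F (rc G q \<psi>) + sg (q * s) (cb s (rc F q \<psi>) G)"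
proof
  fix x
  show "rc (cb s F G) q \<psi> x = (cb (s + q) F (rc G q \<psi>) + sg (q * s) (cb s (rc F q \<psi>) G)) x"
  proof (cases "x \<in> carrier S")
    case True
    then show ?thesis using assms
    proof (induction x arbitrary: F G \<psi> p q s rule: S_lin_induct)
      case one
      note F = one(1) and G = one(2) and \<psi> = one(3)
      let ?Y = "val \<gg> (\<psi> \<one>\<^sub>S)"
      have Y: "?Y \<in> gr \<gg> q" using val_gr[OF \<psi> one_gr_S] by simp
      \<comment> \<open>The coderivation sends 1 to the single generator ?Y, so one derivative of
        the bracket computes its value there.\<close>
      have "cb s F G (\<iota> ?Y) = sg (s * q) (hbr (F (\<iota> ?Y)) (G \<one>\<^sub>S)) + hbr (F \<one>\<^sub>S) (G (\<iota> ?Y))"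
        using cb_lX[OF F G Y] lX_apply[of "\<one>\<^sub>S" "cb s F G" ?Y] lX_apply[of "\<one>\<^sub>S" F ?Y] lX_apply[of "\<one>\<^sub>S" G ?Y]
          cb_one[OF lX_Lm[OF F Y] G] cb_one[OF F lX_Lm[OF G Y]] by simp
      then show ?case using cb_one[OF F rc_Lm[OF G \<psi>]] cb_one[OF rc_Lm[OF F \<psi>] G]
        by (simp add: rc_def Ps_one[OF \<psi>] mult.commute[of q s])
    next
      case (scalar x \<alpha>)
      note F = scalar(4) and G = scalar(5) and \<psi> = scalar(6)
      note L = rc_Lm[OF cb_Lm[OF F G] \<psi>] cb_Lm[OF F rc_Lm[OF G \<psi>]] cb_Lm[OF rc_Lm[OF F \<psi>] G]
      show ?case using scalar(3)[OF F G \<psi>] scalar(1,2)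
        by (simp add: Lm_scalar[OF L(1)] Lm_scalar[OF L(2)] Lm_scalar[OF L(3)] hact_add hact_sg)
    next
      case (mult X i w)
      note X = mult(1) and F = mult(4) and G = mult(5) and \<psi> = mult(6)
      note l = lX_Lm[OF F X] lX_Lm[OF G X] lX_Lm[OF \<psi> X]
      have e1: "lX X (rc (cb s F G) q \<psi>) = sg (q * i) (sg (s * i) (rc (cb s (lX X F) G) q \<psi>) + rc (cb (s + i) F (lX X G)) q \<psi>)
          + rc (cb s F G) (q + i) (lX X \<psi>)"
        unfolding rc_lX[OF cb_Lm[OF F G] \<psi> X] cb_lX[OF F G X] rc_linear ..
      have A2: "rc (lX X G) q \<psi> \<in> Lm (s + q + i)" "rc G (q + i) (lX X \<psi>) \<in> Lm (s + q + i)"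
        using rc_Lm[OF l(2) \<psi>] rc_Lm[OF G l(3)] by (simp_all add: ac_simps)
      have e2: "lX X (cb (s + q) F (rc G q \<psi>)) = sg ((s + q) * i) (cb (s + q) (lX X F) (rc G q \<psi>)) +
          (sg (q * i) (cb (s + q + i) F (rc (lX X G) q \<psi>)) + cb (s + q + i) F (rc G (q + i) (lX X \<psi>)))"
        unfolding cb_lX[OF F rc_Lm[OF G \<psi>] X] rc_lX[OF G \<psi> X]
          cb_add_right[OF F Lm_sg[OF A2(1)] A2(2)] cb_sg(2)[OF F A2(1)] ..
      have A3: "rc (lX X F) q \<psi> \<in> Lm (p + q + i)" "rc F (q + i) (lX X \<psi>) \<in> Lm (p + q + i)"
        using rc_Lm[OF l(1) \<psi>] rc_Lm[OF F l(3)] by (simp_all add: ac_simps)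
      have e3: "lX X (cb s (rc F q \<psi>) G) = sg (s * i) (sg (q * i) (cb s (rc (lX X F) q \<psi>) G) + cb s (rc F (q + i) (lX X \<psi>)) G)
          + cb (s + i) (rc F q \<psi>) (lX X G)"
        unfolding cb_lX[OF rc_Lm[OF F \<psi>] G X] rc_lX[OF F \<psi> X]
          cb_add_left[OF Lm_sg[OF A3(1)] A3(2) G] cb_sg(1)[OF A3(1) G] ..
      show ?case using mult(3)[OF l(1) G \<psi>] mult(3)[OF F l(2) \<psi>] mult(3)[OF F G l(3)]
        unfolding plus_fun_apply sg_fun_apply unfolding lX_apply[OF mult(2)] e1 e2 e3
        by (simp add: sg_add algebra_simps)
    next
      case (add x y)
      note F = add(5) and G = add(6) and \<psi> = add(7)
      note L = rc_Lm[OF cb_Lm[OF F G] \<psi>] cb_Lm[OF F rc_Lm[OF G \<psi>]] cb_Lm[OF rc_Lm[OF F \<psi>] G]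
      show ?case using add(3)[OF F G \<psi>] add(4)[OF F G \<psi>] add(1,2)
        by (simp add: Lm_add[OF L(1)] Lm_add[OF L(2)] Lm_add[OF L(3)] sg_add)
    qed
  qed (simp add: cb_def rc_def)
qed

lemma lX_diff: "lX X (F - G) = lX X F - lX X G"
  by (auto simp: lX_def fun_eq_iff)

text \<open>Left multiplication of S transported to \<open>amb\<close>, so that it distributes over
  the sums and signs of that type.\<close>

definition mX where "mX y z = em (y \<odot> val S z)"

lemma mX_em: "y \<in> carrier S ==> z \<in> carrier S ==> em (y \<odot> z) = mX y (em z)"
  by (simp add: mX_def)

lemma mX_linear:
  assumes "y \<in> carrier S"
  shows "mX y (a + b) = mX y a + mX y b" "mX y (sg e a) = sg e (mX y a)" "mX y (a - b) = mX y a - mX y b"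
proof -
  show *: "mX y (a + b) = mX y a + mX y b" for a b using assms by (simp add: mX_def S.r_distr S.emb_add)
  show **: "mX y (sg e a) = sg e (mX y a)" for e a
    using assms by (simp add: mX_def SA.neg_pow_mult_right S.emb_neg_pow)
  show "mX y (a - b) = mX y a - mX y b" using *[of a "sg 1 b"] **[of 1 b] by simp
qed

lemma PsE_mult: "\<psi> \<in> Lm q ==> X \<in> gr \<gg> i ==> w \<in> carrier S ==>
    PsE q \<psi> (\<iota> X \<odot> w) = sg (q * i) (mX (\<iota> X) (PsE q \<psi> w)) + PsE (q + i) (lX X \<psi>) w"
  by (auto simp: PsE_def Ps_mult S.emb_add S.emb_neg_pow mX_em lX_Lm M.gr_closed)

text \<open>On X w, the terms with X in front of everything reduce to the claim at w, and the terms
  in which X is absorbed form the claims at w for the pairs (\<open>lX X \<psi>\<close>, \<chi>) and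
  (\<psi>, \<open>lX X \<chi>\<close>). Thus the commutator is again attached to an element of
  L.\<close>

theorem Ps_commutator:
  assumes "\<psi> \<in> Lm q" "\<chi> \<in> Lm r" "x \<in> carrier S"
  shows "PsE q \<psi> (Ps r \<chi> x) - sg (q * r) (PsE r \<chi> (Ps q \<psi> x)) =
    PsE (q + r) (rc \<psi> r \<chi> - sg (q * r) (rc \<chi> q \<psi>)) x"
  using assms(3,1,2)
proof (induction x arbitrary: \<psi> \<chi> q r rule: S_lin_induct)
  case one
  note \<psi> = one(1) and \<chi> = one(2)
  let ?Y = "val \<gg> (\<chi> \<one>\<^sub>S)" and ?Z = "val \<gg> (\<psi> \<one>\<^sub>S)"
  have Y: "?Y \<in> gr \<gg> r" "?Z \<in> gr \<gg> q" using val_gr[OF \<chi> one_gr_S] val_gr[OF \<psi> one_gr_S] by simp_all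
  have a: "PsE q \<psi> (\<iota> ?Y) = sg (q * r) (em (\<iota> ?Y \<odot> \<iota> ?Z)) + em (\<iota> (val \<gg> (\<psi> (\<iota> ?Y))))"
    using PsE_mult[OF \<psi> Y(1), of "\<one>\<^sub>S"] Ps_one[OF lX_Lm[OF \<psi> Y(1)]]
    by (simp add: PsE_def Ps_one[OF \<psi>] mX_em lX_def)
  have b: "PsE r \<chi> (\<iota> ?Z) = sg (r * q) (em (\<iota> ?Z \<odot> \<iota> ?Y)) + em (\<iota> (val \<gg> (\<chi> (\<iota> ?Z))))"
    using PsE_mult[OF \<chi> Y(2), of "\<one>\<^sub>S"] Ps_one[OF lX_Lm[OF \<chi> Y(2)]]
    by (simp add: PsE_def Ps_one[OF \<chi>] mX_em lX_def)
  \<comment> \<open>Supercommutativity makes the quadratic terms of the two orders of composition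
    cancel.\<close>
  have c: "em (\<iota> ?Z \<odot> \<iota> ?Y) = sg (q * r) (em (\<iota> ?Y \<odot> \<iota> ?Z))"
    by (simp add: \<iota>_comm[OF Y(2,1)] S.emb_neg_pow)
  have L: "rc \<psi> r \<chi> \<in> Lm (q + r)" "rc \<chi> q \<psi> \<in> Lm (q + r)"
    using rc_Lm[OF \<psi> \<chi>] rc_Lm[OF \<chi> \<psi>] by (simp_all add: ac_simps)
  have "PsE (q + r) (rc \<psi> r \<chi>) \<one>\<^sub>S = em (\<iota> (val \<gg> (\<psi> (\<iota> ?Y))))"
    "PsE (q + r) (rc \<chi> q \<psi>) \<one>\<^sub>S = em (\<iota> (val \<gg> (\<chi> (\<iota> ?Z))))"
    unfolding PsE_def Ps_one[OF L(1)] Ps_one[OF L(2)]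
    by (simp_all add: rc_def Ps_one[OF \<psi>] Ps_one[OF \<chi>])
  then show ?case
    using a b c
    unfolding PsE_diff[OF L(1) Lm_sg[OF L(2)] S.one_closed] PsE_sg[OF L(2) S.one_closed] Ps_one[OF \<psi>] Ps_one[OF \<chi>]
    by (simp add: sg_add mult.commute[of r q])
next
  case (scalar x \<alpha>)
  note \<psi> = scalar(4) and \<chi> = scalar(5)
  define \<theta> where "\<theta> = rc \<psi> r \<chi> - sg (q * r) (rc \<chi> q \<psi>)"
  have L: "\<theta> \<in> Lm (q + r)"
    unfolding \<theta>_def using rc_Lm[OF \<psi> \<chi>] rc_Lm[OF \<chi> \<psi>] by (auto simp: ac_simps intro!: Lm_diff Lm_sg)
  define ma where "ma z = em (val S z \<odot> \<kappa> \<alpha>)" for z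
  have ma: "em (z \<odot> \<kappa> \<alpha>) = ma (em z)" if "z \<in> carrier S" for z using that by (simp add: ma_def)
  have mal: "ma (a - sg e b) = ma a - sg e (ma b)" for a b e
  proof -
    have "ma (a + c) = ma a + ma c" for a c using scalar(2) by (simp add: ma_def S.l_distr S.emb_add)
    moreover have "ma (- sg e b) = - sg e (ma b)"
      using scalar(2) by (simp add: ma_def S.l_minus S.emb_a_inv SA.neg_pow_mult_left S.emb_neg_pow)
    ultimately show ?thesis by (metis diff_conv_add_uminus)
  qed
  show ?case unfolding \<theta>_def[symmetric]
    using arg_cong[OF scalar(3)[OF \<psi> \<chi>, folded \<theta>_def], of ma] \<psi> \<chi> L scalar(1,2)
    by (simp add: PsE_def Ps_scalar[OF \<psi>] Ps_scalar[OF \<chi>] Ps_scalar[OF L] ma mal)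
next
  case (mult X i w)
  note X = mult(1) and w = mult(2) and \<psi> = mult(4) and \<chi> = mult(5)
  have Xc: "\<iota> X \<in> carrier S" using X by auto
  note l = lX_Lm[OF \<psi> X] lX_Lm[OF \<chi> X]
  have swap: "PsE q \<psi> (Ps r \<chi> (\<iota> X \<odot> w)) = sg (r * i) (sg (q * i) (mX (\<iota> X) (PsE q \<psi> (Ps r \<chi> w)))
      + PsE (q + i) (lX X \<psi>) (Ps r \<chi> w)) + PsE q \<psi> (Ps (r + i) (lX X \<chi>) w)"
    if \<psi>: "\<psi> \<in> Lm q" and \<chi>: "\<chi> \<in> Lm r" for \<psi> \<chi> q r
  proof -
    have "PsE q \<psi> (Ps r \<chi> (\<iota> X \<odot> w)) = sg (r * i) (PsE q \<psi> (\<iota> X \<odot> Ps r \<chi> w)) + PsE q \<psi> (Ps (r + i) (lX X \<chi>) w)"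
      using \<psi> \<chi> w Xc lX_Lm[OF \<chi> X] by (simp add: PsE_def Ps_mult[OF \<chi> X w] Ps_add Ps_neg_pow S.emb_add S.emb_neg_pow)
    then show ?thesis using PsE_mult[OF \<psi> X, of "Ps r \<chi> w"] \<chi> w by simp
  qed
  have L: "rc \<psi> r \<chi> \<in> Lm (q + r)" "rc \<chi> q \<psi> \<in> Lm (q + r)"
    "rc (lX X \<psi>) r \<chi> \<in> Lm (q + r + i)" "rc \<psi> (r + i) (lX X \<chi>) \<in> Lm (q + r + i)"
    "rc (lX X \<chi>) q \<psi> \<in> Lm (q + r + i)" "rc \<chi> (q + i) (lX X \<psi>) \<in> Lm (q + r + i)"
    using rc_Lm[OF \<psi> \<chi>] rc_Lm[OF \<chi> \<psi>] rc_Lm[OF l(1) \<chi>] rc_Lm[OF \<psi> l(2)] rc_Lm[OF l(2) \<psi>] rc_Lm[OF \<chi> l(1)]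
    by (simp_all add: ac_simps)
  let ?\<theta> = "rc \<psi> r \<chi> - sg (q * r) (rc \<chi> q \<psi>)"
  have \<theta>: "?\<theta> \<in> Lm (q + r)" using L by (intro Lm_diff Lm_sg)
  have l\<theta>: "lX X ?\<theta> = sg (r * i) (rc (lX X \<psi>) r \<chi>) + rc \<psi> (r + i) (lX X \<chi>) -
      sg (q * r) (sg (q * i) (rc (lX X \<chi>) q \<psi>) + rc \<chi> (q + i) (lX X \<psi>))"
    unfolding lX_diff lX_linear rc_lX[OF \<psi> \<chi> X] rc_lX[OF \<chi> \<psi> X] ..
  have i1: "PsE (q + r) ?\<theta> w = PsE q \<psi> (Ps r \<chi> w) - sg (q * r) (PsE r \<chi> (Ps q \<psi> w))"
    by (rule mult(3)[OF \<psi> \<chi>, symmetric])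
  have i2: "PsE (q + i) (lX X \<psi>) (Ps r \<chi> w) - sg ((q + i) * r) (PsE r \<chi> (Ps (q + i) (lX X \<psi>) w)) =
      PsE (q + r + i) (rc (lX X \<psi>) r \<chi>) w - sg ((q + i) * r) (PsE (q + r + i) (rc \<chi> (q + i) (lX X \<psi>)) w)"
    using mult(3)[OF l(1) \<chi>]
    unfolding add.assoc[of q i r] add.commute[of i r] add.assoc[symmetric] PsE_diff[OF L(3) Lm_sg[OF L(6)] w] PsE_sg[OF L(6) w] .
  have i3: "PsE q \<psi> (Ps (r + i) (lX X \<chi>) w) - sg (q * (r + i)) (PsE (r + i) (lX X \<chi>) (Ps q \<psi> w)) =
      PsE (q + r + i) (rc \<psi> (r + i) (lX X \<chi>)) w - sg (q * (r + i)) (PsE (q + r + i) (rc (lX X \<chi>) q \<psi>) w)"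
    using mult(3)[OF \<psi> l(2)]
    unfolding add.assoc[symmetric] PsE_diff[OF L(4) Lm_sg[OF L(5)] w] PsE_sg[OF L(5) w] .
  have "PsE (q + r + i) (lX X ?\<theta>) w = sg (r * i) (PsE (q + r + i) (rc (lX X \<psi>) r \<chi>) w) + PsE (q + r + i) (rc \<psi> (r + i) (lX X \<chi>)) w
      - sg (q * r) (sg (q * i) (PsE (q + r + i) (rc (lX X \<chi>) q \<psi>) w) + PsE (q + r + i) (rc \<chi> (q + i) (lX X \<psi>)) w)"
    unfolding l\<theta> using L w by (simp only: PsE_diff PsE_plus PsE_sg Lm_plus Lm_sg)
  moreover have "PsE (q + i) (lX X \<psi>) (Ps r \<chi> w) = sg ((q + i) * r) (PsE r \<chi> (Ps (q + i) (lX X \<psi>) w)) +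
      PsE (q + r + i) (rc (lX X \<psi>) r \<chi>) w - sg ((q + i) * r) (PsE (q + r + i) (rc \<chi> (q + i) (lX X \<psi>)) w)"
    using i2 by (simp add: diff_eq_eq add.commute add_diff_eq)
  moreover have "PsE q \<psi> (Ps (r + i) (lX X \<chi>) w) = sg (q * (r + i)) (PsE (r + i) (lX X \<chi>) (Ps q \<psi> w)) +
      PsE (q + r + i) (rc \<psi> (r + i) (lX X \<chi>)) w - sg (q * (r + i)) (PsE (q + r + i) (rc (lX X \<chi>) q \<psi>) w)"
    using i3 by (simp add: diff_eq_eq add.commute add_diff_eq)
  ultimately show ?case
    unfolding PsE_mult[OF \<theta> X w] i1 swap[OF \<psi> \<chi>] swap[OF \<chi> \<psi>]
    using Xc by (simp only: mX_linear) (simp add: sg_add sg_diff algebra_simps)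
next
  case (add x y)
  note \<psi> = add(5) and \<chi> = add(6)
  define \<theta> where "\<theta> = rc \<psi> r \<chi> - sg (q * r) (rc \<chi> q \<psi>)"
  have L: "\<theta> \<in> Lm (q + r)"
    unfolding \<theta>_def using rc_Lm[OF \<psi> \<chi>] rc_Lm[OF \<chi> \<psi>] by (auto simp: ac_simps intro!: Lm_diff Lm_sg)
  show ?case unfolding \<theta>_def[symmetric]
    using add(3)[OF \<psi> \<chi>, folded \<theta>_def] add(4)[OF \<psi> \<chi>, folded \<theta>_def] \<psi> \<chi> L add(1,2)
    by (simp add: PsE_def Ps_add[OF \<psi>] Ps_add[OF \<chi>] Ps_add[OF L] S.emb_add sg_add algebra_simps)
qed

section \<open>These maps are coderivations\<close>

abbreviation "E \<equiv> Hom K S S"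

definition PH where "PH q \<psi> = (\<lambda>x\<in>carrier S. Ps q \<psi> x)"

lemma Ps_act: "\<psi> \<in> Lm q ==> x \<in> carrier S ==> \<alpha> \<in> carrier K ==> Ps q \<psi> (x \<bullet>\<^bsub>S\<^esub> \<alpha>) = Ps q \<psi> x \<bullet>\<^bsub>S\<^esub> \<alpha>"
  by (simp add: S_act Ps_scalar)

lemma PH_gr: "\<psi> \<in> Lm q ==> PH q \<psi> \<in> gr E q"
  unfolding PH_def by (rule TT.Hom_grI[OF TT.HomI]) (auto simp: Ps_add Ps_act Ps_gr)

text \<open>The map id \<otimes> G on pairs, for G of parity q; the twist is the sign of moving G
  past the first factor.\<close>

definition gl where "gl q G = (\<lambda>v w. pur (twist S q v) (G w))"

lemma gl_balanced:
  assumes G: "G \<in> gr E q"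
  shows "gl q G \<in> balanced K S S TG"
proof (rule balancedI)
  note Gc = TT.Hom_closed[OF TT.Hom_gr_closed[OF G]] and Ga = TT.Hom_additive[OF TT.Hom_gr_closed[OF G]]
  show "gl q G m \<in> additive_maps S TG" if "m \<in> carrier S" for m
    unfolding gl_def using that by (intro additive_maps_comp[OF Ga balanced_right[OF TT.pure_balanced]]) auto
  show "(\<lambda>m. gl q G m n) \<in> additive_maps S TG" if "n \<in> carrier S" for n
    unfolding gl_def using that Gc by (intro additive_maps_comp[OF SA.M.twist_additive balanced_left[OF TT.pure_balanced]]) auto
  fix m n j \<alpha> i assume *: "m \<in> carrier S" "n \<in> gr S j" "\<alpha> \<in> gr K i"
  then have c: "n \<in> carrier S" "\<alpha> \<in> carrier K" "twist S q m \<in> carrier S" using gr_S_closed by auto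
  have n: "G n \<in> gr S (q + j)" using TT.Hom_gr[OF G *(2)] .
  have "pur (twist S q (m \<bullet>\<^bsub>S\<^esub> \<alpha>)) (G n) = neg_pow TG (q * i) (pur (twist S q m \<bullet>\<^bsub>S\<^esub> \<alpha>) (G n))"
    using * c Gc by (simp add: SA.twist_act TT.pure_neg_pow_left SA.act_closed)
  also have "\<dots> = neg_pow TG (q * i + i * (q + j)) (pur (twist S q m) (G n \<bullet>\<^bsub>S\<^esub> \<alpha>))"
    using c Gc by (simp add: balanced_scalar[OF TT.pure_balanced c(3) n *(3)] SA.act_closed)
  finally show "gl q G (m \<bullet>\<^bsub>S\<^esub> \<alpha>) n = neg_pow TG (i * j) (gl q G m (n \<bullet>\<^bsub>S\<^esub> \<alpha>))"
    using c by (simp add: gl_def TT.Hom_act[OF TT.Hom_gr_closed[OF G]] distrib_left mult.commute[of q i])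
qed

lemma left_balanced:
  assumes F: "F \<in> carrier E"
  shows "(\<lambda>v w. pur (F v) w) \<in> balanced K S S TG"
proof (rule balancedI)
  note Fc = TT.Hom_closed[OF F]
  show "pur (F m) \<in> additive_maps S TG" if "m \<in> carrier S" for m
    using that Fc by (intro balanced_right[OF TT.pure_balanced]) auto
  show "(\<lambda>m. pur (F m) n) \<in> additive_maps S TG" if "n \<in> carrier S" for n
    by (rule additive_maps_comp[OF TT.Hom_additive[OF F] balanced_left[OF TT.pure_balanced that]])
  fix m n j \<alpha> i assume *: "m \<in> carrier S" "n \<in> gr S j" "\<alpha> \<in> gr K i"
  then show "pur (F (m \<bullet>\<^bsub>S\<^esub> \<alpha>)) n = neg_pow TG (i * j) (pur (F m) (n \<bullet>\<^bsub>S\<^esub> \<alpha>))"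
    using balanced_scalar[OF TT.pure_balanced Fc *(2,3), of m] by (simp add: TT.Hom_act[OF F] K.gr_closed)
qed

text \<open>On pairs, the right-hand side of the coderivation identity: Psi \<otimes> id + id
  \<otimes> Psi for the coderivation attached to \<psi>.\<close>

definition cdf where "cdf q \<psi> = (\<lambda>u v. pur (Ps q \<psi> u) v \<boxplus> pur (twist S q u) (Ps q \<psi> v))"

lemma cdf_balanced:
  assumes "\<psi> \<in> Lm q"
  shows "cdf q \<psi> \<in> balanced K S S TG"
  by (rule TT.balanced_cong[OF TT.balanced_sum[OF TT.TG_abelian
          left_balanced[OF TT.Hom_gr_closed[OF PH_gr]] gl_balanced[OF PH_gr]]])
    (use assms in \<open>auto simp: cdf_def PH_def gl_def\<close>)

lemma twist_Ps:
  assumes \<psi>: "\<psi> \<in> Lm q" and u: "u \<in> gr S l"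
  shows "Ps q \<psi> (twist S i u) = neg_pow S (q * i) (twist S i (Ps q \<psi> u))"
proof -
  have "Ps q \<psi> u \<in> gr S (q + l)" using Ps_gr[OF u \<psi>] .
  then show ?thesis using u \<psi> gr_S_closed by (simp add: Ps_neg_pow distrib_left mult.commute[of q i])
qed

text \<open>Under multiplication by \<open>dX X\<close> the map Psi \<otimes> id + id \<otimes> Psi
  obeys the same recursion as Psi does under multiplication by X. Both sides are additive in y, so
  homogeneous pure tensors suffice.\<close>

lemma cd_dX:
  assumes \<psi>: "\<psi> \<in> Lm q" and X: "X \<in> gr \<gg> i" and y: "y \<in> carrier TG"
  shows "tensor_lift TG (cdf q \<psi>) (dX X \<bowtie> y) =
    neg_pow TG (q * i) (dX X \<bowtie> tensor_lift TG (cdf q \<psi>) y) \<boxplus> tensor_lift TG (cdf (q + i) (lX X \<psi>)) y"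
proof -
  note l = lX_Lm[OF \<psi> X]
  have Xc: "X \<in> carrier \<gg>" "\<iota> X \<in> carrier S" using X by auto
  note b = cdf_balanced[OF \<psi>] cdf_balanced[OF l]
  note ad = TT.tensor_lift_additive[OF TT.TG_abelian b(1)] TT.tensor_lift_additive[OF TT.TG_abelian b(2)]
  show ?thesis
  proof (rule TT.TG_additive_eqI[OF y additive_maps_comp[OF TT.T_mult_additive_right ad(1)]
        additive_maps_sum[OF TT.TG_abelian additive_maps_sgn[OF TT.TG_abelian additive_maps_comp[OF ad(1) TT.T_mult_additive_right]] ad(2)]])
    show "dX X \<in> carrier TG" "dX X \<in> carrier TG" using Xc by auto
    fix k u j v assume uv: "u \<in> gr S k" "v \<in> gr S j"
    then have c: "u \<in> carrier S" "v \<in> carrier S" using gr_S_closed by auto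
    \<comment> \<open>The equation between tensors is verified in \<open>amb\<close>, where the
      eight or so signed terms can be matched by ring normalisation, and pulled back by injectivity
      of \<open>emb\<close>.\<close>
    let ?E = "emb TG"
    let ?t = "\<lambda>a b. ?E (pur a b)"
    have tn: "?t (neg_pow S e a) b' = sg e (?t a b')" "?t a (neg_pow S e b') = sg e (?t a b')"
      if "a \<in> carrier S" "b' \<in> carrier S" for e a b'
      using that by (simp_all add: TT.pure_neg_pow_left TT.pure_neg_pow_right TT.TG.emb_neg_pow)
    have ta: "?t (a \<oplus>\<^bsub>S\<^esub> a') b' = ?t a b' + ?t a' b'" "?t b' (a \<oplus>\<^bsub>S\<^esub> a') = ?t b' a + ?t b' a'"
      if "a \<in> carrier S" "a' \<in> carrier S" "b' \<in> carrier S" for a a' b'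
      using that by (simp_all add: TT.pure_add_left TT.pure_add_right TT.TG.emb_add)
    have cd: "?E (cdf q' \<psi>' a b') = ?t (Ps q' \<psi>' a) b' + ?t (twist S q' a) (Ps q' \<psi>' b')"
      if "a \<in> carrier S" "b' \<in> carrier S" "\<psi>' \<in> Lm q'" for a b' \<psi>' q'
      using that by (simp add: cdf_def TT.TG.emb_add)
    have lhs: "?E (tensor_lift TG (cdf q \<psi>) (dX X \<bowtie> pur u v)) =
        ?E (cdf q \<psi> (\<iota> X \<odot> u) v) + ?E (cdf q \<psi> (twist S i u) (\<iota> X \<odot> v))"
      using c Xc balanced_closed[OF b(1)]
      by (simp add: dX_pure[OF X] additive_maps_add[OF ad(1)] TT.tensor_lift_pure[OF TT.TG_abelian b(1)] TT.TG.emb_add)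
    have dX': "?E (dX X \<bowtie> pur a b') = ?t (\<iota> X \<odot> a) b' + ?t (twist S i a) (\<iota> X \<odot> b')"
      if "a \<in> carrier S" "b' \<in> carrier S" for a b'
      using that Xc by (simp add: dX_pure[OF X] TT.TG.emb_add)
    have rhs: "?E (neg_pow TG (q * i) (dX X \<bowtie> tensor_lift TG (cdf q \<psi>) (pur u v)) \<boxplus>
        tensor_lift TG (cdf (q + i) (lX X \<psi>)) (pur u v)) =
      sg (q * i) (?E (dX X \<bowtie> pur (Ps q \<psi> u) v) + ?E (dX X \<bowtie> pur (twist S q u) (Ps q \<psi> v))) +
        ?E (cdf (q + i) (lX X \<psi>) u v)"
    proof -
      have "dX X \<bowtie> cdf q \<psi> u v = dX X \<bowtie> pur (Ps q \<psi> u) v \<boxplus> dX X \<bowtie> pur (twist S q u) (Ps q \<psi> v)"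
        unfolding cdf_def using c \<psi> Xc by (intro additive_maps_add[OF TT.T_mult_additive_right]) auto
      then show ?thesis
        using c \<psi> Xc balanced_closed[OF b(2)]
        by (simp add: TT.tensor_lift_pure[OF TT.TG_abelian b(1)] TT.tensor_lift_pure[OF TT.TG_abelian b(2)]
            TT.TG.emb_add TT.TG.emb_neg_pow)
    qed
    have "?E (tensor_lift TG (cdf q \<psi>) (dX X \<bowtie> pur u v)) =
        ?E (neg_pow TG (q * i) (dX X \<bowtie> tensor_lift TG (cdf q \<psi>) (pur u v)) \<boxplus>
        tensor_lift TG (cdf (q + i) (lX X \<psi>)) (pur u v))"
      unfolding lhs rhs using c \<psi> l Xc uv
      by (simp add: cd dX' del: SA.M.twist_gr)
        (simp add: Ps_mult[OF \<psi> X] ta tn twist_Ps[OF \<psi>] SA.twist_mult[OF iota_gr[OF X]] SA.M.twist_twist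
          sg_add algebra_simps del: SA.M.twist_gr)
    then show "tensor_lift TG (cdf q \<psi>) (dX X \<bowtie> pur u v) =
        neg_pow TG (q * i) (dX X \<bowtie> tensor_lift TG (cdf q \<psi>) (pur u v)) \<boxplus>
        tensor_lift TG (cdf (q + i) (lX X \<psi>)) (pur u v)"
    proof (rule TT.TG.emb_inject)
      have uv': "pur u v \<in> carrier TG" using c by simp
      show "tensor_lift TG (cdf q \<psi>) (dX X \<bowtie> pur u v) \<in> carrier TG"
        using uv' Xc by (intro additive_maps_closed[OF ad(1)]) auto
      show "neg_pow TG (q * i) (dX X \<bowtie> tensor_lift TG (cdf q \<psi>) (pur u v)) \<boxplus>
          tensor_lift TG (cdf (q + i) (lX X \<psi>)) (pur u v) \<in> carrier TG"
        using Xc additive_maps_closed[OF ad(1) uv'] additive_maps_closed[OF ad(2) uv'] by auto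
    qed
  qed
qed

text \<open>By \<open>Ps_mult\<close> and \<open>cd_dX\<close> both sides satisfy the same recursion
  on words, and at 1 both are \<open>dX\<close> of the element \<psi>(1).\<close>

theorem Ps_coderivation:
  assumes "\<psi> \<in> Lm q" "x \<in> carrier S"
  shows "\<Delta> (Ps q \<psi> x) = tensor_lift TG (cdf q \<psi>) (\<Delta> x)"
  using assms(2,1)
proof (induction x arbitrary: \<psi> q rule: S_lin_induct)
  case one
  have Y: "val \<gg> (\<psi> \<one>\<^sub>S) \<in> carrier \<gg>" by simp
  show ?case using one
    by (simp add: TT.tensor_lift_pure[OF TT.TG_abelian cdf_balanced])
      (simp add: cdf_def Ps_one coproduct_iota dX_def SA.M.twist_gr[OF one_gr_S])
next
  case (scalar x \<alpha>)
  note \<psi> = scalar(4)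
  note b = cdf_balanced[OF \<psi>]
  note a = act_tensor_lift[OF TT.TG_abelian b \<Delta>_closed[OF scalar(1)] scalar(2)]
  have pa: "pur u v \<bullet>\<^bsub>TT.T\<^esub> \<alpha> = pur u (v \<odot> \<kappa> \<alpha>)" if "u \<in> carrier S" "v \<in> carrier S" for u v
    using that scalar(2) by (simp add: TT.T_act TT.tensor_lift_pure[OF TT.TG_abelian TT.act_balanced] S_act)
  have aa: "(\<lambda>y. y \<bullet>\<^bsub>TT.T\<^esub> \<alpha>) \<in> additive_maps TG TG"
    unfolding TT.T_act by (rule TT.tensor_lift_additive[OF TT.TG_abelian TT.act_balanced[OF scalar(2)]])
  have "tensor_lift TG (\<lambda>u v. cdf q \<psi> u (v \<odot> \<kappa> \<alpha>)) (\<Delta> x) = tensor_lift TG (cdf q \<psi>) (\<Delta> x) \<bullet>\<^bsub>TT.T\<^esub> \<alpha>"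
  proof (rule TT.TG_additive_eqI[OF \<Delta>_closed[OF scalar(1)] TT.tensor_lift_additive[OF TT.TG_abelian a(2)]
        additive_maps_comp[OF TT.tensor_lift_additive[OF TT.TG_abelian b] aa]])
    fix k u j v assume "u \<in> gr S k" "v \<in> gr S j"
    then have c: "u \<in> carrier S" "v \<in> carrier S" using gr_S_closed by auto
    have "tensor_lift TG (\<lambda>u v. cdf q \<psi> u (v \<odot> \<kappa> \<alpha>)) (pur u v) = cdf q \<psi> u (v \<odot> \<kappa> \<alpha>)"
      by (rule TT.tensor_lift_pure[OF TT.TG_abelian a(2) c])
    also have "\<dots> = cdf q \<psi> u v \<bullet>\<^bsub>TT.T\<^esub> \<alpha>"
      using c \<psi> scalar(2) unfolding cdf_def by (simp add: Ps_scalar additive_maps_add[OF aa] pa)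
    finally show "tensor_lift TG (\<lambda>u v. cdf q \<psi> u (v \<odot> \<kappa> \<alpha>)) (pur u v) =
        tensor_lift TG (cdf q \<psi>) (pur u v) \<bullet>\<^bsub>TT.T\<^esub> \<alpha>"
      unfolding TT.tensor_lift_pure[OF TT.TG_abelian b c] .
  qed
  then show ?case using scalar(3)[OF \<psi>] scalar(1,2) \<psi> by (simp add: Ps_scalar \<Delta>_scalar a(1))
next
  case (mult X i w)
  note \<psi> = mult(4) and X = mult(1)
  note l = lX_Lm[OF \<psi> X]
  have Xc: "X \<in> carrier \<gg>" "\<iota> X \<in> carrier S" using X by auto
  have "\<Delta> (Ps q \<psi> (\<iota> X \<odot> w)) = neg_pow TG (q * i) (dX X \<bowtie> \<Delta> (Ps q \<psi> w)) \<boxplus> \<Delta> (Ps (q + i) (lX X \<psi>) w)"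
    using Xc mult(2) \<psi> l
    by (simp add: Ps_mult[OF \<psi> X] additive_maps_add[OF \<Delta>_additive] additive_maps_neg_pow[OF \<Delta>_additive S_ab TT.TG_abelian] \<Delta>_mult)
  then show ?case using mult(3)[OF \<psi>] mult(3)[OF l] mult(2) Xc by (simp add: \<Delta>_mult cd_dX[OF \<psi> X])
next
  case (add x y)
  then show ?case
    by (simp add: Ps_add additive_maps_add[OF \<Delta>_additive]
        additive_maps_add[OF TT.tensor_lift_additive[OF TT.TG_abelian cdf_balanced]])
qed

end

section \<open>The counit and the projection to degree one\<close>

context graded_right_module
begin

lemma lact_one: assumes "m \<in> carrier M" shows "lact K M \<one>\<^bsub>K\<^esub> m = m"
  using assms
proof (induction m rule: M.gr_induct)
  case (gr i y)
  then show ?case by (simp add: lact_gr[OF _ K.gr_one] act_one M.gr_closed)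
next
  case (add y z)
  then show ?case by (simp add: additive_maps_add[OF lact_additive])
qed

text \<open>The left action puts the scalars behind m in reversed order; the sign of exchanging them
  by supercommutativity is the one collected by acting twice.\<close>

lemma lact_mult:
  assumes "m \<in> carrier M" "\<alpha> \<in> carrier K" "\<beta> \<in> carrier K"
  shows "lact K M (\<alpha> \<otimes>\<^bsub>K\<^esub> \<beta>) m = lact K M \<alpha> (lact K M \<beta> m)"
  using assms(2)
proof (induction \<alpha> rule: K.gr_induct)
  case (gr i \<alpha>)
  from assms(3) show ?case
  proof (induction \<beta> rule: K.gr_induct)
    case (gr j \<beta>)
    from assms(1) show ?case
    proof (induction m rule: M.gr_induct)
      case (gr k m)
      note \<alpha> = \<open>\<alpha> \<in> gr K i\<close> and \<beta> = \<open>\<beta> \<in> gr K j\<close>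
      have c: "\<alpha> \<in> carrier K" "\<beta> \<in> carrier K" "m \<in> carrier M" using \<alpha> \<beta> gr by auto
      have "\<alpha> \<otimes>\<^bsub>K\<^esub> \<beta> \<in> gr K (i + j)" using \<alpha> \<beta> by (rule K.gr_mult)
      then have "lact K M (\<alpha> \<otimes>\<^bsub>K\<^esub> \<beta>) m = neg_pow M ((i + j) * k) (m \<bullet>\<^bsub>M\<^esub> (\<alpha> \<otimes>\<^bsub>K\<^esub> \<beta>))" using gr by (simp add: lact_gr)
      also have "m \<bullet>\<^bsub>M\<^esub> (\<alpha> \<otimes>\<^bsub>K\<^esub> \<beta>) = neg_pow M (i * j) (m \<bullet>\<^bsub>M\<^esub> \<beta> \<bullet>\<^bsub>M\<^esub> \<alpha>)"
        using c K.supercommutative[OF \<alpha> \<beta>] by (simp add: act_neg_pow_right act_mult)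
      finally have l: "lact K M (\<alpha> \<otimes>\<^bsub>K\<^esub> \<beta>) m = neg_pow M ((i + j) * k + i * j) (m \<bullet>\<^bsub>M\<^esub> \<beta> \<bullet>\<^bsub>M\<^esub> \<alpha>)"
        using c by (simp add: act_closed)
      have mb: "m \<bullet>\<^bsub>M\<^esub> \<beta> \<in> gr M (k + j)" using gr \<beta> by (rule act_gr)
      have "lact K M \<alpha> (lact K M \<beta> m) = neg_pow M (j * k) (lact K M \<alpha> (m \<bullet>\<^bsub>M\<^esub> \<beta>))"
        using gr \<beta> c by (simp add: lact_gr[OF gr \<beta>] additive_maps_neg_pow[OF lact_additive M_ab M_ab] act_closed)
      also have "\<dots> = neg_pow M (j * k + i * (k + j)) (m \<bullet>\<^bsub>M\<^esub> \<beta> \<bullet>\<^bsub>M\<^esub> \<alpha>)"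
        using c by (simp add: lact_gr[OF mb \<alpha>] act_closed)
      finally show ?case using l by (simp add: algebra_simps)
    next
      case (add y z)
      then show ?case using gr \<open>\<alpha> \<in> gr K i\<close>
        by (simp add: additive_maps_add[OF lact_additive] lact_closed K.gr_closed)
    qed
  next
    case (add y z)
    then show ?case using gr assms(1)
      by (simp add: K.r_distr lact_add_scalar K.gr_closed additive_maps_add[OF lact_additive] lact_closed)
  qed
next
  case (add y z)
  then show ?case using assms by (simp add: K.l_distr lact_add_scalar lact_closed)
qed

lemma lact_act:
  assumes "m \<in> carrier M" "\<alpha> \<in> carrier K" "\<beta> \<in> carrier K"
  shows "lact K M \<alpha> (m \<bullet>\<^bsub>M\<^esub> \<beta>) = lact K M \<alpha> m \<bullet>\<^bsub>M\<^esub> \<beta>"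
  using assms(2)
proof (induction \<alpha> rule: K.gr_induct)
  case (gr i \<alpha>)
  from assms(3) show ?case
  proof (induction \<beta> rule: K.gr_induct)
    case (gr j \<beta>)
    from assms(1) show ?case
    proof (induction m rule: M.gr_induct)
      case (gr k m)
      note \<alpha> = \<open>\<alpha> \<in> gr K i\<close> and \<beta> = \<open>\<beta> \<in> gr K j\<close>
      have c: "\<alpha> \<in> carrier K" "\<beta> \<in> carrier K" "m \<in> carrier M" using \<alpha> \<beta> gr by auto
      have mb: "m \<bullet>\<^bsub>M\<^esub> \<beta> \<in> gr M (k + j)" using gr \<beta> by (rule act_gr)
      have "m \<bullet>\<^bsub>M\<^esub> \<beta> \<bullet>\<^bsub>M\<^esub> \<alpha> = neg_pow M (i * j) (m \<bullet>\<^bsub>M\<^esub> \<alpha> \<bullet>\<^bsub>M\<^esub> \<beta>)"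
        using c K.supercommutative[OF \<beta> \<alpha>] by (simp add: act_mult[symmetric] act_neg_pow_right mult.commute[of j i])
      then show ?case using c
        by (simp add: lact_gr[OF mb \<alpha>] lact_gr[OF gr \<alpha>] act_neg_pow_left act_closed distrib_left)
    next
      case (add y z)
      then show ?case using gr \<open>\<alpha> \<in> gr K i\<close>
        by (simp add: act_add_left additive_maps_add[OF lact_additive] lact_closed K.gr_closed act_closed)
    qed
  next
    case (add y z)
    then show ?case using gr assms(1)
      by (simp add: act_add_right K.gr_closed additive_maps_add[OF lact_additive] lact_closed act_closed)
  qed
next
  case (add y z)
  then show ?case using assms by (simp add: act_closed lact_add_scalar lact_closed act_add_left)
qed

text \<open>The square-zero extension $\mathbb K\oplus M$.\<close>

definition sqz :: "('k \<times> 'm) ring"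
  where "sqz = \<lparr>carrier = carrier K \<times> carrier M,
    mult = (\<lambda>(\<alpha>, x) (\<beta>, y). (\<alpha> \<otimes>\<^bsub>K\<^esub> \<beta>, lact K M \<alpha> y \<oplus>\<^bsub>M\<^esub> x \<bullet>\<^bsub>M\<^esub> \<beta>)), one = (\<one>\<^bsub>K\<^esub>, \<zero>\<^bsub>M\<^esub>),
    zero = (\<zero>\<^bsub>K\<^esub>, \<zero>\<^bsub>M\<^esub>), add = (\<lambda>(\<alpha>, x) (\<beta>, y). (\<alpha> \<oplus>\<^bsub>K\<^esub> \<beta>, x \<oplus>\<^bsub>M\<^esub> y))\<rparr>"

lemma sqz_simps [simp]:
  "carrier sqz = carrier K \<times> carrier M" "\<one>\<^bsub>sqz\<^esub> = (\<one>\<^bsub>K\<^esub>, \<zero>\<^bsub>M\<^esub>)" "\<zero>\<^bsub>sqz\<^esub> = (\<zero>\<^bsub>K\<^esub>, \<zero>\<^bsub>M\<^esub>)"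
  "(\<alpha>, x) \<otimes>\<^bsub>sqz\<^esub> (\<beta>, y) = (\<alpha> \<otimes>\<^bsub>K\<^esub> \<beta>, lact K M \<alpha> y \<oplus>\<^bsub>M\<^esub> x \<bullet>\<^bsub>M\<^esub> \<beta>)"
  "(\<alpha>, x) \<oplus>\<^bsub>sqz\<^esub> (\<beta>, y) = (\<alpha> \<oplus>\<^bsub>K\<^esub> \<beta>, x \<oplus>\<^bsub>M\<^esub> y)"
  by (simp_all add: sqz_def)

lemma lact_zero [simp]: "\<alpha> \<in> carrier K ==> lact K M \<alpha> \<zero>\<^bsub>M\<^esub> = \<zero>\<^bsub>M\<^esub>"
  by (rule additive_maps_zero[OF lact_additive M_ab M_ab])

lemma lact_zero_scalar [simp]: "m \<in> carrier M ==> lact K M \<zero>\<^bsub>K\<^esub> m = \<zero>\<^bsub>M\<^esub>"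
  using lact_add_scalar[of "\<zero>\<^bsub>K\<^esub>" "\<zero>\<^bsub>K\<^esub>" m] lact_closed[of m "\<zero>\<^bsub>K\<^esub>"] by (simp add: M.add.l_cancel_one')

lemma sqz_ring: "ring sqz"
proof (rule ringI)
  show "abelian_group sqz"
  proof (rule abelian_groupI)
    fix x assume "x \<in> carrier sqz"
    then obtain \<alpha> m where "x = (\<alpha>, m)" "\<alpha> \<in> carrier K" "m \<in> carrier M" by auto
    then show "\<exists>y\<in>carrier sqz. y \<oplus>\<^bsub>sqz\<^esub> x = \<zero>\<^bsub>sqz\<^esub>"
      by (intro bexI[of _ "(\<ominus>\<^bsub>K\<^esub> \<alpha>, \<ominus>\<^bsub>M\<^esub> m)"]) (auto simp: K.l_neg M.l_neg)
  qed (auto simp: K.a_ac M.a_ac)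
  show "Group.monoid sqz"
  proof (rule monoidI)
    fix x y z assume "x \<in> carrier sqz" "y \<in> carrier sqz" "z \<in> carrier sqz"
    then obtain \<alpha> u \<beta> v \<gamma> w where "x = (\<alpha>, u)" "y = (\<beta>, v)" "z = (\<gamma>, w)"
      and c: "\<alpha> \<in> carrier K" "u \<in> carrier M" "\<beta> \<in> carrier K" "v \<in> carrier M" "\<gamma> \<in> carrier K" "w \<in> carrier M" by auto
    then show "x \<otimes>\<^bsub>sqz\<^esub> y \<otimes>\<^bsub>sqz\<^esub> z = x \<otimes>\<^bsub>sqz\<^esub> (y \<otimes>\<^bsub>sqz\<^esub> z)"
      using lact_closed act_closed
      by (simp add: K.m_assoc lact_mult act_add_left lact_act act_mult additive_maps_add[OF lact_additive] M.a_assoc)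
  qed (auto simp: lact_closed act_closed lact_one act_one)
next
  fix x y z assume "x \<in> carrier sqz" "y \<in> carrier sqz" "z \<in> carrier sqz"
  then obtain \<alpha> u \<beta> v \<gamma> w where xyz: "x = (\<alpha>, u)" "y = (\<beta>, v)" "z = (\<gamma>, w)"
    and c: "\<alpha> \<in> carrier K" "u \<in> carrier M" "\<beta> \<in> carrier K" "v \<in> carrier M" "\<gamma> \<in> carrier K" "w \<in> carrier M" by auto
  show "(x \<oplus>\<^bsub>sqz\<^esub> y) \<otimes>\<^bsub>sqz\<^esub> z = x \<otimes>\<^bsub>sqz\<^esub> z \<oplus>\<^bsub>sqz\<^esub> y \<otimes>\<^bsub>sqz\<^esub> z"
    using c lact_closed act_closed
    by (simp add: xyz K.l_distr lact_add_scalar act_add_left M.add_swap4)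
  show "z \<otimes>\<^bsub>sqz\<^esub> (x \<oplus>\<^bsub>sqz\<^esub> y) = z \<otimes>\<^bsub>sqz\<^esub> x \<oplus>\<^bsub>sqz\<^esub> z \<otimes>\<^bsub>sqz\<^esub> y"
    using c lact_closed act_closed
    by (simp add: xyz K.r_distr additive_maps_add[OF lact_additive] act_add_right M.add_swap4)
qed

end

context sym_alg
begin

text \<open>The counit and the projection of $S(\mathfrak g)$ to $\mathfrak g$, as the components of one ring morphism.\<close>

definition "sqz_hom = (SOME f. f \<in> ring_hom S sqz \<and> (\<forall>\<alpha>\<in>carrier K. f (\<kappa> \<alpha>) = (\<alpha>, \<zero>\<^bsub>\<gg>\<^esub>)) \<and>
  (\<forall>X\<in>carrier \<gg>. f (\<iota> X) = (\<zero>\<^bsub>K\<^esub>, X)))"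

definition "\<epsilon> x = fst (sqz_hom x)"
definition "\<pi> x = snd (sqz_hom x)"

text \<open>Generators are sent to the square-zero part, where all products vanish; the commutation
  relations and the vanishing of odd squares therefore hold automatically.\<close>

lemma sqz_hom: "sqz_hom \<in> ring_hom S sqz" "\<alpha> \<in> carrier K ==> sqz_hom (\<kappa> \<alpha>) = (\<alpha>, \<zero>\<^bsub>\<gg>\<^esub>)"
  "X \<in> carrier \<gg> ==> sqz_hom (\<iota> X) = (\<zero>\<^bsub>K\<^esub>, X)"
proof -
  have sn: "neg_pow sqz e (\<zero>\<^bsub>K\<^esub>, \<zero>\<^bsub>\<gg>\<^esub>) = (\<zero>\<^bsub>K\<^esub>, \<zero>\<^bsub>\<gg>\<^esub>)" for e
    using abelian_group.neg_pow_zero[OF ring.is_abelian_group[OF sqz_ring]] by simp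
  obtain f where f: "f \<in> ring_hom S sqz" "\<And>\<alpha>. \<alpha> \<in> carrier K ==> f (\<kappa> \<alpha>) = (\<alpha>, \<zero>\<^bsub>\<gg>\<^esub>)"
    "\<And>X. X \<in> carrier \<gg> ==> f (\<iota> X) = (\<zero>\<^bsub>K\<^esub>, X)"
    by (rule S_universal[OF sqz_ring, of "\<lambda>\<alpha>. (\<alpha>, \<zero>\<^bsub>\<gg>\<^esub>)" "\<lambda>X. (\<zero>\<^bsub>K\<^esub>, X)"])
      (auto simp: act_closed lact_gr M.gr_closed K.gr_closed sn)
  have "sqz_hom \<in> ring_hom S sqz \<and> (\<forall>\<alpha>\<in>carrier K. sqz_hom (\<kappa> \<alpha>) = (\<alpha>, \<zero>\<^bsub>\<gg>\<^esub>)) \<and>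
    (\<forall>X\<in>carrier \<gg>. sqz_hom (\<iota> X) = (\<zero>\<^bsub>K\<^esub>, X))"
    unfolding sqz_hom_def by (rule someI[of _ f]) (use f in auto)
  then show "sqz_hom \<in> ring_hom S sqz" "\<alpha> \<in> carrier K ==> sqz_hom (\<kappa> \<alpha>) = (\<alpha>, \<zero>\<^bsub>\<gg>\<^esub>)"
    "X \<in> carrier \<gg> ==> sqz_hom (\<iota> X) = (\<zero>\<^bsub>K\<^esub>, X)" by auto
qed

interpretation sh: ring_hom_ring S sqz sqz_hom
  by (rule ring_hom_ringI2[OF S.ring_axioms sqz_ring sqz_hom(1)])

lemma sqz_hom_eq: "sqz_hom x = (\<epsilon> x, \<pi> x)"
  by (simp add: \<epsilon>_def \<pi>_def)

lemma \<epsilon>_closed [simp, intro]: "x \<in> carrier S ==> \<epsilon> x \<in> carrier K"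
  and \<pi>_closed [simp, intro]: "x \<in> carrier S ==> \<pi> x \<in> carrier \<gg>"
  using sh.hom_closed[of x] by (simp_all add: sqz_hom_eq)

lemma \<epsilon>_additive: "\<epsilon> \<in> additive_maps S K" and \<pi>_additive: "\<pi> \<in> additive_maps S \<gg>"
  using sh.hom_add by (auto intro!: additive_mapsI simp: sqz_hom_eq)

lemma \<epsilon>_one [simp]: "\<epsilon> \<one>\<^sub>S = \<one>\<^bsub>K\<^esub>" and \<pi>_one [simp]: "\<pi> \<one>\<^sub>S = \<zero>\<^bsub>\<gg>\<^esub>"
  using sh.hom_one by (simp_all add: sqz_hom_eq)

lemma \<epsilon>_scalar: "x \<in> carrier S ==> \<alpha> \<in> carrier K ==> \<epsilon> (x \<odot> \<kappa> \<alpha>) = \<epsilon> x \<star> \<alpha>"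
  and \<pi>_scalar: "x \<in> carrier S ==> \<alpha> \<in> carrier K ==> \<pi> (x \<odot> \<kappa> \<alpha>) = \<pi> x \<triangleleft> \<alpha>"
  using sh.hom_mult[of x "\<kappa> \<alpha>"] sqz_hom(2)[of \<alpha>] by (simp_all add: sqz_hom_eq act_closed)

lemma \<epsilon>_mult: "X \<in> carrier \<gg> ==> x \<in> carrier S ==> \<epsilon> (\<iota> X \<odot> x) = \<zero>\<^bsub>K\<^esub>"
  and \<pi>_mult: "X \<in> carrier \<gg> ==> x \<in> carrier S ==> \<pi> (\<iota> X \<odot> x) = X \<triangleleft> \<epsilon> x"
  using sh.hom_mult[of "\<iota> X" x] sqz_hom(3)[of X] by (simp_all add: sqz_hom_eq act_closed)

lemma \<epsilon>_gr: "x \<in> gr S j ==> \<epsilon> x \<in> gr K j"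
proof (induction rule: gr_S_induct)
  case (scalar k \<alpha>)
  then show ?case using \<epsilon>_scalar[of "\<one>\<^sub>S" \<alpha>] by (simp add: K.gr_closed)
next
  case (mult X i j w)
  then show ?case using gr_S_closed by (simp add: \<epsilon>_mult M.gr_closed)
next
  case (add k x y)
  then show ?case using gr_S_closed by (auto simp: additive_maps_add[OF \<epsilon>_additive])
qed

lemma \<pi>_gr: "x \<in> gr S j ==> \<pi> x \<in> gr \<gg> j"
proof (induction rule: gr_S_induct)
  case (scalar k \<alpha>)
  then show ?case using \<pi>_scalar[of "\<one>\<^sub>S" \<alpha>] by (simp add: K.gr_closed)
next
  case (mult X i j w)
  then show ?case using gr_S_closed by (simp add: \<pi>_mult M.gr_closed act_gr \<epsilon>_gr)
next
  case (add k x y)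
  then show ?case using gr_S_closed by (auto simp: additive_maps_add[OF \<pi>_additive])
qed

end

context lie_sym
begin

definition piL where "piL = (\<lambda>x. if x \<in> carrier S then emb \<gg> (\<pi> x) else 0)"
definition cst where "cst a = (\<lambda>x. if x \<in> carrier S then emb \<gg> (a \<triangleleft> \<epsilon> x) else 0)"

lemma piL_Lm: "piL \<in> Lm 0"
  by (rule LmI)
    (auto simp: piL_def additive_maps_add[OF \<pi>_additive] M.emb_add \<pi>_scalar hact_def hgr_def gr_S_closed \<pi>_gr)

lemma cst_Lm: "a \<in> gr \<gg> p ==> cst a \<in> Lm p"
  by (rule LmI)
    (auto simp: cst_def additive_maps_add[OF \<epsilon>_additive] M.emb_add act_add_right act_closed \<epsilon>_scalar act_mult
      hact_def hgr_def gr_S_closed M.gr_closed intro!: imageI act_gr \<epsilon>_gr)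

lemma cst_add: "a \<in> carrier \<gg> ==> b \<in> carrier \<gg> ==> cst (a \<oplus>\<^bsub>\<gg>\<^esub> b) = cst a + cst b"
  by (auto simp: cst_def fun_eq_iff act_add_left act_closed M.emb_add)

lemma piL_one [simp]: "piL \<one>\<^sub>S = 0"
  by (simp add: piL_def)

lemma cst_one [simp]: "a \<in> carrier \<gg> ==> cst a \<one>\<^sub>S = emb \<gg> a"
  by (simp add: cst_def act_one)

text \<open>The generic element has the constant X as its derivative in direction X. As constants
  have derivative zero, the Leibniz rule determines every bracket formed from \<open>piL\<close> and
  constants.\<close>

lemma lX_piL: "X \<in> carrier \<gg> ==> lX X piL = cst X"
  by (auto simp: lX_def piL_def cst_def fun_eq_iff \<pi>_mult)

lemma lX_cst: "X \<in> carrier \<gg> ==> a \<in> carrier \<gg> ==> lX X (cst a) = 0"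
  by (auto simp: lX_def cst_def fun_eq_iff \<epsilon>_mult)

text \<open>The values of an attached coderivation have counit zero. In the induction the derivative
  of the constant vanishes and the other term is an instance of the claim.\<close>

lemma rc_cst:
  assumes "a \<in> gr \<gg> p" "\<psi> \<in> Lm q"
  shows "rc (cst a) q \<psi> = 0"
proof
  fix x
  have ac: "a \<in> carrier \<gg>" using assms by auto
  show "rc (cst a) q \<psi> x = 0 x"
  proof (cases "x \<in> carrier S")
    case True
    then show ?thesis using assms(2)
    proof (induction x arbitrary: \<psi> q rule: S_lin_induct)
      case one
      then show ?case using lX_apply[of "\<one>\<^sub>S" "cst a" "val \<gg> (\<psi> \<one>\<^sub>S)"] ac
        by (simp add: rc_def Ps_one lX_cst)
    next
      case (scalar x \<alpha>)
      then show ?case using Lm_scalar[OF rc_Lm[OF cst_Lm[OF assms(1)] scalar(4)] scalar(1,2)] scalar(3)[OF scalar(4)] by simp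
    next
      case (mult X i w)
      then have "X \<in> carrier \<gg>" by auto
      then show ?case using mult(3)[OF lX_Lm[OF mult(4,1)]] ac
        by (simp add: lX_apply[OF mult(2)] rc_lX[OF cst_Lm[OF assms(1)] mult(4,1)] lX_cst rc_linear lX_linear)
    next
      case (add x y)
      then show ?case using Lm_add[OF rc_Lm[OF cst_Lm[OF assms(1)] add(5)] add(1,2)] by simp
    qed
  qed (simp add: rc_def)
qed

text \<open>\<psi> is recovered from its coderivation as the part in degree one. The derivative of
  \<open>piL\<close> is a constant, which the coderivation kills by \<open>rc_cst\<close>, so only
  the derivative of \<psi> survives.\<close>

lemma rc_piL:
  assumes "\<psi> \<in> Lm q"
  shows "rc piL q \<psi> = \<psi>"
proof
  fix x
  show "rc piL q \<psi> x = \<psi> x"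
  proof (cases "x \<in> carrier S")
    case True
    then show ?thesis using assms
    proof (induction x arbitrary: \<psi> q rule: S_lin_induct)
      case one
      have Y: "val \<gg> (\<psi> \<one>\<^sub>S) \<in> carrier \<gg>" by simp
      show ?case using lX_apply[of "\<one>\<^sub>S" "piL" "val \<gg> (\<psi> \<one>\<^sub>S)"] Lm_emb[OF one, of "\<one>\<^sub>S"]
        by (simp add: rc_def Ps_one[OF one] lX_piL[OF Y])
    next
      case (scalar x \<alpha>)
      then show ?case using Lm_scalar[OF rc_Lm[OF piL_Lm scalar(4)] scalar(1,2)] Lm_scalar[OF scalar(4,1,2)] scalar(3)[OF scalar(4)] by simp
    next
      case (mult X i w)
      then have "X \<in> carrier \<gg>" by auto
      then show ?case using mult(3)[OF lX_Lm[OF mult(4,1)]] rc_cst[OF mult(1,4)]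
        by (simp add: lX_apply[OF mult(2)] rc_lX[OF piL_Lm mult(4,1)] lX_piL)
    next
      case (add x y)
      then show ?case using Lm_add[OF rc_Lm[OF piL_Lm add(5)] add(1,2)] Lm_add[OF add(5,1,2)] by simp
    qed
  qed (simp add: rc_def Lm_outside[OF assms])
qed

lemma cb_cst:
  assumes "a \<in> gr \<gg> p" "b \<in> gr \<gg> q"
  shows "cb q (cst a) (cst b) = cst (brk \<gg> a b)"
proof
  fix x
  have ab: "a \<in> carrier \<gg>" "b \<in> carrier \<gg>" "brk \<gg> a b \<in> gr \<gg> (p + q)" using assms brk_even by auto
  note L = cst_Lm[OF assms(1)] cst_Lm[OF assms(2)] cb_Lm[OF cst_Lm[OF assms(1)] cst_Lm[OF assms(2)]] cst_Lm[OF ab(3)]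
  show "cb q (cst a) (cst b) x = cst (brk \<gg> a b) x"
  proof (cases "x \<in> carrier S")
    case True
    then show ?thesis
    proof (induction x rule: S_lin_induct)
      case one
      then show ?case using ab by (simp add: cb_one[OF L(1,2)] hbr_def)
    next
      case (scalar x \<alpha>)
      then show ?case by (simp add: Lm_scalar[OF L(3)] Lm_scalar[OF L(4)])
    next
      case (mult X i w)
      then have "X \<in> carrier \<gg>" by auto
      then show ?case using ab cb_zero(2)[OF L(2)] cb_zero(1)[OF L(1)]
        by (simp add: lX_apply[OF mult(2)] cb_lX[OF L(1,2) mult(1)] lX_cst)
    next
      case (add x y)
      then show ?case by (simp add: Lm_add[OF L(3)] Lm_add[OF L(4)])
    qed
  qed (simp add: cb_def cst_def)
qed

text \<open>Derivatives of a constant vanish, so the Leibniz rule only differentiates G, and that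
  term carries no sign. The bracket is therefore pointwise bracketing with Y.\<close>

lemma cb_cst_left:
  assumes "Y \<in> gr \<gg> p" "G \<in> Lm q" "x \<in> carrier S"
  shows "cb q (cst Y) G x = sg 0 (hbr (emb \<gg> Y) (G x))"
  using assms(3,2)
proof (induction x arbitrary: G q rule: S_lin_induct)
  case one
  then show ?case using cb_one[OF cst_Lm[OF assms(1)]] assms(1) by (simp add: M.gr_closed)
next
  case (scalar x \<alpha>)
  then show ?case using Lm_scalar[OF cb_Lm[OF cst_Lm[OF assms(1)] scalar(4)] scalar(1,2)]
    by (simp add: Lm_scalar[OF scalar(4)] hbr_hact_right)
next
  case (mult X i w)
  then have "X \<in> carrier \<gg>" "Y \<in> carrier \<gg>" using assms by auto
  then show ?case using mult(3)[OF lX_Lm[OF mult(4,1)]] cb_zero(2)[OF mult(4)]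
    by (simp add: lX_apply[OF mult(2)] cb_lX[OF cst_Lm[OF assms(1)] mult(4,1)] lX_cst)
next
  case (add x y)
  then show ?case using Lm_add[OF cb_Lm[OF cst_Lm[OF assms(1)] add(5)] add(1,2)]
    by (simp add: Lm_add[OF add(5)] hbr_add_right)
qed

section \<open>Powers of the adjoint action of the generic element\<close>

text \<open>
  The projection \<open>piL\<close> of $S(\mathfrak g)$ to $\mathfrak g$ is the generic even element of the convolution
  superalgebra; \<open>xp p\<close> is its adjoint action on the part of parity \<open>p\<close>.
\<close>

definition xp where "xp p F = cb p piL F"
definition Fn where "Fn p a n = (xp p ^^ n) (cst a)"

lemma xp_Lm: "F \<in> Lm p ==> xp p F \<in> Lm p"
  unfolding xp_def using cb_Lm[OF piL_Lm, of F p] by simp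

lemma xp_pow_Lm: "F \<in> Lm p ==> (xp p ^^ n) F \<in> Lm p"
  by (induction n) (auto intro: xp_Lm)

lemma Fn_Lm: "a \<in> gr \<gg> p ==> Fn p a n \<in> Lm p"
  unfolding Fn_def by (intro xp_pow_Lm cst_Lm)

lemma Fn_0: "Fn p a 0 = cst a" and Fn_Suc: "Fn p a (Suc n) = xp p (Fn p a n)"
  by (simp_all add: Fn_def)

lemma xp_leibniz:
  assumes "F \<in> Lm p" "G \<in> Lm q"
  shows "xp (p + q) (cb q F G) = cb q (xp p F) G + cb q F (xp q G)"
  unfolding xp_def using cb_jacobi[OF piL_Lm assms] by simp

text \<open>The derivation rule \<open>rc_cb\<close> with \<open>rc_piL\<close> for the factor
  \<open>piL\<close>. This gives the bracket of \<psi> with G, turned around by skewness.\<close>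

lemma rc_xp:
  assumes "G \<in> Lm p" "\<psi> \<in> Lm q"
  shows "rc (xp p G) q \<psi> = xp (p + q) (rc G q \<psi>) - cb q G \<psi>"
proof -
  have "rc (xp p G) q \<psi> = xp (p + q) (rc G q \<psi>) + sg (q * p) (cb p \<psi> G)"
    unfolding xp_def rc_cb[OF piL_Lm assms] rc_piL[OF assms(2)] ..
  also have "sg (q * p) (cb p \<psi> G) = - cb q G \<psi>"
    unfolding cb_skew[OF assms(2,1)] by (simp add: sg_minus mult.commute)
  finally show ?thesis by (simp only: diff_conv_add_uminus)
qed

text \<open>The product of generators along a list of positions. Keeping positions instead of
  elements allows inversions, and hence Koszul signs, to be read off from the list.\<close>

definition wdl where "wdl X l = foldr (\<lambda>k y. \<iota> (X k) \<odot> y) l \<one>\<^sub>S"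

lemma wdl_simps [simp]: "wdl X [] = \<one>\<^sub>S" "wdl X (k # l) = \<iota> (X k) \<odot> wdl X l"
  by (simp_all add: wdl_def)

lemma wdl_closed: "(\<And>k. k \<in> set l ==> X k \<in> carrier \<gg>) ==> wdl X l \<in> carrier S"
  by (induction l) auto

lemma xp_wdl:
  fixes X :: "nat \<Rightarrow> 'g" and d :: "nat \<Rightarrow> bit"
  assumes "G \<in> Lm p" "\<And>k. k \<in> set l ==> X k \<in> gr \<gg> (d k)" "sorted_wrt (<) l"
  shows "xp p G (wdl X l) = (\<Sum>i\<in>set l. sg (d i * (p + (\<Sum>j | j \<in> set l \<and> j < i. d j)))
    (hbr (emb \<gg> (X i)) (G (wdl X (remove1 i l)))))"
  using assms
proof (induction l arbitrary: G p)
  case Nil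
  then show ?case by (simp add: xp_def cb_one[OF piL_Lm])
next
  case (Cons m l)
  have G: "G \<in> Lm p" and Xm: "X m \<in> gr \<gg> (d m)" and l: "sorted_wrt (<) l" "\<And>k. k \<in> set l ==> m < k"
    using Cons.prems by auto
  have Xc: "X m \<in> carrier \<gg>" using Xm by auto
  have mn: "m \<notin> set l" using l by auto
  have w: "wdl X l \<in> carrier S" by (rule wdl_closed) (use Cons.prems in auto)
  have "xp p G (wdl X (m # l)) = sg (p * d m) (cb p (cst (X m)) G (wdl X l)) + xp (p + d m) (lX (X m) G) (wdl X l)"
    using w by (simp add: xp_def lX_apply cb_lX[OF piL_Lm G Xm] lX_piL[OF Xc])
  also have "cb p (cst (X m)) G (wdl X l) = hbr (emb \<gg> (X m)) (G (wdl X l))"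
    using cb_cst_left[OF Xm G w] by simp
  also have "xp (p + d m) (lX (X m) G) (wdl X l) = (\<Sum>i\<in>set l. sg (d i * (p + d m + (\<Sum>j | j \<in> set l \<and> j < i. d j)))
    (hbr (emb \<gg> (X i)) (lX (X m) G (wdl X (remove1 i l)))))"
    by (rule Cons.IH) (use lX_Lm[OF G Xm] Cons.prems in auto)
  also have "\<dots> = (\<Sum>i\<in>set l. sg (d i * (p + (\<Sum>j | j \<in> set (m # l) \<and> j < i. d j)))
    (hbr (emb \<gg> (X i)) (G (wdl X (remove1 i (m # l))))))"
  proof (rule sum.cong[OF refl])
    fix i assume i: "i \<in> set l"
    have "{j. j \<in> set (m # l) \<and> j < i} = insert m {j. j \<in> set l \<and> j < i}" using l(2)[OF i] by auto
    then have "(\<Sum>j | j \<in> set (m # l) \<and> j < i. d j) = d m + (\<Sum>j | j \<in> set l \<and> j < i. d j)"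
      using mn by simp
    moreover have "wdl X (remove1 i l) \<in> carrier S" by (rule wdl_closed) (use Cons.prems set_remove1_subset[of i l] in auto)
    ultimately show "sg (d i * (p + d m + (\<Sum>j | j \<in> set l \<and> j < i. d j)))
        (hbr (emb \<gg> (X i)) (lX (X m) G (wdl X (remove1 i l)))) =
        sg (d i * (p + (\<Sum>j | j \<in> set (m # l) \<and> j < i. d j))) (hbr (emb \<gg> (X i)) (G (wdl X (remove1 i (m # l)))))"
      using i mn by (auto simp: lX_def add.assoc)
  qed
  finally show ?case
  proof -
    assume *: "xp p G (wdl X (m # l)) = sg (p * d m) (hbr (emb \<gg> (X m)) (G (wdl X l))) +
      (\<Sum>i\<in>set l. sg (d i * (p + (\<Sum>j | j \<in> set (m # l) \<and> j < i. d j)))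
        (hbr (emb \<gg> (X i)) (G (wdl X (remove1 i (m # l))))))"
    have e: "{j. j \<in> insert m (set l) \<and> j < m} = {}" using l(2) by force
    show ?thesis unfolding * list.set(2) sum.insert[OF finite_set mn] e
      by (simp add: mult.commute[of p])
  qed
qed

text \<open>The Koszul exponent of a list of distinct positions, computed recursively: the head
  contributes its inversions with the smaller positions after it. \<open>kz_koszul\<close> relates
  it to \<open>koszul\<close>.\<close>

fun kz :: "(nat \<Rightarrow> bit) \<Rightarrow> nat list \<Rightarrow> bit" where
  "kz d [] = 0"
| "kz d (i # l) = d i * (\<Sum>j | j \<in> set l \<and> j < i. d j) + kz d l"

lemma foldr_brk_closed:
  "(\<And>k. k \<in> set s ==> X k \<in> carrier \<gg>) ==> a \<in> carrier \<gg> ==> foldr (\<lambda>k y. brk \<gg> (X k) y) s a \<in> carrier \<gg>"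
  by (induction s) auto

lemma hbr_emb: "x \<in> carrier \<gg> ==> y \<in> carrier \<gg> ==> hbr (emb \<gg> x) (emb \<gg> y) = emb \<gg> (brk \<gg> x y)"
  by (simp add: hbr_def)

lemma hbr_sum_right: "hbr x (sum f A) = (\<Sum>i\<in>A. hbr x (f i))"
  by (induction A rule: infinite_finite_induct) (auto simp: hbr_add_right)

text \<open>Iterating \<open>xp_wdl\<close> takes out the letters one at a time, so the orders of
  extraction are the permutations of the positions. The signs against the remaining letters add up
  to \<open>kz\<close>; those against a combine to p times the total parity.\<close>

lemma Fn_wdl:
  fixes X :: "nat \<Rightarrow> 'g" and d :: "nat \<Rightarrow> bit"
  assumes a: "a \<in> gr \<gg> p" and X: "\<And>k. k \<in> set l ==> X k \<in> gr \<gg> (d k)" and l: "sorted_wrt (<) l"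
  shows "Fn p a (length l) (wdl X l) = sg (p * (\<Sum>k\<in>set l. d k))
    (\<Sum>s\<in>permutations_of_set (set l). sg (kz d s) (emb \<gg> (foldr (\<lambda>k y. brk \<gg> (X k) y) s a)))"
  using X l
proof (induction "length l" arbitrary: l)
  case 0
  then show ?case using a by (simp add: Fn_0 M.gr_closed)
next
  case (Suc n)
  have ac: "a \<in> carrier \<gg>" using a by auto
  have l: "sorted_wrt (<) l" "distinct l" "l \<noteq> []"
    using Suc.prems Suc.hyps(2) strict_sorted_iff by auto
  let ?e = "\<lambda>s. emb \<gg> (foldr (\<lambda>k y. brk \<gg> (X k) y) s a)"
  let ?A = "set l"
  have "Fn p a (length l) (wdl X l) = xp p (Fn p a n) (wdl X l)" using Suc.hyps(2)[symmetric] by (simp add: Fn_Suc)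
  also have "\<dots> = (\<Sum>i\<in>?A. sg (d i * (p + (\<Sum>j | j \<in> ?A \<and> j < i. d j)))
    (hbr (emb \<gg> (X i)) (Fn p a n (wdl X (remove1 i l)))))"
    by (rule xp_wdl[OF Fn_Lm[OF a] Suc.prems])
  also have "\<dots> = (\<Sum>i\<in>?A. \<Sum>s\<in>permutations_of_set (?A - {i}). sg (p * (\<Sum>k\<in>?A. d k)) (sg (kz d (i # s)) (?e (i # s))))"
  proof (rule sum.cong[OF refl])
    fix i assume i: "i \<in> ?A"
    have s: "set (remove1 i l) = ?A - {i}" using l by simp
    have sp: "sorted_wrt (<) (remove1 i l)" using l(1,2) sorted_remove1 by (auto simp: strict_sorted_iff)
    have "Fn p a n (wdl X (remove1 i l)) = sg (p * (\<Sum>k\<in>?A - {i}. d k)) (\<Sum>s\<in>permutations_of_set (?A - {i}). sg (kz d s) (?e s))"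
    proof -
      have len: "length (remove1 i l) = n" using Suc.hyps(2) i by (simp add: length_remove1)
      show ?thesis using Suc.hyps(1)[OF len[symmetric] _ sp] Suc.prems(1) unfolding len s by auto
    qed
    then have "sg (d i * (p + (\<Sum>j | j \<in> ?A \<and> j < i. d j))) (hbr (emb \<gg> (X i)) (Fn p a n (wdl X (remove1 i l)))) =
      (\<Sum>s\<in>permutations_of_set (?A - {i}). sg (d i * (p + (\<Sum>j | j \<in> ?A \<and> j < i. d j)) + (p * (\<Sum>k\<in>?A - {i}. d k) + kz d s))
        (hbr (emb \<gg> (X i)) (?e s)))"
      by (simp add: hbr_sg hbr_sum_right sg_sum)
    also have "\<dots> = (\<Sum>s\<in>permutations_of_set (?A - {i}). sg (p * (\<Sum>k\<in>?A. d k)) (sg (kz d (i # s)) (?e (i # s))))"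
    proof (rule sum.cong[OF refl])
      fix s assume "s \<in> permutations_of_set (?A - {i})"
      then have ss: "set s = ?A - {i}" by (simp add: permutations_of_set_def)
      have Xi: "X i \<in> carrier \<gg>" using Suc.prems(1)[OF i] by auto
      have fc: "foldr (\<lambda>k y. brk \<gg> (X k) y) s a \<in> carrier \<gg>"
        by (rule foldr_brk_closed) (use ss Suc.prems(1) ac in auto)
      have "{j. j \<in> ?A \<and> j < i} = {j. j \<in> set s \<and> j < i}" using ss by auto
      moreover have "(\<Sum>k\<in>?A. d k) = d i + (\<Sum>k\<in>?A - {i}. d k)" using i by (simp add: sum.remove)
      ultimately show "sg (d i * (p + (\<Sum>j | j \<in> ?A \<and> j < i. d j)) + (p * (\<Sum>k\<in>?A - {i}. d k) + kz d s))
        (hbr (emb \<gg> (X i)) (?e s)) = sg (p * (\<Sum>k\<in>?A. d k)) (sg (kz d (i # s)) (?e (i # s)))"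
        using Xi fc by (simp add: hbr_emb sum_distrib_left[symmetric] algebra_simps)
    qed
    finally show "sg (d i * (p + (\<Sum>j | j \<in> ?A \<and> j < i. d j))) (hbr (emb \<gg> (X i)) (Fn p a n (wdl X (remove1 i l)))) =
      (\<Sum>s\<in>permutations_of_set (?A - {i}). sg (p * (\<Sum>k\<in>?A. d k)) (sg (kz d (i # s)) (?e (i # s))))" .
  qed
  \<comment> \<open>Permutations are grouped by their first entry i, the letter of the outermost
    bracket.\<close>
  also have "\<dots> = (\<Sum>i\<in>?A. \<Sum>s\<in>(#) i ` permutations_of_set (?A - {i}). sg (p * (\<Sum>k\<in>?A. d k)) (sg (kz d s) (?e s)))"
    by (rule sum.cong[OF refl], subst sum.reindex) (auto simp: inj_on_def)
  also have "\<dots> = (\<Sum>s\<in>(\<Union>i\<in>?A. (#) i ` permutations_of_set (?A - {i})). sg (p * (\<Sum>k\<in>?A. d k)) (sg (kz d s) (?e s)))"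
    by (rule sum.UNION_disjoint[symmetric]) auto
  also have "(\<Union>i\<in>?A. (#) i ` permutations_of_set (?A - {i})) = permutations_of_set ?A"
    using l by (subst permutations_of_set_nonempty) auto
  finally show ?case by (simp add: sg_sum)
qed

text \<open>Every bracket with the generic element consumes exactly one letter, and the constant
  left after n brackets vanishes on nonempty words; when the letters run out early, the sum in
  \<open>xp_wdl\<close> is empty.\<close>

lemma Fn_wdl_0:
  fixes X :: "nat \<Rightarrow> 'g" and d :: "nat \<Rightarrow> bit"
  assumes a: "a \<in> gr \<gg> p" and X: "\<And>k. k \<in> set l ==> X k \<in> gr \<gg> (d k)" and l: "sorted_wrt (<) l" and n: "n \<noteq> length l"
  shows "Fn p a n (wdl X l) = 0"
  using X l n
proof (induction n arbitrary: l)
  case 0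
  then obtain m l' where l': "l = m # l'" by (cases l) auto
  have "wdl X l' \<in> carrier S" by (rule wdl_closed) (use 0 l' in auto)
  moreover have "X m \<in> carrier \<gg>" "a \<in> carrier \<gg>" using 0 l' a by auto
  ultimately show ?case by (simp add: l' Fn_0 lX_apply lX_cst)
next
  case (Suc n)
  have "Fn p a n (wdl X (remove1 i l)) = 0" if i: "i \<in> set l" for i
  proof (rule Suc.IH)
    have d: "distinct l" "sorted l" using Suc.prems by (auto simp: strict_sorted_iff)
    show "sorted_wrt (<) (remove1 i l)" using d sorted_remove1 by (auto simp: strict_sorted_iff)
    show "X k \<in> gr \<gg> (d k)" if "k \<in> set (remove1 i l)" for k using that Suc.prems d by auto
    show "n \<noteq> length (remove1 i l)"
      using i Suc.prems length_pos_if_in_set[OF i] by (auto simp: length_remove1)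
  qed
  then show ?case by (simp add: Fn_Suc xp_wdl[OF Fn_Lm[OF a] Suc.prems(1,2)])
qed

text \<open>The inversions of m # l split into those starting at position 0, counted by the head
  term of \<open>kz\<close>, and the shifted inversions of l.\<close>

lemma kz_koszul:
  assumes "distinct l"
  shows "kz d l = (\<Sum>(i, j) \<in> {(i, j). i < j \<and> j < length l \<and> l ! i > l ! j}. d (l ! i) * d (l ! j))"
  using assms
proof (induction l)
  case (Cons m l)
  let ?P = "\<lambda>l. {(i, j). i < j \<and> j < length l \<and> l ! i > l ! j}"
  have fin: "finite (?P l)" for l :: "nat list"
    by (rule finite_subset[of _ "{..<length l} \<times> {..<length l}"]) auto
  have P: "?P (m # l) = (\<lambda>j. (0, Suc j)) ` {j. j < length l \<and> l ! j < m} \<union> map_prod Suc Suc ` ?P l"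
    (is "_ = ?A \<union> ?B")
  proof (intro equalityI subsetI)
    fix x assume "x \<in> ?P (m # l)"
    then obtain i j where x: "x = (i, j)" "i < j" "j < Suc (length l)" "(m # l) ! i > (m # l) ! j" by auto
    then obtain j' where j': "j = Suc j'" by (cases j) auto
    show "x \<in> ?A \<union> ?B"
    proof (cases i)
      case 0
      then show ?thesis using x j' by auto
    next
      case (Suc i')
      then have "x = map_prod Suc Suc (i', j')" "(i', j') \<in> ?P l" using x j' by auto
      then show ?thesis by blast
    qed
  qed auto
  have "(\<Sum>(i, j)\<in>?A. d ((m # l) ! i) * d ((m # l) ! j)) = (\<Sum>j | j < length l \<and> l ! j < m. d m * d (l ! j))"
    by (subst sum.reindex) (auto simp: inj_on_def)
  also have "\<dots> = (\<Sum>j | j \<in> set l \<and> j < m. d m * d j)"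
    by (rule sum.reindex_bij_betw[of "\<lambda>j. l ! j", where g = "\<lambda>j. d m * d j"])
      (use Cons.prems in \<open>auto simp: bij_betw_def inj_on_def in_set_conv_nth nth_eq_iff_index_eq image_def\<close>)
  finally have A: "(\<Sum>(i, j)\<in>?A. d ((m # l) ! i) * d ((m # l) ! j)) = (\<Sum>j | j \<in> set l \<and> j < m. d m * d j)" .
  have B: "(\<Sum>(i, j)\<in>?B. d ((m # l) ! i) * d ((m # l) ! j)) = kz d l"
    using Cons by (subst sum.reindex) (auto simp: inj_on_def case_prod_unfold)
  have "(\<Sum>(i, j)\<in>?P (m # l). d ((m # l) ! i) * d ((m # l) ! j)) = (\<Sum>j | j \<in> set l \<and> j < m. d m * d j) + kz d l"
    unfolding P using fin by (subst sum.union_disjoint) (auto simp: A B)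
  then show ?case by (simp add: sum_distrib_left)
qed simp

text \<open>\<open>phi_hom\<close> sums over permuting functions, while the induction of
  \<open>Fn_wdl\<close> runs over lists; this bijection translates between them.\<close>

lemma permutes_permutations:
  "bij_betw (\<lambda>s. map s [0..<n]) {s. s permutes {..<n}} (permutations_of_set {..<n})"
proof (rule bij_betw_imageI)
  show "inj_on (\<lambda>s. map s [0..<n]) {s. s permutes {..<n}}"
  proof (rule inj_onI, rule ext)
    fix s t x assume *: "s \<in> {s. s permutes {..<n}}" "t \<in> {s. s permutes {..<n}}" "map s [0..<n] = map t [0..<n]"
    show "s x = t x"
    proof (cases "x < n")
      case True
      then show ?thesis using *(3) by simp
    next
      case False
      then show ?thesis using * by (auto simp: permutes_not_in)
    qed
  qed
  show "(\<lambda>s. map s [0..<n]) ` {s. s permutes {..<n}} = permutations_of_set {..<n}"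
  proof (intro equalityI subsetI)
    fix l assume "l \<in> (\<lambda>s. map s [0..<n]) ` {s. s permutes {..<n}}"
    then obtain s where s: "s permutes {..<n}" "l = map s [0..<n]" by auto
    then show "l \<in> permutations_of_set {..<n}"
      using permutes_image[OF s(1)] permutes_inj_on[OF s(1)]
      by (auto simp: permutations_of_set_def distinct_map atLeast0LessThan)
  next
    fix l assume "l \<in> permutations_of_set {..<n}"
    then have l: "set l = {..<n}" "distinct l" by (auto simp: permutations_of_set_def)
    then have len: "length l = n" using distinct_card by fastforce
    define s where "s k = (if k < n then l ! k else k)" for k
    have "bij_betw s {..<n} {..<n}"
    proof (rule bij_betw_imageI)
      show "inj_on s {..<n}" using l len by (auto simp: inj_on_def s_def nth_eq_iff_index_eq)
      have "s ` {..<n} = (!) l ` {..<length l}" using len by (auto simp: s_def)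
      then show "s ` {..<n} = {..<n}" using l(1) by (auto simp: set_conv_nth image_def)
    qed
    then have "s permutes {..<n}" by (rule bij_imp_permutes) (simp add: s_def)
    moreover have "l = map s [0..<n]" using len by (auto simp: s_def intro: nth_equalityI)
    ultimately show "l \<in> (\<lambda>s. map s [0..<n]) ` {s. s permutes {..<n}}" by auto
  qed
qed

lemma Fn_word:
  fixes X :: "nat \<Rightarrow> 'g" and d :: "nat \<Rightarrow> bit"
  assumes a: "a \<in> gr \<gg> p" and X: "\<And>k. k < n ==> X k \<in> gr \<gg> (d k)"
  shows "Fn p a n (wdl X [0..<n]) = sg (p * (\<Sum>k<n. d k))
    (\<Sum>s\<in>{s. s permutes {..<n}}. sg (koszul n d s) (emb \<gg> (foldr (\<lambda>k y. brk \<gg> (X (s k)) y) [0..<n] a)))"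
proof -
  have "Fn p a (length [0..<n]) (wdl X [0..<n]) = sg (p * (\<Sum>k\<in>set [0..<n]. d k))
    (\<Sum>s\<in>permutations_of_set (set [0..<n]). sg (kz d s) (emb \<gg> (foldr (\<lambda>k y. brk \<gg> (X k) y) s a)))"
    by (rule Fn_wdl[OF a]) (use X in \<open>auto simp: strict_sorted_iff\<close>)
  also have "set [0..<n] = {..<n}" by auto
  also have "(\<Sum>s\<in>permutations_of_set {..<n}. sg (kz d s) (emb \<gg> (foldr (\<lambda>k y. brk \<gg> (X k) y) s a))) =
    (\<Sum>s\<in>{s. s permutes {..<n}}. sg (kz d (map s [0..<n])) (emb \<gg> (foldr (\<lambda>k y. brk \<gg> (X k) y) (map s [0..<n]) a)))"
    by (rule sum.reindex_bij_betw[OF permutes_permutations, symmetric])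
  also have "\<dots> = (\<Sum>s\<in>{s. s permutes {..<n}}. sg (koszul n d s) (emb \<gg> (foldr (\<lambda>k y. brk \<gg> (X (s k)) y) [0..<n] a)))"
  proof (rule sum.cong[OF refl])
    fix s assume "s \<in> {s. s permutes {..<n}}"
    then have "distinct (map s [0..<n])" by (simp add: distinct_map permutes_inj_on)
    then have "kz d (map s [0..<n]) = (\<Sum>(i, j) \<in> {(i, j). i < j \<and> j < n \<and> s i > s j}. d (s i) * d (s j))"
      by (subst kz_koszul) (auto intro!: sum.cong)
    then show "sg (kz d (map s [0..<n])) (emb \<gg> (foldr (\<lambda>k y. brk \<gg> (X k) y) (map s [0..<n]) a)) =
        sg (koszul n d s) (emb \<gg> (foldr (\<lambda>k y. brk \<gg> (X (s k)) y) [0..<n] a))"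
      by (simp add: koszul_def foldr_map comp_def)
  qed
  finally show ?thesis by simp
qed

section \<open>Filtration by word length\<close>

text \<open>F vanishes to order k on words. Brackets add these orders and \<open>piL\<close> has
  order 1, so at each element only finitely many terms of a series in ad pi are nonzero.\<close>

definition vanishes where "vanishes k F \<longleftrightarrow> (\<forall>m x. m < k \<longrightarrow> fil m x \<longrightarrow> F x = 0)"

lemma vanishesD: "vanishes k F ==> fil m x ==> m < k ==> F x = 0"
  by (auto simp: vanishes_def)

lemma vanishes_0 [simp]: "vanishes 0 F"
  by (simp add: vanishes_def)

lemma fil_one: "fil n \<one>\<^sub>S"
  using fil_scalar[of "\<one>\<^bsub>K\<^esub>" n] by simp

lemma vanishes_lX: "vanishes k F ==> X \<in> gr \<gg> i ==> vanishes (k - 1) (lX X F)"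
  unfolding vanishes_def
proof (intro allI impI)
  fix m x assume *: "\<forall>m x. m < k \<longrightarrow> fil m x \<longrightarrow> F x = 0" "X \<in> gr \<gg> i" "m < k - 1" "fil m x"
  then have "fil (Suc m) (\<iota> X \<odot> x)" "Suc m < k" by (auto intro: fil_mult)
  then have "F (\<iota> X \<odot> x) = 0" using * by blast
  then show "lX X F x = 0" by (simp add: lX_def)
qed

text \<open>Taking off a letter lowers the word length by one and the order of just one of F and G
  by one. The cases k = 0 and l = 0 are separate because an order of zero cannot drop
  further.\<close>

lemma cb_vanishes_aux:
  assumes "fil m x" "F \<in> Lm p" "G \<in> Lm q" "vanishes k F" "vanishes l G" "m < k + l"
  shows "cb q F G x = 0"
  using assms
proof (induction arbitrary: F G p q k l rule: fil.induct)
  case (fil_scalar \<alpha> n)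
  then have "F \<one>\<^sub>S = 0 \<or> G \<one>\<^sub>S = 0"
    using vanishesD[OF fil_scalar(4) fil_one, of 0] vanishesD[OF fil_scalar(5) fil_one, of 0] by (cases "k = 0") auto
  then have "cb q F G \<one>\<^sub>S = 0" using cb_one[OF fil_scalar(2,3)] by auto
  then show ?case using Lm_scalar[OF cb_Lm[OF fil_scalar(2,3)], of "\<one>\<^sub>S" \<alpha>] fil_scalar(1) by simp
next
  case (fil_mult X i n w)
  note F = fil_mult(4) and G = fil_mult(5)
  have w: "w \<in> carrier S" using fil_mult fil_closed by blast
  have "cb q (lX X F) G w = 0"
  proof (cases "k = 0")
    case True
    then show ?thesis using fil_mult.IH[OF lX_Lm[OF F fil_mult(1)] G, of 0 l] fil_mult.prems by simp
  next
    case False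
    then show ?thesis
      using fil_mult.IH[OF lX_Lm[OF F fil_mult(1)] G vanishes_lX[OF fil_mult(6,1)] fil_mult(7)] fil_mult.prems by simp
  qed
  moreover have "cb (q + i) F (lX X G) w = 0"
  proof (cases "l = 0")
    case True
    then show ?thesis using fil_mult.IH[OF F lX_Lm[OF G fil_mult(1)], of k 0] fil_mult.prems by simp
  next
    case False
    then show ?thesis
      using fil_mult.IH[OF F lX_Lm[OF G fil_mult(1)] fil_mult(6) vanishes_lX[OF fil_mult(7,1)]] fil_mult.prems by simp
  qed
  ultimately show ?case by (simp add: lX_apply[OF w] cb_lX[OF F G fil_mult(1)])
next
  case (fil_add n x y)
  then show ?case using Lm_add[OF cb_Lm[OF fil_add.prems(1,2)]] fil_closed by simp
qed

lemma cb_vanishes: "F \<in> Lm p ==> G \<in> Lm q ==> vanishes k F ==> vanishes l G ==> vanishes (k + l) (cb q F G)"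
  unfolding vanishes_def[of "k + l"] using cb_vanishes_aux by blast

lemma piL_vanishes: "vanishes 1 piL"
proof -
  have "piL x = 0" if "fil m x" "m = 0" for m x
    using that
  proof (induction rule: fil.induct)
    case (fil_scalar \<alpha> n)
    then show ?case using Lm_scalar[OF piL_Lm, of "\<one>\<^sub>S" \<alpha>] by simp
  next
    case (fil_add n x y)
    then show ?case using Lm_add[OF piL_Lm] fil_closed by simp
  qed simp
  then show ?thesis by (auto simp: vanishes_def)
qed

lemma xp_vanishes: "F \<in> Lm p ==> vanishes k F ==> vanishes (Suc k) (xp p F)"
  unfolding xp_def using cb_vanishes[OF piL_Lm _ piL_vanishes, of F p k] by simp

lemma xp_pow_vanishes: "F \<in> Lm p ==> vanishes k F ==> vanishes (n + k) ((xp p ^^ n) F)"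
  by (induction n) (auto intro: xp_vanishes xp_pow_Lm)

lemma Fn_vanishes: "a \<in> gr \<gg> p ==> vanishes n (Fn p a n)"
  unfolding Fn_def using xp_pow_vanishes[OF cst_Lm vanishes_0, of a p n] by simp

text \<open>The coproduct distributes the letters of x over two factors, so \<psi> only meets
  elements with no more letters than x. A series may thus be truncated inside the
  coderivation.\<close>

lemma Ps_cong_fil:
  assumes "fil m x" "\<psi> \<in> Lm q" "\<chi> \<in> Lm q" "\<And>y. fil m y ==> \<psi> y = \<chi> y"
  shows "Ps q \<psi> x = Ps q \<chi> x"
  using assms
proof (induction arbitrary: \<psi> \<chi> q rule: fil.induct)
  case (fil_scalar \<alpha> n)
  then show ?case
    using Ps_scalar[OF fil_scalar(2), of "\<one>\<^sub>S" \<alpha>] Ps_scalar[OF fil_scalar(3), of "\<one>\<^sub>S" \<alpha>] fil_one by (simp add: Ps_one)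
next
  case (fil_mult X i n w)
  have w: "w \<in> carrier S" using fil_mult fil_closed by blast
  have "Ps q \<psi> w = Ps q \<chi> w"
    by (rule fil_mult.IH[OF fil_mult.prems(1,2) fil_mult.prems(3)]) (rule fil_mono, assumption, simp)
  moreover have "Ps (q + i) (lX X \<psi>) w = Ps (q + i) (lX X \<chi>) w"
  proof (rule fil_mult.IH)
    show "lX X \<psi> \<in> Lm (q + i)" "lX X \<chi> \<in> Lm (q + i)" using fil_mult.prems fil_mult.hyps(1) by (auto intro: lX_Lm)
    show "lX X \<psi> y = lX X \<chi> y" if "fil n y" for y
      using fil_mult.prems(3)[OF fil.fil_mult[OF fil_mult.hyps(1) that]] by (simp add: lX_def)
  qed
  ultimately show ?case
    by (simp only: Ps_mult[OF fil_mult.prems(1) fil_mult.hyps(1) w] Ps_mult[OF fil_mult.prems(2) fil_mult.hyps(1) w])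
next
  case (fil_add n x y)
  have "x \<in> carrier S" "y \<in> carrier S" using fil_add.hyps fil_closed by blast+
  then show ?case using fil_add.IH[OF fil_add.prems]
    by (simp only: Ps_add[OF fil_add.prems(1)] Ps_add[OF fil_add.prems(2)])
qed

lemma fil_neg_pow: "fil n x ==> fil n (neg_pow S e x)"
  by (simp add: neg_pow_def fil_neg)

text \<open>Part of the word, possibly empty, is replaced by one generator, so the length grows by
  at most one. This is why the outer map is truncated at \<open>Suc N\<close> later on.\<close>

lemma Ps_fil: "fil m x ==> \<psi> \<in> Lm q ==> fil (Suc m) (Ps q \<psi> x)"
proof (induction arbitrary: \<psi> q rule: fil.induct)
  case (fil_scalar \<alpha> n)
  then show ?case
    using Ps_scalar[OF fil_scalar(2), of "\<one>\<^sub>S" \<alpha>] by (simp add: Ps_one fil_iota fil.fil_scalar)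
next
  case (fil_mult X i n w)
  have w: "w \<in> carrier S" using fil_mult fil_closed by blast
  have "fil (Suc (Suc n)) (neg_pow S (q * i) (\<iota> X \<odot> Ps q \<psi> w))"
    using fil_mult by (intro fil_neg_pow fil.fil_mult) auto
  moreover have "fil (Suc (Suc n)) (Ps (q + i) (lX X \<psi>) w)"
    by (rule fil_mono[OF fil_mult.IH[OF lX_Lm]]) (use fil_mult in auto)
  ultimately show ?case using fil_mult w by (simp add: Ps_mult fil.fil_add)
next
  case (fil_add n x y)
  then show ?case using fil_closed by (simp add: Ps_add fil.fil_add)
qed

section \<open>Power series in the adjoint action\<close>

text \<open>Multiplication of F by a scalar on the values. For even \<alpha> the scalar commutes
  with all others, so the result is again right linear.\<close>

definition hs where "hs \<alpha> F = (\<lambda>x. hact (F x) \<alpha>)"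

lemma even_comm: "\<alpha> \<in> gr K 0 ==> \<beta> \<in> carrier K ==> \<alpha> \<star> \<beta> = \<beta> \<star> \<alpha>"
proof -
  assume a: "\<alpha> \<in> gr K 0" and "\<beta> \<in> carrier K"
  from this(2) show ?thesis
  proof (induction \<beta> rule: K.gr_induct)
    case (gr i y)
    then show ?case using K.supercommutative[OF a gr] by simp
  next
    case (add y z)
    then show ?case using a by (simp add: K.l_distr K.r_distr K.gr_closed)
  qed
qed

lemma hs_Lm: "F \<in> Lm p ==> \<alpha> \<in> gr K 0 ==> hs \<alpha> F \<in> Lm p"
proof (rule LmI)
  fix x \<beta> assume "F \<in> Lm p" "\<alpha> \<in> gr K 0" "x \<in> carrier S" "\<beta> \<in> carrier K"
  then show "hs \<alpha> F (x \<odot> \<kappa> \<beta>) = hact (hs \<alpha> F x) \<beta>"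
    using even_comm[of \<alpha> \<beta>] by (simp add: hs_def Lm_scalar hact_hact K.gr_closed)
next
  fix j x assume "F \<in> Lm p" "\<alpha> \<in> gr K 0" "x \<in> gr S j"
  then show "hs \<alpha> F x \<in> hgr (p + j)" using hact_hgr[OF Lm_gr, of F p x j \<alpha> 0] by (simp add: hs_def)
qed (auto simp: hs_def Lm_outside Lm_add hact_add K.gr_closed)

lemma hs_linear:
  assumes "\<alpha> \<in> carrier K"
  shows "hs \<alpha> (F + G) = hs \<alpha> F + hs \<alpha> G" "hs \<alpha> (- F) = - hs \<alpha> F" "hs \<alpha> (sg e F) = sg e (hs \<alpha> F)"
    "hs \<alpha> (sum H A) = (\<Sum>i\<in>A. hs \<alpha> (H i))" "hs \<alpha> 0 = 0"
  using assms by (auto simp: hs_def fun_eq_iff hact_add hact_minus hact_sg sum_fun_apply hact_sum)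

lemma hs_hs: "\<alpha> \<in> carrier K ==> \<beta> \<in> carrier K ==> hs \<beta> (hs \<alpha> F) = hs (\<alpha> \<star> \<beta>) F"
  by (simp add: hs_def hact_hact)

lemma hs_add_scalar: "\<alpha> \<in> carrier K ==> \<beta> \<in> carrier K ==> hs (\<alpha> \<oplus>\<^bsub>K\<^esub> \<beta>) F = hs \<alpha> F + hs \<beta> F"
  by (auto simp: hs_def fun_eq_iff hact_add_scalar)

lemma lX_hs: "\<alpha> \<in> carrier K ==> lX X (hs \<alpha> F) = hs \<alpha> (lX X F)"
  by (auto simp: lX_def hs_def fun_eq_iff)

lemma rc_hs: "\<alpha> \<in> carrier K ==> rc (hs \<alpha> F) q \<psi> = hs \<alpha> (rc F q \<psi>)"
  by (auto simp: rc_def hs_def fun_eq_iff)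

lemma cb_hs_left:
  assumes "F \<in> Lm p" "G \<in> Lm q" and \<alpha>: "\<alpha> \<in> gr K 0"
  shows "cb q (hs \<alpha> F) G = hs \<alpha> (cb q F G)"
proof
  fix x
  have \<alpha>c: "\<alpha> \<in> carrier K" using \<alpha> by auto
  show "cb q (hs \<alpha> F) G x = hs \<alpha> (cb q F G) x"
  proof (cases "x \<in> carrier S")
    case True
    then show ?thesis using assms(1,2)
    proof (induction x arbitrary: F G p q rule: S_lin_induct)
      case one
      then show ?case using cb_one[OF hs_Lm[OF one(1) \<alpha>] one(2)] hbr_hact_left[OF Lm_one[OF one(2)] \<alpha>]
        by (simp add: hs_def cb_one)
    next
      case (scalar x \<beta>)
      note L = cb_Lm[OF hs_Lm[OF scalar(4) \<alpha>] scalar(5)] hs_Lm[OF cb_Lm[OF scalar(4,5)] \<alpha>]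
      show ?case using scalar(3)[OF scalar(4,5)] scalar(1,2) by (simp add: Lm_scalar[OF L(1)] Lm_scalar[OF L(2)])
    next
      case (mult X i w)
      note F = mult(4) and G = mult(5)
      show ?case
        using mult(3)[OF lX_Lm[OF F mult(1)] G] mult(3)[OF F lX_Lm[OF G mult(1)]]
        unfolding lX_apply[OF mult(2)] lX_hs[OF \<alpha>c] cb_lX[OF hs_Lm[OF F \<alpha>] G mult(1)] cb_lX[OF F G mult(1)]
        by (simp add: hs_linear[OF \<alpha>c])
    next
      case (add x y)
      note L = cb_Lm[OF hs_Lm[OF add(5) \<alpha>] add(6)] hs_Lm[OF cb_Lm[OF add(5,6)] \<alpha>]
      show ?case using add(3)[OF add(5,6)] add(4)[OF add(5,6)] add(1,2)
        by (simp add: Lm_add[OF L(1)] Lm_add[OF L(2)])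
    qed
  qed (simp add: cb_def hs_def \<alpha>c)
qed

lemma cb_hs_right:
  assumes "F \<in> Lm p" "G \<in> Lm q" and \<alpha>: "\<alpha> \<in> gr K 0"
  shows "cb q F (hs \<alpha> G) = hs \<alpha> (cb q F G)"
proof -
  have \<alpha>c: "\<alpha> \<in> carrier K" using \<alpha> by auto
  show ?thesis
    unfolding cb_skew[OF assms(1) hs_Lm[OF assms(2) \<alpha>]] cb_hs_left[OF assms(2,1) \<alpha>] cb_skew[OF assms(1,2)]
    by (simp only: hs_linear[OF \<alpha>c])
qed

lemma xp_linear:
  shows "F \<in> Lm p ==> G \<in> Lm p ==> xp p (F + G) = xp p F + xp p G"
    and "F \<in> Lm p ==> xp p (- F) = - xp p F"
    and "F \<in> Lm p ==> \<alpha> \<in> gr K 0 ==> xp p (hs \<alpha> F) = hs \<alpha> (xp p F)"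
    and "(\<And>i. i \<in> A ==> H i \<in> Lm p) ==> xp p (sum H A) = (\<Sum>i\<in>A. xp p (H i))"
  unfolding xp_def
  by (auto intro: cb_add_right[OF piL_Lm] cb_minus(2)[OF piL_Lm] cb_hs_right[OF piL_Lm] cb_sum_right piL_Lm)

lemma xp_pow_linear:
  shows "F \<in> Lm p ==> (xp p ^^ n) (- F) = - (xp p ^^ n) F"
    and "F \<in> Lm p ==> \<alpha> \<in> gr K 0 ==> (xp p ^^ n) (hs \<alpha> F) = hs \<alpha> ((xp p ^^ n) F)"
    and "(\<And>i. i \<in> A ==> H i \<in> Lm p) ==> (xp p ^^ n) (sum H A) = (\<Sum>i\<in>A. (xp p ^^ n) (H i))"
  by (induction n) (auto simp: xp_linear xp_pow_Lm)

text \<open>Iterate \<open>rc_xp\<close>, starting from the constant, which the coderivation kills.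
  With x for ad pi on the bracket and u for ad pi on a, the operator obtained is minus the sum of
  x^i u^(n-1-i), that is, minus the difference quotient of t^n at x and u.\<close>

lemma rc_Fn:
  assumes a: "a \<in> gr \<gg> p" and \<psi>: "\<psi> \<in> Lm q"
  shows "rc (Fn p a n) q \<psi> = - (\<Sum>i<n. (xp (p + q) ^^ i) (cb q (Fn p a (n - 1 - i)) \<psi>))"
proof (induction n)
  case 0
  then show ?case by (simp add: Fn_0 rc_cst[OF a \<psi>])
next
  case (Suc n)
  let ?t = "\<lambda>i. (xp (p + q) ^^ i) (cb q (Fn p a (n - 1 - i)) \<psi>)"
  have t: "?t i \<in> Lm (p + q)" for i by (intro xp_pow_Lm cb_Lm Fn_Lm a \<psi>)
  have "rc (Fn p a (Suc n)) q \<psi> = xp (p + q) (- (\<Sum>i<n. ?t i)) - cb q (Fn p a n) \<psi>"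
    unfolding Fn_Suc rc_xp[OF Fn_Lm[OF a] \<psi>] Suc ..
  also have "xp (p + q) (- (\<Sum>i<n. ?t i)) = - (\<Sum>i<n. xp (p + q) (?t i))"
    by (simp only: xp_linear(2)[OF Lm_sum[OF t]] xp_linear(4)[OF t])
  also have "(\<Sum>i<n. xp (p + q) (?t i)) = (\<Sum>i<n. (xp (p + q) ^^ Suc i) (cb q (Fn p a (Suc n - 1 - Suc i)) \<psi>))"
    by (rule sum.cong) auto
  also have "- \<dots> - cb q (Fn p a n) \<psi> = - (\<Sum>i<Suc n. (xp (p + q) ^^ i) (cb q (Fn p a (Suc n - 1 - i)) \<psi>))"
    unfolding sum.lessThan_Suc_shift by (simp only: funpow.simps minus_add_distrib diff_conv_add_uminus add.commute id_apply diff_zero diff_Suc_1)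
  finally show ?case .
qed

definition deg where "deg x = (LEAST m. fil m x)"

lemma deg: "x \<in> carrier S ==> fil (deg x) x" and deg_le: "fil m x ==> deg x \<le> m"
  unfolding deg_def using ex_fil[of x] by (auto intro: LeastI_ex Least_le)

definition phiT where "phiT c p a M = (\<Sum>n\<le>M. hs (c n) (Fn p a n))"

text \<open>$\varphi^a$ for \<open>a\<close> of parity \<open>p\<close>; the sum over $n$ is locally finite.\<close>

definition phiL where "phiL c p a x = (if x \<in> carrier S then phiT c p a (deg x) x else 0)"

lemma phiT_Lm: "a \<in> gr \<gg> p ==> (\<And>n. c n \<in> gr K 0) ==> phiT c p a M \<in> Lm p"
  unfolding phiT_def by (intro Lm_sum hs_Lm Fn_Lm)

lemma phiT_apply: "phiT c p a M x = (\<Sum>n\<le>M. hact (Fn p a n x) (c n))"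
  by (simp add: phiT_def sum_fun_apply hs_def)

lemma phiT_fil:
  assumes "a \<in> gr \<gg> p" "\<And>n. c n \<in> gr K 0" "fil m x" "m \<le> M"
  shows "phiT c p a M x = phiT c p a m x"
  unfolding phiT_apply
proof (rule sum.mono_neutral_right)
  show "\<forall>i\<in>{..M} - {..m}. hact (Fn p a i x) (c i) = 0"
    using vanishesD[OF Fn_vanishes[OF assms(1)] assms(3)] K.gr_closed[OF assms(2)] by auto
qed (use assms(4) in auto)

lemma phiL_fil:
  assumes "a \<in> gr \<gg> p" "\<And>n. c n \<in> gr K 0" "fil m x" "m \<le> M"
  shows "phiL c p a x = phiT c p a M x"
proof -
  have "x \<in> carrier S" using assms fil_closed by blast
  then show ?thesis
    using phiT_fil[OF assms(1,2) deg, of x M] deg_le[OF assms(3)] assms(4) by (simp add: phiL_def)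
qed

text \<open>The truncation index depends on the argument. For each identity a bound common to the
  arguments involved is chosen, and the truncated sums lie in L.\<close>

lemma phiL_Lm: assumes a: "a \<in> gr \<gg> p" and c: "\<And>n. c n \<in> gr K 0" shows "phiL c p a \<in> Lm p"
proof (rule LmI)
  note T = phiT_Lm[of a p c, OF a c]
  show "phiL c p a x = 0" if "x \<notin> carrier S" for x using that by (simp add: phiL_def)
  show "phiL c p a (x \<oplus>\<^bsub>S\<^esub> y) = phiL c p a x + phiL c p a y" if xy: "x \<in> carrier S" "y \<in> carrier S" for x y
  proof -
    let ?M = "max (deg x) (deg y)"
    have f: "fil ?M x" "fil ?M y" using deg[OF xy(1)] deg[OF xy(2)] fil_mono by (meson max.cobounded1 max.cobounded2)+
    then have "fil ?M (x \<oplus>\<^bsub>S\<^esub> y)" by (rule fil_add)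
    then show ?thesis using f Lm_add[OF T xy]
      by (simp only: phiL_fil[of a p c, OF a c _ order.refl])
  qed
  show "phiL c p a (x \<odot> \<kappa> \<alpha>) = hact (phiL c p a x) \<alpha>" if x: "x \<in> carrier S" "\<alpha> \<in> carrier K" for x \<alpha>
  proof -
    obtain n where n: "fil n (x \<odot> \<kappa> \<alpha>)" using ex_fil[of "x \<odot> \<kappa> \<alpha>"] x by auto
    let ?M = "max (deg x) n"
    have f: "fil ?M x" "fil ?M (x \<odot> \<kappa> \<alpha>)" using deg[OF x(1)] n fil_mono by (meson max.cobounded1 max.cobounded2)+
    then show ?thesis using Lm_scalar[OF T x]
      by (simp only: phiL_fil[of a p c, OF a c _ order.refl])
  qed
  show "phiL c p a x \<in> hgr (p + j)" if x: "x \<in> gr S j" for j x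
    using Lm_gr[OF T x] x gr_S_closed by (simp add: phiL_def)
qed

end

section \<open>A functional equation for $t/(e^t-1)$\<close>

text \<open>The series t / (e^t - 1), obtained by inverting (e^t - 1) / t. Its coefficients
  \<open>bco n\<close> are B_n / n! with the Bernoulli numbers B_n, where B_1 = -1/2.\<close>

definition todd :: "rat fps" where "todd = inverse (Abs_fps (\<lambda>n. 1 / fact (Suc n)))"
definition bco :: "nat \<Rightarrow> rat" where "bco n = fps_nth todd n"

lemma todd_exp: "todd * (fps_exp 1 - 1) = fps_X"
proof -
  let ?U = "Abs_fps (\<lambda>n. 1 / fact (Suc n)) :: rat fps"
  have "fps_exp 1 - 1 = fps_X * ?U"
  proof (rule fps_ext)
    fix n show "fps_nth (fps_exp 1 - 1) n = fps_nth (fps_X * ?U) n" by (cases n) (auto simp: algebra_simps)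
  qed
  moreover have "todd * ?U = 1" unfolding todd_def by (rule inverse_mult_eq_1) simp
  ultimately show ?thesis by (simp add: mult.left_commute)
qed

text \<open>The series f(u X) for f(t) = t / (e^t - 1). The variable X records the total degree, so
  the identity in two variables becomes one of power series in X with rational parameters u and
  v.\<close>

definition todd_scaled :: "rat \<Rightarrow> rat fps" where "todd_scaled u = Abs_fps (\<lambda>n. bco n * u ^ n)"

lemma bco_sum: "(\<Sum>k\<le>n. bco k * (if n - k = 0 then 0 else 1 / fact (n - k))) = (if n = 1 then 1 else 0)"
proof -
  have "fps_nth (todd * (fps_exp 1 - 1)) n = (\<Sum>k\<le>n. bco k * (if n - k = 0 then 0 else 1 / fact (n - k)))"
    unfolding fps_mult_nth atLeast0AtMost by (rule sum.cong) (auto simp: bco_def)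
  then show ?thesis unfolding todd_exp by simp
qed

lemma todd_scaled_exp: "todd_scaled u * (fps_exp u - 1) = fps_const u * fps_X"
proof (rule fps_ext)
  fix n
  have "fps_nth (todd_scaled u * (fps_exp u - 1)) n = (\<Sum>k\<le>n. u ^ n * (bco k * (if n - k = 0 then 0 else 1 / fact (n - k))))"
    unfolding fps_mult_nth atLeast0AtMost
    by (rule sum.cong) (auto simp: todd_scaled_def power_add[symmetric])
  also have "\<dots> = u ^ n * (if n = 1 then 1 else 0)" unfolding sum_distrib_left[symmetric] bco_sum ..
  finally show "fps_nth (todd_scaled u * (fps_exp u - 1)) n = fps_nth (fps_const u * fps_X) n"
    by (cases "n = 1") auto
qed

text \<open>Write u X = f(u X) (e^(u X) - 1), and likewise for v. Then the factor in parentheses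
  times X becomes f(u X) f(v X) (e^((u+v) X) - 1), because (p - 1) + (q - 1) + (p - 1) (q - 1) = p q
  - 1. The assumption makes e^((u+v) X) - 1 nonzero, so it can be cancelled.\<close>

lemma todd_functional_equation:
  assumes "u + v \<noteq> 0"
  shows "todd_scaled (u + v) * (fps_const u * todd_scaled v + fps_const v * todd_scaled u + fps_const (u * v) * fps_X) =
    fps_const (u + v) * todd_scaled u * todd_scaled v"
proof -
  let ?f = todd_scaled and ?e = fps_exp
  have ne: "?e (u + v) - 1 \<noteq> (0 :: rat fps)"
  proof
    assume "?e (u + v) - 1 = (0 :: rat fps)"
    then have "fps_nth (?e (u + v) - 1 :: rat fps) 1 = 0" by simp
    with assms show False by simp
  qed
  have X: "fps_const u * fps_X = ?f u * (?e u - 1)" "fps_const v * fps_X = ?f v * (?e v - 1)"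
    by (simp_all add: todd_scaled_exp)
  have "?f (u + v) * (fps_const u * ?f v + fps_const v * ?f u + fps_const (u * v) * fps_X) * (?e (u + v) - 1) * fps_X =
    (?f (u + v) * (?e (u + v) - 1)) * ((fps_const u * fps_X) * ?f v + (fps_const v * fps_X) * ?f u + (fps_const u * fps_X) * (fps_const v * fps_X))"
    by (simp add: algebra_simps flip: fps_const_mult)
  also have "\<dots> = (fps_const (u + v) * fps_X) * (?f u * ?f v * (?e u * ?e v - 1))"
    unfolding todd_scaled_exp[of "u + v"] X by (simp add: algebra_simps)
  also have "\<dots> = fps_const (u + v) * ?f u * ?f v * (?e (u + v) - 1) * fps_X"
    by (simp add: fps_exp_add_mult algebra_simps)
  finally show ?thesis using ne by simp
qed

lemma todd_scaled_mult_nth: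
  "(\<Sum>n\<le>m. bco n * bco (m - n) * (u ^ n * v ^ (m - n))) = fps_nth (todd_scaled u * todd_scaled v) m"
  unfolding fps_mult_nth atLeast0AtMost by (rule sum.cong) (auto simp: todd_scaled_def)

text \<open>
  The functional equation in homogeneous degree \<open>k\<close>, divided by $uv$ and dehomogenised by $u=1$,
  $v=z$.
\<close>

definition todd_poly :: "nat \<Rightarrow> rat poly" where
  "todd_poly k = (\<Sum>n\<le>Suc k. smult (bco n * bco (Suc k - n))
      (\<Sum>i<n. [:1, 1:] ^ i * [:0, 1:] ^ (Suc k - n) + [:1, 1:] ^ i * [:0, 1:] ^ (n - 1 - i)))
    + smult (bco k) ([:1, 1:] ^ k)"

text \<open>For z different from -1, z times the value at z is the coefficient of X^(k+1) in the
  functional equation at u = 1 and v = z. A polynomial over the rationals with zero values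
  everywhere is zero, and the auxiliary factors z and 1 + z cancel in an integral domain.\<close>

lemma todd_poly_eq_0: "todd_poly k = 0"
proof -
  have z: "z * poly (todd_poly k) z = 0" if z: "1 + z \<noteq> 0" for z :: rat
  proof -
    let ?f = todd_scaled
    \<comment> \<open>The two geometric sums are the difference quotients of t^n at 1 + z with 1 and
      with z; their denominators are z and 1.\<close>
    have inner: "z * (\<Sum>i<n. (1 + z) ^ i * z ^ l + (1 + z) ^ i * z ^ (n - 1 - i)) =
        (1 + z) ^ n * z ^ l - 1 ^ n * z ^ l + z * ((1 + z) ^ n * 1 ^ l) - z * (z ^ n * 1 ^ l)" for n l
    proof -
      have "(1 + z) ^ n - 1 = z * (\<Sum>i<n. (1 + z) ^ i)"
        using power_diff_1_eq[of "1 + z" n] by simp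
      moreover have "(1 + z) ^ n - z ^ n = (\<Sum>i<n. (1 + z) ^ i * z ^ (n - 1 - i))"
        using power_diff_sumr2[of "1 + z" n z] by (simp add: mult.commute)
      ultimately have *: "z * (\<Sum>i<n. (1 + z) ^ i) * z ^ l + z * (\<Sum>i<n. (1 + z) ^ i * z ^ (n - 1 - i)) =
          ((1 + z) ^ n - 1) * z ^ l + z * ((1 + z) ^ n - z ^ n)" by simp
      have "z * (\<Sum>i<n. (1 + z) ^ i * z ^ l + (1 + z) ^ i * z ^ (n - 1 - i)) =
          z * (\<Sum>i<n. (1 + z) ^ i) * z ^ l + z * (\<Sum>i<n. (1 + z) ^ i * z ^ (n - 1 - i))"
        unfolding sum.distrib sum_distrib_right[symmetric] by (simp only: distrib_left mult.assoc)
      then show ?thesis unfolding * by (simp add: left_diff_distrib right_diff_distrib)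
    qed
    have "z * poly (todd_poly k) z = (\<Sum>n\<le>Suc k. bco n * bco (Suc k - n) *
        (z * (\<Sum>i<n. (1 + z) ^ i * z ^ (Suc k - n) + (1 + z) ^ i * z ^ (n - 1 - i)))) + z * (bco k * (1 + z) ^ k)"
      by (simp add: todd_poly_def poly_sum distrib_left sum_distrib_left algebra_simps)
    also have "\<dots> = fps_nth (?f (1 + z) * ?f z - ?f 1 * ?f z + fps_const z * (?f (1 + z) * ?f 1) - fps_const z * (?f z * ?f 1)
        + fps_const z * (fps_X * ?f (1 + z))) (Suc k)"
    proof -
      have "(\<Sum>n\<le>Suc k. bco n * bco (Suc k - n) * ((1 + z) ^ n * z ^ (Suc k - n) - 1 ^ n * z ^ (Suc k - n)
          + z * ((1 + z) ^ n * 1 ^ (Suc k - n)) - z * (z ^ n * 1 ^ (Suc k - n)))) =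
        (\<Sum>n\<le>Suc k. bco n * bco (Suc k - n) * ((1 + z) ^ n * z ^ (Suc k - n))) -
        (\<Sum>n\<le>Suc k. bco n * bco (Suc k - n) * (1 ^ n * z ^ (Suc k - n))) +
        z * (\<Sum>n\<le>Suc k. bco n * bco (Suc k - n) * ((1 + z) ^ n * 1 ^ (Suc k - n))) -
        z * (\<Sum>n\<le>Suc k. bco n * bco (Suc k - n) * (z ^ n * 1 ^ (Suc k - n)))"
        unfolding sum_distrib_left sum.distrib[symmetric] sum_subtractf[symmetric]
        by (rule sum.cong[OF refl]) (simp only: distrib_left right_diff_distrib mult.left_commute)
      also have "\<dots> = fps_nth (?f (1 + z) * ?f z - ?f 1 * ?f z + fps_const z * (?f (1 + z) * ?f 1) - fps_const z * (?f z * ?f 1)) (Suc k)"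
        unfolding todd_scaled_mult_nth by (simp only: fps_add_nth fps_sub_nth fps_mult_left_const_nth)
      finally have *: "(\<Sum>n\<le>Suc k. bco n * bco (Suc k - n) * ((1 + z) ^ n * z ^ (Suc k - n) - 1 ^ n * z ^ (Suc k - n)
          + z * ((1 + z) ^ n * 1 ^ (Suc k - n)) - z * (z ^ n * 1 ^ (Suc k - n)))) = \<dots>" .
      show ?thesis unfolding inner * by (simp add: todd_scaled_def)
    qed
    also have "?f (1 + z) * ?f z - ?f 1 * ?f z + fps_const z * (?f (1 + z) * ?f 1) - fps_const z * (?f z * ?f 1)
        + fps_const z * (fps_X * ?f (1 + z)) = ?f (1 + z) * (fps_const 1 * ?f z + fps_const z * ?f 1 + fps_const (1 * z) * fps_X)
        - fps_const (1 + z) * ?f 1 * ?f z"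
      by (simp add: algebra_simps flip: fps_const_add)
    also have "\<dots> = 0" unfolding todd_functional_equation[of 1 z, OF z] by simp
    finally show ?thesis by simp
  qed
  \<comment> \<open>The factor 1 + z covers the excluded point z = -1.\<close>
  have "poly ([:1, 1:] * ([:0, 1:] * todd_poly k)) z = 0" for z
  proof -
    have "poly ([:1, 1:] * ([:0, 1:] * todd_poly k)) z = (1 + z) * (z * poly (todd_poly k) z)"
      by (simp add: algebra_simps)
    moreover have "(1 + z) * (z * poly (todd_poly k) z) = 0"
      using z[of z] by (cases "1 + z = 0") (simp_all only: mult_zero_left mult_zero_right not_False_eq_True)
    ultimately show ?thesis by simp
  qed
  then have "[:1, 1:] * ([:0, 1:] * todd_poly k) = 0" by (simp only: poly_all_0_iff_0[symmetric]) simp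
  then have "[:1, 1:] = (0 :: rat poly) \<or> [:0, 1:] = (0 :: rat poly) \<or> todd_poly k = 0"
    by (simp only: mult_eq_0_iff)
  then show ?thesis by simp
qed

section \<open>Rational scalars and the power series $\varphi_c$\<close>

context lie_sym
begin

definition zi :: "int \<Rightarrow> 'k" where "zi k = [k] \<cdot>\<^bsub>K\<^esub> \<one>\<^bsub>K\<^esub>"

lemma zi_closed [simp, intro]: "zi k \<in> carrier K"
  by (simp add: zi_def K.add.int_pow_closed)

lemma zi_1 [simp]: "zi 1 = \<one>\<^bsub>K\<^esub>"
  by (simp add: zi_def K.add.int_pow_1)

lemma zi_add: "zi (k + l) = zi k \<oplus>\<^bsub>K\<^esub> zi l"
  by (simp add: zi_def K.add.int_pow_mult)

lemma zi_0 [simp]: "zi 0 = \<zero>\<^bsub>K\<^esub>"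
  using zi_add[of 0 0] by (simp add: K.add.l_cancel_one')

lemma zi_minus: "zi (- k) = \<ominus>\<^bsub>K\<^esub> zi k"
  by (simp add: zi_def K.add.int_pow_neg)

lemma zi_mult: "zi (k * l) = zi k \<star> zi l"
  by (simp add: zi_def K.add_pow_ldistr_int K.add.int_pow_pow mult.commute[of k] K.add.int_pow_closed)

lemma zi_nat: "zi (int n) = [n] \<cdot>\<^bsub>K\<^esub> \<one>\<^bsub>K\<^esub>"
  by (simp add: zi_def add_pow_int_ge)

lemma zi_even: "zi k \<in> gr K 0"
proof -
  have n: "zi (int n) \<in> gr K 0" for n
  proof (induction n)
    case (Suc n)
    have "zi (int (Suc n)) = zi (int n) \<oplus>\<^bsub>K\<^esub> \<one>\<^bsub>K\<^esub>" by (metis of_nat_Suc add.commute zi_1 zi_add)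
    then show ?case using Suc K.gr_one by auto
  qed simp
  show ?thesis
  proof (cases "k \<ge> 0")
    case True
    then show ?thesis using n[of "nat k"] by simp
  next
    case False
    then show ?thesis using n[of "nat (- k)"] zi_minus[of k] K.gr_a_inv[of "zi (- k)" 0] by simp
  qed
qed

lemma zi_unit: "k \<noteq> 0 ==> zi k \<in> Units K"
proof -
  have p: "zi k \<in> Units K" if "k > 0" for k
    using contains_rationals that zi_nat[of "nat k"] by (simp add: contains_rationals_def)
  assume "k \<noteq> 0"
  then consider "k > 0" | "- k > 0" by linarith
  then show ?thesis
  proof cases
    case 2
    have "zi (- 1) \<star> zi (- 1) = \<one>\<^bsub>K\<^esub>" by (simp add: zi_mult[symmetric])
    then have "zi (- 1) \<in> Units K" unfolding Units_def by auto
    then show ?thesis using zi_mult[of "- 1" "- k"] p[OF 2] by simp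
  qed (rule p)
qed

lemma Units_cancel: "u \<in> Units K ==> x \<in> carrier K ==> y \<in> carrier K ==> x \<star> u = y \<star> u ==> x = y"
  by (metis K.Units_closed K.Units_inv_closed K.Units_r_inv K.m_assoc K.r_one)

text \<open>The even part of x u is the even part of x times u. If x u is even, cancelling u
  identifies x with its own even part.\<close>

lemma even_cancel:
  assumes "x \<in> carrier K" "u \<in> Units K" "u \<in> gr K 0" "x \<star> u \<in> gr K 0"
  shows "x \<in> gr K 0"
proof -
  have uc: "u \<in> carrier K" using assms by auto
  let ?a = "prt K 0 x" and ?b = "prt K 1 x"
  have ab: "?a \<in> gr K 0" "?b \<in> gr K 1" using assms by auto
  have x: "?a \<oplus>\<^bsub>K\<^esub> ?b = x" by (rule K.prt_sum[OF assms(1)])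
  have g: "?a \<star> u \<in> gr K 0" "?b \<star> u \<in> gr K 1"
    using K.gr_mult[OF ab(1) assms(3)] K.gr_mult[OF ab(2) assms(3)] by simp_all
  have "x \<star> u = ?a \<star> u \<oplus>\<^bsub>K\<^esub> ?b \<star> u"
    using K.l_distr[of ?a ?b u] x ab uc by auto
  then have "x \<star> u = prt K 0 (?a \<star> u \<oplus>\<^bsub>K\<^esub> ?b \<star> u)" using assms(4) by simp
  also have "\<dots> = ?a \<star> u" using K.prt_plus[OF g(1), of "?b \<star> u"] g by simp
  finally have "x = ?a" using Units_cancel[OF assms(2)] assms(1) ab by auto
  then show ?thesis using ab by simp
qed

lemma inv_even: "u \<in> Units K ==> u \<in> gr K 0 ==> inv\<^bsub>K\<^esub> u \<in> gr K 0"
  using even_cancel[of "inv\<^bsub>K\<^esub> u" u] K.gr_one by simp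

text \<open>The canonical map from the rationals into the even part of K, shown below to respect
  sums and products. It carries the coefficients of t / (e^t - 1) and the identities of rational
  polynomials over to K.\<close>

definition ofr :: "rat \<Rightarrow> 'k"
  where "ofr q = zi (fst (quotient_of q)) \<star> inv\<^bsub>K\<^esub> (zi (snd (quotient_of q)))"

lemma zi_comm: "x \<in> carrier K ==> zi k \<star> x = x \<star> zi k"
  by (rule even_comm[OF zi_even])

lemma snd_quotient_of [simp]: "snd (quotient_of q) \<noteq> 0"
  using quotient_of_denom_pos' less_imp_neq by metis

lemma ofr_closed [simp, intro]: "ofr q \<in> carrier K"
  by (simp add: ofr_def zi_unit)

lemma ofr_even: "ofr q \<in> gr K 0"
  unfolding ofr_def using K.gr_mult[OF zi_even inv_even[OF zi_unit zi_even]] by simp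

text \<open>Frees \<open>ofr\<close> from the reduced fraction chosen by \<open>quotient_of\<close>:
  cross-multiply and cancel the invertible denominator.\<close>

lemma ofr_mult_zi: assumes "b \<noteq> 0" shows "ofr (of_int a / of_int b) \<star> zi b = zi a"
proof -
  let ?q = "of_int a / of_int b :: rat"
  obtain c d where cd: "quotient_of ?q = (c, d)" by (cases "quotient_of ?q")
  have d: "d \<noteq> 0" using snd_quotient_of[of ?q] cd by simp
  have "?q = of_int c / of_int d" using quotient_of_div[OF cd] .
  then have "(of_int (c * b) :: rat) = of_int (a * d)" using assms d by (simp add: field_simps)
  then have eq: "c * b = a * d" by (simp only: of_int_eq_iff)
  have o: "ofr ?q \<star> zi d = zi c" using zi_unit[OF d] by (simp add: ofr_def cd K.m_assoc)
  show ?thesis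
  proof (rule Units_cancel[OF zi_unit[OF d]])
    have "ofr ?q \<star> zi b \<star> zi d = ofr ?q \<star> zi d \<star> zi b"
      by (simp add: K.m_assoc zi_comm[of "zi b"])
    then show "ofr ?q \<star> zi b \<star> zi d = zi a \<star> zi d"
      unfolding o by (simp only: zi_mult[symmetric] eq)
  qed auto
qed

lemma ofr_eqI:
  assumes "b \<noteq> 0" "x \<in> carrier K" "x \<star> zi b = zi a" "q = of_int a / of_int b"
  shows "ofr q = x"
  by (rule Units_cancel[OF zi_unit[OF assms(1)]]) (use ofr_mult_zi[OF assms(1)] assms in auto)

lemma rat_fraction:
  fixes q :: rat
  obtains a b where "b \<noteq> 0" "q = of_int a / of_int b"
  using quotient_of_div[of q] snd_quotient_of[of q] by (metis prod.collapse)

lemma ofr_add: "ofr (s + t) = ofr s \<oplus>\<^bsub>K\<^esub> ofr t"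
proof -
  obtain a b where ab: "b \<noteq> 0" "s = of_int a / of_int b" by (rule rat_fraction)
  obtain c d where cd: "d \<noteq> 0" "t = of_int c / of_int d" by (rule rat_fraction)
  have s: "ofr s \<star> zi b = zi a" and t: "ofr t \<star> zi d = zi c"
    using ofr_mult_zi ab cd by auto
  have "(ofr s \<oplus>\<^bsub>K\<^esub> ofr t) \<star> zi (b * d) = ofr s \<star> zi b \<star> zi d \<oplus>\<^bsub>K\<^esub> ofr t \<star> zi d \<star> zi b"
    by (simp add: K.l_distr zi_mult K.m_assoc zi_comm[of "zi b"])
  then have "(ofr s \<oplus>\<^bsub>K\<^esub> ofr t) \<star> zi (b * d) = zi (a * d + c * b)"
    unfolding s t by (simp add: zi_mult zi_add)
  moreover have "s + t = of_int (a * d + c * b) / of_int (b * d)" using ab cd by (simp add: add_frac_eq)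
  ultimately show ?thesis using ab cd by (intro ofr_eqI[of "b * d" _ "a * d + c * b"]) auto
qed

lemma ofr_mult: "ofr (s * t) = ofr s \<star> ofr t"
proof -
  obtain a b where ab: "b \<noteq> 0" "s = of_int a / of_int b" by (rule rat_fraction)
  obtain c d where cd: "d \<noteq> 0" "t = of_int c / of_int d" by (rule rat_fraction)
  have s: "ofr s \<star> zi b = zi a" and t: "ofr t \<star> zi d = zi c"
    using ofr_mult_zi ab cd by auto
  have "(ofr s \<star> ofr t) \<star> zi (b * d) = ofr s \<star> (ofr t \<star> zi b) \<star> zi d"
    by (simp add: zi_mult K.m_assoc)
  also have "\<dots> = (ofr s \<star> zi b) \<star> (ofr t \<star> zi d)"
    by (simp add: zi_comm[of "ofr t", symmetric] K.m_assoc)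
  finally have "(ofr s \<star> ofr t) \<star> zi (b * d) = zi (a * c)"
    unfolding s t by (simp add: zi_mult)
  moreover have "s * t = of_int (a * c) / of_int (b * d)" using ab cd by simp
  ultimately show ?thesis using ab cd by (intro ofr_eqI[of "b * d" _ "a * c"]) auto
qed

lemma ofr_1 [simp]: "ofr 1 = \<one>\<^bsub>K\<^esub>" and ofr_0 [simp]: "ofr 0 = \<zero>\<^bsub>K\<^esub>"
  by (rule ofr_eqI[of 1 _ 1], simp_all) (rule ofr_eqI[of 1 _ 0], simp_all)

lemma ofr_minus: "ofr (- t) = \<ominus>\<^bsub>K\<^esub> ofr t"
  using ofr_add[of "- t" t] by (intro K.minus_equality[symmetric]) auto

lemma ofr_sum: "finite A ==> ofr (sum f A) = (\<Oplus>\<^bsub>K\<^esub>i\<in>A. ofr (f i))"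
  by (induction A rule: finite_induct) (auto simp: ofr_add)

lemma ofr_inverse: "k \<noteq> 0 ==> ofr (1 / of_int k) = inv\<^bsub>K\<^esub> (zi k)"
  by (rule ofr_eqI[of k _ 1]) (auto simp: zi_unit)

section \<open>The coefficients of the series belonging to a unit c\<close>

lemma even_units_simps:
  assumes "c \<in> even_units K"
  shows "c \<in> gr K 0" "c \<in> carrier K" "c \<in> Units K" "inv\<^bsub>K\<^esub> c \<in> gr K 0" "inv\<^bsub>K\<^esub> c \<in> carrier K"
    "c \<star> inv\<^bsub>K\<^esub> c = \<one>\<^bsub>K\<^esub>"
proof -
  obtain e where e: "c \<in> gr K 0" "e \<in> gr K 0" "e \<star> c = \<one>\<^bsub>K\<^esub>" "c \<star> e = \<one>\<^bsub>K\<^esub>"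
    using assms by (auto simp: even_units_def Units_def)
  then show c: "c \<in> gr K 0" "c \<in> carrier K" "c \<in> Units K" by (auto simp: Units_def)
  then show "inv\<^bsub>K\<^esub> c \<in> gr K 0" by (intro inv_even)
  then show "inv\<^bsub>K\<^esub> c \<in> carrier K" "c \<star> inv\<^bsub>K\<^esub> c = \<one>\<^bsub>K\<^esub>" using c by auto
qed

lemma even_pow: "x \<in> gr K 0 ==> x [^]\<^bsub>K\<^esub> (n :: nat) \<in> gr K 0"
proof (induction n)
  case (Suc n)
  then show ?case using K.gr_mult[of "x [^]\<^bsub>K\<^esub> n" 0 x 0] by simp
qed (simp add: K.gr_one)

text \<open>The coefficients of c f(t/c) for f(t) = t / (e^t - 1), which is t / (e^(t/c) -
  1).\<close>

definition psc where "psc c n = c \<star> inv\<^bsub>K\<^esub> c [^]\<^bsub>K\<^esub> n \<star> ofr (bco n)"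

lemma psc_even: assumes "c \<in> even_units K" shows "psc c n \<in> gr K 0"
proof -
  note c = even_units_simps[OF assms]
  have "c \<star> inv\<^bsub>K\<^esub> c [^]\<^bsub>K\<^esub> n \<in> gr K 0" using K.gr_mult[OF c(1) even_pow[OF c(4), of n]] by simp
  then show ?thesis unfolding psc_def using K.gr_mult[OF _ ofr_even] by (metis add_0_right)
qed

lemma exp_minus_one_ofr:
  assumes "c \<in> even_units K"
  shows "exp_minus_one K c n = inv\<^bsub>K\<^esub> c [^]\<^bsub>K\<^esub> n \<star> ofr (if n = 0 then 0 else 1 / fact n)"
proof -
  have "ofr (1 / of_int (int (fact n))) = inv\<^bsub>K\<^esub> (zi (int (fact n)))" by (rule ofr_inverse) simp
  then show ?thesis using even_units_simps(5)[OF assms] zi_nat[of "fact n"] by (simp add: exp_minus_one_def)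
qed

lemma psc_sum:
  assumes c: "c \<in> even_units K"
  shows "(\<Oplus>\<^bsub>K\<^esub>k\<in>{..n}. psc c k \<star> exp_minus_one K c (n - k)) = (if n = 1 then \<one>\<^bsub>K\<^esub> else \<zero>\<^bsub>K\<^esub>)"
proof -
  note cu = even_units_simps[OF c]
  let ?e = "inv\<^bsub>K\<^esub> c" and ?r = "\<lambda>n. if n = 0 then 0 else 1 / fact n :: rat"
  have "psc c k \<star> exp_minus_one K c (n - k) = c \<star> ?e [^]\<^bsub>K\<^esub> n \<star> ofr (bco k * ?r (n - k))"
    if "k \<le> n" for k
  proof -
    have p: "?e [^]\<^bsub>K\<^esub> n = ?e [^]\<^bsub>K\<^esub> k \<star> ?e [^]\<^bsub>K\<^esub> (n - k)"
      using that cu by (simp add: K.nat_pow_mult)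
    have "psc c k \<star> exp_minus_one K c (n - k) =
        c \<star> ?e [^]\<^bsub>K\<^esub> k \<star> (ofr (bco k) \<star> ?e [^]\<^bsub>K\<^esub> (n - k)) \<star> ofr (?r (n - k))"
      unfolding psc_def exp_minus_one_ofr[OF c] using cu by (simp add: K.m_assoc)
    also have "ofr (bco k) \<star> ?e [^]\<^bsub>K\<^esub> (n - k) = ?e [^]\<^bsub>K\<^esub> (n - k) \<star> ofr (bco k)"
      using cu by (intro even_comm[OF ofr_even]) simp
    finally show ?thesis unfolding p ofr_mult using cu by (simp add: K.m_assoc)
  qed
  then have "(\<Oplus>\<^bsub>K\<^esub>k\<in>{..n}. psc c k \<star> exp_minus_one K c (n - k)) =
      (\<Oplus>\<^bsub>K\<^esub>k\<in>{..n}. c \<star> ?e [^]\<^bsub>K\<^esub> n \<star> ofr (bco k * ?r (n - k)))"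
    using cu by (intro K.finsum_cong') auto
  also have "\<dots> = c \<star> ?e [^]\<^bsub>K\<^esub> n \<star> ofr (\<Sum>k\<le>n. bco k * ?r (n - k))"
    using cu by (subst K.finsum_rdistr[symmetric]) (auto simp: ofr_sum simp del: diff_is_0_eq diff_is_0_eq')
  also have "\<dots> = (if n = 1 then \<one>\<^bsub>K\<^esub> else \<zero>\<^bsub>K\<^esub>)"
    unfolding bco_sum using cu by simp
  finally show ?thesis .
qed

lemma phi_series_unit:
  assumes c: "c \<in> even_units K"
  shows "phi_series K c n = psc c n"
proof (cases "c = \<zero>\<^bsub>K\<^esub>")
  case True
  \<comment> \<open>A unit equal to zero forces the zero ring, in which the separate branch of
    \<open>phi_series\<close> for c = 0 gives the same coefficients.\<close>
  then have "\<one>\<^bsub>K\<^esub> = \<zero>\<^bsub>K\<^esub>" using even_units_simps(5,6)[OF c] by (metis K.l_null)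
  then have "carrier K = {\<zero>\<^bsub>K\<^esub>}" by (rule K.one_zeroD)
  moreover have "phi_series K c n \<in> carrier K" using True by (simp add: phi_series_def)
  ultimately show ?thesis using K.gr_closed[OF psc_even[OF c, of n]] by auto
next
  case False
  note cu = even_units_simps[OF c]
  let ?E = "exp_minus_one K c"
  let ?P = "\<lambda>b. range b \<subseteq> gr K 0 \<and> (\<forall>n. (\<Oplus>\<^bsub>K\<^esub>k\<in>{..n}. b k \<star> ?E (n - k)) = (if n = 1 then \<one>\<^bsub>K\<^esub> else \<zero>\<^bsub>K\<^esub>))"
  have Ec: "?E k \<in> carrier K" for k using cu by (simp add: exp_minus_one_ofr[OF c])
  have E1: "?E 1 = inv\<^bsub>K\<^esub> c" "?E 0 = \<zero>\<^bsub>K\<^esub>" using cu by (simp_all add: exp_minus_one_ofr[OF c])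
  have "(THE b. ?P b) = psc c"
  proof (rule the_equality)
    show "?P (psc c)" using psc_even[OF c] psc_sum[OF c] by auto
    fix b assume b: "?P b"
    have bc: "b k \<in> carrier K" "psc c k \<in> carrier K" for k using b psc_even[OF c] by blast+
    have "b n = psc c n" for n
    proof (induction n rule: less_induct)
      case (less n)
      \<comment> \<open>The coefficient at n + 1 determines b n: in it b (n + 1) is multiplied by
        the constant term of e^(t/c) - 1, which is zero, and b n by the invertible linear
        coefficient.\<close>
      have split: "(\<Oplus>\<^bsub>K\<^esub>k\<in>{..Suc n}. f k \<star> ?E (Suc n - k)) = f n \<star> inv\<^bsub>K\<^esub> c \<oplus>\<^bsub>K\<^esub> (\<Oplus>\<^bsub>K\<^esub>k\<in>{..<n}. f k \<star> ?E (Suc n - k))"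
        if f: "\<And>k. f k \<in> carrier K" for f
      proof -
        have "{..Suc n} = insert (Suc n) (insert n {..<n})" by auto
        then show ?thesis using f Ec E1 cu by (simp add: Suc_diff_le)
      qed
      have "b n \<star> inv\<^bsub>K\<^esub> c \<oplus>\<^bsub>K\<^esub> (\<Oplus>\<^bsub>K\<^esub>k\<in>{..<n}. b k \<star> ?E (Suc n - k)) =
        psc c n \<star> inv\<^bsub>K\<^esub> c \<oplus>\<^bsub>K\<^esub> (\<Oplus>\<^bsub>K\<^esub>k\<in>{..<n}. psc c k \<star> ?E (Suc n - k))"
        using b unfolding split[of b, OF bc(1), symmetric] split[of "psc c", OF bc(2), symmetric] psc_sum[OF c] by blast
      moreover have "(\<Oplus>\<^bsub>K\<^esub>k\<in>{..<n}. b k \<star> ?E (Suc n - k)) = (\<Oplus>\<^bsub>K\<^esub>k\<in>{..<n}. psc c k \<star> ?E (Suc n - k))"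
        using less bc Ec by (intro K.finsum_cong') auto
      ultimately have "b n \<star> inv\<^bsub>K\<^esub> c = psc c n \<star> inv\<^bsub>K\<^esub> c"
        using bc Ec cu by (simp add: K.add.right_cancel K.finsum_closed Pi_def)
      then show ?case by (rule Units_cancel[OF K.Units_inv_Units[OF cu(3)] bc])
    qed
    then show "b = psc c" by blast
  qed
  then show ?thesis using False by (simp add: phi_series_def)
qed

end

text \<open>This is f(-t) = f(t) + t for f(t) = t / (e^t - 1), proved by multiplying with e^t - 1.
  It says that the first coefficient is -1/2 and that all later odd ones vanish.\<close>

lemma bco_reflection: "(- 1) ^ n * bco n = bco n + (if n = 1 then 1 else 0)"
proof -
  let ?E = "fps_exp 1 :: rat fps"
  have EE: "fps_exp (- 1) * ?E = 1" using fps_exp_add_mult[of "- 1" "1 :: rat"] by simp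
  have "todd_scaled (- 1) * (?E - 1) = - (todd_scaled (- 1) * (fps_exp (- 1) - 1)) * ?E"
    using EE by (simp add: algebra_simps)
  also have "\<dots> = fps_X * ?E" unfolding todd_scaled_exp by (simp add: fps_const_neg[symmetric] del: fps_const_neg)
  also have "\<dots> = (todd + fps_X) * (?E - 1)" using todd_exp by (simp add: algebra_simps)
  finally have "todd_scaled (- 1) = todd + fps_X" using mult_right_cancel[of "?E - 1"]
  proof -
    assume *: "todd_scaled (- 1) * (?E - 1) = (todd + fps_X) * (?E - 1)"
    have "?E - 1 \<noteq> 0"
    proof
      assume "?E - 1 = 0"
      then have "fps_nth (?E - 1) 1 = 0" by simp
      then show False by simp
    qed
    with * show ?thesis by simp
  qed
  then have "fps_nth (todd_scaled (- 1)) n = fps_nth (todd + fps_X) n" by simp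
  then show ?thesis by (simp add: todd_scaled_def bco_def mult.commute)
qed

context lie_sym
begin

lemma even_units_neg: assumes "c \<in> even_units K" shows "\<ominus>\<^bsub>K\<^esub> c \<in> even_units K" "inv\<^bsub>K\<^esub> (\<ominus>\<^bsub>K\<^esub> c) = \<ominus>\<^bsub>K\<^esub> (inv\<^bsub>K\<^esub> c)"
proof -
  note c = even_units_simps[OF assms]
  have e: "(\<ominus>\<^bsub>K\<^esub> c) \<star> (\<ominus>\<^bsub>K\<^esub> (inv\<^bsub>K\<^esub> c)) = \<one>\<^bsub>K\<^esub>" "(\<ominus>\<^bsub>K\<^esub> (inv\<^bsub>K\<^esub> c)) \<star> (\<ominus>\<^bsub>K\<^esub> c) = \<one>\<^bsub>K\<^esub>"
    using c by (simp_all add: K.l_minus K.r_minus)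
  show "\<ominus>\<^bsub>K\<^esub> c \<in> even_units K"
    using c(1,4) e by (auto simp: even_units_def Units_def intro!: bexI[of _ "\<ominus>\<^bsub>K\<^esub> (inv\<^bsub>K\<^esub> c)"])
  show "inv\<^bsub>K\<^esub> (\<ominus>\<^bsub>K\<^esub> c) = \<ominus>\<^bsub>K\<^esub> (inv\<^bsub>K\<^esub> c)"
    by (rule K.inv_char) (use c e in auto)
qed

lemma pow_neg: "x \<in> carrier K ==> (\<ominus>\<^bsub>K\<^esub> x) [^]\<^bsub>K\<^esub> n = x [^]\<^bsub>K\<^esub> n \<star> ofr ((- 1) ^ n)" for n :: nat
proof (induction n)
  case (Suc n)
  then show ?case
    by (simp add: ofr_minus K.r_minus K.m_assoc even_comm[OF ofr_even, of x])
qed simp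

text \<open>Replacing c by -c multiplies c c^(-n) by -(-1)^n, and the reflection of
  \<open>bco\<close> turns this into a negated coefficient and the linear term -t.\<close>

lemma psc_neg: assumes "c \<in> even_units K"
  shows "psc (\<ominus>\<^bsub>K\<^esub> c) n = phi_series K \<zero>\<^bsub>K\<^esub> n \<ominus>\<^bsub>K\<^esub> psc c n"
proof -
  note c = even_units_simps[OF assms]
  let ?x = "c \<star> inv\<^bsub>K\<^esub> c [^]\<^bsub>K\<^esub> n"
  have x: "?x \<in> carrier K" using c by simp
  have "psc (\<ominus>\<^bsub>K\<^esub> c) n = \<ominus>\<^bsub>K\<^esub> (?x \<star> ofr ((- 1) ^ n * bco n))"
    using c by (simp add: psc_def even_units_neg[OF assms] pow_neg ofr_mult K.l_minus K.m_assoc)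
  also have "\<dots> = \<ominus>\<^bsub>K\<^esub> (?x \<star> ofr (if n = 1 then 1 else 0)) \<ominus>\<^bsub>K\<^esub> psc c n"
    unfolding bco_reflection ofr_add using x
    by (simp add: psc_def K.r_distr K.minus_add K.minus_eq K.a_comm)
  also have "\<ominus>\<^bsub>K\<^esub> (?x \<star> ofr (if n = 1 then 1 else 0)) = phi_series K \<zero>\<^bsub>K\<^esub> n"
    using c by (simp add: phi_series_def)
  finally show ?thesis .
qed

section \<open>The commutation relations\<close>

lemma hs_one: "F \<in> Lm p ==> hs \<one>\<^bsub>K\<^esub> F = F"
  using Lm_emb[of F p] by (auto simp: hs_def hact_def act_one fun_eq_iff)

lemma hs_zero [simp]: "hs \<zero>\<^bsub>K\<^esub> F = 0"
  using hs_add_scalar[of "\<zero>\<^bsub>K\<^esub>" "\<zero>\<^bsub>K\<^esub>" F] by simp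

lemma hs_diff: "\<alpha> \<in> carrier K ==> hs \<alpha> (F - G) = hs \<alpha> F - hs \<alpha> G"
  using hs_linear(1)[of \<alpha> F "- G"] hs_linear(2)[of \<alpha> G] by simp

lemma hs_uminus_scalar: "\<alpha> \<in> carrier K ==> hs (\<ominus>\<^bsub>K\<^esub> \<alpha>) F = - hs \<alpha> F"
  using hs_add_scalar[of \<alpha> "\<ominus>\<^bsub>K\<^esub> \<alpha>" F] by (simp add: K.r_neg eq_neg_iff_add_eq_0 add.commute)

section \<open>Polynomials in the two actions of the generic element on a bracket of fixed a and
  b\<close>

context
  fixes a b p q
  assumes a: "a \<in> gr \<gg> p" and b: "b \<in> gr \<gg> q"
begin

text \<open>The monomial u^j v^l applied to the bracket of a and b. By \<open>xp_bt\<close> the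
  action of \<open>piL\<close> on the whole bracket is u + v.\<close>

definition bt where "bt j l = cb q (Fn p a j) (Fn q b l)"

lemma bt_Lm: "bt j l \<in> Lm (p + q)"
  unfolding bt_def by (intro cb_Lm Fn_Lm a b)

lemma xp_bt: "xp (p + q) (bt j l) = bt (Suc j) l + bt j (Suc l)"
  unfolding bt_def xp_leibniz[OF Fn_Lm[OF a] Fn_Lm[OF b]] Fn_Suc ..

lemma bt_0: "bt 0 0 = cst (brk \<gg> a b)"
  unfolding bt_def Fn_0 by (rule cb_cst[OF a b])

text \<open>
  A polynomial in $z$ stands for the homogeneous polynomial of degree \<open>N\<close> obtained from it, applied to
  the commuting actions of \<open>piL\<close> on the two arguments of the bracket of \<open>a\<close> and \<open>b\<close>.
\<close>

definition ev where "ev N P = (\<Sum>m\<le>N. hs (ofr (coeff P m)) (bt (N - m) m))"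

lemma ev_add: "ev N (P + Q) = ev N P + ev N Q"
  by (simp add: ev_def ofr_add hs_add_scalar sum.distrib)

lemma ev_0 [simp]: "ev N 0 = 0"
  by (simp add: ev_def)

lemma ev_sum: "ev N (sum f A) = (\<Sum>i\<in>A. ev N (f i))"
  by (induction A rule: infinite_finite_induct) (auto simp: ev_add)

lemma ev_smult: "ev N (smult t P) = hs (ofr t) (ev N P)"
  by (simp add: ev_def hs_linear hs_hs ofr_mult[symmetric] mult.commute)

text \<open>Multiplication by 1 + z is the dehomogenised form of u + v. The degree bound ensures
  that no coefficient of P lies beyond the range of the sum.\<close>

lemma ev_mult:
  assumes "degree P \<le> N"
  shows "ev (Suc N) ([:1, 1:] * P) = xp (p + q) (ev N P)"
proof -
  have "coeff P (Suc N) = 0" using assms by (simp add: coeff_eq_0)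
  then have 1: "ev (Suc N) P = (\<Sum>m\<le>N. hs (ofr (coeff P m)) (bt (Suc N - m) m))"
    by (simp add: ev_def)
  have 2: "ev (Suc N) (pCons 0 P) = (\<Sum>m\<le>N. hs (ofr (coeff P m)) (bt (N - m) (Suc m)))"
    unfolding ev_def sum.atMost_Suc_shift by simp
  have "ev (Suc N) ([:1, 1:] * P) = ev (Suc N) P + ev (Suc N) (pCons 0 P)" by (simp add: ev_add[symmetric])
  also have "\<dots> = (\<Sum>m\<le>N. hs (ofr (coeff P m)) (xp (p + q) (bt (N - m) m)))"
    unfolding 1 2 sum.distrib[symmetric]
    by (rule sum.cong) (auto simp: xp_bt hs_linear Suc_diff_le)
  also have "\<dots> = xp (p + q) (ev N P)"
    unfolding ev_def by (simp add: xp_linear(4)[OF hs_Lm[OF bt_Lm ofr_even]] xp_linear(3)[OF bt_Lm ofr_even])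
  finally show ?thesis .
qed

lemma xp_pow_bt: "(xp (p + q) ^^ i) (bt j l) = ev (i + (j + l)) ([:1, 1:] ^ i * [:0, 1:] ^ l)"
proof (induction i)
  case 0
  have m: "[:0, 1:] ^ l = (monom 1 l :: rat poly)" by (simp add: monom_altdef)
  have "ev (j + l) (monom 1 l) = (\<Sum>m\<in>{l}. hs (ofr (coeff (monom 1 l) m)) (bt (j + l - m) m))"
    unfolding ev_def by (rule sum.mono_neutral_right) auto
  also have "\<dots> = bt j l" by (simp add: hs_one[OF bt_Lm])
  finally show ?case by (simp add: m)
next
  case (Suc i)
  have "degree ([:1, 1:] ^ i * [:0, 1:] ^ l :: rat poly) \<le> i + l"
    by (rule order.trans[OF degree_mult_le]) (simp add: degree_linear_power)
  then have "degree ([:1, 1:] ^ i * [:0, 1:] ^ l :: rat poly) \<le> i + (j + l)" by linarith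
  then show ?case by (simp only: funpow.simps comp_apply Suc ev_mult power_Suc mult.assoc add_Suc)
qed

text \<open>The contribution of the coefficients with indices \<open>n\<close> and \<open>l\<close> to the commutator.\<close>

definition uu where "uu n l = (\<Sum>i<n. (xp (p + q) ^^ i) (bt (n - 1 - i) l) + (xp (p + q) ^^ i) (bt l (n - 1 - i)))"

text \<open>Every summand of \<open>uu n l\<close> is a monomial of degree n + l - 1 in ad pi, hence
  the bound \<open>Suc N\<close> on the sum of the two indices.\<close>

lemma uu_vanishes: "fil N x ==> n + l > Suc N ==> uu n l x = 0"
proof -
  assume x: "fil N x" and N: "n + l > Suc N"
  have "(xp (p + q) ^^ i) (bt j k) x = 0" if "i + (j + k) > N" for i j k
  proof (rule vanishesD[OF xp_pow_vanishes[OF bt_Lm] x that])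
    show "vanishes (j + k) (bt j k)"
      unfolding bt_def by (rule cb_vanishes[OF Fn_Lm[OF a] Fn_Lm[OF b] Fn_vanishes[OF a] Fn_vanishes[OF b]])
  qed
  then show ?thesis using N by (auto simp: uu_def sum_fun_apply intro!: sum.neutral)
qed

lemma uu_ev: "n \<le> Suc k ==> uu n (Suc k - n) =
  ev k (\<Sum>i<n. [:1, 1:] ^ i * [:0, 1:] ^ (Suc k - n) + [:1, 1:] ^ i * [:0, 1:] ^ (n - 1 - i))"
proof -
  assume n: "n \<le> Suc k"
  have "(xp (p + q) ^^ i) (bt (n - 1 - i) (Suc k - n)) + (xp (p + q) ^^ i) (bt (Suc k - n) (n - 1 - i)) =
    ev k ([:1, 1:] ^ i * [:0, 1:] ^ (Suc k - n) + [:1, 1:] ^ i * [:0, 1:] ^ (n - 1 - i))" if i: "i < n" for i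
  proof -
    have e: "i + (n - 1 - i + (Suc k - n)) = k" "i + (Suc k - n + (n - 1 - i)) = k" using n i by auto
    show ?thesis unfolding xp_pow_bt ev_add e ..
  qed
  then show ?thesis by (simp add: uu_def ev_sum)
qed

text \<open>Both compositions are expanded by \<open>rc_Fn\<close>. Skewness turns the brackets
  starting with b around, which reverses the sign of the second composition; its subtraction then
  adds the mirrored monomials with the same sign as those of the first.\<close>

lemma rc_Fn_phiT:
  assumes c: "\<And>n. c n \<in> gr K 0"
  shows "rc (phiT c p a M) q (phiT c q b M) - sg (p * q) (rc (phiT c q b M) p (phiT c p a M)) =
    - (\<Sum>n\<le>M. \<Sum>l\<le>M. hs (c n \<star> c l) (uu n l))"
proof -
  have cc: "c n \<in> carrier K" for n using c by auto
  let ?x = "xp (p + q)"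
  have cbs: "cb q (Fn p a j) (phiT c q b M) = (\<Sum>l\<le>M. hs (c l) (bt j l))"
    "sg (p * q) (cb p (Fn q b j) (phiT c p a M)) = - (\<Sum>l\<le>M. hs (c l) (bt l j))" for j
  proof -
    show "cb q (Fn p a j) (phiT c q b M) = (\<Sum>l\<le>M. hs (c l) (bt j l))"
      unfolding phiT_def bt_def
      by (subst cb_sum_right) (auto intro!: hs_Lm Fn_Lm sum.cong cb_hs_right[OF Fn_Lm Fn_Lm] a b c)
    have "sg (p * q) (cb p (Fn q b j) (phiT c p a M)) = - cb q (phiT c p a M) (Fn q b j)"
      using cb_skew[OF phiT_Lm[of a p c, OF a c] Fn_Lm[OF b], of M j] by simp
    also have "cb q (phiT c p a M) (Fn q b j) = (\<Sum>l\<le>M. hs (c l) (bt l j))"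
      unfolding phiT_def bt_def
      by (subst cb_sum_left) (auto intro!: hs_Lm Fn_Lm sum.cong cb_hs_left[OF Fn_Lm Fn_Lm] a b c)
    finally show "sg (p * q) (cb p (Fn q b j) (phiT c p a M)) = - (\<Sum>l\<le>M. hs (c l) (bt l j))" .
  qed
  have L: "hs (c l) (bt i j) \<in> Lm (p + q)" for l i j by (intro hs_Lm bt_Lm c)
  have xs: "(?x ^^ i) (\<Sum>l\<le>M. hs (c l) (f l)) = (\<Sum>l\<le>M. hs (c l) ((?x ^^ i) (f l)))"
    if "\<And>l. f l \<in> Lm (p + q)" for f i
    using that by (simp add: xp_pow_linear(2,3) hs_Lm c)
  have 1: "rc (phiT c p a M) q (phiT c q b M) =
    - (\<Sum>n\<le>M. hs (c n) (\<Sum>i<n. \<Sum>l\<le>M. hs (c l) ((?x ^^ i) (bt (n - 1 - i) l))))"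
  proof -
    have "rc (phiT c p a M) q (phiT c q b M) = (\<Sum>n\<le>M. hs (c n) (rc (Fn p a n) q (phiT c q b M)))"
      unfolding phiT_def[of c p] by (simp add: rc_sum rc_hs cc)
    then show ?thesis
      unfolding rc_Fn[OF a phiT_Lm[of b q c, OF b c]] cbs xs[OF bt_Lm] hs_linear(2)[OF cc] sum_negf .
  qed
  have 2: "sg (p * q) (rc (phiT c q b M) p (phiT c p a M)) =
    (\<Sum>n\<le>M. hs (c n) (\<Sum>i<n. \<Sum>l\<le>M. hs (c l) ((?x ^^ i) (bt l (n - 1 - i)))))"
  proof -
    have l: "cb p (Fn q b j) (phiT c p a M) \<in> Lm (q + p)" for j by (intro cb_Lm Fn_Lm phiT_Lm a b c)
    have "sg (p * q) ((?x ^^ i) (cb p (Fn q b j) (phiT c p a M))) = - (\<Sum>l\<le>M. hs (c l) ((?x ^^ i) (bt l j)))" for i j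
    proof -
      have "sg (p * q) ((?x ^^ i) (cb p (Fn q b j) (phiT c p a M))) = (?x ^^ i) (sg (p * q) (cb p (Fn q b j) (phiT c p a M)))"
        using l[of j] by (simp add: sg_def xp_pow_linear(1) add.commute)
      then show ?thesis unfolding cbs xp_pow_linear(1)[OF Lm_sum[OF L]] xs[OF bt_Lm] .
    qed
    then have *: "sg (p * q) (- (\<Sum>i<n. (xp (q + p) ^^ i) (cb p (Fn q b (n - 1 - i)) (phiT c p a M)))) =
      (\<Sum>i<n. \<Sum>l\<le>M. hs (c l) ((?x ^^ i) (bt l (n - 1 - i))))" for n
      by (simp add: sg_minus sg_sum add.commute[of q] sum_negf)
    have "rc (phiT c q b M) p (phiT c p a M) = (\<Sum>n\<le>M. hs (c n) (rc (Fn q b n) p (phiT c p a M)))"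
      unfolding phiT_def[of c q] by (simp add: rc_sum rc_hs cc)
    then show ?thesis unfolding rc_Fn[OF b phiT_Lm[of a p c, OF a c]]
      by (simp only: sg_sum hs_linear(3)[OF cc, symmetric] *)
  qed
  have 3: "hs (c n) (\<Sum>i<n. \<Sum>l\<le>M. hs (c l) ((?x ^^ i) (bt (n - 1 - i) l))) +
      hs (c n) (\<Sum>i<n. \<Sum>l\<le>M. hs (c l) ((?x ^^ i) (bt l (n - 1 - i)))) = (\<Sum>l\<le>M. hs (c n \<star> c l) (uu n l))" for n
  proof -
    have "hs (c n) (\<Sum>i<n. \<Sum>l\<le>M. hs (c l) ((?x ^^ i) (bt (n - 1 - i) l))) +
      hs (c n) (\<Sum>i<n. \<Sum>l\<le>M. hs (c l) ((?x ^^ i) (bt l (n - 1 - i)))) =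
      (\<Sum>i<n. \<Sum>l\<le>M. hs (c n \<star> c l) ((?x ^^ i) (bt (n - 1 - i) l) + (?x ^^ i) (bt l (n - 1 - i))))"
      by (simp add: hs_linear[OF cc] hs_linear(1) hs_hs cc even_comm[OF c cc] sum.distrib)
    also have "\<dots> = (\<Sum>l\<le>M. hs (c n \<star> c l) (uu n l))"
      unfolding uu_def by (subst sum.swap) (simp add: hs_linear(4) cc)
    finally show ?thesis .
  qed
  show ?thesis unfolding 1 2 3[symmetric] sum.distrib by simp
qed

text \<open>The products of the two coefficients share the factor c c^(-k), because c^2 c^(-k-1) = c
  c^(-k). What remains is the sum over n in \<open>todd_poly k\<close>, and since that polynomial is
  zero the sum equals -b_k (1 + z)^k, with b_k the coefficient \<open>bco k\<close>.\<close>

lemma uu_sum: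
  assumes c: "c \<in> even_units K"
  shows "(\<Sum>n\<le>Suc k. hs (psc c n \<star> psc c (Suc k - n)) (uu n (Suc k - n))) =
    - hs (psc c k) (Fn (p + q) (brk \<gg> a b) k)"
proof -
  note cu = even_units_simps[OF c]
  let ?e = "inv\<^bsub>K\<^esub> c"
  let ?y = "c \<star> ?e [^]\<^bsub>K\<^esub> k"
  have y: "?y \<in> carrier K" using cu by simp
  have prod: "psc c n \<star> psc c (Suc k - n) = ofr (bco n * bco (Suc k - n)) \<star> ?y" if "n \<le> Suc k" for n
  proof -
    let ?z = "?e [^]\<^bsub>K\<^esub> (Suc k - n)"
    have cz: "?e [^]\<^bsub>K\<^esub> n \<star> c \<star> ?z = ?e [^]\<^bsub>K\<^esub> k"
    proof -
      have "?e [^]\<^bsub>K\<^esub> n \<star> c \<star> ?z = c \<star> (?e [^]\<^bsub>K\<^esub> n \<star> ?z)"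
        using cu even_comm[OF cu(1), of "?e [^]\<^bsub>K\<^esub> n"] by (simp add: K.m_assoc[symmetric])
      also have "?e [^]\<^bsub>K\<^esub> n \<star> ?z = ?e \<star> ?e [^]\<^bsub>K\<^esub> k"
        using cu that even_comm[OF cu(4), of "?e [^]\<^bsub>K\<^esub> k"] by (simp add: K.nat_pow_mult)
      also have "c \<star> (?e \<star> ?e [^]\<^bsub>K\<^esub> k) = ?e [^]\<^bsub>K\<^esub> k"
        using cu by (simp add: K.m_assoc[symmetric])
      finally show ?thesis .
    qed
    have "psc c n \<star> psc c (Suc k - n) =
      c \<star> ?e [^]\<^bsub>K\<^esub> n \<star> (ofr (bco n) \<star> (c \<star> ?z)) \<star> ofr (bco (Suc k - n))"
      unfolding psc_def using cu by (simp add: K.m_assoc)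
    also have "ofr (bco n) \<star> (c \<star> ?z) = c \<star> ?z \<star> ofr (bco n)"
      using cu by (intro even_comm[OF ofr_even]) simp
    also have "c \<star> ?e [^]\<^bsub>K\<^esub> n \<star> (c \<star> ?z \<star> ofr (bco n)) \<star> ofr (bco (Suc k - n)) =
      c \<star> (?e [^]\<^bsub>K\<^esub> n \<star> c \<star> ?z) \<star> (ofr (bco n) \<star> ofr (bco (Suc k - n)))"
      using cu by (simp add: K.m_assoc)
    finally show ?thesis unfolding cz ofr_mult[symmetric] using even_comm[OF ofr_even y] by simp
  qed
  let ?Q = "\<lambda>n. \<Sum>i<n. [:1, 1:] ^ i * [:0, 1:] ^ (Suc k - n) + [:1, 1:] ^ i * [:0, 1:] ^ (n - 1 - i) :: rat poly"
  have "(\<Sum>n\<le>Suc k. hs (psc c n \<star> psc c (Suc k - n)) (uu n (Suc k - n))) =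
    (\<Sum>n\<le>Suc k. hs ?y (ev k (smult (bco n * bco (Suc k - n)) (?Q n))))"
    by (rule sum.cong) (auto simp only: prod uu_ev ev_smult hs_hs ofr_closed y atMost_iff)
  also have "\<dots> = hs ?y (ev k (\<Sum>n\<le>Suc k. smult (bco n * bco (Suc k - n)) (?Q n)))"
    by (simp only: ev_sum hs_linear(4)[OF y])
  also have "(\<Sum>n\<le>Suc k. smult (bco n * bco (Suc k - n)) (?Q n)) = smult (- bco k) ([:1, 1:] ^ k)"
    using todd_poly_eq_0[of k] by (simp add: todd_poly_def eq_neg_iff_add_eq_0)
  also have "hs ?y (ev k (smult (- bco k) ([:1, 1:] ^ k))) = - hs (psc c k) (ev k ([:1, 1:] ^ k))"
    unfolding ev_smult ofr_minus psc_def using y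
    by (simp add: hs_linear(2) hs_hs hs_uminus_scalar even_comm[OF ofr_even y])
  also have "ev k ([:1, 1:] ^ k) = Fn (p + q) (brk \<gg> a b) k"
    using xp_pow_bt[of k 0 0] by (simp add: bt_0 Fn_def)
  finally show ?thesis .
qed

text \<open>At a fixed x of length N the series may be truncated and \<open>rc_Fn_phiT\<close>
  applies. The double sum is then sorted by n + l: terms above \<open>Suc N\<close> vanish at x, and
  n + l = k + 1 gives the term of degree k by \<open>uu_sum\<close>.\<close>

theorem phi_commutator:
  assumes c: "c \<in> even_units K"
  shows "rc (phiL (psc c) p a) q (phiL (psc c) q b) - sg (p * q) (rc (phiL (psc c) q b) p (phiL (psc c) p a)) =
    phiL (psc c) (p + q) (brk \<gg> a b)" (is "?D = _")
proof
  fix x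
  note ev = psc_even[OF c]
  have ab: "brk \<gg> a b \<in> gr \<gg> (p + q)" by (rule brk_even[OF a b])
  note fa = phiL_fil[of a p "psc c", OF a ev] and fb = phiL_fil[of b q "psc c", OF b ev]
  note La = phiL_Lm[of a p "psc c", OF a ev] and Lb = phiL_Lm[of b q "psc c", OF b ev]
  note Ta = phiT_Lm[of a p "psc c", OF a ev] and Tb = phiT_Lm[of b q "psc c", OF b ev]
  show "?D x = phiL (psc c) (p + q) (brk \<gg> a b) x"
  proof (cases "x \<in> carrier S")
    case True
    define N where "N = deg x"
    have x: "fil N x" unfolding N_def by (rule deg[OF True])
    \<comment> \<open>The coderivation lengthens x by at most one letter, so truncation at
      \<open>Suc N\<close> leaves both the inner and the outer map unchanged here.\<close>
    have rcT: "rc (phiL (psc c) p' a') q' (phiL (psc c) q' b') x = rc (phiT (psc c) p' a' (Suc N)) q' (phiT (psc c) q' b' (Suc N)) x"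
      if "a' \<in> gr \<gg> p'" "b' \<in> gr \<gg> q'" for a' b' p' q'
    proof -
      have P: "Ps q' (phiL (psc c) q' b') x = Ps q' (phiT (psc c) q' b' (Suc N)) x"
        by (rule Ps_cong_fil[OF x phiL_Lm phiT_Lm]) (use that ev phiL_fil in auto)
      have "fil (Suc N) (Ps q' (phiT (psc c) q' b' (Suc N)) x)" by (rule Ps_fil[OF x phiT_Lm]) (use that ev in auto)
      then show ?thesis using True P phiL_fil[of a' p' "psc c", OF that(1) ev _ order.refl] by (simp add: rc_def)
    qed
    let ?g = "\<lambda>n l. hs (psc c n \<star> psc c l) (uu n l) x"
    have g0: "?g n l = 0" if "n + l > Suc N" for n l
      using uu_vanishes[OF x that] K.gr_closed[OF ev] by (simp add: hs_def)
    have "?D x = - (\<Sum>n\<le>Suc N. \<Sum>l\<le>Suc N. ?g n l)"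
      using fun_cong[OF rc_Fn_phiT[of "psc c" "Suc N", OF ev], of x] rcT[OF a b] rcT[OF b a]
      by (simp add: sum_fun_apply)
    also have "(\<Sum>n\<le>Suc N. \<Sum>l\<le>Suc N. ?g n l) = (\<Sum>(n, l)\<in>{..Suc N} \<times> {..Suc N}. ?g n l)"
      by (rule sum.cartesian_product)
    also have "\<dots> = (\<Sum>(n, l)\<in>{(n, l). n + l \<le> Suc N}. ?g n l)"
    proof (rule sum.mono_neutral_right)
      show "\<forall>i\<in>{..Suc N} \<times> {..Suc N} - {(n, l). n + l \<le> Suc N}. (case i of (n, l) \<Rightarrow> ?g n l) = 0"
      proof
        fix i assume i: "i \<in> {..Suc N} \<times> {..Suc N} - {(n, l). n + l \<le> Suc N}"
        then show "(case i of (n, l) \<Rightarrow> ?g n l) = 0" using g0[of "fst i" "snd i"] by (auto simp: case_prod_unfold)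
      qed
    qed auto
    also have "\<dots> = (\<Sum>s\<le>Suc N. \<Sum>n\<le>s. ?g n (s - n))" by (rule sum.triangle_reindex_eq)
    \<comment> \<open>Index sum 0 contributes nothing, as \<open>uu 0 0\<close> is an empty sum; the
      remaining index sums are shifted to k + 1.\<close>
    also have "\<dots> = (\<Sum>k\<le>N. \<Sum>n\<le>Suc k. ?g n (Suc k - n))"
      unfolding sum.atMost_Suc_shift[of "\<lambda>s. \<Sum>n\<le>s. ?g n (s - n)"]
      using K.gr_closed[OF ev] by (simp add: uu_def hs_def del: sum.atMost_Suc)
    also have "\<dots> = (\<Sum>k\<le>N. - hs (psc c k) (Fn (p + q) (brk \<gg> a b) k) x)"
      using fun_cong[OF uu_sum[OF c], of _ x] by (simp add: sum_fun_apply del: sum.atMost_Suc)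
    also have "- \<dots> = phiT (psc c) (p + q) (brk \<gg> a b) N x"
      by (simp add: phiT_def sum_fun_apply sum_negf)
    also have "\<dots> = phiL (psc c) (p + q) (brk \<gg> a b) x"
      using phiL_fil[of _ _ "psc c", OF ab ev x order.refl] by simp
    finally show ?thesis .
  qed (simp add: rc_def phiL_def)
qed

text \<open>For any $\varphi$, the series $-t$ of $\Phi_0$ gives an action by which $\varphi^a$ is equivariant in \<open>a\<close>.\<close>

lemma rc_Fn_equivariant:
  "rc (Fn p a n) q (- xp q (cst b)) = Fn (p + q) (brk \<gg> a b) n - cb q (Fn p a n) (cst b)"
proof (induction n)
  case 0
  show ?case unfolding Fn_0 rc_cst[OF a Lm_uminus[OF xp_Lm[OF cst_Lm[OF b]]]] cb_cst[OF a b] by simp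
next
  case (Suc n)
  note L = Fn_Lm[OF a, of n] cst_Lm[OF b]
  note X = xp_Lm[OF L(2)]
  have ab: "brk \<gg> a b \<in> gr \<gg> (p + q)" by (rule brk_even[OF a b])
  have "rc (Fn p a (Suc n)) q (- xp q (cst b)) =
    xp (p + q) (Fn (p + q) (brk \<gg> a b) n + - cb q (Fn p a n) (cst b)) - cb q (Fn p a n) (- xp q (cst b))"
    unfolding Fn_Suc[of p] rc_xp[OF L(1) Lm_uminus[OF X]] Suc by simp
  also have "\<dots> = Fn (p + q) (brk \<gg> a b) (Suc n) - cb q (Fn p a (Suc n)) (cst b)"
    unfolding xp_linear(1)[OF Fn_Lm[OF ab] Lm_uminus[OF cb_Lm[OF L]]] xp_linear(2)[OF cb_Lm[OF L]]
      xp_leibniz[OF L] cb_minus(2)[OF L(1) X] Fn_Suc by simp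
  finally show ?case .
qed

text \<open>The map \<chi> is minus the bracket of \<open>piL\<close> with the constant b. Composing
  it with the coderivation of \<open>phiL c p a\<close> yields, by \<open>rc_xp\<close>, just the
  bracket with that constant, and this cancels the correction term of
  \<open>rc_Fn_equivariant\<close>.\<close>

theorem phi_equivariant:
  assumes c: "\<And>n. c n \<in> gr K 0"
  defines "\<chi> \<equiv> phiL (phi_series K \<zero>\<^bsub>K\<^esub>) q b"
  shows "rc (phiL c p a) q \<chi> - sg (p * q) (rc \<chi> p (phiL c p a)) = phiL c (p + q) (brk \<gg> a b)"
proof -
  note Lb = cst_Lm[OF b] and La = phiL_Lm[of a p c, OF a c]
  have cc: "c n \<in> carrier K" for n using c by auto
  have ab: "brk \<gg> a b \<in> gr \<gg> (p + q)" by (rule brk_even[OF a b])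
  have z: "phi_series K \<zero>\<^bsub>K\<^esub> n \<in> gr K 0" for n using K.gr_one by (auto simp: phi_series_def)
  have \<chi>: "\<chi> = - xp q (cst b)"
  proof
    fix x show "\<chi> x = (- xp q (cst b)) x"
    proof (cases "x \<in> carrier S")
      case True
      let ?M = "Suc (deg x)"
      have "\<chi> x = (\<Sum>n\<le>?M. hs (phi_series K \<zero>\<^bsub>K\<^esub> n) (Fn q b n) x)"
        using phiL_fil[of b q "phi_series K \<zero>\<^bsub>K\<^esub>", OF b z deg[OF True], of ?M] by (simp add: \<chi>_def phiT_def sum_fun_apply del: sum.atMost_Suc)
      also have "\<dots> = (\<Sum>n\<in>{1}. hs (phi_series K \<zero>\<^bsub>K\<^esub> n) (Fn q b n) x)"
        by (rule sum.mono_neutral_right) (auto simp: phi_series_def)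
      also have "\<dots> = - Fn q b 1 x" by (simp add: phi_series_def hs_uminus_scalar hs_one[OF Fn_Lm[OF b]])
      finally show ?thesis by (simp add: Fn_def)
    qed (simp add: \<chi>_def phiL_def Lm_outside[OF xp_Lm[OF Lb]])
  qed
  have 2: "sg (p * q) (rc \<chi> p (phiL c p a)) = - cb q (phiL c p a) (cst b)"
    unfolding \<chi> rc_linear rc_xp[OF Lb La] rc_cst[OF b La] cb_skew[OF La Lb] by (simp add: xp_def cb_zero(1)[OF piL_Lm])
  have "rc (phiL c p a) q \<chi> x = phiL c (p + q) (brk \<gg> a b) x - cb q (phiL c p a) (cst b) x" for x
  proof (cases "x \<in> carrier S")
    case True
    define N where "N = deg x"
    have x: "fil N x" unfolding N_def by (rule deg[OF True])
    let ?T = "phiT c p a (Suc N)"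
    have T: "?T \<in> Lm p" by (intro phiT_Lm a c)
    have f: "fil (Suc N) (Ps q \<chi> x)" unfolding \<chi> by (rule Ps_fil[OF x Lm_uminus[OF xp_Lm[OF Lb]]])
    have "rc (phiL c p a) q \<chi> x = rc ?T q \<chi> x"
      using True phiL_fil[of a p c, OF a c f order.refl] by (simp add: rc_def)
    also have "rc ?T q \<chi> = (\<Sum>n\<le>Suc N. hs (c n) (rc (Fn p a n) q \<chi>))"
      unfolding phiT_def by (simp add: rc_sum rc_hs cc del: sum.atMost_Suc)
    also have "\<dots> = (\<Sum>n\<le>Suc N. hs (c n) (Fn (p + q) (brk \<gg> a b) n)) - (\<Sum>n\<le>Suc N. hs (c n) (cb q (Fn p a n) (cst b)))"
      unfolding \<chi> rc_Fn_equivariant sum_subtractf[symmetric]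
      by (simp only: hs_diff[OF cc])
    also have "(\<Sum>n\<le>Suc N. hs (c n) (cb q (Fn p a n) (cst b))) = cb q ?T (cst b)"
      unfolding phiT_def cb_sum_left[OF hs_Lm[OF Fn_Lm[OF a] c] Lb] cb_hs_left[OF Fn_Lm[OF a] Lb c] ..
    also have "(\<Sum>n\<le>Suc N. hs (c n) (Fn (p + q) (brk \<gg> a b) n)) = phiT c (p + q) (brk \<gg> a b) (Suc N)"
      by (simp only: phiT_def)
    also have "(phiT c (p + q) (brk \<gg> a b) (Suc N) - cb q ?T (cst b)) x = phiL c (p + q) (brk \<gg> a b) x - cb q (phiL c p a) (cst b) x"
    proof -
      \<comment> \<open>The truncation error is zero on words of length at most N, and bracketing
        with a constant does not lower this order.\<close>
      have "vanishes (Suc N) (phiL c p a + - ?T)"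
        unfolding vanishes_def using phiL_fil[of a p c, OF a c, of _ _ "Suc N"] by simp
      then have "vanishes (Suc N) (cb q (phiL c p a + - ?T) (cst b))"
        using cb_vanishes[OF Lm_plus[OF La Lm_uminus[OF T]] Lb _ vanishes_0] by simp
      then have "cb q (phiL c p a + - ?T) (cst b) x = 0" using x by (rule vanishesD) simp
      then show ?thesis
        using phiL_fil[of _ _ c, OF ab c x, of "Suc N"] cb_add_left[OF La Lm_uminus[OF T] Lb] cb_minus(1)[OF T Lb] by simp
    qed
    finally show ?thesis .
  qed (simp add: rc_def phiL_def cb_def)
  then show ?thesis unfolding 2 by (simp add: fun_eq_iff)
qed

end

end

section \<open>The maps $\varphi^a$ and $\Phi^a$\<close>

context lie_sym
begin

sublocale HG: tensor_product K S \<gg>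
  by (intro tensor_product.intro SA.graded_right_module_axioms graded_right_module_axioms)

text \<open>Returns from L to \<open>Hom\<close>: values are read off by \<open>val\<close>, and the
  function becomes extensional instead of zero outside the carrier.\<close>

definition rv where "rv F = (\<lambda>x\<in>carrier S. val \<gg> (F x))"
lemma rv_gr: assumes "F \<in> Lm q" shows "rv F \<in> gr (Hom K S \<gg>) q"
  unfolding rv_def
  by (rule HG.Hom_grI[OF HG.HomI])
    (auto simp: Lm_add[OF assms] S_act Lm_scalar[OF assms] hact_def act_closed intro: val_gr[OF assms])

lemma wdl_snoc:
  "(\<And>k. k \<in> set l ==> X k \<in> carrier \<gg>) ==> X m \<in> carrier \<gg> ==> wdl X (l @ [m]) = wdl X l \<odot> \<iota> (X m)"
proof (induction l)
  case (Cons k l)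
  then show ?case using wdl_closed[of l X] by (simp add: S.m_assoc)
qed simp

lemma wdl_cong: "(\<And>k. k \<in> set l ==> X k = Y k) ==> wdl X l = wdl Y l"
  by (induction l) auto

lemma fil_wdl: "(\<And>k. k \<in> set l ==> X k \<in> gr \<gg> (d k)) ==> fil (length l) (wdl X l)"
  by (induction l) (auto intro: fil_mult fil_one)

text \<open>The formula characterising \<open>phi_hom\<close> speaks of words only, while S also
  contains scalars and sums. The induction over x is therefore made with an arbitrary word in front
  of x; each generator met in x is appended to that word.\<close>

lemma words_eqI:
  assumes f: "f \<in> carrier (Hom K S \<gg>)" and g: "g \<in> carrier (Hom K S \<gg>)"
    and eq: "\<And>n X d. (\<And>k. k < n ==> X k \<in> gr \<gg> (d k)) ==> f (wdl X [0..<n]) = g (wdl X [0..<n])"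
  shows "f = g"
proof (rule HG.Hom_eqI[OF f g])
  fix x assume "x \<in> carrier S"
  then have "\<forall>n X d. (\<forall>k<n. X k \<in> gr \<gg> (d k)) \<longrightarrow> f (wdl X [0..<n] \<odot> x) = g (wdl X [0..<n] \<odot> x)"
  proof (induction x rule: S_lin_induct)
    case one
    show ?case
    proof (intro allI impI)
      fix n :: nat and X :: "nat \<Rightarrow> 'g" and d assume X: "\<forall>k<n. X k \<in> gr \<gg> (d k)"
      then have w: "wdl X [0..<n] \<in> carrier S" by (intro wdl_closed) auto
      have "f (wdl X [0..<n]) = g (wdl X [0..<n])" by (rule eq[of n X d]) (use X in simp)
      then show "f (wdl X [0..<n] \<odot> \<one>\<^sub>S) = g (wdl X [0..<n] \<odot> \<one>\<^sub>S)"
        unfolding S.r_one[OF w] .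
    qed
  next
    case (scalar x \<alpha>)
    show ?case
    proof (intro allI impI)
      fix n :: nat and X :: "nat \<Rightarrow> 'g" and d assume X: "\<forall>k<n. X k \<in> gr \<gg> (d k)"
      then have w: "wdl X [0..<n] \<in> carrier S" by (intro wdl_closed) auto
      then show "f (wdl X [0..<n] \<odot> (x \<odot> \<kappa> \<alpha>)) = g (wdl X [0..<n] \<odot> (x \<odot> \<kappa> \<alpha>))"
        using scalar(1,2) scalar(3)[rule_format, of n X d] X HG.Hom_act[OF f, of "wdl X [0..<n] \<odot> x" \<alpha>] HG.Hom_act[OF g, of "wdl X [0..<n] \<odot> x" \<alpha>]
        by (auto simp: S_act S.m_assoc)
    qed
  next
    case (mult Y i w)
    show ?case
    proof (intro allI impI)
      fix n :: nat and X :: "nat \<Rightarrow> 'g" and d assume X: "\<forall>k<n. X k \<in> gr \<gg> (d k)"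
      let ?X = "X(n := Y)"
      have X': "\<forall>k<Suc n. ?X k \<in> gr \<gg> ((d(n := i)) k)" using X mult(1) by auto
      have c: "wdl X [0..<n] \<in> carrier S" "Y \<in> carrier \<gg>" using X mult(1) by (auto intro!: wdl_closed)
      have "wdl ?X [0..<Suc n] = wdl ?X [0..<n] \<odot> \<iota> Y"
        using wdl_snoc[of "[0..<n]" ?X n] X c(2) by auto
      also have "wdl ?X [0..<n] = wdl X [0..<n]" by (rule wdl_cong) auto
      finally have e: "wdl ?X [0..<Suc n] = wdl X [0..<n] \<odot> \<iota> Y" .
      have "f (wdl ?X [0..<Suc n] \<odot> w) = g (wdl ?X [0..<Suc n] \<odot> w)"
        by (rule mult(3)[rule_format, of "Suc n" ?X "d(n := i)"]) (use X' in blast)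
      then show "f (wdl X [0..<n] \<odot> (\<iota> Y \<odot> w)) = g (wdl X [0..<n] \<odot> (\<iota> Y \<odot> w))"
        unfolding e using c mult(2) by (simp add: S.m_assoc)
    qed
  next
    case (add x y)
    show ?case
    proof (intro allI impI)
      fix n :: nat and X :: "nat \<Rightarrow> 'g" and d assume X: "\<forall>k<n. X k \<in> gr \<gg> (d k)"
      then have w: "wdl X [0..<n] \<in> carrier S" by (intro wdl_closed) auto
      then show "f (wdl X [0..<n] \<odot> (x \<oplus>\<^bsub>S\<^esub> y)) = g (wdl X [0..<n] \<odot> (x \<oplus>\<^bsub>S\<^esub> y))"
        using add(1,2) add(3)[rule_format, of n X d] add(4)[rule_format, of n X d] X
        by (auto simp: S.r_distr additive_maps_add[OF HG.Hom_additive[OF f]] additive_maps_add[OF HG.Hom_additive[OF g]])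
    qed
  qed
  from this[rule_format, of 0] show "f x = g x" using \<open>x \<in> carrier S\<close> by simp
qed

text \<open>On a word of length n only the n-th term of the series is nonzero, by
  \<open>Fn_wdl_0\<close>, and \<open>Fn_word\<close> computes it as the prescribed sum over
  permutations. Uniqueness of the map is \<open>words_eqI\<close>.\<close>

lemma phi_hom_eq:
  assumes a: "a \<in> gr \<gg> i" and c: "\<And>n. c n \<in> gr K 0"
  shows "phi_hom K \<gg> c i a = rv (phiL c i a)"
proof -
  let ?Q = "\<lambda>f. \<forall>n X d. (\<forall>k<n. X k \<in> gr \<gg> (d k)) \<longrightarrow> f (wdl X [0..<n]) =
        neg_pow \<gg> (i * (\<Sum>k<n. d k)) ((\<Oplus>\<^bsub>\<gg>\<^esub>s\<in>{s. s permutes {..<n}}. neg_pow \<gg> (koszul n d s)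
              (foldr (\<lambda>k y. brk \<gg> (X (s k)) y) [0..<n] a)) \<triangleleft> c n)"
  have L: "phiL c i a \<in> Lm i" by (rule phiL_Lm[OF a c])
  have Q: "?Q (rv (phiL c i a))"
  proof (intro allI impI)
    fix n :: nat and X :: "nat \<Rightarrow> 'g" and d assume X: "\<forall>k<n. X k \<in> gr \<gg> (d k)"
    let ?w = "wdl X [0..<n]"
    let ?s = "\<lambda>s. foldr (\<lambda>k y. brk \<gg> (X (s k)) y) [0..<n] a"
    have w: "?w \<in> carrier S" "fil n ?w" using X fil_wdl[of "[0..<n]" X d] by (auto intro!: wdl_closed)
    have sc: "?s s \<in> carrier \<gg>" if s: "s permutes {..<n}" for s
    proof -
      have "foldr (\<lambda>k y. brk \<gg> (X k) y) (map s [0..<n]) a \<in> carrier \<gg>"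
      proof (rule foldr_brk_closed)
        fix k assume "k \<in> set (map s [0..<n])"
        then obtain m where "m < n" "k = s m" by auto
        then have "k < n" using permutes_in_image[OF s, of m] by simp
        then show "X k \<in> carrier \<gg>" using X by auto
      qed (use a in auto)
      then show ?thesis by (simp add: foldr_map comp_def)
    qed
    have cn: "c n \<in> carrier K" using c by auto
    have "phiL c i a ?w = (\<Sum>m\<le>n. hact (Fn i a m ?w) (c m))"
      using phiL_fil[OF a c w(2) order.refl] by (simp add: phiT_apply)
    also have "\<dots> = (\<Sum>m\<in>{n}. hact (Fn i a m ?w) (c m))"
    proof (rule sum.mono_neutral_right)
      have "Fn i a m ?w = 0" if "m \<noteq> n" for m
        by (rule Fn_wdl_0[OF a, of _ _ d]) (use X that in \<open>auto simp: strict_sorted_iff\<close>)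
      then show "\<forall>m\<in>{..n} - {n}. hact (Fn i a m ?w) (c m) = 0" using K.gr_closed[OF c] by auto
    qed auto
    also have "\<dots> = hact (sg (i * (\<Sum>k<n. d k)) (\<Sum>s\<in>{s. s permutes {..<n}}. sg (koszul n d s) (emb \<gg> (?s s)))) (c n)"
      using Fn_word[OF a, of n X d] X by simp
    finally have "val \<gg> (phiL c i a ?w) = val \<gg> (sg (i * (\<Sum>k<n. d k)) (\<Sum>s\<in>{s. s permutes {..<n}}. sg (koszul n d s) (emb \<gg> (?s s)))) \<triangleleft> c n"
      using cn by (simp add: hact_def act_closed)
    also have "val \<gg> (sg (i * (\<Sum>k<n. d k)) (\<Sum>s\<in>{s. s permutes {..<n}}. sg (koszul n d s) (emb \<gg> (?s s)))) =
        neg_pow \<gg> (i * (\<Sum>k<n. d k)) (\<Oplus>\<^bsub>\<gg>\<^esub>s\<in>{s. s permutes {..<n}}. neg_pow \<gg> (koszul n d s) (?s s))"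
      unfolding M.val_sg M.val_sum using sc by (intro arg_cong2[where f = "neg_pow \<gg>"] M.finsum_cong') auto
    finally show "rv (phiL c i a) ?w = neg_pow \<gg> (i * (\<Sum>k<n. d k)) ((\<Oplus>\<^bsub>\<gg>\<^esub>s\<in>{s. s permutes {..<n}}. neg_pow \<gg> (koszul n d s) (?s s)) \<triangleleft> c n)"
      using w cn sc by (simp add: rv_def act_neg_pow_left M.finsum_closed Pi_iff)
  qed
  have "phi_hom K \<gg> c i a = (THE f. f \<in> carrier (Hom K S \<gg>) \<and> ?Q f)"
    unfolding phi_hom_def Let_def wdl_def ..
  also have "\<dots> = rv (phiL c i a)"
  proof (rule the_equality)
    show r: "rv (phiL c i a) \<in> carrier (Hom K S \<gg>) \<and> ?Q (rv (phiL c i a))" using Q HG.Hom_gr_closed[OF rv_gr[OF L]] by blast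
    fix f assume f: "f \<in> carrier (Hom K S \<gg>) \<and> ?Q f"
    show "f = rv (phiL c i a)"
    proof (rule words_eqI[OF conjunct1[OF f] conjunct1[OF r]])
      fix n :: nat and X d assume X: "\<And>k. k < n ==> X k \<in> gr \<gg> (d k)"
      show "f (wdl X [0..<n]) = rv (phiL c i a) (wdl X [0..<n])"
        by (rule trans[OF conjunct2[OF f, rule_format, OF X] conjunct2[OF r, rule_format, OF X, symmetric]])
    qed
  qed
  finally show ?thesis .
qed

definition idS where "idS = (\<lambda>x\<in>carrier S. x)"

lemma idS_gr: "idS \<in> gr E 0"
  unfolding idS_def by (rule TT.Hom_grI[OF TT.HomI]) (auto simp: SA.act_closed)

text \<open>The parity sums in \<open>tensor_map\<close> are carried out: the one over the parity of
  the first factor becomes \<open>twist\<close>, and the one over the parity of the map separates G0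
  from G1.\<close>

lemma sym_tensor_map_id_left:
  assumes G: "G0 \<in> gr E 0" "G1 \<in> gr E 1" and y: "y \<in> carrier TG"
  shows "sym_tensor_map K \<gg> idS (G0 \<oplus>\<^bsub>E\<^esub> G1) y = tensor_lift TG (gl 0 G0) y \<boxplus> tensor_lift TG (gl 1 G1) y"
proof -
  note b = gl_balanced[OF G(1)] gl_balanced[OF G(2)]
  note Gc = TT.Hom_closed[OF TT.Hom_gr_closed[OF G(1)]] TT.Hom_closed[OF TT.Hom_gr_closed[OF G(2)]]
  have "sym_tensor_map K \<gg> idS (G0 \<oplus>\<^bsub>E\<^esub> G1) y = tensor_lift TG (\<lambda>v w. \<Oplus>\<^bsub>TG\<^esub>i\<in>{0,1}. \<Oplus>\<^bsub>TG\<^esub>j\<in>{0,1}.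
        neg_pow TG (i * j) (pur (idS (prt S j v)) (prt E i (G0 \<oplus>\<^bsub>E\<^esub> G1) w))) y"
    unfolding sym_tensor_map_def tensor_map_def Let_def TT.T_TG using y by simp
  also have "\<dots> = tensor_lift TG (\<lambda>v w. gl 0 G0 v w \<boxplus> gl 1 G1 v w) y"
  proof (rule TT.tensor_lift_cong[OF TT.TG_abelian TT.balanced_sum[OF TT.TG_abelian b] _ y, symmetric])
    fix v w assume vw: "v \<in> carrier S" "w \<in> carrier S"
    have i: "(\<Oplus>\<^bsub>TG\<^esub>j\<in>{0,1}. neg_pow TG (i * j) (pur (idS (prt S j v)) u)) = pur (twist S i v) u" if "u \<in> carrier S" for i u
      using vw that by (simp add: TT.TG.finsum_bit idS_def twist_def TT.pure_add_left TT.pure_neg_pow_left)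
    have t: "(\<Oplus>\<^bsub>TG\<^esub>j\<in>{0,1}. neg_pow TG (i * j) (pur (idS (prt S j v)) (prt E i (G0 \<oplus>\<^bsub>E\<^esub> G1) w))) =
        (if i = 0 then gl 0 G0 v w else gl 1 G1 v w)" for i
      by (cases i) (simp_all only: TT.prt_Hom[OF G] i[OF Gc(1)[OF vw(2)]] i[OF Gc(2)[OF vw(2)]] gl_def if_True if_False zero_neq_one one_neq_zero refl)
    have "gl 0 G0 v w \<in> carrier TG" "gl 1 G1 v w \<in> carrier TG"
      using balanced_closed[OF b(1) vw] balanced_closed[OF b(2) vw] by auto
    then show "gl 0 G0 v w \<boxplus> gl 1 G1 v w = (\<Oplus>\<^bsub>TG\<^esub>i\<in>{0,1}. \<Oplus>\<^bsub>TG\<^esub>j\<in>{0,1}.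
        neg_pow TG (i * j) (pur (idS (prt S j v)) (prt E i (G0 \<oplus>\<^bsub>E\<^esub> G1) w)))"
      unfolding t by (simp add: TT.TG.finsum_bit)
  qed
  also have "\<dots> = tensor_lift TG (gl 0 G0) y \<boxplus> tensor_lift TG (gl 1 G1) y"
    by (rule TT.tensor_lift_sum[OF TT.TG_abelian b y])
  finally show ?thesis .
qed

text \<open>The identity is even, so its odd component contributes zero and no sign remains.\<close>

lemma sym_tensor_map_id_right:
  assumes F: "F \<in> carrier E" and y: "y \<in> carrier TG"
  shows "sym_tensor_map K \<gg> F idS y = tensor_lift TG (\<lambda>v w. pur (F v) w) y"
proof -
  interpret E: abelian_group E by (rule TT.Hom_abelian)
  note Fc = TT.Hom_closed[OF F]
  have id: "prt E 0 idS = idS" "prt E 1 idS = \<zero>\<^bsub>E\<^esub>"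
    using TT.prt_Hom[OF idS_gr TT.Hom_zero_gr] TT.Hom_gr_closed[OF idS_gr] by simp_all
  have "sym_tensor_map K \<gg> F idS y = tensor_lift TG (\<lambda>v w. \<Oplus>\<^bsub>TG\<^esub>i\<in>{0,1}. \<Oplus>\<^bsub>TG\<^esub>j\<in>{0,1}.
        neg_pow TG (i * j) (pur (F (prt S j v)) (prt E i idS w))) y"
    unfolding sym_tensor_map_def tensor_map_def Let_def TT.T_TG using y by simp
  also have "\<dots> = tensor_lift TG (\<lambda>v w. pur (F v) w) y"
  proof (rule TT.tensor_lift_cong[OF TT.TG_abelian left_balanced[OF F] _ y, symmetric])
    fix v w assume vw: "v \<in> carrier S" "w \<in> carrier S"
    have z: "pur u \<zero>\<^bsub>S\<^esub> = \<zero>\<^bsub>TG\<^esub>" if "u \<in> carrier S" for u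
      by (rule additive_maps_zero[OF balanced_right[OF TT.pure_balanced that] S_ab TT.TG_abelian])
    have "F v = F (prt S 0 v) \<oplus>\<^bsub>S\<^esub> F (prt S 1 v)"
      using additive_maps_add[OF TT.Hom_additive[OF F], of "prt S 0 v" "prt S 1 v"] SA.M.prt_sum[OF vw(1)] vw by simp
    then show "pur (F v) w = (\<Oplus>\<^bsub>TG\<^esub>i\<in>{0,1}. \<Oplus>\<^bsub>TG\<^esub>j\<in>{0,1}. neg_pow TG (i * j) (pur (F (prt S j v)) (prt E i idS w)))"
    proof -
      have "idS w = w" using vw by (simp add: idS_def)
      then show ?thesis using vw Fc \<open>F v = _\<close> by (simp add: TT.TG.finsum_bit id TT.Hom_simps(2) z TT.pure_add_left)
    qed
  qed
  finally show ?thesis .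
qed

lemma mult_balanced: "(\<odot>) \<in> balanced K S S S"
proof (rule balancedI)
  fix m n j \<alpha> i assume *: "m \<in> carrier S" "n \<in> gr S j" "\<alpha> \<in> gr K i"
  then show "m \<bullet>\<^bsub>S\<^esub> \<alpha> \<odot> n = neg_pow S (i * j) (m \<odot> (n \<bullet>\<^bsub>S\<^esub> \<alpha>))"
    using SA.act_mult_left[OF *] gr_S_closed[OF *(2)] K.gr_closed[OF *(3)] by (simp add: S_act S.m_assoc)
qed (auto intro!: additive_mapsI simp: S.l_distr S.r_distr)

lemma sym_mult_gl:
  assumes \<psi>: "\<psi> \<in> Lm q" and G: "G \<in> gr E q" and eq: "\<And>w. w \<in> carrier S ==> G w = \<iota> (val \<gg> (\<psi> w))"
    and y: "y \<in> carrier TG"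
  shows "sym_mult K \<gg> (tensor_lift TG (gl q G) y) = tensor_lift S (psf q \<psi>) y"
  unfolding sym_mult_def
proof (rule TT.TG_additive_eqI[OF y additive_maps_comp[OF TT.tensor_lift_additive[OF TT.TG_abelian gl_balanced[OF G]]
        TT.tensor_lift_additive[OF S_ab mult_balanced]] TT.tensor_lift_additive[OF S_ab psf_balanced[OF \<psi>]]])
  fix i m j n assume "m \<in> gr S i" "n \<in> gr S j"
  then have c: "m \<in> carrier S" "n \<in> carrier S" using gr_S_closed by auto
  show "tensor_lift S (\<odot>) (tensor_lift TG (gl q G) (pur m n)) = tensor_lift S (psf q \<psi>) (pur m n)"
    unfolding TT.tensor_lift_pure[OF TT.TG_abelian gl_balanced[OF G] c] TT.tensor_lift_pure[OF S_ab psf_balanced[OF \<psi>] c]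
    using c eq by (simp add: gl_def psf_def TT.tensor_lift_pure[OF S_ab mult_balanced])
qed

text \<open>Composed with the inclusion of \<gg>, the map belonging to a is an even plus an odd map,
  one for each component of a; multiplying out after the coproduct gives the attached
  coderivations.\<close>

lemma Phi_map_eq:
  assumes a: "a \<in> carrier \<gg>" and c: "\<And>n. c n \<in> gr K 0"
  shows "Phi_map K \<gg> c a = PH 0 (phiL c 0 (prt \<gg> 0 a)) \<oplus>\<^bsub>E\<^esub> PH 1 (phiL c 1 (prt \<gg> 1 a))"
proof -
  let ?\<psi> = "\<lambda>i. phiL c i (prt \<gg> i a)"
  have L: "?\<psi> i \<in> Lm i" for i by (rule phiL_Lm) (use a c in auto)
  interpret H: abelian_group "Hom K S \<gg>" by (rule HG.Hom_abelian)
  have p: "phi_map K \<gg> c a = rv (?\<psi> 0) \<oplus>\<^bsub>Hom K S \<gg>\<^esub> rv (?\<psi> 1)"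
    using a c by (simp add: phi_map_def phi_hom_eq[OF M.prt_gr[OF a]] H.finsum_bit HG.Hom_gr_closed[OF rv_gr[OF L]])
  define G where "G i = (\<lambda>x\<in>carrier S. \<iota> (val \<gg> (?\<psi> i x)))" for i
  have G: "G i \<in> gr E i" for i
    unfolding G_def
    by (rule TT.Hom_grI[OF TT.HomI])
      (auto simp: Lm_add[OF L] S_act Lm_scalar[OF L] \<iota>_add hact_def act_closed \<iota>_act_\<kappa> intro: iota_gr val_gr[OF L])
  have "compose (carrier S) \<iota> (phi_map K \<gg> c a) = G 0 \<oplus>\<^bsub>E\<^esub> G 1"
    unfolding p by (auto simp: compose_def G_def HG.Hom_simps(3) TT.Hom_simps(3) rv_def \<iota>_add intro!: restrict_ext)
  then have "Phi_map K \<gg> c a x = sym_mult K \<gg> (tensor_lift TG (gl 0 (G 0)) (\<Delta> x) \<boxplus> tensor_lift TG (gl 1 (G 1)) (\<Delta> x))"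
    if "x \<in> carrier S" for x
    using that sym_tensor_map_id_left[OF G G \<Delta>_closed[OF that]] by (simp add: Phi_map_def Let_def idS_def)
  moreover have "sym_mult K \<gg> (tensor_lift TG (gl 0 (G 0)) (\<Delta> x) \<boxplus> tensor_lift TG (gl 1 (G 1)) (\<Delta> x)) =
      Ps 0 (?\<psi> 0) x \<oplus>\<^bsub>S\<^esub> Ps 1 (?\<psi> 1) x" if x: "x \<in> carrier S" for x
  proof -
    have tc: "tensor_lift TG (gl i (G i)) (\<Delta> x) \<in> carrier TG" for i
      by (rule additive_maps_closed[OF TT.tensor_lift_additive[OF TT.TG_abelian gl_balanced[OF G]] \<Delta>_closed[OF x]])
    have "sym_mult K \<gg> (tensor_lift TG (gl i (G i)) (\<Delta> x)) = Ps i (?\<psi> i) x" for i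
      unfolding Ps_def by (rule sym_mult_gl[OF L G _ \<Delta>_closed[OF x]]) (simp add: G_def)
    then show ?thesis
      using additive_maps_add[OF TT.tensor_lift_additive[OF S_ab mult_balanced] tc tc] by (simp add: sym_mult_def)
  qed
  ultimately show ?thesis by (auto simp: Phi_map_def Let_def TT.Hom_simps(3) PH_def fun_eq_iff)
qed

text \<open>Both sides of the coderivation identity are additive in the map, so the homogeneous
  cases of \<open>Ps_coderivation\<close> add up.\<close>

lemma PH_coderivation:
  assumes "\<psi> \<in> Lm 0" "\<chi> \<in> Lm 1"
  shows "coderivation K \<gg> (PH 0 \<psi> \<oplus>\<^bsub>E\<^esub> PH 1 \<chi>)"
proof -
  interpret E: abelian_group E by (rule TT.Hom_abelian)
  note P = PH_gr[OF assms(1)] PH_gr[OF assms(2)]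
  note Pc = TT.Hom_gr_closed[OF P(1)] TT.Hom_gr_closed[OF P(2)]
  let ?F = "PH 0 \<psi> \<oplus>\<^bsub>E\<^esub> PH 1 \<chi>"
  have F: "?F \<in> carrier E" using Pc by simp
  have "\<Delta> (?F x) = sym_tensor_map K \<gg> ?F idS (\<Delta> x) \<boxplus> sym_tensor_map K \<gg> idS ?F (\<Delta> x)" if x: "x \<in> carrier S" for x
  proof -
    have y: "\<Delta> x \<in> carrier TG" by (rule \<Delta>_closed[OF x])
    let ?l = "\<lambda>F. tensor_lift TG (\<lambda>v w. pur (F v) w) (\<Delta> x)" and ?r = "\<lambda>q G. tensor_lift TG (gl q G) (\<Delta> x)"
    note b = left_balanced[OF Pc(1)] left_balanced[OF Pc(2)] gl_balanced[OF P(1)] gl_balanced[OF P(2)]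
    note tc = additive_maps_closed[OF TT.tensor_lift_additive[OF TT.TG_abelian] y]
    have cd: "tensor_lift TG (cdf q \<theta>) (\<Delta> x) = ?l (PH q \<theta>) \<boxplus> ?r q (PH q \<theta>)" if \<theta>: "\<theta> \<in> Lm q" for q \<theta>
    proof -
      note b' = left_balanced[OF TT.Hom_gr_closed[OF PH_gr[OF \<theta>]]] gl_balanced[OF PH_gr[OF \<theta>]]
      have "tensor_lift TG (cdf q \<theta>) (\<Delta> x) = tensor_lift TG (\<lambda>v w. pur (PH q \<theta> v) w \<boxplus> gl q (PH q \<theta>) v w) (\<Delta> x)"
        by (rule TT.tensor_lift_cong[OF TT.TG_abelian cdf_balanced[OF \<theta>] _ y]) (simp add: cdf_def PH_def gl_def)
      then show ?thesis using TT.tensor_lift_sum[OF TT.TG_abelian b' y] by simp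
    qed
    have "?l ?F = tensor_lift TG (\<lambda>v w. pur (PH 0 \<psi> v) w \<boxplus> pur (PH 1 \<chi> v) w) (\<Delta> x)"
      by (rule TT.tensor_lift_cong[OF TT.TG_abelian left_balanced[OF F] _ y])
        (simp add: TT.Hom_simps(3) TT.pure_add_left TT.Hom_closed[OF Pc(1)] TT.Hom_closed[OF Pc(2)])
    then have l: "?l ?F = ?l (PH 0 \<psi>) \<boxplus> ?l (PH 1 \<chi>)" using TT.tensor_lift_sum[OF TT.TG_abelian b(1,2) y] by simp
    have "\<Delta> (?F x) = \<Delta> (Ps 0 \<psi> x) \<boxplus> \<Delta> (Ps 1 \<chi> x)"
      using x assms by (simp add: TT.Hom_simps(3) PH_def additive_maps_add[OF \<Delta>_additive])
    also have "\<dots> = (?l (PH 0 \<psi>) \<boxplus> ?r 0 (PH 0 \<psi>)) \<boxplus> (?l (PH 1 \<chi>) \<boxplus> ?r 1 (PH 1 \<chi>))"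
      using x assms by (simp add: Ps_coderivation cd)
    also have "\<dots> = ?l ?F \<boxplus> (?r 0 (PH 0 \<psi>) \<boxplus> ?r 1 (PH 1 \<chi>))"
      unfolding l by (rule TT.TG.add_swap4[OF b(1,3,2,4)[THEN tc]])
    finally show ?thesis unfolding sym_tensor_map_id_left[OF P y] sym_tensor_map_id_right[OF F y] .
  qed
  then show ?thesis using F unfolding coderivation_def Let_def sym_tensor_eq TT.T_simps idS_def by blast
qed

section \<open>Linearity in \<open>a\<close>\<close>

lemma hact_neg_pow: "\<alpha> \<in> carrier K ==> hact x (neg_pow K e \<alpha>) = sg e (hact x \<alpha>)"
  by (simp add: hact_def act_neg_pow_right M.emb_neg_pow act_closed)

lemma Lm_kappa: "F \<in> Lm q ==> \<beta> \<in> carrier K ==> F (\<kappa> \<beta>) = hact (F \<one>\<^sub>S) \<beta>"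
  using Lm_scalar[of F q "\<one>\<^sub>S" \<beta>] by simp

text \<open>\<open>G'\<close> is $\pm G\alpha$ in the right module $Hom(S(\mathfrak g),\mathfrak g)$, \<open>j\<close> being the parity of \<open>\<alpha>\<close>.\<close>

definition ract where "ract j \<alpha> e G G' \<longleftrightarrow> (\<forall>k. \<forall>x\<in>gr S k. G' x = sg (e + j * k) (hact (G x) \<alpha>))"

text \<open>Taking the derivative moves X out of the argument, so its share j i of the sign is no
  longer part of j k; the exponent e is there to absorb it.\<close>

lemma ract_lX: "ract j \<alpha> e G G' ==> X \<in> gr \<gg> i ==> ract j \<alpha> (e + j * i) (lX X G) (lX X G')"
  unfolding ract_def using gr_S_iota_mult gr_S_closed by (fastforce simp: lX_def distrib_left add.assoc)

text \<open>The derivatives of G and G' are again related by \<open>ract\<close>, so the induction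
  on words goes through. Scalars are exchanged only when the argument is itself a scalar, and this
  is paid for by supercommutativity of K.\<close>

lemma cb_ract:
  assumes \<alpha>: "\<alpha> \<in> gr K j"
  shows "x \<in> gr S k ==> F \<in> Lm p ==> G \<in> Lm q ==> G' \<in> Lm (q + j) ==> ract j \<alpha> e G G' ==>
    cb (q + j) F G' x = sg (e + j * k) (hact (cb q F G x) \<alpha>)"
proof (induction arbitrary: F G G' p q e rule: gr_S_induct)
  case (scalar k \<beta>)
  note L = cb_Lm[OF scalar(2,3)] cb_Lm[OF scalar(2,4)]
  have c: "\<alpha> \<in> carrier K" "\<beta> \<in> carrier K" using \<alpha> scalar by auto
  have "G' \<one>\<^sub>S = sg e (hact (G \<one>\<^sub>S) \<alpha>)" using scalar(5) one_gr_S by (fastforce simp: ract_def)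
  then have "cb (q + j) F G' \<one>\<^sub>S = sg e (hact (cb q F G \<one>\<^sub>S) \<alpha>)"
    using c by (simp add: cb_one[OF scalar(2,4)] cb_one[OF scalar(2,3)] hbr_sg hbr_hact_right)
  then show ?case
    using c K.supercommutative[OF \<alpha> scalar(1)]
    by (simp add: Lm_kappa[OF L(1)] Lm_kappa[OF L(2)] hact_sg hact_hact hact_neg_pow)
next
  case (mult X i j' w)
  note X = mult(1) and F = mult(4) and G = mult(5) and G' = mult(6)
  have w: "w \<in> carrier S" using mult gr_S_closed by blast
  have a: "q + i + j = q + j + i" by (simp add: ac_simps)
  have 1: "cb (q + j) (lX X F) G' w = sg (e + j * j') (hact (cb q (lX X F) G w) \<alpha>)"
    by (rule mult(3)[OF lX_Lm[OF F X] G G' mult(7)])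
  have 2: "cb (q + j + i) F (lX X G') w = sg (e + j * i + j * j') (hact (cb (q + i) F (lX X G) w) \<alpha>)"
    using mult(3)[OF F lX_Lm[OF G X] _ ract_lX[OF mult(7) X]] lX_Lm[OF G' X] unfolding a by blast
  show ?case
    unfolding lX_apply[OF w] cb_lX[OF F G' X] cb_lX[OF F G X]
    using 1 2 \<alpha> by (simp add: hact_add hact_sg K.gr_closed sg_add) (simp add: algebra_simps)
next
  case (add k x y)
  note L = cb_Lm[OF add(5,6)] cb_Lm[OF add(5,7)]
  have "x \<in> carrier S" "y \<in> carrier S" using add gr_S_closed by blast+
  then show ?case using add(3)[OF add(5-8)] add(4)[OF add(5-8)] \<alpha>
    by (simp add: Lm_add[OF L(1)] Lm_add[OF L(2)] hact_add sg_add K.gr_closed)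
qed

lemma Fn_ract:
  assumes a: "a \<in> gr \<gg> p" and \<alpha>: "\<alpha> \<in> gr K j"
  shows "ract j \<alpha> 0 (Fn p a n) (Fn (p + j) (a \<triangleleft> \<alpha>) n)"
proof (induction n)
  case 0
  have c: "\<alpha> \<in> carrier K" "a \<in> carrier \<gg>" using a \<alpha> by auto
  show ?case unfolding ract_def
  proof (intro allI ballI)
    fix k x assume x: "x \<in> gr S k"
    then have xc: "x \<in> carrier S" by (rule gr_S_closed)
    have e: "\<epsilon> x \<in> carrier K" using xc by simp
    have "a \<triangleleft> \<alpha> \<triangleleft> \<epsilon> x = neg_pow \<gg> (j * k) (a \<triangleleft> \<epsilon> x \<triangleleft> \<alpha>)"
      using c e K.supercommutative[OF \<alpha> \<epsilon>_gr[OF x]] by (simp add: act_mult[symmetric] act_neg_pow_right)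
    then show "Fn (p + j) (a \<triangleleft> \<alpha>) 0 x = sg (0 + j * k) (hact (Fn p a 0 x) \<alpha>)"
      using c e xc by (simp add: Fn_0 cst_def hact_def act_closed M.emb_neg_pow)
  qed
next
  case (Suc n)
  show ?case unfolding ract_def Fn_Suc xp_def
    by (intro allI ballI cb_ract[OF \<alpha> _ piL_Lm Fn_Lm[OF a] Fn_Lm[OF act_gr[OF a \<alpha>]] Suc])
qed

lemma phiL_ract:
  assumes a: "a \<in> gr \<gg> p" and \<alpha>: "\<alpha> \<in> gr K j" and c: "\<And>n. c n \<in> gr K 0"
  shows "ract j \<alpha> 0 (phiL c p a) (phiL c (p + j) (a \<triangleleft> \<alpha>))"
  unfolding ract_def
proof (intro allI ballI)
  fix k x assume x: "x \<in> gr S k"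
  have cc: "\<alpha> \<in> carrier K" "c n \<in> carrier K" for n using \<alpha> c by auto
  have "hact (Fn (p + j) (a \<triangleleft> \<alpha>) n x) (c n) = sg (j * k) (hact (hact (Fn p a n x) (c n)) \<alpha>)" for n
    using Fn_ract[OF a \<alpha>, of n] x cc even_comm[OF c cc(1), of n] by (simp add: ract_def hact_sg hact_hact)
  then show "phiL c (p + j) (a \<triangleleft> \<alpha>) x = sg (0 + j * k) (hact (phiL c p a x) \<alpha>)"
    using gr_S_closed[OF x] cc by (simp add: phiL_def phiT_apply hact_sum sg_sum)
qed

lemma Fn_add: "a \<in> gr \<gg> p ==> b \<in> gr \<gg> p ==> Fn p (a \<oplus>\<^bsub>\<gg>\<^esub> b) n = Fn p a n + Fn p b n"
proof (induction n)
  case (Suc n)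
  show ?case unfolding Fn_Suc Suc.IH[OF Suc.prems] xp_linear(1)[OF Fn_Lm[OF Suc.prems(1)] Fn_Lm[OF Suc.prems(2)]] ..
qed (simp add: Fn_0 cst_add M.gr_closed)

lemma phiL_add:
  assumes "a \<in> gr \<gg> p" "b \<in> gr \<gg> p" and c: "\<And>n. c n \<in> gr K 0"
  shows "phiL c p (a \<oplus>\<^bsub>\<gg>\<^esub> b) = phiL c p a + phiL c p b"
  using assms(1,2) K.gr_closed[OF c]
  by (auto simp: phiL_def phiT_apply Fn_add hact_add sum.distrib fun_eq_iff)

text \<open>The relation passes from elements of L to their coderivations: \<open>Ps_mult\<close>
  reduces it to shorter words, with \<open>ract_lX\<close> for the term in which \<psi> absorbs a
  letter.\<close>

lemma Ps_ract:
  assumes \<alpha>: "\<alpha> \<in> gr K j"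
  shows "x \<in> gr S k ==> \<psi> \<in> Lm q ==> \<psi>' \<in> Lm (q + j) ==> ract j \<alpha> e \<psi> \<psi>' ==>
    Ps (q + j) \<psi>' x = neg_pow S (e + j * k) (Ps q \<psi> x \<odot> \<kappa> \<alpha>)"
proof (induction arbitrary: \<psi> \<psi>' q e rule: gr_S_induct)
  case (scalar k \<beta>)
  have c: "\<alpha> \<in> carrier K" "\<beta> \<in> carrier K" "\<kappa> \<alpha> \<in> carrier S" "\<kappa> \<beta> \<in> carrier S" using \<alpha> scalar by auto
  let ?Y = "val \<gg> (\<psi> \<one>\<^sub>S)"
  have Y: "?Y \<in> carrier \<gg>" "\<iota> ?Y \<in> carrier S" by auto
  have "\<psi>' \<one>\<^sub>S = sg e (hact (\<psi> \<one>\<^sub>S) \<alpha>)" using scalar(4) one_gr_S by (fastforce simp: ract_def)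
  then have 1: "\<iota> (val \<gg> (\<psi>' \<one>\<^sub>S)) = neg_pow S e (\<iota> ?Y \<odot> \<kappa> \<alpha>)"
    using c Y by (simp add: hact_def act_closed \<iota>_neg_pow \<iota>_act_\<kappa>)
  have 2: "\<kappa> \<alpha> \<odot> \<kappa> \<beta> = neg_pow S (j * k) (\<kappa> \<beta> \<odot> \<kappa> \<alpha>)"
    using SA.act_mult_left[OF S.one_closed gr_S_kappa[OF scalar(1)] \<alpha>] c by (simp add: S_act)
  have 3: "Ps r \<theta> (\<kappa> \<beta>) = \<iota> (val \<gg> (\<theta> \<one>\<^sub>S)) \<odot> \<kappa> \<beta>" if "\<theta> \<in> Lm r" for r \<theta>
    using Ps_scalar[OF that S.one_closed c(2)] Ps_one[OF that] c by simp
  show ?case unfolding 3[OF scalar(2)] 3[OF scalar(3)] 1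
    using c Y 2 by (simp add: SA.neg_pow_mult_left SA.neg_pow_mult_right S.m_assoc)
next
  case (mult X i j' w)
  note X = mult(1) and \<psi> = mult(4) and \<psi>' = mult(5)
  note l = lX_Lm[OF \<psi> X]
  have w: "w \<in> carrier S" "\<iota> X \<in> carrier S" "\<kappa> \<alpha> \<in> carrier S" using mult gr_S_closed \<alpha> by auto
  have a: "q + i + j = q + j + i" by (simp add: ac_simps)
  have 1: "Ps (q + j) \<psi>' w = neg_pow S (e + j * j') (Ps q \<psi> w \<odot> \<kappa> \<alpha>)" by (rule mult(3)[OF \<psi> \<psi>' mult(6)])
  have 2: "Ps (q + j + i) (lX X \<psi>') w = neg_pow S (e + j * i + j * j') (Ps (q + i) (lX X \<psi>) w \<odot> \<kappa> \<alpha>)"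
    using mult(3)[OF l _ ract_lX[OF mult(6) X]] lX_Lm[OF \<psi>' X] unfolding a by blast
  show ?case
    unfolding Ps_mult[OF \<psi>' X w(1)] Ps_mult[OF \<psi> X w(1)] 1 2
    using w \<psi> l by (simp add: S.l_distr SA.neg_pow_mult_left SA.neg_pow_mult_right S.m_assoc S.neg_pow_add algebra_simps)
next
  case (add k x y)
  have c: "x \<in> carrier S" "y \<in> carrier S" "\<kappa> \<alpha> \<in> carrier S" using add gr_S_closed \<alpha> by auto
  then show ?case using add(3)[OF add(5-7)] add(4)[OF add(5-7)] add(5,6)
    by (simp add: Ps_add S.l_distr S.neg_pow_add)
qed

section \<open>Representations by coderivations\<close>

lemma rc_add_right: "F \<in> Lm p ==> \<psi> \<in> Lm q ==> \<chi> \<in> Lm q ==> rc F q (\<psi> + \<chi>) = rc F q \<psi> + rc F q \<chi>"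
  by (auto simp: rc_def fun_eq_iff Ps_plus Lm_add)

lemma rc_zero_right: "F \<in> Lm p ==> rc F q 0 = 0"
  using rc_add_right[of F p 0 q 0] by simp

text \<open>The operation on L that corresponds to the supercommutator of the attached
  coderivations, by \<open>Ps_commutator\<close>.\<close>

definition comm where "comm p F q G = rc F q G - sg (p * q) (rc G p F)"

text \<open>The conditions, expressed in L and on homogeneous elements, under which attaching
  coderivations to \<phi> gives a K-linear morphism of Lie superalgebras: grading, additivity,
  scalars and brackets.\<close>

definition rep_family :: "(bit \<Rightarrow> 'g \<Rightarrow> ('k, 'g) sym_elem \<Rightarrow> 'g amb) \<Rightarrow> bool"
  where "rep_family \<phi> \<longleftrightarrow>
    (\<forall>i. \<forall>a\<in>gr \<gg> i. \<phi> i a \<in> Lm i) \<and>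
    (\<forall>i. \<forall>a\<in>gr \<gg> i. \<forall>b\<in>gr \<gg> i. \<phi> i (a \<oplus>\<^bsub>\<gg>\<^esub> b) = \<phi> i a + \<phi> i b) \<and>
    (\<forall>i j. \<forall>a\<in>gr \<gg> i. \<forall>\<alpha>\<in>gr K j. ract j \<alpha> 0 (\<phi> i a) (\<phi> (i + j) (a \<triangleleft> \<alpha>))) \<and>
    (\<forall>i j. \<forall>a\<in>gr \<gg> i. \<forall>b\<in>gr \<gg> j. comm i (\<phi> i a) j (\<phi> j b) = \<phi> (i + j) (brk \<gg> a b))"

lemma rep_familyD:
  assumes "rep_family \<phi>"
  shows "a \<in> gr \<gg> i ==> \<phi> i a \<in> Lm i"
    and "a \<in> gr \<gg> i ==> b \<in> gr \<gg> i ==> \<phi> i (a \<oplus>\<^bsub>\<gg>\<^esub> b) = \<phi> i a + \<phi> i b"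
    and "a \<in> gr \<gg> i ==> \<alpha> \<in> gr K j ==> ract j \<alpha> 0 (\<phi> i a) (\<phi> (i + j) (a \<triangleleft> \<alpha>))"
    and "a \<in> gr \<gg> i ==> b \<in> gr \<gg> j ==> comm i (\<phi> i a) j (\<phi> j b) = \<phi> (i + j) (brk \<gg> a b)"
    and "\<phi> i \<zero>\<^bsub>\<gg>\<^esub> = 0"
proof -
  show add: "a \<in> gr \<gg> i ==> b \<in> gr \<gg> i ==> \<phi> i (a \<oplus>\<^bsub>\<gg>\<^esub> b) = \<phi> i a + \<phi> i b" for a b i
    using assms by (simp add: rep_family_def)
  show "\<phi> i \<zero>\<^bsub>\<gg>\<^esub> = 0" using add[of "\<zero>\<^bsub>\<gg>\<^esub>" i "\<zero>\<^bsub>\<gg>\<^esub>"] by simp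
qed (use assms in \<open>simp_all add: rep_family_def\<close>)

lemma comm_zero: "F \<in> Lm p ==> comm p F q 0 = 0" "F \<in> Lm q ==> comm p 0 q F = 0"
  by (simp_all add: comm_def rc_zero_right rc_linear(4))

lemma comm_add_left:
  "F \<in> Lm p ==> F' \<in> Lm p ==> G \<in> Lm q ==> comm p (F + F') q G = comm p F q G + comm p F' q G"
  by (simp add: comm_def rc_linear(1) rc_add_right sg_add)

lemma comm_skew: "comm q G p F = - sg (p * q) (comm p F q G)"
  by (simp add: comm_def sg_diff mult.commute[of q])

lemma comm_add_right:
  "F \<in> Lm p ==> G \<in> Lm q ==> G' \<in> Lm q ==> comm p F q (G + G') = comm p F q G + comm p F q G'"
  by (simp add: comm_skew[of p F q] comm_add_left sg_add)

lemma rep_family_zero: "rep_family (\<lambda>i a. 0)"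
  by (simp add: rep_family_def ract_def comm_zero)

lemma phi_series_zero_even: "phi_series K \<zero>\<^bsub>K\<^esub> n \<in> gr K 0"
  using K.gr_one by (auto simp: phi_series_def)

lemma rep_family_phiL:
  assumes c: "c \<in> even_units K \<union> {\<zero>\<^bsub>K\<^esub>}"
  shows "rep_family (phiL (phi_series K c))"
proof -
  have ev: "phi_series K c n \<in> gr K 0" for n
    using c phi_series_zero_even psc_even phi_series_unit by auto
  have "comm i (phiL (phi_series K c) i a) j (phiL (phi_series K c) j b) = phiL (phi_series K c) (i + j) (brk \<gg> a b)"
    if "a \<in> gr \<gg> i" "b \<in> gr \<gg> j" for a b i j
  proof (cases "c = \<zero>\<^bsub>K\<^esub>")
    case True
    then show ?thesis using phi_equivariant[OF that phi_series_zero_even] by (simp add: comm_def)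
  next
    case False
    then have "c \<in> even_units K" "phi_series K c = psc c" using c phi_series_unit by auto
    then show ?thesis using phi_commutator[OF that] by (simp add: comm_def)
  qed
  then show ?thesis
    by (simp add: rep_family_def phiL_Lm[OF _ ev] phiL_add[OF _ _ ev] phiL_ract[OF _ _ ev])
qed

text \<open>With the second series written as a difference by \<open>psc_neg\<close>,
  \<open>phi_equivariant\<close> and \<open>phi_commutator\<close> evaluate the two commutators to
  the same element of L.\<close>

lemma comm_opposite:
  assumes d: "d \<in> even_units K" and a: "a \<in> gr \<gg> i" and b: "b \<in> gr \<gg> j"
  shows "comm i (phiL (phi_series K d) i a) j (phiL (phi_series K (\<ominus>\<^bsub>K\<^esub> d)) j b) = 0"
proof -
  let ?z = "phi_series K \<zero>\<^bsub>K\<^esub>"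
  have s: "phi_series K d = psc d" "phi_series K (\<ominus>\<^bsub>K\<^esub> d) = psc (\<ominus>\<^bsub>K\<^esub> d)"
    using phi_series_unit[OF d] phi_series_unit[OF even_units_neg(1)[OF d]] by auto
  note c = K.gr_closed[OF psc_even[OF d]] K.gr_closed[OF phi_series_zero_even]
  have "hact x (psc (\<ominus>\<^bsub>K\<^esub> d) n) = hact x (?z n) - hact x (psc d n)" for x n
    unfolding psc_neg[OF d] K.minus_eq using c hact_neg_pow[of "psc d n" x 1] by (simp add: hact_add_scalar)
  then have m: "phiL (psc (\<ominus>\<^bsub>K\<^esub> d)) j b = phiL ?z j b - phiL (psc d) j b"
    by (auto simp: phiL_def phiT_apply sum_subtractf fun_eq_iff)
  note La = phiL_Lm[of a i "psc d", OF a psc_even[OF d]] and Lb = phiL_Lm[of b j "psc d", OF b psc_even[OF d]]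
  note Lz = phiL_Lm[of b j ?z, OF b phi_series_zero_even]
  have "comm i (phiL (psc d) i a) j (phiL (psc (\<ominus>\<^bsub>K\<^esub> d)) j b) =
      comm i (phiL (psc d) i a) j (phiL ?z j b) - comm i (phiL (psc d) i a) j (phiL (psc d) j b)"
    using comm_add_right[OF La Lm_diff[OF Lz Lb] Lb] unfolding m by simp
  also have "\<dots> = 0"
    using phi_equivariant[OF a b psc_even[OF d]] phi_commutator[OF a b d] by (simp add: comm_def)
  finally show ?thesis unfolding s .
qed

text \<open>A family is only controlled on homogeneous elements, so the two components of a are
  treated separately and their coderivations added.\<close>

definition rp where "rp \<phi> a = PH 0 (\<phi> 0 (prt \<gg> 0 a)) \<oplus>\<^bsub>E\<^esub> PH 1 (\<phi> 1 (prt \<gg> 1 a))"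

abbreviation "EL \<equiv> End_lie K S"

lemma EL_simps: "carrier EL = carrier E" "\<zero>\<^bsub>EL\<^esub> = \<zero>\<^bsub>E\<^esub>" "(\<oplus>\<^bsub>EL\<^esub>) = (\<oplus>\<^bsub>E\<^esub>)" "gr EL = gr E" "act EL = act E"
  "brk EL F G = (\<Oplus>\<^bsub>E\<^esub>i\<in>{0,1}. \<Oplus>\<^bsub>E\<^esub>j\<in>{0,1}. compose (carrier S) (prt E i F) (prt E j G) \<ominus>\<^bsub>E\<^esub>
      neg_pow E (i * j) (compose (carrier S) (prt E j G) (prt E i F)))"
  by (simp_all add: End_lie_def Let_def supermodule.extend_def lie_algebra.fields_def)

lemma Ps_zero: "x \<in> carrier S ==> Ps q 0 x = \<zero>\<^bsub>S\<^esub>"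
  using PsE_zero[of x q] S.emb_inject[of "Ps q 0 x" "\<zero>\<^bsub>S\<^esub>"] by (simp add: PsE_def)

lemma PH_zero: "PH q 0 = \<zero>\<^bsub>E\<^esub>"
  by (auto simp: PH_def TT.Hom_simps(2) Ps_zero intro!: restrict_ext)

lemma PH_plus: "\<psi> \<in> Lm q ==> \<chi> \<in> Lm q ==> PH q (\<psi> + \<chi>) = PH q \<psi> \<oplus>\<^bsub>E\<^esub> PH q \<chi>"
  by (auto simp: PH_def TT.Hom_simps(3) Ps_plus intro!: restrict_ext)

interpretation E: abelian_group E by (rule TT.Hom_abelian)

lemma PH_closed [simp]: "\<psi> \<in> Lm q ==> PH q \<psi> \<in> carrier E"
  by (rule TT.Hom_gr_closed[OF PH_gr])

lemma em_PH: "x \<in> carrier S ==> em (PH q \<psi> x) = PsE q \<psi> x"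
  by (simp add: PH_def PsE_def)

lemma em_add_E: "F \<in> carrier E ==> G \<in> carrier E ==> x \<in> carrier S ==> em ((F \<oplus>\<^bsub>E\<^esub> G) x) = em (F x) + em (G x)"
  by (simp add: TT.Hom_simps(3) S.emb_add TT.Hom_closed)

lemma em_diff_E:
  assumes "F \<in> carrier E" "G \<in> carrier E" "x \<in> carrier S"
  shows "em ((F \<ominus>\<^bsub>E\<^esub> neg_pow E e G) x) = em (F x) - sg e (em (G x))"
proof -
  have G: "neg_pow E e G \<in> carrier E" using assms by simp
  have "em ((\<ominus>\<^bsub>E\<^esub> neg_pow E e G) x) = - em (neg_pow E e G x)"
    using assms(3) TT.Hom_closed[OF G] by (simp add: TT.Hom_a_inv[OF G] S.emb_a_inv)
  then show ?thesis
    unfolding E.minus_eq em_add_E[OF assms(1) E.a_inv_closed[OF G] assms(3)] TT.Hom_neg_pow_apply[OF assms(2,3)]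
    using TT.Hom_closed[OF assms(2,3)] by (simp add: S.emb_neg_pow)
qed

lemma E_eqI: "F \<in> carrier E ==> G \<in> carrier E ==> (\<And>x. x \<in> carrier S ==> em (F x) = em (G x)) ==> F = G"
  using TT.Hom_eqI S.emb_inject TT.Hom_closed by metis

text \<open>The bracket of \<open>End_lie\<close> splits into four terms by the parities of the two
  maps. Each is a supercommutator evaluated by \<open>Ps_commutator\<close>; the terms are then
  regrouped by total parity.\<close>

lemma brk_EL_PH:
  assumes \<psi>: "\<And>i. \<psi> i \<in> Lm i" and \<chi>: "\<And>i. \<chi> i \<in> Lm i"
  defines "F \<equiv> PH 0 (\<psi> 0) \<oplus>\<^bsub>E\<^esub> PH 1 (\<psi> 1)" and "G \<equiv> PH 0 (\<chi> 0) \<oplus>\<^bsub>E\<^esub> PH 1 (\<chi> 1)"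
  shows "brk EL F G = PH 0 (comm 0 (\<psi> 0) 0 (\<chi> 0) + comm 1 (\<psi> 1) 1 (\<chi> 1)) \<oplus>\<^bsub>E\<^esub>
    PH 1 (comm 0 (\<psi> 0) 1 (\<chi> 1) + comm 1 (\<psi> 1) 0 (\<chi> 0))"
proof -
  have L: "comm i (\<psi> i) j (\<chi> j) \<in> Lm (i + j)" for i j
    using rc_Lm[OF \<psi> \<chi>, of i j] rc_Lm[OF \<chi> \<psi>, of j i] by (auto simp: comm_def add.commute intro!: Lm_diff Lm_sg)
  have P: "prt E i F = PH i (\<psi> i)" "prt E i G = PH i (\<chi> i)" for i
    using TT.prt_Hom[OF PH_gr[OF \<psi>] PH_gr[OF \<psi>]] TT.prt_Hom[OF PH_gr[OF \<chi>] PH_gr[OF \<chi>]]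
    by (cases i; simp add: F_def G_def)+
  have co: "compose (carrier S) (PH q \<theta>) (PH r \<eta>) \<in> carrier E" if "\<theta> \<in> Lm q" "\<eta> \<in> Lm r" for q r \<theta> \<eta>
    unfolding compose_def
    by (rule TT.HomI) (use that in \<open>auto simp: PH_def Ps_add Ps_act SA.act_closed\<close>)
  have t: "compose (carrier S) (PH i (\<psi> i)) (PH j (\<chi> j)) \<ominus>\<^bsub>E\<^esub> neg_pow E (i * j) (compose (carrier S) (PH j (\<chi> j)) (PH i (\<psi> i))) =
      PH (i + j) (comm i (\<psi> i) j (\<chi> j))" for i j
  proof (rule E_eqI)
    fix x assume x: "x \<in> carrier S"
    have "em ((compose (carrier S) (PH i (\<psi> i)) (PH j (\<chi> j)) \<ominus>\<^bsub>E\<^esub> neg_pow E (i * j) (compose (carrier S) (PH j (\<chi> j)) (PH i (\<psi> i)))) x) =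
        PsE i (\<psi> i) (Ps j (\<chi> j) x) - sg (i * j) (PsE j (\<chi> j) (Ps i (\<psi> i) x))"
      unfolding em_diff_E[OF co[OF \<psi> \<chi>] co[OF \<chi> \<psi>] x] using x \<psi> \<chi> by (simp add: compose_def PH_def PsE_def)
    then show "em ((compose (carrier S) (PH i (\<psi> i)) (PH j (\<chi> j)) \<ominus>\<^bsub>E\<^esub> neg_pow E (i * j) (compose (carrier S) (PH j (\<chi> j)) (PH i (\<psi> i)))) x) =
        em (PH (i + j) (comm i (\<psi> i) j (\<chi> j)) x)"
      unfolding em_PH[OF x] comm_def Ps_commutator[OF \<psi> \<chi> x] .
  qed (use L in \<open>simp_all add: co \<psi> \<chi> E.minus_closed\<close>)
  have "brk EL F G = (\<Oplus>\<^bsub>E\<^esub>i\<in>{0,1}. \<Oplus>\<^bsub>E\<^esub>j\<in>{0,1}. PH (i + j) (comm i (\<psi> i) j (\<chi> j)))"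
    unfolding EL_simps(6) P t ..
  also have "\<dots> = (PH 0 (comm 0 (\<psi> 0) 0 (\<chi> 0)) \<oplus>\<^bsub>E\<^esub> PH 1 (comm 0 (\<psi> 0) 1 (\<chi> 1))) \<oplus>\<^bsub>E\<^esub>
      (PH 0 (comm 1 (\<psi> 1) 1 (\<chi> 1)) \<oplus>\<^bsub>E\<^esub> PH 1 (comm 1 (\<psi> 1) 0 (\<chi> 0)))"
    using L[of 0 0] L[of 0 1] L[of 1 0] L[of 1 1] by (simp add: E.finsum_bit E.a_comm)
  also have "\<dots> = PH 0 (comm 0 (\<psi> 0) 0 (\<chi> 0) + comm 1 (\<psi> 1) 1 (\<chi> 1)) \<oplus>\<^bsub>E\<^esub>
      PH 1 (comm 0 (\<psi> 0) 1 (\<chi> 1) + comm 1 (\<psi> 1) 0 (\<chi> 0))"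
    using L[of 0 0] L[of 0 1] L[of 1 0] L[of 1 1] by (simp add: PH_plus E.add_swap4)
  finally show ?thesis .
qed

lemma rp_gr:
  assumes \<phi>: "rep_family \<phi>" and a: "a \<in> gr \<gg> i"
  shows "rp \<phi> a = PH i (\<phi> i a)"
proof -
  have "PH j (\<phi> j (prt \<gg> j a)) = (if j = i then PH i (\<phi> i a) else \<zero>\<^bsub>E\<^esub>)" for j
    unfolding M.prt_homogeneous[OF a] by (cases "j = i") (simp_all only: rep_familyD(5)[OF \<phi>] PH_zero if_True if_False refl)
  then show ?thesis using rep_familyD(1)[OF \<phi> a] unfolding rp_def by (cases i) simp_all
qed

lemma rp_closed: "rep_family \<phi> ==> a \<in> carrier \<gg> ==> rp \<phi> a \<in> carrier E"
  by (simp add: rp_def rep_familyD(1))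

lemma rp_add:
  assumes "rep_family \<phi>" "a \<in> carrier \<gg>" "b \<in> carrier \<gg>"
  shows "rp \<phi> (a \<oplus>\<^bsub>\<gg>\<^esub> b) = rp \<phi> a \<oplus>\<^bsub>E\<^esub> rp \<phi> b"
  using assms
  by (simp add: rp_def M.prt_add rep_familyD(2)[OF assms(1)] PH_plus rep_familyD(1)[OF assms(1)] E.add_swap4)

text \<open>A scalar acts on \<open>Hom\<close> by left multiplication in the argument. For
  homogeneous data this left multiplication has the sign exponent j k, which is the one in
  \<open>ract\<close> with e = 0.\<close>

lemma rp_act:
  assumes \<phi>: "rep_family \<phi>" and a: "a \<in> carrier \<gg>" and \<alpha>: "\<alpha> \<in> carrier K" and x: "x \<in> carrier S"
  shows "rp \<phi> (a \<triangleleft> \<alpha>) x = rp \<phi> a (lact K S \<alpha> x)"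
  using \<alpha>
proof (induction \<alpha> rule: K.gr_induct)
  case (gr j \<alpha>)
  note \<alpha> = gr
  have \<alpha>c: "\<alpha> \<in> carrier K" using \<alpha> by auto
  from a show ?case
  proof (induction a rule: M.gr_induct)
    case (gr i a)
    note L = rep_familyD(1)[OF \<phi> gr] rep_familyD(1)[OF \<phi> act_gr[OF gr \<alpha>]]
    from x show ?case unfolding rp_gr[OF \<phi> gr] rp_gr[OF \<phi> act_gr[OF gr \<alpha>]]
    proof (induction x rule: SA.M.gr_induct)
      case (gr k x)
      have c: "x \<in> carrier S" "x \<bullet>\<^bsub>S\<^esub> \<alpha> \<in> carrier S" using gr \<alpha>c SA.act_closed by auto
      show ?case
        using c \<alpha>c Ps_ract[OF \<alpha> gr L rep_familyD(3)[OF \<phi> \<open>a \<in> gr \<gg> i\<close> \<alpha>]] L(1)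
        by (simp add: PH_def SA.lact_gr[OF gr \<alpha>] Ps_neg_pow Ps_act) (simp add: S_act)
    next
      case (add y z)
      then show ?case using L SA.lact_closed[OF _ \<alpha>c]
        by (simp add: PH_def Ps_add additive_maps_add[OF SA.lact_additive[OF \<alpha>c]])
    qed
  next
    case (add b c)
    then show ?case using \<alpha>c x SA.lact_closed[OF x \<alpha>c]
      by (simp add: act_add_left act_closed rp_add[OF \<phi>] TT.Hom_simps(3))
  qed
next
  case (add \<beta> \<gamma>)
  then show ?case using a x SA.lact_closed[OF x]
    by (simp add: act_add_right act_closed rp_add[OF \<phi>] TT.Hom_simps(3) SA.lact_add_scalar
        additive_maps_add[OF TT.Hom_additive[OF rp_closed[OF \<phi> a]]])
qed

lemma prt_brk:
  assumes "a \<in> carrier \<gg>" "b \<in> carrier \<gg>"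
  shows "prt \<gg> 0 (brk \<gg> a b) = brk \<gg> (prt \<gg> 0 a) (prt \<gg> 0 b) \<oplus>\<^bsub>\<gg>\<^esub> brk \<gg> (prt \<gg> 1 a) (prt \<gg> 1 b)" (is ?A)
    and "prt \<gg> 1 (brk \<gg> a b) = brk \<gg> (prt \<gg> 0 a) (prt \<gg> 1 b) \<oplus>\<^bsub>\<gg>\<^esub> brk \<gg> (prt \<gg> 1 a) (prt \<gg> 0 b)" (is ?B)
proof -
  let ?a = "\<lambda>i. prt \<gg> i a" and ?b = "\<lambda>i. prt \<gg> i b"
  have g: "brk \<gg> (?a i) (?b j) \<in> gr \<gg> (i + j)" for i j using assms by (intro brk_even) auto
  have c: "brk \<gg> (?a i) (?b j) \<in> carrier \<gg>" for i j using assms by auto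
  have "brk \<gg> a b = brk \<gg> (?a 0 \<oplus>\<^bsub>\<gg>\<^esub> ?a 1) (?b 0 \<oplus>\<^bsub>\<gg>\<^esub> ?b 1)" using assms by (simp add: M.prt_sum)
  also have "\<dots> = (brk \<gg> (?a 0) (?b 0) \<oplus>\<^bsub>\<gg>\<^esub> brk \<gg> (?a 1) (?b 1)) \<oplus>\<^bsub>\<gg>\<^esub> (brk \<gg> (?a 0) (?b 1) \<oplus>\<^bsub>\<gg>\<^esub> brk \<gg> (?a 1) (?b 0))"
    using assms c by (simp add: brk_add_left brk_add_right M.a_ac)
  finally have e: "brk \<gg> a b = \<dots>" .
  have h: "brk \<gg> (?a 0) (?b 0) \<oplus>\<^bsub>\<gg>\<^esub> brk \<gg> (?a 1) (?b 1) \<in> gr \<gg> 0" "brk \<gg> (?a 0) (?b 1) \<oplus>\<^bsub>\<gg>\<^esub> brk \<gg> (?a 1) (?b 0) \<in> gr \<gg> 1"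
    using g[of 0 0] g[of 1 1] g[of 0 1] g[of 1 0] by auto
  show ?A unfolding e using M.prt_plus[OF h(1)] h(2) by simp
  show ?B unfolding e using M.prt_plus[OF h(2)] h M.a_comm M.gr_closed by (metis add_0_left bit_char_2(1))
qed

text \<open>In the direct product the two factors have zero bracket with each other, so the sum of
  the two families respects brackets once the mixed commutators vanish. They are assumed to vanish
  in one order; \<open>comm_skew\<close> supplies the other.\<close>

theorem coderivation_rep_pair:
  assumes \<phi>: "rep_family \<phi>" and \<chi>: "rep_family \<chi>"
    and cross: "\<And>i j a b. a \<in> gr \<gg> i ==> b \<in> gr \<gg> j ==> comm i (\<phi> i a) j (\<chi> j b) = 0"
    and f: "\<And>a b. a \<in> carrier \<gg> ==> b \<in> carrier \<gg> ==> f (a, b) = rp \<phi> a \<oplus>\<^bsub>E\<^esub> rp \<chi> b"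
  shows "coderivation_rep K (lie_prod \<gg> \<gg>) \<gg> f"
proof -
  define \<Psi> where "\<Psi> h i = \<phi> i (prt \<gg> i (fst h)) + \<chi> i (prt \<gg> i (snd h))" for h i
  note L = rep_familyD(1)[OF \<phi>] rep_familyD(1)[OF \<chi>]
  have \<Psi>: "\<Psi> (a, b) i \<in> Lm i" if "a \<in> carrier \<gg>" "b \<in> carrier \<gg>" for a b i
    using that L by (auto simp: \<Psi>_def intro!: Lm_plus)
  have fP: "f (a, b) = PH 0 (\<Psi> (a, b) 0) \<oplus>\<^bsub>E\<^esub> PH 1 (\<Psi> (a, b) 1)" if "a \<in> carrier \<gg>" "b \<in> carrier \<gg>" for a b
    using that by (simp add: f \<Psi>_def rp_def PH_plus L E.add_swap4)
  note rc = rp_closed[OF \<phi>] rp_closed[OF \<chi>]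
  have fc: "f (a, b) \<in> carrier E" if "a \<in> carrier \<gg>" "b \<in> carrier \<gg>" for a b
    using that rc by (simp add: f)
  have brk: "f (brk \<gg> a a', brk \<gg> b b') = brk EL (f (a, b)) (f (a', b'))"
    if c: "a \<in> carrier \<gg>" "b \<in> carrier \<gg>" "a' \<in> carrier \<gg>" "b' \<in> carrier \<gg>" for a b a' b'
  proof -
    let ?A = "\<lambda>i j. brk \<gg> (prt \<gg> i a) (prt \<gg> j a')" and ?B = "\<lambda>i j. brk \<gg> (prt \<gg> i b) (prt \<gg> j b')"
    have g: "?A i j \<in> gr \<gg> (i + j)" "?B i j \<in> gr \<gg> (i + j)" for i j using c by (auto intro: brk_even)
    have k: "comm i (\<Psi> (a, b) i) j (\<Psi> (a', b') j) = \<phi> (i + j) (?A i j) + \<chi> (i + j) (?B i j)" for i j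
    proof -
      have p: "prt \<gg> i a \<in> gr \<gg> i" "prt \<gg> i b \<in> gr \<gg> i" "prt \<gg> j a' \<in> gr \<gg> j" "prt \<gg> j b' \<in> gr \<gg> j" using c by auto
      have "comm i (\<chi> i (prt \<gg> i b)) j (\<phi> j (prt \<gg> j a')) = 0"
        unfolding comm_skew[of i _ j] cross[OF p(3,2)] by simp
      then show ?thesis unfolding \<Psi>_def fst_conv snd_conv
        using p L by (simp add: comm_add_left comm_add_right Lm_plus cross rep_familyD(4)[OF \<phi>] rep_familyD(4)[OF \<chi>])
    qed
    have b: "brk EL (f (a, b)) (f (a', b')) = PH 0 (\<phi> 0 (?A 0 0) + \<chi> 0 (?B 0 0) + (\<phi> 0 (?A 1 1) + \<chi> 0 (?B 1 1))) \<oplus>\<^bsub>E\<^esub>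
        PH 1 (\<phi> 1 (?A 0 1) + \<chi> 1 (?B 0 1) + (\<phi> 1 (?A 1 0) + \<chi> 1 (?B 1 0)))"
      unfolding fP[OF c(1,2)] fP[OF c(3,4)] brk_EL_PH[of "\<Psi> (a, b)" "\<Psi> (a', b')", OF \<Psi>[OF c(1,2)] \<Psi>[OF c(3,4)]] k by simp
    have "\<Psi> (brk \<gg> a a', brk \<gg> b b') 0 = \<phi> 0 (?A 0 0) + \<chi> 0 (?B 0 0) + (\<phi> 0 (?A 1 1) + \<chi> 0 (?B 1 1))"
      using c g[of 0 0] g[of 1 1] by (simp add: \<Psi>_def prt_brk rep_familyD(2)[OF \<phi>] rep_familyD(2)[OF \<chi>])
    moreover have "\<Psi> (brk \<gg> a a', brk \<gg> b b') 1 = \<phi> 1 (?A 0 1) + \<chi> 1 (?B 0 1) + (\<phi> 1 (?A 1 0) + \<chi> 1 (?B 1 0))"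
      using c g[of 0 1] g[of 1 0] by (simp add: \<Psi>_def prt_brk rep_familyD(2)[OF \<phi>] rep_familyD(2)[OF \<chi>])
    ultimately show ?thesis unfolding b using c by (simp add: fP)
  qed
  have "lie_morphism K (lie_prod \<gg> \<gg>) EL f"
    unfolding lie_morphism_def
  proof (intro conjI allI ballI)
    show "f \<in> linear_maps K (lie_prod \<gg> \<gg>) EL"
    proof -
      have "f (a \<oplus>\<^bsub>\<gg>\<^esub> a', b \<oplus>\<^bsub>\<gg>\<^esub> b') = f (a, b) \<oplus>\<^bsub>E\<^esub> f (a', b')"
        if "a \<in> carrier \<gg>" "b \<in> carrier \<gg>" "a' \<in> carrier \<gg>" "b' \<in> carrier \<gg>" for a b a' b'
        using that rc by (simp add: f rp_add[OF \<phi>] rp_add[OF \<chi>] E.add_swap4)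
      moreover have "f (a \<triangleleft> \<alpha>, b \<triangleleft> \<alpha>) = f (a, b) \<bullet>\<^bsub>E\<^esub> \<alpha>"
        if "a \<in> carrier \<gg>" "b \<in> carrier \<gg>" "\<alpha> \<in> carrier K" for a b \<alpha>
        using that SA.lact_closed
        by (auto simp: f act_closed TT.Hom_simps(3,4) rp_act[OF \<phi>] rp_act[OF \<chi>] intro!: restrict_ext)
      ultimately show ?thesis
        using fc by (auto simp: linear_maps_def lie_prod_def EL_simps)
    qed
    show "f ` gr (lie_prod \<gg> \<gg>) i \<subseteq> gr EL i" for i
      by (auto simp: lie_prod_def EL_simps f M.gr_closed rp_gr[OF \<phi>] rp_gr[OF \<chi>] intro!: TT.Hom_gr_add PH_gr L)
    show "f (brk (lie_prod \<gg> \<gg>) X Y) = brk EL (f X) (f Y)"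
      if "X \<in> carrier (lie_prod \<gg> \<gg>)" "Y \<in> carrier (lie_prod \<gg> \<gg>)" for X Y
      using that brk by (auto simp: lie_prod_def)
  qed
  moreover have "coderivation K \<gg> (f h)" if "h \<in> carrier (lie_prod \<gg> \<gg>)" for h
    using that by (auto simp: lie_prod_def fP intro!: PH_coderivation \<Psi>)
  ultimately show ?thesis by (simp add: coderivation_rep_def)
qed

lemma Phi_rp:
  assumes "c \<in> even_units K \<union> {\<zero>\<^bsub>K\<^esub>}" "a \<in> carrier \<gg>"
  shows "Phi K \<gg> c a = rp (phiL (phi_series K c)) a"
proof -
  have "phi_series K c n \<in> gr K 0" for n
    using assms(1) phi_series_zero_even psc_even phi_series_unit by auto
  then show ?thesis unfolding Phi_def rp_def by (rule Phi_map_eq[OF assms(2)])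
qed

lemma zero_rep_rp: "zero_rep K \<gg> a = rp (\<lambda>i a. 0) a"
  by (simp add: zero_rep_def rp_def PH_zero EL_simps(2))

end

theorem theorem6p5:
  fixes K :: "'k superring" and \<gg> :: "('k, 'g) lie_algebra"
  assumes "commutative_superring K" and "contains_rationals K" and "lie_superalgebra K \<gg>"
  shows "(\<forall>c \<in> even_units K \<union> {\<zero>\<^bsub>K\<^esub>}.
            coderivation_rep K (lie_prod \<gg> \<gg>) \<gg> (pair_rep K \<gg> (Phi K \<gg> c) (zero_rep K \<gg>)) \<and>
            coderivation_rep K (lie_prod \<gg> \<gg>) \<gg> (pair_rep K \<gg> (zero_rep K \<gg>) (Phi K \<gg> c))) \<and>
         (\<forall>d \<in> even_units K.
            coderivation_rep K (lie_prod \<gg> \<gg>) \<gg> (pair_rep K \<gg> (Phi K \<gg> d) (Phi K \<gg> (\<ominus>\<^bsub>K\<^esub> d))))"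
proof -
  interpret lie_sym K \<gg> by (intro lie_sym.intro lie_sym_axioms.intro assms)
  show ?thesis
  proof (intro conjI ballI)
    fix c assume c: "c \<in> even_units K \<union> {\<zero>\<^bsub>K\<^esub>}"
    note r = rep_family_phiL[OF c]
    show "coderivation_rep K (lie_prod \<gg> \<gg>) \<gg> (pair_rep K \<gg> (Phi K \<gg> c) (zero_rep K \<gg>))"
    proof (rule coderivation_rep_pair[OF r rep_family_zero])
      show "comm i (phiL (phi_series K c) i a) j 0 = 0" if "a \<in> gr \<gg> i" for i j a
        by (rule comm_zero(1)[OF rep_familyD(1)[OF r that]])
      show "pair_rep K \<gg> (Phi K \<gg> c) (zero_rep K \<gg>) (a, b) = rp (phiL (phi_series K c)) a \<oplus>\<^bsub>E\<^esub> rp (\<lambda>i a. 0) b"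
        if "a \<in> carrier \<gg>" for a b
        by (simp only: pair_rep_def case_prod_conv Phi_rp[OF c that] EL_simps(3) zero_rep_rp[of b, symmetric])
    qed
    show "coderivation_rep K (lie_prod \<gg> \<gg>) \<gg> (pair_rep K \<gg> (zero_rep K \<gg>) (Phi K \<gg> c))"
    proof (rule coderivation_rep_pair[OF rep_family_zero r])
      show "comm i 0 j (phiL (phi_series K c) j b) = 0" if "b \<in> gr \<gg> j" for i j b
        by (rule comm_zero(2)[OF rep_familyD(1)[OF r that]])
      show "pair_rep K \<gg> (zero_rep K \<gg>) (Phi K \<gg> c) (a, b) = rp (\<lambda>i a. 0) a \<oplus>\<^bsub>E\<^esub> rp (phiL (phi_series K c)) b"
        if "b \<in> carrier \<gg>" for a b
        by (simp only: pair_rep_def case_prod_conv Phi_rp[OF c that] EL_simps(3) zero_rep_rp[of a, symmetric])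
    qed
  next
    fix d assume d: "d \<in> even_units K"
    then have d': "d \<in> even_units K \<union> {\<zero>\<^bsub>K\<^esub>}" "\<ominus>\<^bsub>K\<^esub> d \<in> even_units K \<union> {\<zero>\<^bsub>K\<^esub>}"
      using even_units_neg(1)[OF d] by auto
    show "coderivation_rep K (lie_prod \<gg> \<gg>) \<gg> (pair_rep K \<gg> (Phi K \<gg> d) (Phi K \<gg> (\<ominus>\<^bsub>K\<^esub> d)))"
      by (rule coderivation_rep_pair[OF rep_family_phiL[OF d'(1)] rep_family_phiL[OF d'(2)]])
        (auto simp: comm_opposite[OF d] pair_rep_def Phi_rp[OF d'(1)] Phi_rp[OF d'(2)] EL_simps(3))
  qed
qed

end
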